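(* Let $X$ be a set of $n$ points in $\mathbb{R}^d$ with the Euclidean distance $\ell_2$, and let $T$ be a spanning tree on $X$ (an $n$-node tree). For any $\alpha>1$, there is an algorithm that computes an $\alpha$-approximation of the cut weights of $T$ in time and space $\tilde{O}(n^{1+1/\alpha^2})$.
   Context: Edges of $T$ are weighted by $\ell_2$. For an edge $e=(x,y)$ of $T$, let $L(e)$ (resp. $R(e)$) be the connected component containing $x$ (resp. $y$) of the forest obtained from $T$ by removing $e$ and all edges $e'$ of $T$ with $\ell_2(e')\ge \ell_2(e)$ (i.e. keeping only the edges lighter than $e$). The cut weight of $e$ is $\mathrm{CW}(e)=\max_{u\in L(e),\,v\in R(e)}\ell_2(u,v)$. A function $\mathrm{ACW}$ on the edges of $T$ is an $\alpha$-approximation of the cut weights if $\mathrm{CW}(e)\le\mathrm{ACW}(e)\le\alpha\cdot\mathrm{CW}(e)$ for every edge $e$ of $T$. The notation $\tilde{O}(\cdot)$ hides polylogarithmic factors in $n$. Convention: the dimension is assumed to be $d=O(\log n)$, and dependence on $d$ is suppressed in running times. *)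

theory Defs
  imports
    "HOL-Analysis.L2_Norm"
    "HOL-Library.Log_Nat"
    "HOL-Library.Landau_Symbols"
    "HOL-Probability.SPMF"
begin

section \<open>Points, spanning trees and cut weights\<close>

text \<open>
  The dimension varies with the number of points, so a point of \<open>\<real>\<^sup>d\<close> is a real list of length \<open>d\<close>.
\<close>

type_synonym point = "real list"

definition euclid :: "nat \<Rightarrow> point set" where
  "euclid d = {p. length p = d}"

definition l2 :: "point \<Rightarrow> point \<Rightarrow> real" where
  "l2 u v = L2_set (\<lambda>j. u ! j - v ! j) {..<length u}"

text \<open>
  An undirected simple graph is a symmetric, irreflexive relation; the undirected edge \<open>{x, y}\<close>
  is present as both \<open>(x, y)\<close> and \<open>(y, x)\<close>.
\<close>

definition graph_cycle :: "('a \<times> 'a) set \<Rightarrow> 'a list \<Rightarrow> bool" where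
  "graph_cycle T p \<longleftrightarrow> length p \<ge> 3 \<and> distinct p \<and>
     (\<forall>i<length p. (p ! i, p ! (Suc i mod length p)) \<in> T)"

definition spanning_tree_on :: "'a set \<Rightarrow> ('a \<times> 'a) set \<Rightarrow> bool" where
  "spanning_tree_on X T \<longleftrightarrow>
     finite X \<and> X \<noteq> {} \<and> T \<subseteq> X \<times> X \<and> sym T \<and> irrefl T \<and>
     (\<forall>x\<in>X. \<forall>y\<in>X. (x, y) \<in> T\<^sup>*) \<and>
     (\<nexists>p. graph_cycle T p)"

definition lighter_forest :: "(point \<times> point) set \<Rightarrow> point \<Rightarrow> point \<Rightarrow> (point \<times> point) set" where
  "lighter_forest T x y = T - {(x, y), (y, x)} - {(u, v). l2 u v \<ge> l2 x y}"

definition component :: "('a \<times> 'a) set \<Rightarrow> 'a \<Rightarrow> 'a set" where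
  "component F x = F\<^sup>* `` {x}"

definition cut_weight :: "(point \<times> point) set \<Rightarrow> point \<Rightarrow> point \<Rightarrow> real" where
  "cut_weight T x y =
     Max {l2 u v | u v. u \<in> component (lighter_forest T x y) x \<and>
                        v \<in> component (lighter_forest T x y) y}"

text \<open>Functions on the edges take the unordered pair \<open>{x, y}\<close> as argument.\<close>

definition approximates_cut_weights ::
    "real \<Rightarrow> (point \<times> point) set \<Rightarrow> (point set \<Rightarrow> real) \<Rightarrow> bool" where
  "approximates_cut_weights \<alpha> T ACW \<longleftrightarrow>
     (\<forall>(x, y)\<in>T. cut_weight T x y \<le> ACW {x, y} \<and> ACW {x, y} \<le> \<alpha> * cut_weight T x y)"

section \<open>A randomised real random access machine\<close>

text \<open>
  Programs are finite and the same program serves all inputs. Memory consists of banks of cells;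
  a bank name is fixed in the program text, the index of a cell within its bank is computed.
  Natural-number cells and indices are charged their bit length, so that large integers cannot be
  used to pack many operations into one. Real arithmetic, including the square root, and real
  comparisons are exact and have unit cost. There is no rounding of reals to integers, and the only
  constants are natural numbers, so that no information can be hidden in a real constant.
  The source of randomness is a fair coin.
\<close>

datatype iop = IPlus | IMinus | ITimes | IDivide

datatype iexp = IConst nat | IRead nat iexp | IBin iop iexp iexp

datatype rop = RPlus | RMinus | RTimes | RDivide

datatype rexp = ROfNat iexp | RRead nat iexp | RBin rop rexp rexp | RSqrt rexp

datatype bexp = ILess iexp iexp | RLess rexp rexp | Neg bexp | Conj bexp bexp

datatype com =
    Skip
  | IWrite nat iexp iexp
  | RWrite nat iexp rexp
  | Flip nat iexp
  | Seq com com
  | Cond bexp com com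
  | Loop bexp com

text \<open>
  The sets \<open>icells\<close> and \<open>rcells\<close> contain the pairs (bank, index) of the cells in use, that is,
  the cells of the input and all cells written so far.
\<close>

record state =
  imem :: "nat \<Rightarrow> nat \<Rightarrow> nat"
  rmem :: "nat \<Rightarrow> nat \<Rightarrow> real"
  icells :: "(nat \<times> nat) set"
  rcells :: "(nat \<times> nat) set"
  run_time :: nat
  peak_space :: nat

definition nat_len :: "nat \<Rightarrow> nat" where
  "nat_len k = max 1 (floorlog 2 k)"

fun iop_val :: "iop \<Rightarrow> nat \<Rightarrow> nat \<Rightarrow> nat" where
  "iop_val IPlus x y = x + y"
| "iop_val IMinus x y = x - y"
| "iop_val ITimes x y = x * y"
| "iop_val IDivide x y = x div y"

fun rop_val :: "rop \<Rightarrow> real \<Rightarrow> real \<Rightarrow> real" where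
  "rop_val RPlus x y = x + y"
| "rop_val RMinus x y = x - y"
| "rop_val RTimes x y = x * y"
| "rop_val RDivide x y = x / y"

primrec ival :: "state \<Rightarrow> iexp \<Rightarrow> nat" where
  "ival s (IConst k) = k"
| "ival s (IRead a e) = imem s a (ival s e)"
| "ival s (IBin f e1 e2) = iop_val f (ival s e1) (ival s e2)"

primrec icost :: "state \<Rightarrow> iexp \<Rightarrow> nat" where
  "icost s (IConst k) = nat_len k"
| "icost s (IRead a e) = icost s e + nat_len (ival s e) + nat_len (ival s (IRead a e))"
| "icost s (IBin f e1 e2) = icost s e1 + icost s e2 + nat_len (ival s e1) + nat_len (ival s e2)"

primrec rval :: "state \<Rightarrow> rexp \<Rightarrow> real" where
  "rval s (ROfNat e) = real (ival s e)"
| "rval s (RRead a e) = rmem s a (ival s e)"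
| "rval s (RBin f e1 e2) = rop_val f (rval s e1) (rval s e2)"
| "rval s (RSqrt e) = sqrt (rval s e)"

primrec rcost :: "state \<Rightarrow> rexp \<Rightarrow> nat" where
  "rcost s (ROfNat e) = icost s e + nat_len (ival s e)"
| "rcost s (RRead a e) = icost s e + nat_len (ival s e) + 1"
| "rcost s (RBin f e1 e2) = rcost s e1 + rcost s e2 + 1"
| "rcost s (RSqrt e) = rcost s e + 1"

primrec bval :: "state \<Rightarrow> bexp \<Rightarrow> bool" where
  "bval s (ILess e1 e2) \<longleftrightarrow> ival s e1 < ival s e2"
| "bval s (RLess e1 e2) \<longleftrightarrow> rval s e1 < rval s e2"
| "bval s (Neg b) \<longleftrightarrow> \<not> bval s b"
| "bval s (Conj b1 b2) \<longleftrightarrow> bval s b1 \<and> bval s b2"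

primrec bcost :: "state \<Rightarrow> bexp \<Rightarrow> nat" where
  "bcost s (ILess e1 e2) = icost s e1 + icost s e2 + nat_len (ival s e1) + nat_len (ival s e2)"
| "bcost s (RLess e1 e2) = rcost s e1 + rcost s e2 + 1"
| "bcost s (Neg b) = bcost s b + 1"
| "bcost s (Conj b1 b2) = bcost s b1 + bcost s b2 + 1"

text \<open>Every cell in use is charged for its index and its contents; a real number has size 1.\<close>

definition mem_size :: "state \<Rightarrow> nat" where
  "mem_size s = (\<Sum>(a, i)\<in>icells s. nat_len i + nat_len (imem s a i))
              + (\<Sum>(a, i)\<in>rcells s. nat_len i + 1)"

definition charge :: "nat \<Rightarrow> state \<Rightarrow> state" where
  "charge t s = s\<lparr>run_time := run_time s + t\<rparr>"

definition update_peak :: "state \<Rightarrow> state" where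
  "update_peak s = s\<lparr>peak_space := max (peak_space s) (mem_size s)\<rparr>"

definition write_nat :: "nat \<Rightarrow> nat \<Rightarrow> nat \<Rightarrow> state \<Rightarrow> state" where
  "write_nat a i k s = update_peak
     (s\<lparr>imem := (imem s)(a := (imem s a)(i := k)), icells := insert (a, i) (icells s)\<rparr>)"

definition write_real :: "nat \<Rightarrow> nat \<Rightarrow> real \<Rightarrow> state \<Rightarrow> state" where
  "write_real a i r s = update_peak
     (s\<lparr>rmem := (rmem s)(a := (rmem s a)(i := r)), rcells := insert (a, i) (rcells s)\<rparr>)"

text \<open>Nontermination is the missing probability mass of a sub-probability mass function.\<close>

partial_function (spmf) loop_spmf ::
    "('s \<Rightarrow> bool) \<Rightarrow> ('s \<Rightarrow> 's spmf) \<Rightarrow> 's \<Rightarrow> 's spmf" where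
  "loop_spmf b f s = (if b s then bind_spmf (f s) (loop_spmf b f) else return_spmf s)"

primrec exec :: "com \<Rightarrow> state \<Rightarrow> state spmf" where
  "exec Skip s = return_spmf (charge 1 s)"
| "exec (IWrite a e f) s = return_spmf
     (charge (icost s e + icost s f + nat_len (ival s e) + nat_len (ival s f))
        (write_nat a (ival s e) (ival s f) s))"
| "exec (RWrite a e f) s = return_spmf
     (charge (icost s e + rcost s f + nat_len (ival s e) + 1)
        (write_real a (ival s e) (rval s f) s))"
| "exec (Flip a e) s = map_spmf
     (\<lambda>b. charge (icost s e + nat_len (ival s e) + 1) (write_nat a (ival s e) (of_bool b) s))
     coin_spmf"
| "exec (Seq c1 c2) s = bind_spmf (exec c1 s) (exec c2)"
| "exec (Cond b c1 c2) s =
     (if bval s b then exec c1 (charge (bcost s b) s) else exec c2 (charge (bcost s b) s))"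
| "exec (Loop b c) s = map_spmf (\<lambda>t. charge (bcost t b) t)
     (loop_spmf (\<lambda>t. bval t b) (\<lambda>t. exec c (charge (bcost t b) t)) s)"

section \<open>Input and output\<close>

text \<open>
  A tree on a point set is presented by a list of the points, without repetition, and a list of the
  edges as pairs of positions in the first list, each undirected edge being listed exactly once.
\<close>

definition presents ::
    "point list \<Rightarrow> (nat \<times> nat) list \<Rightarrow> point set \<Rightarrow> (point \<times> point) set \<Rightarrow> bool" where
  "presents pts es X T \<longleftrightarrow>
     distinct pts \<and> set pts = X \<and>
     (\<forall>(i, j)\<in>set es. i < length pts \<and> j < length pts) \<and>
     distinct (map (\<lambda>(i, j). {i, j}) es) \<and>
     T = (\<Union>(i, j)\<in>set es. {(pts ! i, pts ! j), (pts ! j, pts ! i)})"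

definition bank :: "'a::zero list \<Rightarrow> nat \<Rightarrow> 'a" where
  "bank xs i = (if i < length xs then xs ! i else 0)"

text \<open>
  Integer bank 0 holds the number of points and the dimension, integer bank 1 the edges.
  Real bank 0 holds \<open>\<alpha>\<close>, real bank 1 the coordinates, point by point.
\<close>

definition input_state :: "real \<Rightarrow> nat \<Rightarrow> point list \<Rightarrow> (nat \<times> nat) list \<Rightarrow> state" where
  "input_state \<alpha> d pts es = update_peak
     \<lparr>imem = (\<lambda>_ _. 0)(0 := bank [length pts, d], 1 := bank (concat (map (\<lambda>(i, j). [i, j]) es))),
      rmem = (\<lambda>_ _. 0)(0 := bank [\<alpha>], 1 := bank (concat pts)),
      icells = {0} \<times> {..<2} \<union> {1} \<times> {..<2 * length es},
      rcells = {0} \<times> {..<1} \<union> {1} \<times> {..<length (concat pts)},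
      run_time = 0, peak_space = 0\<rparr>"

text \<open>The value for the edge at position \<open>k\<close> of the edge list is returned in cell \<open>k\<close> of real bank 2.\<close>

definition outputs ::
    "point list \<Rightarrow> (nat \<times> nat) list \<Rightarrow> state \<Rightarrow> (point set \<Rightarrow> real) \<Rightarrow> bool" where
  "outputs pts es s ACW \<longleftrightarrow>
     (\<forall>k<length es. ACW {pts ! fst (es ! k), pts ! snd (es ! k)} = rmem s 2 k)"

section \<open>Bounds up to polylogarithmic factors\<close>

definition soft_O :: "(nat \<Rightarrow> real) \<Rightarrow> (nat \<Rightarrow> real) set" where
  "soft_O g = (\<Union>k::nat. O(\<lambda>n. g n * ln (real n) ^ k))"

end

theory Submission
  imports Defs "HOL-Analysis.Harmonic_Numbers" "HOL-Real_Asymp.Real_Asymp"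
begin

text \<open>
  The algorithm is Indyk's reduction of furthest neighbours to one-dimensional projections.
  Kruskal's algorithm, relabelling the smaller class, meets the components \<open>L(e)\<close> and \<open>R(e)\<close> of
  every edge \<open>e\<close>; the classes are stored so that \<open>L(e)\<close> and \<open>R(e)\<close> are prefixes of arrays, and
  the smaller sides have total size at most \<open>n log n\<close>. The points are projected with random signs,
  each coordinate being split into polylogarithmically many copies to make the projections nearly
  Gaussian. With a threshold \<open>\<tau>\<close> near \<open>sqrt (2 ln n)\<close> standard deviations, a pair at distance
  \<open>D\<close> has projected distance at least \<open>\<tau> D / \<alpha>\<close> with probability about \<open>n powr (- 1 / \<alpha>\<^sup>2)\<close>, so
  that about \<open>n powr (1 / \<alpha>\<^sup>2)\<close> projections see every pair once, while a projected distance above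
  \<open>\<tau> D / (1 + \<epsilon>)\<close> has probability at most \<open>1 / n\<close>.

  For a point \<open>u\<close> of the smaller side of \<open>e\<close>, the points of the larger side are examined in order of
  decreasing projection as long as the projected distance to \<open>u\<close> is at least \<open>\<tau>\<close> times the largest
  distance found for \<open>e\<close> so far. All levels of a merge sort are kept, so every prefix of an array is
  a union of few sorted blocks. Each point examined is either one of the few exceptional pairs or
  raises the best distance of \<open>e\<close> by a factor \<open>1 + \<epsilon>\<close>; as the cut weight lies between the weight
  of \<open>e\<close> and \<open>3 n\<close> times it, the latter happens polylogarithmically often. A search that stays
  within a corresponding budget ends with a best distance between \<open>CW(e) / \<alpha>\<close> and \<open>CW(e)\<close>.
  Logarithmically many repetitions with fresh coins make the failure probability polynomially small.
\<close>

section \<open>A step-counting program logic\<close>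

text \<open>All coins are flipped before the first one is read, so initialisation and search are
  deterministic programs and their logic needs no probability; only the flipping loop is analysed as
  a distribution, and the remaining probability theory concerns uniform bit strings. The budget caps
  the number of candidates examined in a repetition for every outcome of the coins, so the resource
  bounds hold surely and chance affects the answer alone. The slack \<epsilon> = 1 / h, with h near
  log n, is small enough to be free: it multiplies the exponent \<rho> * ln n of the hit probability
  by (1 + 1 / h)^2, that is, adds O(1). It is large enough that counting improvements by the factor
  1 + \<epsilon> costs only one more logarithm. A limit theorem with polynomially small additive
  error would say nothing about tail probabilities that are themselves polynomially small. The lower
  tail bound therefore compares the sign walk with the heat kernel, up to a constant factor and an
  additive error that is much smaller than the tail. Best distances between CW / \<alpha> and CW are
  finally multiplied by \<alpha>.\<close>

primrec iv :: "(nat \<Rightarrow> nat \<Rightarrow> nat) \<Rightarrow> iexp \<Rightarrow> nat" where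
  "iv I (IConst k) = k"
| "iv I (IRead a e) = I a (iv I e)"
| "iv I (IBin f e1 e2) = iop_val f (iv I e1) (iv I e2)"

primrec rv :: "(nat \<Rightarrow> nat \<Rightarrow> nat) \<Rightarrow> (nat \<Rightarrow> nat \<Rightarrow> real) \<Rightarrow> rexp \<Rightarrow> real" where
  "rv I R (ROfNat e) = real (iv I e)"
| "rv I R (RRead a e) = R a (iv I e)"
| "rv I R (RBin f e1 e2) = rop_val f (rv I R e1) (rv I R e2)"
| "rv I R (RSqrt e) = sqrt (rv I R e)"

primrec bv :: "(nat \<Rightarrow> nat \<Rightarrow> nat) \<Rightarrow> (nat \<Rightarrow> nat \<Rightarrow> real) \<Rightarrow> bexp \<Rightarrow> bool" where
  "bv I R (ILess e1 e2) \<longleftrightarrow> iv I e1 < iv I e2"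
| "bv I R (RLess e1 e2) \<longleftrightarrow> rv I R e1 < rv I R e2"
| "bv I R (Neg b) \<longleftrightarrow> \<not> bv I R b"
| "bv I R (Conj b1 b2) \<longleftrightarrow> bv I R b1 \<and> bv I R b2"

lemma ival_eq: "ival s e = iv (imem s) e"
  by (induction e) auto

lemma rval_eq: "rval s e = rv (imem s) (rmem s) e"
  by (induction e) (auto simp: ival_eq)

lemma bval_eq: "bval s b = bv (imem s) (rmem s) b"
  by (induction b) (auto simp: ival_eq rval_eq)

text \<open>An exponent: with all cells at most \<open>M\<close>, an expression has value at most
  \<open>M ^ isz e\<close>. A constant k gets \<open>Suc k\<close> because k < 2^k.\<close>

primrec isz :: "iexp \<Rightarrow> nat" where
  "isz (IConst k) = Suc k"
| "isz (IRead a e) = 1"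
| "isz (IBin f e1 e2) = isz e1 + isz e2"

text \<open>Weights bound the cost of evaluation in units of \<open>nat_len M\<close>. They are read
  off the program text, so for a fixed program they are constants.\<close>

primrec iwt :: "iexp \<Rightarrow> nat" where
  "iwt (IConst k) = Suc k"
| "iwt (IRead a e) = iwt e + isz e + 1"
| "iwt (IBin f e1 e2) = iwt e1 + iwt e2 + isz e1 + isz e2"

primrec rwt :: "rexp \<Rightarrow> nat" where
  "rwt (ROfNat e) = iwt e + isz e"
| "rwt (RRead a e) = iwt e + isz e + 1"
| "rwt (RBin f e1 e2) = rwt e1 + rwt e2 + 1"
| "rwt (RSqrt e) = rwt e + 1"

primrec bwt :: "bexp \<Rightarrow> nat" where
  "bwt (ILess e1 e2) = iwt e1 + iwt e2 + isz e1 + isz e2"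
| "bwt (RLess e1 e2) = rwt e1 + rwt e2 + 1"
| "bwt (Neg b) = bwt b + 1"
| "bwt (Conj b1 b2) = bwt b1 + bwt b2 + 1"

primrec cwt :: "com \<Rightarrow> nat" where
  "cwt Skip = 1"
| "cwt (IWrite a e f) = iwt e + iwt f + isz e + isz f"
| "cwt (RWrite a e f) = iwt e + rwt f + isz e + 1"
| "cwt (Flip a e) = iwt e + isz e + 1"
| "cwt (Seq c1 c2) = max (cwt c1) (cwt c2)"
| "cwt (Cond b c1 c2) = max (bwt b) (max (cwt c1) (cwt c2))"
| "cwt (Loop b c) = max (bwt b) (cwt c)"

primrec imods :: "com \<Rightarrow> nat set" where
  "imods Skip = {}"
| "imods (IWrite a e f) = {a}"
| "imods (RWrite a e f) = {}"
| "imods (Flip a e) = {a}"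
| "imods (Seq c1 c2) = imods c1 \<union> imods c2"
| "imods (Cond b c1 c2) = imods c1 \<union> imods c2"
| "imods (Loop b c) = imods c"

primrec rmods :: "com \<Rightarrow> nat set" where
  "rmods Skip = {}"
| "rmods (IWrite a e f) = {}"
| "rmods (RWrite a e f) = {a}"
| "rmods (Flip a e) = {}"
| "rmods (Seq c1 c2) = rmods c1 \<union> rmods c2"
| "rmods (Cond b c1 c2) = rmods c1 \<union> rmods c2"
| "rmods (Loop b c) = rmods c"

lemma nat_len_pow_le:
  assumes "x \<le> M ^ z" "M \<ge> 2" "z \<ge> 1"
  shows "nat_len x \<le> z * nat_len M"
proof -
  have M: "M < 2 ^ floorlog 2 M"
    by (metis floorlog_leD one_less_numeral_iff order_refl semiring_norm(76))
  have "M ^ z < (2 ^ floorlog 2 M) ^ z"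
    using M assms by (intro power_strict_mono) auto
  also have "\<dots> = 2 ^ (z * floorlog 2 M)"
    by (metis mult.commute power_mult)
  finally have "floorlog 2 x \<le> z * floorlog 2 M"
    using assms by (intro floorlog_leI) auto
  moreover have "floorlog 2 M \<ge> 1"
    using M assms by (cases "floorlog 2 M") auto
  ultimately show ?thesis
    using assms unfolding nat_len_def by (auto simp: max_def)
qed

lemma iv_le:
  assumes "\<And>a i. I a i \<le> M" "M \<ge> (2::nat)"
  shows "iv I e \<le> M ^ isz e"
proof (induction e)
  case (IConst k)
  have "k < 2 ^ k" by simp
  also have "(2::nat) ^ k \<le> M ^ k" using assms by (intro power_mono) auto
  also have "\<dots> \<le> M ^ Suc k" using assms by simp
  finally show ?case by simp
next
  case (IRead a e)
  then show ?case using assms by simp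
next
  case (IBin f e1 e2)
  let ?a = "M ^ isz e1" and ?b = "M ^ isz e2"
  have pos: "isz e \<ge> 1" for e by (induction e) auto
  have ge: "M ^ isz e \<ge> 2" for e
    using assms pos[of e] self_le_power[of M "isz e"] by simp
  \<comment> \<open>Both factors are at least 2, so a sum is absorbed by the product.\<close>
  have "?a + ?b \<le> ?a * ?b"
    using mult_le_mono[OF ge[of e1] order_refl[of ?b]] mult_le_mono[OF order_refl[of ?a] ge[of e2]] by linarith
  moreover have "?a \<le> ?a * ?b" using ge[of e2] by simp
  moreover have "iv I e1 * iv I e2 \<le> ?a * ?b" using IBin by (intro mult_le_mono) auto
  moreover have "iv I e1 div iv I e2 \<le> iv I e1" by simp
  ultimately show ?case using IBin
    by (cases f) (auto simp: power_add intro: order_trans[OF diff_le_self] order_trans[OF div_le_dividend])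
qed

lemma isz_pos: "isz e \<ge> 1"
  by (induction e) auto

lemma nat_len_ge_1: "1 \<le> nat_len k"
  by (simp add: nat_len_def)

context
  fixes s :: state and M :: nat
  assumes bnd: "\<And>a i. imem s a i \<le> M" and M: "M \<ge> 2"
begin

lemma nat_len_ival: "nat_len (ival s e) \<le> isz e * nat_len M"
  unfolding ival_eq by (rule nat_len_pow_le[OF iv_le[OF bnd M] M isz_pos])

lemma icost_le: "icost s e \<le> iwt e * nat_len M"
proof (induction e)
  case (IConst k)
  show ?case using nat_len_ival[of "IConst k"] by simp
next
  case (IRead a e)
  then show ?case using nat_len_ival[of e] nat_len_ival[of "IRead a e"] by (simp add: algebra_simps)
next
  case (IBin f e1 e2)
  then show ?case using nat_len_ival[of e1] nat_len_ival[of e2] by (simp add: algebra_simps)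
qed

lemma rcost_le: "rcost s e \<le> rwt e * nat_len M"
proof (induction e)
  case (ROfNat e)
  show ?case using nat_len_ival[of e] icost_le[of e] by (simp add: algebra_simps)
next
  case (RRead a e)
  show ?case using nat_len_ival[of e] icost_le[of e] nat_len_ge_1[of M] by (simp add: algebra_simps)
next
  case (RBin f e1 e2)
  then show ?case using nat_len_ge_1[of M] by (simp add: algebra_simps)
next
  case (RSqrt e)
  then show ?case using nat_len_ge_1[of M] by (simp add: algebra_simps)
qed

lemma bcost_le: "bcost s b \<le> bwt b * nat_len M"
proof (induction b)
  case (ILess e1 e2)
  show ?case using nat_len_ival[of e1] nat_len_ival[of e2] icost_le[of e1] icost_le[of e2]
    by (simp add: algebra_simps)
next
  case (RLess e1 e2)
  show ?case using rcost_le[of e1] rcost_le[of e2] nat_len_ge_1[of M] by (simp add: algebra_simps)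
next
  case (Neg b)
  then show ?case using nat_len_ge_1[of M] by (simp add: algebra_simps)
next
  case (Conj b1 b2)
  then show ?case using nat_len_ge_1[of M] by (simp add: algebra_simps)
qed

end

text \<open>Each write costs at least as much time as the space it adds, so time bounds space.\<close>

definition space_ok :: "nat \<Rightarrow> state \<Rightarrow> bool" where
  "space_ok A s \<longleftrightarrow> finite (icells s) \<and> finite (rcells s) \<and>
     mem_size s \<le> A + run_time s \<and> peak_space s \<le> A + run_time s"

lemma space_ok_charge: "space_ok A s \<Longrightarrow> space_ok A (charge t s)"
  by (auto simp: space_ok_def charge_def mem_size_def)

text \<open>Covers a new cell as well as an overwritten one: in the latter case the old summand is
  dropped, which only helps.\<close>

lemma sum_insert_le:
  fixes f f' :: "'a \<Rightarrow> nat"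
  assumes "finite A" "\<And>y. y \<noteq> x \<Longrightarrow> f' y = f y"
  shows "sum f' (insert x A) \<le> sum f A + f' x"
proof -
  have "sum f' (insert x A) = f' x + sum f' (A - {x})"
    using assms by (simp add: sum.insert_remove)
  also have "sum f' (A - {x}) = sum f (A - {x})"
    using assms by (intro sum.cong) auto
  also have "\<dots> \<le> sum f A" using assms by (intro sum_mono2) auto
  finally show ?thesis by simp
qed

lemma space_ok_write_nat:
  assumes "space_ok A s" "nat_len i + nat_len k \<le> t"
  shows "space_ok A (charge t (write_nat a i k s))"
proof -
  let ?f = "\<lambda>(b, j). nat_len j + nat_len (imem s b j)"
  let ?f' = "\<lambda>(b, j). nat_len j + nat_len (((imem s)(a := (imem s a)(i := k))) b j)"
  have "sum ?f' (insert (a, i) (icells s)) \<le> sum ?f (icells s) + ?f' (a, i)"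
    using assms by (intro sum_insert_le) (auto simp: space_ok_def split: if_splits)
  then show ?thesis
    using assms by (auto simp: space_ok_def charge_def mem_size_def write_nat_def update_peak_def)
qed

lemma space_ok_write_real:
  assumes "space_ok A s" "nat_len i + 1 \<le> t"
  shows "space_ok A (charge t (write_real a i r s))"
proof -
  let ?f = "\<lambda>(b, j). nat_len j + 1"
  have "sum ?f (insert (a, i) (rcells s)) \<le> sum ?f (rcells s) + ?f (a, i)"
    using assms by (intro sum_insert_le) (auto simp: space_ok_def)
  then show ?thesis
    using assms by (auto simp: space_ok_def charge_def mem_size_def write_real_def update_peak_def)
qed

text \<open>
  A state is abstracted to its integer and real memory and a step counter; every step is charged
  \<open>Z * nat_len M\<close>, which suffices for programs of weight \<open>Z\<close> whose integers stay below \<open>M\<close>.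
\<close>

type_synonym ipart = "nat \<Rightarrow> nat \<Rightarrow> nat"
type_synonym rpart = "nat \<Rightarrow> nat \<Rightarrow> real"

locale ram =
  fixes Z M :: nat
  assumes M: "M \<ge> 2"
begin

definition bnd :: "ipart \<Rightarrow> bool" where
  "bnd I \<longleftrightarrow> (\<forall>a i. I a i \<le> M)"

text \<open>Sums on both sides avoid truncated subtraction. Besides time, the relation carries the
  word bound, the space invariant and the frame condition for banks outside \<open>imods\<close> and
  \<open>rmods\<close>, so that all of them compose at once.\<close>

definition stp :: "com \<Rightarrow> state \<Rightarrow> nat \<Rightarrow> state \<Rightarrow> nat \<Rightarrow> bool" where
  "stp c s T t T' \<longleftrightarrow>
     run_time t + Z * nat_len M * T \<le> run_time s + Z * nat_len M * T' \<and> bnd (imem t) \<and>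
     (\<forall>A. space_ok A s \<longrightarrow> space_ok A t) \<and>
     (\<forall>a. a \<notin> imods c \<longrightarrow> imem t a = imem s a) \<and> (\<forall>a. a \<notin> rmods c \<longrightarrow> rmem t a = rmem s a)"

lemma stp_trans: "stp c s T t T' \<Longrightarrow> stp c t T' u T'' \<Longrightarrow> stp c s T u T''"
  unfolding stp_def by auto

lemma stp_mono: "stp c s T t T' \<Longrightarrow> imods c \<subseteq> imods c' \<Longrightarrow> rmods c \<subseteq> rmods c' \<Longrightarrow> stp c' s T t T'"
  unfolding stp_def by blast

lemma stp_charge:
  assumes "t \<le> Z * nat_len M" "bnd (imem s)"
  shows "stp c s T (charge t s) (Suc T)"
  using assms by (auto simp: stp_def charge_def[of t s] intro: space_ok_charge[of _ s t, unfolded charge_def])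

text \<open>A deterministic triple in weakest-precondition style: the run must be a point mass,
  which also gives termination. The step counter is an argument of the postcondition, so time bounds
  are proved like any other property.\<close>

definition ok :: "com \<Rightarrow> ipart \<Rightarrow> rpart \<Rightarrow> nat \<Rightarrow> (ipart \<Rightarrow> rpart \<Rightarrow> nat \<Rightarrow> bool) \<Rightarrow> bool" where
  "ok c I R T Q \<longleftrightarrow> (cwt c \<le> Z \<longrightarrow> bnd I \<longrightarrow> (\<forall>s. imem s = I \<longrightarrow> rmem s = R \<longrightarrow>
     (\<exists>t T'. exec c s = return_spmf t \<and> stp c s T t T' \<and> Q (imem t) (rmem t) T')))"

text \<open>Besides weakening the postcondition, it hands over the word bound and the frame for
  banks that \<open>c\<close> does not write, so that postconditions need list only what
  changes.\<close>

lemma ok_conseq: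
  assumes "ok c I R T P"
    and "\<And>I' R' T'. P I' R' T' \<Longrightarrow> bnd I' \<Longrightarrow> (\<And>a. a \<notin> imods c \<Longrightarrow> I' a = I a) \<Longrightarrow>
           (\<And>a. a \<notin> rmods c \<Longrightarrow> R' a = R a) \<Longrightarrow> Q I' R' T'"
  shows "ok c I R T Q"
  using assms unfolding ok_def stp_def by metis

lemma ok_bnd: "(bnd I \<Longrightarrow> ok c I R T Q) \<Longrightarrow> ok c I R T Q"
  unfolding ok_def by blast

lemma ok_Skip:
  assumes "Q I R (Suc T)"
  shows "ok Skip I R T Q"
  unfolding ok_def
proof (intro impI allI)
  fix s :: state assume s: "cwt Skip \<le> Z" "bnd I" "imem s = I" "rmem s = R"
  have "1 * 1 \<le> Z * nat_len M" using s nat_len_ge_1[of M] by (intro mult_le_mono) auto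
  then have "stp Skip s T (charge 1 s) (Suc T)" using s by (intro stp_charge) auto
  then show "\<exists>t T'. exec Skip s = return_spmf t \<and> stp Skip s T t T' \<and> Q (imem t) (rmem t) T'"
    using s assms by (intro exI[of _ "charge 1 s"] exI[of _ "Suc T"]) (auto simp: charge_def)
qed

lemma ok_IWrite:
  assumes "iv I f \<le> M" "Q (I(a := (I a)(iv I e := iv I f))) R (Suc T)"
  shows "ok (IWrite a e f) I R T Q"
  unfolding ok_def
proof (intro impI allI)
  fix s :: state assume s: "cwt (IWrite a e f) \<le> Z" "bnd I" "imem s = I" "rmem s = R"
  let ?t = "icost s e + icost s f + nat_len (ival s e) + nat_len (ival s f)"
  have b: "imem s b j \<le> M" for b j using s by (auto simp: bnd_def)
  have "?t \<le> (iwt e + iwt f + isz e + isz f) * nat_len M"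
    using icost_le[OF b M, of e] icost_le[OF b M, of f] nat_len_ival[OF b M, of e] nat_len_ival[OF b M, of f]
    by (simp add: algebra_simps)
  also have "\<dots> \<le> Z * nat_len M" using s by (intro mult_le_mono1) simp
  finally have "?t \<le> Z * nat_len M" .
  moreover have "space_ok A (charge ?t (write_nat a (ival s e) (ival s f) s))" if "space_ok A s" for A
    using that by (intro space_ok_write_nat) auto
  ultimately have "stp (IWrite a e f) s T (charge ?t (write_nat a (ival s e) (ival s f) s)) (Suc T)"
    using s assms by (auto simp: stp_def charge_def write_nat_def update_peak_def bnd_def ival_eq)
  then show "\<exists>t T'. exec (IWrite a e f) s = return_spmf t \<and> stp (IWrite a e f) s T t T' \<and> Q (imem t) (rmem t) T'"
    using s assms
    by (intro exI[of _ "charge ?t (write_nat a (ival s e) (ival s f) s)"] exI[of _ "Suc T"])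
       (auto simp: charge_def write_nat_def update_peak_def ival_eq)
qed

lemma ok_RWrite:
  assumes "Q I (R(a := (R a)(iv I e := rv I R f))) (Suc T)"
  shows "ok (RWrite a e f) I R T Q"
  unfolding ok_def
proof (intro impI allI)
  fix s :: state assume s: "cwt (RWrite a e f) \<le> Z" "bnd I" "imem s = I" "rmem s = R"
  let ?t = "icost s e + rcost s f + nat_len (ival s e) + 1"
  have b: "imem s b j \<le> M" for b j using s by (auto simp: bnd_def)
  have "?t \<le> (iwt e + rwt f + isz e + 1) * nat_len M"
    using icost_le[OF b M, of e] rcost_le[OF b M, of f] nat_len_ival[OF b M, of e] nat_len_ge_1[of M]
    by (simp add: algebra_simps)
  also have "\<dots> \<le> Z * nat_len M" using s by (intro mult_le_mono1) simp
  finally have "?t \<le> Z * nat_len M" .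
  moreover have "space_ok A (charge ?t (write_real a (ival s e) (rval s f) s))" if "space_ok A s" for A
    using that by (intro space_ok_write_real) auto
  ultimately have "stp (RWrite a e f) s T (charge ?t (write_real a (ival s e) (rval s f) s)) (Suc T)"
    using s assms by (auto simp: stp_def charge_def write_real_def update_peak_def bnd_def ival_eq)
  then show "\<exists>t T'. exec (RWrite a e f) s = return_spmf t \<and> stp (RWrite a e f) s T t T' \<and> Q (imem t) (rmem t) T'"
    using s assms
    by (intro exI[of _ "charge ?t (write_real a (ival s e) (rval s f) s)"] exI[of _ "Suc T"])
       (auto simp: charge_def write_real_def update_peak_def ival_eq rval_eq)
qed

lemma ok_Seq:
  assumes "ok c1 I R T (\<lambda>I R T. ok c2 I R T Q)"
  shows "ok (Seq c1 c2) I R T Q"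
  unfolding ok_def
proof (intro impI allI)
  fix s :: state assume s: "cwt (Seq c1 c2) \<le> Z" "bnd I" "imem s = I" "rmem s = R"
  obtain t T' where t: "exec c1 s = return_spmf t" "stp c1 s T t T'" "ok c2 (imem t) (rmem t) T' Q"
    using assms[unfolded ok_def[of c1]] s by auto
  have "bnd (imem t)" "cwt c2 \<le> Z" using t s by (auto simp: stp_def)
  then obtain u T'' where u: "exec c2 t = return_spmf u" "stp c2 t T' u T''" "Q (imem u) (rmem u) T''"
    using t(3) unfolding ok_def by blast
  have "stp (Seq c1 c2) s T u T''"
    by (rule stp_trans[OF stp_mono[OF t(2)] stp_mono[OF u(2)]]) auto
  then show "\<exists>t T'. exec (Seq c1 c2) s = return_spmf t \<and> stp (Seq c1 c2) s T t T' \<and> Q (imem t) (rmem t) T'"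
    using t u by auto
qed

lemma ok_Cond:
  assumes "bv I R b \<Longrightarrow> ok c1 I R (Suc T) Q" "\<not> bv I R b \<Longrightarrow> ok c2 I R (Suc T) Q"
  shows "ok (Cond b c1 c2) I R T Q"
  unfolding ok_def
proof (intro impI allI)
  fix s :: state assume s: "cwt (Cond b c1 c2) \<le> Z" "bnd I" "imem s = I" "rmem s = R"
  have b: "imem s b j \<le> M" for b j using s by (auto simp: bnd_def)
  have "bcost s b \<le> bwt b * nat_len M" by (rule bcost_le[OF b M])
  also have "\<dots> \<le> Z * nat_len M" using s by (intro mult_le_mono1) simp
  finally have c: "bcost s b \<le> Z * nat_len M" .
  let ?c = "if bval s b then c1 else c2"
  have ch: "stp ?c s T (charge (bcost s b) s) (Suc T)"
    using c s by (intro stp_charge) auto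
  have "ok ?c I R (Suc T) Q" using assms s by (auto simp: bval_eq)
  moreover have "cwt ?c \<le> Z" "imem (charge (bcost s b) s) = I" "rmem (charge (bcost s b) s) = R"
    using s by (auto simp: charge_def)
  ultimately obtain u T'' where u: "exec ?c (charge (bcost s b) s) = return_spmf u"
      "stp ?c (charge (bcost s b) s) (Suc T) u T''" "Q (imem u) (rmem u) T''"
    unfolding ok_def using s(2) by blast
  have "stp (Cond b c1 c2) s T u T''"
    by (rule stp_mono[OF stp_trans[OF ch u(2)]]) auto
  then show "\<exists>t T'. exec (Cond b c1 c2) s = return_spmf t \<and> stp (Cond b c1 c2) s T t T' \<and> Q (imem t) (rmem t) T'"
    using u by (auto split: if_splits)
qed

text \<open>The measure \<open>mea\<close> decreases in every round, so the loop unfolds to a point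
  mass. Both \<open>step\<close> and \<open>fin\<close> may use the frame relative to the state
  before the loop.\<close>

lemma ok_Loop:
  fixes mea :: "ipart \<Rightarrow> rpart \<Rightarrow> nat"
  assumes "Inv I R T"
    and step: "\<And>I' R' T'. Inv I' R' T' \<Longrightarrow> bv I' R' b \<Longrightarrow> bnd I' \<Longrightarrow>
           (\<And>a. a \<notin> imods c \<Longrightarrow> I' a = I a) \<Longrightarrow> (\<And>a. a \<notin> rmods c \<Longrightarrow> R' a = R a) \<Longrightarrow>
           ok c I' R' (Suc T') (\<lambda>I'' R'' T''. Inv I'' R'' T'' \<and> mea I'' R'' < mea I' R')"
    and fin: "\<And>I' R' T'. Inv I' R' T' \<Longrightarrow> \<not> bv I' R' b \<Longrightarrow> bnd I' \<Longrightarrow>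
           (\<And>a. a \<notin> imods c \<Longrightarrow> I' a = I a) \<Longrightarrow> (\<And>a. a \<notin> rmods c \<Longrightarrow> R' a = R a) \<Longrightarrow> Q I' R' (Suc T')"
  shows "ok (Loop b c) I R T Q"
  unfolding ok_def
proof (intro impI allI)
  fix s0 :: state assume s0: "cwt (Loop b c) \<le> Z" "bnd I" "imem s0 = I" "rmem s0 = R"
  have cb: "bcost s b \<le> Z * nat_len M" if "bnd (imem s)" for s :: state
  proof -
    have "bcost s b \<le> bwt b * nat_len M" using that M by (intro bcost_le) (auto simp: bnd_def)
    also have "\<dots> \<le> Z * nat_len M" using s0 by (intro mult_le_mono1) simp
    finally show ?thesis .
  qed
  \<comment> \<open>The start \<open>s0\<close> stays fixed while the current state varies, so that
    \<open>stp\<close> accumulates the cost of all rounds and the frame refers to the loop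
    entry.\<close>
  have main: "\<exists>t T'. loop_spmf (\<lambda>t. bval t b) (\<lambda>t. exec c (charge (bcost t b) t)) s = return_spmf t \<and>
      stp c s0 T0 t T' \<and> Inv (imem t) (rmem t) T' \<and> \<not> bval t b"
    if "Inv (imem s) (rmem s) T1" "stp c s0 T0 s T1" for s :: state and T1 T0
    using that
  proof (induction "mea (imem s) (rmem s)" arbitrary: s T1 rule: less_induct)
    case less
    have bs: "bnd (imem s)" using less.prems by (simp add: stp_def)
    show ?case
    proof (cases "bval s b")
      case False
      then show ?thesis using less.prems
        by (intro exI[of _ s] exI[of _ T1]) (simp add: loop_spmf.simps)
    next
      case True
      let ?s = "charge (bcost s b) s"
      have 1: "stp c s T1 ?s (Suc T1)" by (rule stp_charge[OF cb[OF bs] bs])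
      have fr: "\<And>a. a \<notin> imods c \<Longrightarrow> imem s a = I a" "\<And>a. a \<notin> rmods c \<Longrightarrow> rmem s a = R a"
        using less.prems(2) s0 by (auto simp: stp_def)
      have "ok c (imem s) (rmem s) (Suc T1) (\<lambda>I'' R'' T''. Inv I'' R'' T'' \<and> mea I'' R'' < mea (imem s) (rmem s))"
        using True by (intro step less.prems bs fr) (auto simp: bval_eq)
      moreover have "imem ?s = imem s" "rmem ?s = rmem s" by (auto simp: charge_def)
      ultimately obtain t T' where t: "exec c ?s = return_spmf t" "stp c ?s (Suc T1) t T'"
          "Inv (imem t) (rmem t) T'" "mea (imem t) (rmem t) < mea (imem s) (rmem s)"
        using s0 bs unfolding ok_def by (metis cwt.simps(7) max.boundedE)
      have "\<exists>u T''. loop_spmf (\<lambda>t. bval t b) (\<lambda>t. exec c (charge (bcost t b) t)) t = return_spmf u \<and>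
          stp c s0 T0 u T'' \<and> Inv (imem u) (rmem u) T'' \<and> \<not> bval u b"
        by (rule less.hyps[OF t(4) t(3) stp_trans[OF less.prems(2) stp_trans[OF 1 t(2)]]])
      then show ?thesis using True t by (subst loop_spmf.simps) simp
    qed
  qed
  have "stp c s0 T s0 T" using s0 by (simp add: stp_def)
  from main[OF _ this] assms(1) s0 obtain t T' where t:
      "loop_spmf (\<lambda>t. bval t b) (\<lambda>t. exec c (charge (bcost t b) t)) s0 = return_spmf t"
      "stp c s0 T t T'" "Inv (imem t) (rmem t) T'" "\<not> bval t b" by auto
  have bt: "bnd (imem t)" using t(2) by (simp add: stp_def)
  have "stp c s0 T (charge (bcost t b) t) (Suc T')"
    by (rule stp_trans[OF t(2) stp_charge[OF cb[OF bt] bt]])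
  moreover have "Q (imem t) (rmem t) (Suc T')"
    using t s0 by (intro fin bt) (auto simp: stp_def bval_eq)
  ultimately show "\<exists>t T'. exec (Loop b c) s0 = return_spmf t \<and> stp (Loop b c) s0 T t T' \<and> Q (imem t) (rmem t) T'"
    using t(1) by (intro exI[of _ "charge (bcost t b) t"] exI[of _ "Suc T'"])
      (auto simp: charge_def stp_def)
qed

end

abbreviation IV :: "nat \<Rightarrow> iexp" where "IV v \<equiv> IRead v (IConst 0)"
abbreviation RV :: "nat \<Rightarrow> rexp" where "RV v \<equiv> RRead v (IConst 0)"
abbreviation assign :: "nat \<Rightarrow> iexp \<Rightarrow> com" where "assign v e \<equiv> IWrite v (IConst 0) e"
abbreviation rassign :: "nat \<Rightarrow> rexp \<Rightarrow> com" where "rassign v e \<equiv> RWrite v (IConst 0) e"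

definition For :: "nat \<Rightarrow> iexp \<Rightarrow> com \<Rightarrow> com" where
  "For v e c = Seq (assign v (IConst 0)) (Loop (ILess (IV v) e) (Seq c (assign v (IBin IPlus (IV v) (IConst 1)))))"

lemma mods_For [simp]:
  "imods (For v e c) = insert v (imods c)" "rmods (For v e c) = rmods c"
  by (auto simp: For_def)

context ram
begin

text \<open>The bound \<open>e\<close> is evaluated anew in every round; \<open>len\<close> demands
  that only banks left alone by the body determine it. The counter value is supplied to
  \<open>step\<close> and \<open>fin\<close>, so \<open>P\<close> need not carry it.\<close>

lemma ok_For:
  assumes v: "v \<notin> imods c"
    and len: "\<And>I'. (\<And>a. a \<noteq> v \<Longrightarrow> a \<notin> imods c \<Longrightarrow> I' a = I a) \<Longrightarrow> iv I' e = len" "len \<le> M"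
    and init: "P 0 (I(v := (I v)(0 := 0))) R (Suc T)"
    and step: "\<And>k I' R' T'. k < len \<Longrightarrow> P k I' R' T' \<Longrightarrow> I' v 0 = k \<Longrightarrow> bnd I' \<Longrightarrow>
           (\<And>a. a \<noteq> v \<Longrightarrow> a \<notin> imods c \<Longrightarrow> I' a = I a) \<Longrightarrow> (\<And>a. a \<notin> rmods c \<Longrightarrow> R' a = R a) \<Longrightarrow>
           ok c I' R' (Suc T') (\<lambda>I'' R'' T''. P (Suc k) (I''(v := (I'' v)(0 := Suc k))) R'' (Suc T''))"
    and fin: "\<And>I' R' T'. P len I' R' T' \<Longrightarrow> I' v 0 = len \<Longrightarrow> bnd I' \<Longrightarrow>
           (\<And>a. a \<noteq> v \<Longrightarrow> a \<notin> imods c \<Longrightarrow> I' a = I a) \<Longrightarrow> (\<And>a. a \<notin> rmods c \<Longrightarrow> R' a = R a) \<Longrightarrow>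
           Q I' R' (Suc T')"
  shows "ok (For v e c) I R T Q"
  unfolding For_def
proof -
  let ?I = "I(v := (I v)(0 := 0))"
  let ?Inv = "\<lambda>I' R' T'. P (I' v 0) I' R' T' \<and> I' v 0 \<le> len"
  let ?c = "Seq c (assign v (IBin IPlus (IV v) (IConst 1)))"
  have fr: "I' a = I a" if "\<And>a. a \<notin> imods ?c \<Longrightarrow> I' a = ?I a" "a \<noteq> v" "a \<notin> imods c" for I' a
    using that(1)[of a] that(2,3) by auto
  have "ok (Loop (ILess (IV v) e) ?c) ?I R (Suc T) Q"
  proof (rule ok_Loop[where Inv = ?Inv and mea = "\<lambda>I' R'. len - I' v 0"])
    show "?Inv ?I R (Suc T)" using init by simp
  next
    fix I' R' T'
    assume a: "?Inv I' R' T'" "bv I' R' (ILess (IV v) e)" "bnd I'"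
      "\<And>a. a \<notin> imods ?c \<Longrightarrow> I' a = ?I a" "\<And>a. a \<notin> rmods ?c \<Longrightarrow> R' a = R a"
    have f: "\<And>a. a \<noteq> v \<Longrightarrow> a \<notin> imods c \<Longrightarrow> I' a = I a" using fr[OF a(4)] by blast
    have lt: "I' v 0 < len" using a(2) len(1)[OF f] by simp
    have "ok c I' R' (Suc T') (\<lambda>I'' R'' T''. P (Suc (I' v 0)) (I''(v := (I'' v)(0 := Suc (I' v 0)))) R'' (Suc T''))"
      using a lt f by (intro step) auto
    then show "ok ?c I' R' (Suc T')
        (\<lambda>I'' R'' T''. ?Inv I'' R'' T'' \<and> len - I'' v 0 < len - I' v 0)"
      using lt v len(2) by (intro ok_Seq) (rule ok_conseq, assumption, rule ok_IWrite, auto)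
  next
    fix I' R' T'
    assume a: "?Inv I' R' T'" "\<not> bv I' R' (ILess (IV v) e)" "bnd I'"
      "\<And>a. a \<notin> imods ?c \<Longrightarrow> I' a = ?I a" "\<And>a. a \<notin> rmods ?c \<Longrightarrow> R' a = R a"
    have f: "\<And>a. a \<noteq> v \<Longrightarrow> a \<notin> imods c \<Longrightarrow> I' a = I a" using fr[OF a(4)] by blast
    have "I' v 0 = len" using a len(1)[OF f] by simp
    then show "Q I' R' (Suc T')" using a f by (intro fin) auto
  qed
  then show "ok (Seq (assign v (IConst 0)) (Loop (ILess (IV v) e) ?c)) I R T Q"
    by (intro ok_Seq ok_IWrite) simp_all
qed

end

section \<open>Rademacher sums\<close>

text \<open>Expectation over \<open>N\<close> fair bits, padded with \<open>False\<close>. The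
  recursion on the first bit mirrors one round of the coin loop, which makes the link to
  \<open>spmf\<close> a plain induction.\<close>

primrec avg :: "nat \<Rightarrow> ((nat \<Rightarrow> bool) \<Rightarrow> real) \<Rightarrow> real" where
  "avg 0 f = f (\<lambda>_. False)"
| "avg (Suc N) f = (avg N (\<lambda>b. f (case_nat True b)) + avg N (\<lambda>b. f (case_nat False b))) / 2"

lemma avg_mono:
  assumes "\<And>b. (\<And>q. q \<ge> N \<Longrightarrow> \<not> b q) \<Longrightarrow> f b \<le> g b"
  shows "avg N f \<le> avg N g"
  using assms
proof (induction N arbitrary: f g)
  case (Suc N)
  have "avg N (\<lambda>b. f (case_nat x b)) \<le> avg N (\<lambda>b. g (case_nat x b))" for x
    by (intro Suc.IH Suc.prems) (auto split: nat.splits)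
  then show ?case by (simp add: add_mono divide_right_mono)
qed auto

lemma avg_cong:
  assumes "\<And>b. (\<And>q. q \<ge> N \<Longrightarrow> \<not> b q) \<Longrightarrow> f b = g b"
  shows "avg N f = avg N g"
  using assms by (intro antisym avg_mono) auto

lemma avg_const [simp]: "avg N (\<lambda>b. c) = c"
  by (induction N) auto

lemma avg_add: "avg N (\<lambda>b. f b + g b) = avg N f + avg N g"
  by (induction N arbitrary: f g) (auto simp: field_simps)

lemma avg_cmult: "avg N (\<lambda>b. c * f b) = c * avg N f"
  by (induction N arbitrary: f) (auto simp: field_simps)

lemma avg_multc: "avg N (\<lambda>b. f b * c) = avg N f * c"
  using avg_cmult[of N c f] by (simp add: mult.commute)

lemma avg_sum: "finite A \<Longrightarrow> avg N (\<lambda>b. \<Sum>x\<in>A. f x b) = (\<Sum>x\<in>A. avg N (f x))"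
  by (induction A rule: finite_induct) (auto simp: avg_add)

lemma avg_split:
  "avg (N + M) f = avg N (\<lambda>b. avg M (\<lambda>b'. f (\<lambda>q. if q < N then b q else b' (q - N))))"
proof (induction N arbitrary: f)
  case (Suc N)
  have *: "case_nat x (\<lambda>q. if q < N then b q else b' (q - N)) =
      (\<lambda>q. if q < Suc N then case_nat x b q else b' (q - Suc N))" for x b b'
    by (auto simp: fun_eq_iff split: nat.splits)
  show ?case by (simp add: Suc.IH *)
qed auto

text \<open>Padded with \<open>False\<close> beyond \<open>L\<close>, so that a block has the form
  of the strings over which \<open>avg L\<close> ranges.\<close>

definition blk :: "nat \<Rightarrow> nat \<Rightarrow> (nat \<Rightarrow> bool) \<Rightarrow> nat \<Rightarrow> bool" where
  "blk L i b = (\<lambda>q. q < L \<and> b (i * L + q))"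

lemma avg_prod: "avg (m * L) (\<lambda>b. \<Prod>i<m. F i (blk L i b)) = (\<Prod>i<m. avg L (F i))"
proof (induction m)
  case (Suc m)
  let ?c = "\<lambda>b b' q. if q < m * L then b q else b' (q - m * L)"
  have 1: "blk L i (?c b b') = blk L i b" if "i < m" for i b b'
  proof -
    have "i * L + q < m * L" if "q < L" for q
    proof -
      have "i * L + q < Suc i * L" using that by simp
      also have "\<dots> \<le> m * L" using \<open>i < m\<close> by (intro mult_le_mono) auto
      finally show ?thesis .
    qed
    then show ?thesis by (auto simp: blk_def fun_eq_iff)
  qed
  have 2: "blk L m (?c b b') = (\<lambda>q. q < L \<and> b' q)" for b b'
    by (auto simp: blk_def fun_eq_iff)
  have 3: "avg L (\<lambda>b'. F m (\<lambda>q. q < L \<and> b' q)) = avg L (F m)"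
  proof (rule avg_cong)
    fix b :: "nat \<Rightarrow> bool" assume "\<And>q. q \<ge> L \<Longrightarrow> \<not> b q"
    then have "(\<lambda>q. q < L \<and> b q) = b" by (auto simp: fun_eq_iff not_less[symmetric])
    then show "F m (\<lambda>q. q < L \<and> b q) = F m b" by simp
  qed
  have "avg (Suc m * L) (\<lambda>b. \<Prod>i<Suc m. F i (blk L i b)) =
      avg (m * L) (\<lambda>b. avg L (\<lambda>b'. (\<Prod>i<m. F i (blk L i b)) * F m (\<lambda>q. q < L \<and> b' q)))"
    by (simp add: add.commute[of L] avg_split 1 2)
  also have "\<dots> = avg (m * L) (\<lambda>b. (\<Prod>i<m. F i (blk L i b)) * avg L (F m))"
    by (simp only: avg_cmult 3)
  finally show ?case by (simp only: avg_multc Suc.IH prod.lessThan_Suc)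
qed auto

lemma avg_blk:
  assumes "i < m"
  shows "avg (m * L) (\<lambda>b. F (blk L i b)) = avg L F"
proof -
  let ?F = "\<lambda>j b. if j = i then F b else 1"
  have "avg (m * L) (\<lambda>b. \<Prod>j<m. ?F j (blk L j b)) = (\<Prod>j<m. avg L (?F j))"
    by (rule avg_prod)
  moreover have "(\<Prod>j<m. ?F j (blk L j b)) = F (blk L i b)" for b
    using assms by (simp add: prod.delta)
  moreover have "(\<Prod>j<m. avg L (?F j)) = avg L F"
    using assms by (subst prod.remove[of _ i]) auto
  ultimately show ?thesis by simp
qed

section \<open>Upper tail of a sign sum\<close>

definition sgb :: "bool \<Rightarrow> real" where "sgb x = (if x then 1 else -1)"

lemma avg_sgb_Suc:
  "avg (Suc N) (\<lambda>b. f (\<Sum>q<Suc N. c q * sgb (b q))) =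
     (avg N (\<lambda>b. f (c 0 + (\<Sum>q<N. c (Suc q) * sgb (b q)))) +
      avg N (\<lambda>b. f (- c 0 + (\<Sum>q<N. c (Suc q) * sgb (b q))))) / 2"
  unfolding sum.lessThan_Suc_shift by (simp add: sgb_def)

lemma sinh_le_mult_cosh: "0 \<le> x \<Longrightarrow> sinh x \<le> x * cosh (x :: real)"
proof -
  assume x: "0 \<le> x"
  have "(\<lambda>x. x * cosh x - sinh x) 0 \<le> (\<lambda>x. x * cosh x - sinh x) x"
  proof (rule DERIV_nonneg_imp_nondecreasing[OF x])
    fix y :: real assume "0 \<le> y"
    then show "\<exists>z. ((\<lambda>x. x * cosh x - sinh x) has_real_derivative z) (at y) \<and> 0 \<le> z"
      by (intro exI[of _ "y * sinh y"] conjI) (auto intro!: derivative_eq_intros)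
  qed
  then show ?thesis by simp
qed

text \<open>A sign is sub-Gaussian: cosh x * exp (- x^2 / 2) decreases for x \<ge> 0, because sinh x
  \<le> x * cosh x.\<close>

lemma cosh_le_exp: "cosh x \<le> exp (x\<^sup>2 / 2)" for x :: real
proof -
  have "cosh x \<le> exp (x\<^sup>2 / 2)" if x: "0 \<le> x" for x :: real
  proof -
    have "(\<lambda>x. cosh x * exp (- (x\<^sup>2 / 2))) x \<le> (\<lambda>x. cosh x * exp (- (x\<^sup>2 / 2))) 0"
    proof (rule DERIV_nonpos_imp_nonincreasing[OF x])
      fix y :: real assume "0 \<le> y"
      then show "\<exists>z. ((\<lambda>x. cosh x * exp (- (x\<^sup>2 / 2))) has_real_derivative z) (at y) \<and> z \<le> 0"
        using sinh_le_mult_cosh[of y]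
        by (intro exI[of _ "(sinh y - y * cosh y) * exp (- (y\<^sup>2 / 2))"] conjI)
           (auto intro!: derivative_eq_intros mult_nonpos_nonneg simp: algebra_simps)
    qed
    then show ?thesis by (simp add: exp_minus field_simps)
  qed
  from this[of "\<bar>x\<bar>"] show ?thesis by simp
qed

lemma avg_exp_le:
  "avg N (\<lambda>b. exp (s * (\<Sum>q<N. c q * sgb (b q)))) \<le> exp (s\<^sup>2 * (\<Sum>q<N. (c q)\<^sup>2) / 2)"
proof (induction N arbitrary: c)
  case (Suc N)
  let ?A = "avg N (\<lambda>b. exp (s * (\<Sum>q<N. c (Suc q) * sgb (b q))))"
  have e: "exp (s * (z + S)) = exp (s * z) * exp (s * S)" for z S
    unfolding exp_add[symmetric] by (simp add: distrib_left)
  have "avg (Suc N) (\<lambda>b. exp (s * (\<Sum>q<Suc N. c q * sgb (b q)))) =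
      (exp (s * c 0) * ?A + exp (s * - c 0) * ?A) / 2"
    unfolding avg_sgb_Suc[where f = "\<lambda>x. exp (s * x)"] e avg_cmult ..
  also have "\<dots> = cosh (s * c 0) * ?A" by (simp add: cosh_field_def distrib_right)
  also have "\<dots> \<le> exp ((s * c 0)\<^sup>2 / 2) * exp (s\<^sup>2 * (\<Sum>q<N. (c (Suc q))\<^sup>2) / 2)"
    using avg_mono[of N "\<lambda>_. 0" "\<lambda>b. exp (s * (\<Sum>q<N. c (Suc q) * sgb (b q)))"]
    by (intro mult_mono cosh_le_exp Suc.IH) auto
  also have "\<dots> = exp (s\<^sup>2 * (\<Sum>q<Suc N. (c q)\<^sup>2) / 2)"
    unfolding sum.lessThan_Suc_shift exp_add[symmetric] by (simp add: field_simps power_mult_distrib)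
  finally show ?case .
qed auto

lemma avg_tail_le:
  assumes "0 \<le> a" "(\<Sum>q<N. (c q)\<^sup>2) = V" "V > 0"
  shows "avg N (\<lambda>b. of_bool (a \<le> (\<Sum>q<N. c q * sgb (b q)))) \<le> exp (- a\<^sup>2 / (2 * V))"
proof -
  \<comment> \<open>The Chernoff parameter, which minimises - s * a + s^2 * V / 2.\<close>
  let ?s = "a / V"
  have "avg N (\<lambda>b. of_bool (a \<le> (\<Sum>q<N. c q * sgb (b q)))) \<le>
      avg N (\<lambda>b. exp (- ?s * a) * exp (?s * (\<Sum>q<N. c q * sgb (b q))))"
  proof (rule avg_mono)
    fix b :: "nat \<Rightarrow> bool"
    let ?x = "\<Sum>q<N. c q * sgb (b q)"
    have "0 \<le> ?s * (?x - a)" if "a \<le> ?x" using that assms by (intro mult_nonneg_nonneg) auto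
    then have "1 \<le> exp (- ?s * a) * exp (?s * ?x)" if "a \<le> ?x"
      using that unfolding exp_add[symmetric] by (simp add: algebra_simps diff_divide_distrib)
    then show "of_bool (a \<le> ?x) \<le> exp (- ?s * a) * exp (?s * ?x)" by (auto simp del: mult_minus_left)
  qed
  also have "\<dots> = exp (- ?s * a) * avg N (\<lambda>b. exp (?s * (\<Sum>q<N. c q * sgb (b q))))"
    by (rule avg_cmult)
  also have "\<dots> \<le> exp (- ?s * a) * exp (?s\<^sup>2 * (\<Sum>q<N. (c q)\<^sup>2) / 2)"
    by (intro mult_left_mono avg_exp_le) auto
  also have "\<dots> = exp (- a\<^sup>2 / (2 * V))"
    using assms unfolding exp_add[symmetric] by (simp add: field_simps power2_eq_square)
  finally show ?thesis .
qed

section \<open>Lower tail of a sign sum\<close>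

lemma cosh_ge_exp:
  fixes y :: real
  assumes "y\<^sup>2 \<le> 2"
  shows "exp (y\<^sup>2 / 2 - y ^ 4 / 4) \<le> cosh y"
proof -
  have "\<bar>y / 2\<bar> \<le> \<bar>sinh (y / 2)\<bar>"
    using real_le_abs_sinh[of "y / 2"] by (simp add: sinh_field_def exp_minus)
  then have "(y / 2)\<^sup>2 \<le> (sinh (y / 2))\<^sup>2" by (metis abs_ge_zero power2_abs power_mono)
  moreover have "cosh y = 1 + 2 * (sinh (y / 2))\<^sup>2"
    using cosh_double[of "y / 2"] by (simp add: cosh_square_eq)
  ultimately have "1 + y\<^sup>2 / 2 \<le> cosh y" by (simp add: power_divide)
  moreover have "y\<^sup>2 / 2 - (y\<^sup>2 / 2)\<^sup>2 \<le> ln (1 + y\<^sup>2 / 2)"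
    using assms by (intro ln_one_plus_pos_lower_bound) auto
  then have "exp (y\<^sup>2 / 2 - (y\<^sup>2 / 2)\<^sup>2) \<le> 1 + y\<^sup>2 / 2"
    by (metis add_pos_nonneg exp_le_cancel_iff exp_ln less_numeral_extra(1) zero_le_divide_iff zero_le_numeral zero_le_power2)
  ultimately show ?thesis by (simp add: power_divide)
qed

lemma sqrt_ge_exp:
  fixes q :: real
  assumes "0 \<le> q" "q \<le> 1"
  shows "exp (q / 2 - q\<^sup>2 / 2) \<le> sqrt (1 + q)"
proof -
  have "exp (q - q\<^sup>2) \<le> 1 + q"
    using ln_one_plus_pos_lower_bound[of q] assms
    by (metis add_pos_nonneg exp_le_cancel_iff exp_ln less_numeral_extra(1))
  then have "(exp (q / 2 - q\<^sup>2 / 2))\<^sup>2 \<le> 1 + q"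
    by (simp add: exp_double[symmetric] right_diff_distrib)
  then show ?thesis by (rule real_le_rsqrt)
qed

text \<open>The heat kernel, a subsolution of the Rademacher walk up to a small multiplicative error.\<close>

definition heat :: "real \<Rightarrow> real \<Rightarrow> real" where
  "heat s x = exp (- (x\<^sup>2 / (2 * s))) / sqrt s"

text \<open>With q = c^2 / s and y = x * c / s, averaging the two shifts gives exp (- x^2 / (2 * s)
  - q / 2) * cosh y / sqrt s. To second order this agrees with the kernel of variance s + c^2; the
  mismatch y^4 / 4 + q^2 / 2 is at most \<theta> * c^2.\<close>

lemma heat_step:
  assumes s: "0 < s0" "s0 \<le> s" "s0 \<le> 1" and B: "1 \<le> B" "\<bar>x\<bar> \<le> B"
    and c: "c\<^sup>2 \<le> \<kappa>" and \<theta>: "\<theta> = \<kappa> * B ^ 4 / s0 ^ 4" "\<theta> \<le> 1"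
  shows "exp (- (\<theta> * c\<^sup>2)) * heat (s + c\<^sup>2) x \<le> (heat s (x + c) + heat s (x - c)) / 2"
proof -
  define q where "q = c\<^sup>2 / s"
  define y where "y = x * c / s"
  have sp: "0 < s" using s by simp
  have q0: "0 \<le> q" using sp by (simp add: q_def)
  have B4: "1 \<le> B ^ 2" "B ^ 2 \<le> B ^ 4" using B by (auto simp: power_increasing one_le_power)
  have s4: "0 < s0 ^ 4" "s0 ^ 4 \<le> s0 ^ 2" "s0 ^ 2 \<le> s0" "s0\<^sup>2 \<le> s\<^sup>2"
    using s power_decreasing[of 2 4 s0] power_decreasing[of 1 2 s0] power_mono[of s0 s 2] by auto
  have \<kappa>0: "0 \<le> \<kappa>" using c order_trans zero_le_power2 by blast
  have ks: "\<kappa> * B ^ 2 / s0 ^ 2 \<le> \<theta>" "\<kappa> / s0 ^ 2 \<le> \<kappa> * B ^ 2 / s0 ^ 2" "\<kappa> / s0 \<le> \<kappa> / s0 ^ 2"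
    unfolding \<theta>(1) using s4 s B4 \<kappa>0
    by (intro frac_le mult_left_mono mult_nonneg_nonneg; simp add: mult_le_cancel_left1)+
  have x2: "x\<^sup>2 \<le> B\<^sup>2" using B by (metis abs_ge_zero power2_abs power_mono)
  have y2: "y\<^sup>2 \<le> c\<^sup>2 * B\<^sup>2 / s0\<^sup>2"
    unfolding y_def power_divide power_mult_distrib using x2 s4 s
    by (subst mult.commute, intro frac_le mult_left_mono) auto
  have "c\<^sup>2 * B\<^sup>2 / s0\<^sup>2 \<le> \<kappa> * B\<^sup>2 / s0\<^sup>2" using c by (intro divide_right_mono mult_right_mono) auto
  then have y2': "y\<^sup>2 \<le> 1" using y2 ks \<theta> by linarith
  have "q \<le> \<kappa> / s0" unfolding q_def using c s \<kappa>0 by (intro frac_le) auto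
  then have q1: "q \<le> 1" using ks \<theta> by linarith
  have y4: "y ^ 4 \<le> \<theta> * c\<^sup>2"
  proof -
    have "y ^ 4 = y\<^sup>2 * y\<^sup>2" by (simp add: power2_eq_square power4_eq_xxxx)
    also have "\<dots> \<le> (c\<^sup>2 * B\<^sup>2 / s0\<^sup>2) * (\<kappa> * B\<^sup>2 / s0\<^sup>2)"
      using y2 \<open>c\<^sup>2 * B\<^sup>2 / s0\<^sup>2 \<le> \<kappa> * B\<^sup>2 / s0\<^sup>2\<close> by (intro mult_mono) auto
    also have "\<dots> = \<theta> * c\<^sup>2" by (simp add: \<theta> power2_eq_square power4_eq_xxxx field_simps)
    finally show ?thesis .
  qed
  have q2: "q\<^sup>2 \<le> \<theta> * c\<^sup>2"
  proof -
    have "q\<^sup>2 = c\<^sup>2 * (c\<^sup>2 / s\<^sup>2)" by (simp add: q_def power2_eq_square)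
    also have "\<dots> \<le> c\<^sup>2 * (\<kappa> / s0\<^sup>2)" using c s4 s \<kappa>0 by (intro mult_left_mono frac_le) auto
    also have "\<dots> \<le> c\<^sup>2 * \<theta>" using ks by (intro mult_left_mono) auto
    finally show ?thesis by (simp add: mult.commute)
  qed
  have "x\<^sup>2 / (2 * s) - x\<^sup>2 / (2 * (s + c\<^sup>2)) \<le> y\<^sup>2 / 2"
  proof -
    have "x\<^sup>2 / (2 * s) - x\<^sup>2 / (2 * (s + c\<^sup>2)) = x\<^sup>2 * c\<^sup>2 / (2 * (s * (s + c\<^sup>2)))"
      using sp by (simp add: field_simps add_pos_nonneg add_nonneg_eq_0_iff pos_add_strict)
    also have "\<dots> \<le> x\<^sup>2 * c\<^sup>2 / (2 * (s * s))"
      using sp by (intro divide_left_mono mult_left_mono mult_pos_pos) (auto simp: add_pos_nonneg)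
    also have "\<dots> = y\<^sup>2 / 2" by (simp add: y_def power2_eq_square algebra_simps)
    finally show ?thesis .
  qed
  then have "- (\<theta> * c\<^sup>2) - x\<^sup>2 / (2 * (s + c\<^sup>2)) \<le>
      - (x\<^sup>2 / (2 * s)) - q / 2 + (y\<^sup>2 / 2 - y ^ 4 / 4) + (q / 2 - q\<^sup>2 / 2)"
    using y4 q2 zero_le_power2[of q] by linarith
  then have "exp (- (\<theta> * c\<^sup>2) - x\<^sup>2 / (2 * (s + c\<^sup>2))) \<le>
      exp (- (x\<^sup>2 / (2 * s)) - q / 2) * exp (y\<^sup>2 / 2 - y ^ 4 / 4) * exp (q / 2 - q\<^sup>2 / 2)"
    by (simp add: exp_add[symmetric])
  also have "\<dots> \<le> exp (- (x\<^sup>2 / (2 * s)) - q / 2) * cosh y * sqrt (1 + q)"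
    using y2' q0 q1 by (intro mult_mono mult_nonneg_nonneg cosh_ge_exp sqrt_ge_exp) auto
  finally have main: "exp (- (\<theta> * c\<^sup>2) - x\<^sup>2 / (2 * (s + c\<^sup>2))) \<le>
      exp (- (x\<^sup>2 / (2 * s)) - q / 2) * cosh y * sqrt (1 + q)" .
  have sq: "sqrt (s + c\<^sup>2) = sqrt s * sqrt (1 + q)"
    using sp by (simp add: q_def real_sqrt_mult[symmetric] distrib_left)
  have sqp: "0 < sqrt s" "0 < sqrt (1 + q)" using sp q0 by auto
  have "exp (- (\<theta> * c\<^sup>2)) * heat (s + c\<^sup>2) x =
      exp (- (\<theta> * c\<^sup>2) - x\<^sup>2 / (2 * (s + c\<^sup>2))) / (sqrt s * sqrt (1 + q))"
    by (simp add: heat_def sq exp_diff exp_minus field_simps)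
  also have "\<dots> \<le> exp (- (x\<^sup>2 / (2 * s)) - q / 2) * cosh y / sqrt s"
    using main sqp by (simp add: field_simps)
  also have "\<dots> = (heat s (x + c) + heat s (x - c)) / 2"
  proof -
    have 1: "- ((x + c)\<^sup>2 / (2 * s)) = - (x\<^sup>2 / (2 * s)) - q / 2 + (- y)"
      and 2: "- ((x - c)\<^sup>2 / (2 * s)) = - (x\<^sup>2 / (2 * s)) - q / 2 + y"
      using sp by (auto simp: q_def y_def power2_eq_square field_simps)
    define E where "E = exp (- (x\<^sup>2 / (2 * s)) - q / 2)"
    show ?thesis unfolding heat_def 1 2 exp_add[of _ y] exp_add[of _ "- y"] E_def[symmetric]
      using sqp by (simp add: cosh_field_def field_simps)
  qed
  finally show ?thesis .
qed

lemma avg_ge_heat: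
  assumes s: "0 < s0" "s0 \<le> 1" and B: "1 \<le> B"
    and \<theta>: "\<theta> = \<kappa> * B ^ 4 / s0 ^ 4" "\<theta> \<le> 1" "0 \<le> \<theta>"
    and f: "\<And>y. 0 \<le> f y" "\<And>y. heat s0 y - \<delta> \<le> f y"
    and \<delta>: "0 \<le> \<delta>" "\<And>s y. s0 \<le> s \<Longrightarrow> s \<le> s0 + 1 \<Longrightarrow> B \<le> \<bar>y\<bar> \<Longrightarrow> heat s y \<le> \<delta>"
    and c: "\<And>q. q < N \<Longrightarrow> (c q)\<^sup>2 \<le> \<kappa>" "(\<Sum>q<N. (c q)\<^sup>2) = V" "V \<le> 1"
  shows "exp (- (\<theta> * V)) * heat (s0 + V) x - \<delta> \<le> avg N (\<lambda>b. f (x + (\<Sum>q<N. c q * sgb (b q))))"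
  using c
proof (induction N arbitrary: c V x)
  case 0
  then show ?case using f(2) by simp
next
  case (Suc N)
  define V' where "V' = (\<Sum>q<N. (c (Suc q))\<^sup>2)"
  have V: "V = (c 0)\<^sup>2 + V'"
    using Suc.prems(2) unfolding sum.lessThan_Suc_shift by (simp add: V'_def)
  have V'1: "V' \<le> 1" using V Suc.prems(3) zero_le_power2[of "c 0"] by linarith
  have V'0: "0 \<le> V'" by (auto simp: V'_def intro: sum_nonneg)
  have V0: "0 \<le> V" by (simp add: V V'0)
  show ?case
  proof (cases "\<bar>x\<bar> \<le> B")
    case False
    then have "heat (s0 + V) x \<le> \<delta>" using V0 Suc.prems(3) by (intro \<delta>) auto
    moreover have "exp (- (\<theta> * V)) * heat (s0 + V) x \<le> 1 * heat (s0 + V) x"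
      using mult_nonneg_nonneg[OF \<theta>(3) V0] V0 s by (intro mult_right_mono) (auto simp: heat_def)
    ultimately have "exp (- (\<theta> * V)) * heat (s0 + V) x - \<delta> \<le> avg (Suc N) (\<lambda>_. 0)" by simp
    also have "\<dots> \<le> avg (Suc N) (\<lambda>b. f (x + (\<Sum>q<Suc N. c q * sgb (b q))))"
      using f(1) by (intro avg_mono) auto
    finally show ?thesis .
  next
    case True
    have IH: "exp (- (\<theta> * V')) * heat (s0 + V') x' - \<delta> \<le>
        avg N (\<lambda>b. f (x' + (\<Sum>q<N. c (Suc q) * sgb (b q))))" for x'
      using Suc.prems(1) V'1 by (intro Suc.IH V'_def[symmetric]) auto
    have "exp (- (\<theta> * (c 0)\<^sup>2)) * heat (s0 + V' + (c 0)\<^sup>2) x \<le>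
        (heat (s0 + V') (x + c 0) + heat (s0 + V') (x - c 0)) / 2"
      using True s B \<theta> V'0 Suc.prems by (intro heat_step[of s0 "s0 + V'" B x "c 0" \<kappa> \<theta>]) auto
    then have "exp (- (\<theta> * V')) * (exp (- (\<theta> * (c 0)\<^sup>2)) * heat (s0 + V' + (c 0)\<^sup>2) x) \<le>
        exp (- (\<theta> * V')) * ((heat (s0 + V') (x + c 0) + heat (s0 + V') (x - c 0)) / 2)"
      by (intro mult_left_mono) auto
    moreover have "exp (- (\<theta> * V')) * (exp (- (\<theta> * (c 0)\<^sup>2)) * heat (s0 + V' + (c 0)\<^sup>2) x) =
        exp (- (\<theta> * V)) * heat (s0 + V) x"
      by (simp add: V exp_add[symmetric] algebra_simps)
    ultimately have "exp (- (\<theta> * V)) * heat (s0 + V) x - \<delta> \<le>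
        ((exp (- (\<theta> * V')) * heat (s0 + V') (x + c 0) - \<delta>) +
         (exp (- (\<theta> * V')) * heat (s0 + V') (x - c 0) - \<delta>)) / 2"
      by (simp add: field_simps)
    also have "\<dots> \<le> (avg N (\<lambda>b. f (x + c 0 + (\<Sum>q<N. c (Suc q) * sgb (b q)))) +
        avg N (\<lambda>b. f (x - c 0 + (\<Sum>q<N. c (Suc q) * sgb (b q))))) / 2"
      by (intro divide_right_mono add_mono IH) auto
    also have "\<dots> = avg (Suc N) (\<lambda>b. f (x + (\<Sum>q<Suc N. c q * sgb (b q))))"
      unfolding avg_sgb_Suc[where f = "\<lambda>z. f (x + z)"] by (simp add: algebra_simps)
    finally show ?thesis .
  qed
qed


text \<open>The tail contains the window from t to t + 2 * w, whose indicator, scaled by 1 / sqrt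
  s0, dominates a narrow heat kernel centred at t + w up to \<delta>. Running the walk widens the
  kernel to variance s0 + 1, where its value at distance t + w is exp (- t^2 / 2) up to a constant.
  The scale sqrt s0 costs the polynomial in h.\<close>

lemma avg_tail_ge_unit:
  fixes h t K :: real
  assumes h: "1 \<le> h" and t: "0 \<le> t" "t \<le> 4 * h" "t\<^sup>2 / 2 \<le> 8 * h"
    and K: "2 ^ 68 * h ^ 14 \<le> K"
    and c: "(\<Sum>q<N. (c q)\<^sup>2) = 1" "\<And>q. q < N \<Longrightarrow> (c q)\<^sup>2 \<le> 1 / K"
  shows "exp (- (t\<^sup>2 / 2)) / (2048 * h\<^sup>2) \<le> avg N (\<lambda>b. of_bool (t \<le> (\<Sum>q<N. c q * sgb (b q))))"
proof -
  \<comment> \<open>The half-width w keeps t * w below 1 / 2, so moving the centre costs a constant.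
    The variance s0 is chosen for w^2 / (2 * s0) = 64 * h, and B^2 = 256 * h gives the same exponent
    at the cut-off, as variances stay below 2. Both truncation errors are thus at most
    \<delta>.\<close>
  define s0 where "s0 = 1 / (8192 * h ^ 3)"
  define w where "w = 1 / (8 * h)"
  define B where "B = 16 * sqrt h"
  define \<delta> where "\<delta> = exp (- (64 * h)) / sqrt s0"
  define \<theta> where "\<theta> = (1 / K) * B ^ 4 / s0 ^ 4"
  define f :: "real \<Rightarrow> real" where "f y = of_bool (\<bar>y\<bar> \<le> w) / sqrt s0" for y
  have hp: "0 < h" using h by simp
  have h3: "1 \<le> h ^ 3" "h ^ 3 \<le> h ^ 4" using h by (auto intro: power_increasing)
  have s0: "0 < s0" "s0 \<le> 1" using hp h3 by (auto simp: s0_def divide_simps)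
  have sq0: "0 < sqrt s0" using s0 by simp
  have "0 < 2 ^ 68 * h ^ 14" using hp by (intro mult_pos_pos) auto
  then have Kp: "0 < K" using K by (rule less_le_trans)
  have B1: "1 \<le> B" using real_sqrt_ge_one[OF h] unfolding B_def by linarith
  have B2: "B\<^sup>2 = 256 * h" using hp by (simp add: B_def power_mult_distrib)
  have B4: "B ^ 4 = 65536 * h\<^sup>2"
  proof -
    have "B ^ 4 = (B\<^sup>2)\<^sup>2" by (simp add: power_mult[symmetric])
    also have "\<dots> = 65536 * h\<^sup>2" unfolding B2 by (simp add: power2_eq_square)
    finally show ?thesis .
  qed
  have s4: "s0 ^ 4 = 1 / (2 ^ 52 * h ^ 12)"
    by (simp add: s0_def power_divide power_mult_distrib power_mult[symmetric])
  have "h\<^sup>2 * h ^ 12 = h ^ 14" by (simp add: power_add[symmetric])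
  \<comment> \<open>The origin of 2^68 and h^14: B^4 contributes 2^16 * h^2, and 1 / s0^4
    contributes 2^52 * h^12.\<close>
  then have "65536 * h\<^sup>2 * (2 ^ 52 * h ^ 12) = 2 ^ 68 * h ^ 14" by (simp add: mult.assoc[symmetric] mult.commute)
  then have "\<theta> = 2 ^ 68 * h ^ 14 / K"
    unfolding \<theta>_def B4 s4 by (simp add: field_simps)
  then have \<theta>1: "\<theta> \<le> 1" using K Kp by (simp add: divide_le_eq)
  have \<theta>0: "0 \<le> \<theta>" using Kp s0 by (simp add: \<theta>_def B4)
  have w0: "0 < w" "w * h \<le> 1 / 8" "w \<le> 1" using h by (auto simp: w_def divide_simps)
  have \<delta>0: "0 \<le> \<delta>" using sq0 by (simp add: \<delta>_def)
  have f2: "heat s0 y - \<delta> \<le> f y" for y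
  proof (cases "\<bar>y\<bar> \<le> w")
    case True
    have "heat s0 y \<le> 1 / sqrt s0" using s0 by (auto simp: heat_def divide_right_mono)
    then show ?thesis using True \<delta>0 by (simp add: f_def)
  next
    case False
    then have "w\<^sup>2 \<le> y\<^sup>2" using w0 by (simp add: abs_le_square_iff[symmetric])
    then have "w\<^sup>2 / (2 * s0) \<le> y\<^sup>2 / (2 * s0)" using s0 by (simp add: divide_right_mono)
    moreover have "w\<^sup>2 / (2 * s0) = 64 * h"
      using hp by (simp add: w_def s0_def field_simps power2_eq_square power3_eq_cube)
    ultimately have "heat s0 y \<le> \<delta>" using s0 by (auto simp: heat_def \<delta>_def intro!: divide_right_mono)
    then show ?thesis using False by (simp add: f_def)
  qed
  have \<delta>2: "heat s y \<le> \<delta>" if "s0 \<le> s" "s \<le> s0 + 1" "B \<le> \<bar>y\<bar>" for s y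
  proof -
    have "256 * h \<le> y\<^sup>2" unfolding B2[symmetric] using that B1 by (simp add: abs_le_square_iff[symmetric])
    moreover have "2 * s \<le> 4" "0 < s" using that s0 by auto
    ultimately have "256 * h / 4 \<le> y\<^sup>2 / (2 * s)" using hp by (intro frac_le) auto
    then show ?thesis using that s0 unfolding heat_def \<delta>_def
      by (intro frac_le) auto
  qed
  have main: "exp (- (\<theta> * 1)) * heat (s0 + 1) (- (t + w)) - \<delta> \<le>
      avg N (\<lambda>b. f (- (t + w) + (\<Sum>q<N. c q * sgb (b q))))"
    using s0 B1 \<theta>1 \<theta>0 f2 \<delta>2 c \<theta>_def sq0
    by (intro avg_ge_heat[where B = B and \<kappa> = "1 / K"]) (auto simp: f_def \<delta>_def)
  have "avg N (\<lambda>b. f (- (t + w) + (\<Sum>q<N. c q * sgb (b q)))) \<le>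
      avg N (\<lambda>b. (1 / sqrt s0) * of_bool (t \<le> (\<Sum>q<N. c q * sgb (b q))))"
    using sq0 by (intro avg_mono) (auto simp: f_def)
  note fle = this
  have le: "sqrt s0 * (exp (- \<theta>) * heat (s0 + 1) (- (t + w)) - \<delta>) \<le>
      avg N (\<lambda>b. of_bool (t \<le> (\<Sum>q<N. c q * sgb (b q))))" (is "_ \<le> ?P")
  proof -
    have "exp (- (\<theta> * 1)) * heat (s0 + 1) (- (t + w)) - \<delta> \<le> 1 / sqrt s0 * ?P"
      using main fle unfolding avg_cmult by linarith
    then have "sqrt s0 * (exp (- (\<theta> * 1)) * heat (s0 + 1) (- (t + w)) - \<delta>) \<le> sqrt s0 * (1 / sqrt s0 * ?P)"
      using sq0 by (intro mult_left_mono) auto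
    then show ?thesis using sq0 by simp
  qed
  have e1: "exp 1 \<le> (272 / 100 :: real)" using e_less_272 by simp
  have e2: "exp 2 \<le> (74 / 10 :: real)"
  proof -
    have "exp 2 = exp 1 * exp (1::real)" unfolding exp_add[symmetric] by simp
    also have "\<dots> \<le> (272 / 100) * (272 / 100)" using e1 by (intro mult_mono) auto
    finally show ?thesis by simp
  qed
  have tw: "(t + w)\<^sup>2 / (2 * (s0 + 1)) \<le> t\<^sup>2 / 2 + 1"
  proof -
    have "(t + w)\<^sup>2 / (2 * (s0 + 1)) \<le> (t + w)\<^sup>2 / 2" using s0 by (intro divide_left_mono) auto
    also have "\<dots> = t\<^sup>2 / 2 + t * w + w\<^sup>2 / 2" by (simp add: power2_eq_square field_simps)
    also have "t * w \<le> 4 * h * w" using t w0 by (intro mult_right_mono) auto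
    also have "4 * h * w \<le> 1 / 2" using w0 by (simp add: mult.commute)
    also have "w\<^sup>2 \<le> 1" using w0 by (simp add: power_le_one)
    finally show ?thesis by simp
  qed
  have H: "exp (- 1) * (exp (- (t\<^sup>2 / 2) - 1) / (3 / 2)) \<le> exp (- \<theta>) * heat (s0 + 1) (- (t + w))"
  proof -
    have "sqrt (s0 + 1) \<le> 3 / 2" using s0 by (intro real_le_lsqrt) (auto simp: power2_eq_square)
    then have "exp (- (t\<^sup>2 / 2) - 1) / (3 / 2) \<le> heat (s0 + 1) (- (t + w))"
      unfolding heat_def using tw s0 by (intro frac_le) (auto simp: power2_commute power2_minus add.commute)
    then show ?thesis using \<theta>1 by (intro mult_mono) auto
  qed
  have sl: "1 / (91 * h\<^sup>2) \<le> sqrt s0"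
  proof (rule real_le_rsqrt)
    have "8192 * h ^ 3 \<le> 8281 * h ^ 4" using h3 hp by (intro mult_mono) auto
    then show "(1 / (91 * h\<^sup>2))\<^sup>2 \<le> s0"
      unfolding s0_def power_divide power_mult_distrib using hp by (auto intro!: divide_left_mono simp flip: power_mult)
  qed
  let ?E = "exp (- (t\<^sup>2 / 2))"
  have Ep: "exp (- 1) * (exp (- (t\<^sup>2 / 2) - 1) / (3 / 2)) = ?E / (exp 2 * (3 / 2))"
  proof -
    have "exp (- 1) * exp (- (t\<^sup>2 / 2) - 1) = ?E * exp (- 2)" unfolding exp_add[symmetric] by simp
    then show ?thesis by (simp add: exp_minus field_simps)
  qed
  have d: "sqrt s0 * \<delta> = exp (- (64 * h))" using sq0 by (simp add: \<delta>_def)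
  have m1: "?E / (exp 2 * (3 / 2)) * (1 / (91 * h\<^sup>2)) \<le> sqrt s0 * (exp (- \<theta>) * heat (s0 + 1) (- (t + w)))"
  proof -
    have "1 / (91 * h\<^sup>2) * (?E / (exp 2 * (3 / 2))) \<le> sqrt s0 * (exp (- \<theta>) * heat (s0 + 1) (- (t + w)))"
      using sq0 by (intro mult_mono[OF sl H[unfolded Ep]]) auto
    then show ?thesis by (simp only: mult.commute)
  qed
  \<comment> \<open>Numerically e^2 * (3 / 2) * 91 < 1024, where 91 exceeds sqrt 8192; the remaining
    factor 2 in 2048 pays for the additive error \<delta>.\<close>
  have q: "?E / (1024 * h\<^sup>2) \<le> ?E / (exp 2 * (3 / 2)) * (1 / (91 * h\<^sup>2))"
  proof -
    have "exp 2 * (3 / 2) * (91 * h\<^sup>2) \<le> (74 / 10) * (3 / 2) * (91 * h\<^sup>2)"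
      using e2 by (intro mult_right_mono) auto
    also have "\<dots> \<le> 1024 * h\<^sup>2" by simp
    finally have "?E / (1024 * h\<^sup>2) \<le> ?E / (exp 2 * (3 / 2) * (91 * h\<^sup>2))"
      using hp by (intro divide_left_mono) auto
    then show ?thesis by simp
  qed
  have r: "exp (- (64 * h)) \<le> ?E / (2048 * h\<^sup>2)"
  proof -
    have "h \<le> exp h" using exp_ge_add_one_self[of h] by linarith
    then have "h\<^sup>2 \<le> (exp h)\<^sup>2" using hp by (intro power_mono) auto
    then have "h\<^sup>2 \<le> exp (2 * h)" by (simp add: exp_double)
    moreover have "(2048::real) \<le> exp (11 * h)"
    proof -
      have "(2::real) ^ 11 \<le> exp 1 ^ 11" using exp_ge_add_one_self[of 1] by (intro power_mono) auto
      also have "\<dots> = exp 11" unfolding exp_of_nat_mult[symmetric] by simp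
      also have "\<dots> \<le> exp (11 * h)" using h by simp
      finally show ?thesis by simp
    qed
    ultimately have "2048 * h\<^sup>2 \<le> exp (11 * h) * exp (2 * h)" by (intro mult_mono) auto
    also have "\<dots> = exp (13 * h)" unfolding exp_add[symmetric] by simp
    finally have "2048 * h\<^sup>2 * exp (- (64 * h)) \<le> exp (13 * h) * exp (- (64 * h))" by (intro mult_right_mono) auto
    also have "\<dots> \<le> ?E" unfolding exp_add[symmetric] using t h by simp
    finally show ?thesis using hp by (simp add: field_simps)
  qed
  have "?E / (2048 * h\<^sup>2) = ?E / (1024 * h\<^sup>2) - ?E / (2048 * h\<^sup>2)" using hp by (simp add: field_simps)
  also have "\<dots> \<le> sqrt s0 * (exp (- \<theta>) * heat (s0 + 1) (- (t + w))) - exp (- (64 * h))"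
    using m1 q r by linarith
  also have "\<dots> \<le> ?P" using le d by (simp add: right_diff_distrib)
  finally show ?thesis .
qed

lemma avg_tail_ge:
  fixes h t K V :: real
  assumes h: "1 \<le> h" and t: "0 \<le> t" "t \<le> 4 * h" "t\<^sup>2 / 2 \<le> 8 * h"
    and K: "2 ^ 68 * h ^ 14 \<le> K"
    and c: "(\<Sum>q<N. (c q)\<^sup>2) = V" "0 < V" "\<And>q. q < N \<Longrightarrow> (c q)\<^sup>2 \<le> V / K"
  shows "exp (- (t\<^sup>2 / 2)) / (2048 * h\<^sup>2) \<le> avg N (\<lambda>b. of_bool (t * sqrt V \<le> (\<Sum>q<N. c q * sgb (b q))))"
proof -
  let ?c = "\<lambda>q. c q / sqrt V"
  have "exp (- (t\<^sup>2 / 2)) / (2048 * h\<^sup>2) \<le> avg N (\<lambda>b. of_bool (t \<le> (\<Sum>q<N. ?c q * sgb (b q))))"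
  proof (rule avg_tail_ge_unit[OF h t K])
    show "(\<Sum>q<N. (?c q)\<^sup>2) = 1" using c by (simp add: power_divide flip: sum_divide_distrib)
    show "(?c q)\<^sup>2 \<le> 1 / K" if "q < N" for q
      using c(3)[OF that] c(2) by (simp add: power_divide divide_le_eq mult.commute)
  qed
  also have "avg N (\<lambda>b. of_bool (t \<le> (\<Sum>q<N. ?c q * sgb (b q)))) =
      avg N (\<lambda>b. of_bool (t * sqrt V \<le> (\<Sum>q<N. c q * sgb (b q))))"
    using c by (simp add: pos_le_divide_eq flip: sum_divide_distrib)
  finally show ?thesis .
qed

section \<open>Cut weights of a tree\<close>

lemma rtrancl_distinct_path:
  assumes "(x, y) \<in> r\<^sup>*"
  shows "\<exists>p. p \<noteq> [] \<and> distinct p \<and> p ! 0 = x \<and> last p = y \<and> (\<forall>i. Suc i < length p \<longrightarrow> (p ! i, p ! Suc i) \<in> r)"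
  using assms
proof (induction rule: rtrancl_induct)
  case base
  show ?case by (intro exI[of _ "[x]"]) auto
next
  case (step y z)
  then obtain p where p: "p \<noteq> []" "distinct p" "p ! 0 = x" "last p = y"
      "\<And>i. Suc i < length p \<Longrightarrow> (p ! i, p ! Suc i) \<in> r" by blast
  show ?case
  proof (cases "z \<in> set p")
    case True
    then obtain k where k: "k < length p" "p ! k = z" by (auto simp: in_set_conv_nth)
    have "last (take (Suc k) p) = z" using k by (simp add: take_Suc_conv_app_nth)
    then show ?thesis using p k
      by (intro exI[of _ "take (Suc k) p"]) auto
  next
    case False
    have "((p @ [z]) ! i, (p @ [z]) ! Suc i) \<in> r" if "Suc i < length (p @ [z])" for i
    proof (cases "Suc i < length p")
      case True
      then show ?thesis using p by (simp add: nth_append)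
    next
      case False
      then have "i = length p - 1" using that by simp
      then show ?thesis using p step by (auto simp: nth_append last_conv_nth)
    qed
    then show ?thesis using p False
      by (intro exI[of _ "p @ [z]"]) (auto simp: nth_append)
  qed
qed

text \<open>Crossing the new edge back undoes crossing it, so one crossing suffices. This is what
  lets Kruskal's algorithm update connectivity by merging two labels.\<close>

lemma rtrancl_insert_sym:
  assumes "sym r"
  shows "(u, v) \<in> (insert (i, j) (insert (j, i) r))\<^sup>* \<longleftrightarrow>
    (u, v) \<in> r\<^sup>* \<or> (u, i) \<in> r\<^sup>* \<and> (j, v) \<in> r\<^sup>* \<or> (u, j) \<in> r\<^sup>* \<and> (i, v) \<in> r\<^sup>*"
proof
  have sy: "(b, a) \<in> r\<^sup>*" if "(a, b) \<in> r\<^sup>*" for a b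
    using that sym_rtrancl[OF assms] by (auto dest: symD)
  assume "(u, v) \<in> (insert (i, j) (insert (j, i) r))\<^sup>*"
  then show "(u, v) \<in> r\<^sup>* \<or> (u, i) \<in> r\<^sup>* \<and> (j, v) \<in> r\<^sup>* \<or> (u, j) \<in> r\<^sup>* \<and> (i, v) \<in> r\<^sup>*"
  proof (induction rule: rtrancl_induct)
    case (step y z)
    then consider "(y, z) \<in> r" | "y = i" "z = j" | "y = j" "z = i" by auto
    then show ?case
    proof cases
      case 1
      then show ?thesis using step.IH by (meson rtrancl.rtrancl_into_rtrancl)
    next
      case 2
      then show ?thesis using step.IH by (metis rtrancl.rtrancl_refl rtrancl_trans sy)
    next
      case 3
      then show ?thesis using step.IH by (metis rtrancl.rtrancl_refl rtrancl_trans sy)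
    qed
  qed auto
next
  let ?r = "insert (i, j) (insert (j, i) r)"
  have m: "(a, b) \<in> ?r\<^sup>*" if "(a, b) \<in> r\<^sup>*" for a b
    using that rtrancl_mono[of r ?r] by auto
  have ij: "(i, j) \<in> ?r\<^sup>*" "(j, i) \<in> ?r\<^sup>*" by auto
  assume "(u, v) \<in> r\<^sup>* \<or> (u, i) \<in> r\<^sup>* \<and> (j, v) \<in> r\<^sup>* \<or> (u, j) \<in> r\<^sup>* \<and> (i, v) \<in> r\<^sup>*"
  then show "(u, v) \<in> ?r\<^sup>*"
    using m ij by (meson rtrancl_trans)
qed

section \<open>Trees given by edge lists over positions\<close>

locale tree_instance =
  fixes d n :: nat and pts :: "point list" and es :: "(nat \<times> nat) list"
    and X :: "point set" and T :: "(point \<times> point) set"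
  assumes X: "X \<subseteq> euclid d" "card X = n"
    and tree: "spanning_tree_on X T"
    and pres: "presents pts es X T"
begin

definition ex :: "nat \<Rightarrow> nat" where "ex e = fst (es ! e)"
definition ey :: "nat \<Rightarrow> nat" where "ey e = snd (es ! e)"
abbreviation E :: nat where "E \<equiv> length es"
definition dd :: "nat \<Rightarrow> nat \<Rightarrow> real" where "dd i j = l2 (pts ! i) (pts ! j)"
definition wt :: "nat \<Rightarrow> real" where "wt e = dd (ex e) (ey e)"
definition Gr :: "nat set \<Rightarrow> (nat \<times> nat) set" where
  "Gr F = (\<Union>e\<in>F. {(ex e, ey e), (ey e, ex e)})"
definition comp :: "nat \<Rightarrow> nat \<Rightarrow> nat set" where
  "comp e x = {v. v < n \<and> (x, v) \<in> (Gr {f. f < E \<and> wt f < wt e})\<^sup>*}"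

lemma pts: "distinct pts" "set pts = X" "length pts = n"
  using pres X by (auto simp: presents_def distinct_card)

lemma nth_X: "i < n \<Longrightarrow> pts ! i \<in> X"
  using pts by (metis nth_mem)

lemma length_pt: "i < n \<Longrightarrow> length (pts ! i) = d"
  using nth_X X by (auto simp: euclid_def)

lemma pts_inj: "i < n \<Longrightarrow> j < n \<Longrightarrow> pts ! i = pts ! j \<longleftrightarrow> i = j"
  using pts by (simp add: nth_eq_iff_index_eq)

lemma n_pos: "n > 0"
  using tree X by (auto simp: spanning_tree_on_def card_gt_0_iff)

lemma ex_ey_lt: assumes e: "e < E" shows "ex e < n" "ey e < n"
proof -
  from e have "(ex e, ey e) \<in> set es" by (simp add: ex_def ey_def)
  moreover have "\<forall>(i, j)\<in>set es. i < length pts \<and> j < length pts" using pres by (simp add: presents_def)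
  ultimately have "ex e < n \<and> ey e < n" using pts(3) by blast
  then show "ex e < n" "ey e < n" by auto
qed

lemmas ex_lt = ex_ey_lt(1) and ey_lt = ex_ey_lt(2)

lemma T_eq: "T = (\<lambda>(i, j). (pts ! i, pts ! j)) ` Gr {..<E}"
proof -
  have "T = (\<Union>(i, j)\<in>set es. {(pts ! i, pts ! j), (pts ! j, pts ! i)})"
    using pres by (simp add: presents_def)
  also have "set es = (\<lambda>e. (ex e, ey e)) ` {..<E}"
    by (auto simp: ex_def ey_def set_conv_nth)
  finally show ?thesis by (auto simp: Gr_def)
qed

lemma edge_T:
  assumes "e < E"
  shows "(pts ! ex e, pts ! ey e) \<in> T" "(pts ! ey e, pts ! ex e) \<in> T"
proof -
  have "(ex e, ey e) \<in> Gr {..<E}" "(ey e, ex e) \<in> Gr {..<E}" using assms by (auto simp: Gr_def)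
  then show "(pts ! ex e, pts ! ey e) \<in> T" "(pts ! ey e, pts ! ex e) \<in> T"
    unfolding T_eq by (auto dest: imageI[where f = "\<lambda>(i, j). (pts ! i, pts ! j)"])
qed

lemma Gr_lt: "F \<subseteq> {..<E} \<Longrightarrow> (i, j) \<in> Gr F \<Longrightarrow> i < n \<and> j < n"
  by (auto simp: Gr_def ex_lt ey_lt)

lemma ex_neq_ey: "e < E \<Longrightarrow> ex e \<noteq> ey e"
  using edge_T[of e] tree by (auto simp: spanning_tree_on_def irrefl_def)

lemma edge_inj:
  assumes "e < E" "f < E" "{ex e, ey e} = {ex f, ey f}"
  shows "e = f"
proof -
  have "distinct (map (\<lambda>(i, j). {i, j}) es)" using pres by (simp add: presents_def)
  moreover have "map (\<lambda>(i, j). {i, j}) es ! e = {ex e, ey e}" "map (\<lambda>(i, j). {i, j}) es ! f = {ex f, ey f}"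
    using assms by (simp_all add: ex_def ey_def case_prod_beta)
  ultimately show ?thesis
    using assms nth_eq_iff_index_eq[of "map (\<lambda>(i, j). {i, j}) es" e f] by simp
qed

lemma sym_Gr: "sym (Gr F)"
  by (auto simp: Gr_def sym_def)

lemma conn_sym: "(u, v) \<in> (Gr F)\<^sup>* \<Longrightarrow> (v, u) \<in> (Gr F)\<^sup>*"
  using sym_rtrancl[OF sym_Gr] by (auto dest: symD)

lemma Gr_insert: "Gr (insert e F) = insert (ex e, ey e) (insert (ey e, ex e) (Gr F))"
  by (auto simp: Gr_def)

lemma conn_insert:
  "(u, v) \<in> (Gr (insert e F))\<^sup>* \<longleftrightarrow> (u, v) \<in> (Gr F)\<^sup>* \<or>
     (u, ex e) \<in> (Gr F)\<^sup>* \<and> (ey e, v) \<in> (Gr F)\<^sup>* \<or>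
     (u, ey e) \<in> (Gr F)\<^sup>* \<and> (ex e, v) \<in> (Gr F)\<^sup>*"
  unfolding Gr_insert by (rule rtrancl_insert_sym[OF sym_Gr])

lemma dd_sym: "i < n \<Longrightarrow> j < n \<Longrightarrow> dd i j = dd j i"
  by (simp add: dd_def l2_def length_pt L2_set_def power2_commute)

lemma dd_triangle: "i < n \<Longrightarrow> j < n \<Longrightarrow> k < n \<Longrightarrow> dd i k \<le> dd i j + dd j k"
  using L2_set_triangle_ineq[of "\<lambda>q. pts ! i ! q - pts ! j ! q" "\<lambda>q. pts ! j ! q - pts ! k ! q" "{..<d}"]
  by (simp add: dd_def l2_def length_pt)

lemma dd_nonneg: "0 \<le> dd i j"
  by (simp add: dd_def l2_def L2_set_nonneg)

lemma dd_pos: "i < n \<Longrightarrow> j < n \<Longrightarrow> i \<noteq> j \<Longrightarrow> 0 < dd i j"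
proof (rule ccontr)
  assume ij: "i < n" "j < n" "i \<noteq> j" "\<not> 0 < dd i j"
  then have "dd i j = 0" using dd_nonneg[of i j] by simp
  then have "\<forall>q<d. pts ! i ! q = pts ! j ! q"
    using ij by (simp add: dd_def l2_def length_pt L2_set_eq_0_iff)
  then have "pts ! i = pts ! j" using ij by (intro nth_equalityI) (auto simp: length_pt)
  then show False using ij pts_inj by blast
qed

lemma wt_pos: "e < E \<Longrightarrow> 0 < wt e"
  by (simp add: wt_def dd_pos ex_lt ey_lt ex_neq_ey)

text \<open>A simple path between the ends of e that avoids e is closed by e to a cycle. One vertex
  would make e a loop and two would make it occur twice in the list, so the path has the three
  vertices that \<open>graph_cycle\<close> demands.\<close>

lemma acyclic:
  assumes e: "e < E" and F: "F \<subseteq> {..<E}" "e \<notin> F"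
  shows "(ex e, ey e) \<notin> (Gr F)\<^sup>*"
proof
  assume c: "(ex e, ey e) \<in> (Gr F)\<^sup>*"
  obtain p where p: "p \<noteq> []" "distinct p" "p ! 0 = ex e" "last p = ey e"
      "\<And>i. Suc i < length p \<Longrightarrow> (p ! i, p ! Suc i) \<in> Gr F"
    using rtrancl_distinct_path[OF c] by blast
  have l1: "length p \<noteq> 1"
  proof
    assume "length p = 1"
    then have "last p = p ! 0" using p(1) by (simp add: last_conv_nth)
    then show False using p(3,4) ex_neq_ey[OF e] by simp
  qed
  have l2: "length p \<noteq> 2"
  proof
    assume len: "length p = 2"
    then have "last p = p ! 1" using p(1) by (simp add: last_conv_nth)
    then have "(ex e, ey e) \<in> Gr F" using p(5)[of 0] len p(3,4) by simp
    then obtain f where "f \<in> F" "ex e = ex f \<and> ey e = ey f \<or> ex e = ey f \<and> ey e = ex f"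
      by (auto simp: Gr_def)
    then have f: "f \<in> F" "{ex e, ey e} = {ex f, ey f}" by auto
    then show False using edge_inj[OF e] F by blast
  qed
  have "length p \<noteq> 0" using p by simp
  with l1 l2 have l3: "length p \<ge> 3" by linarith
  have lt: "p ! i < n" if "i < length p" for i
    using that
  proof (induction i)
    case 0
    then show ?case using p ex_lt[OF e] by simp
  next
    case (Suc i)
    then show ?case using p(5)[of i] Gr_lt[OF F(1)] by blast
  qed
  have GT: "(pts ! a, pts ! b) \<in> T" if "(a, b) \<in> Gr F" for a b
    using that F unfolding T_eq by (intro image_eqI[of _ _ "(a, b)"]) (auto simp: Gr_def)
  have "graph_cycle T (map ((!) pts) p)"
    unfolding graph_cycle_def
  proof (intro conjI allI impI)
    have "inj_on ((!) pts) (set p)"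
      using lt pts_inj by (auto simp: inj_on_def in_set_conv_nth)
    then show "distinct (map ((!) pts) p)" using p by (simp add: distinct_map)
    show "3 \<le> length (map ((!) pts) p)" using l3 by simp
    fix i assume i: "i < length (map ((!) pts) p)"
    show "(map ((!) pts) p ! i, map ((!) pts) p ! (Suc i mod length (map ((!) pts) p))) \<in> T"
    proof (cases "Suc i < length p")
      case True
      then show ?thesis using GT[OF p(5)] by simp
    next
      case False
      then have "i = length p - 1" "Suc i = length p" using i by auto
      then show ?thesis using p edge_T(2)[OF e] i by (simp add: last_conv_nth)
    qed
  qed
  then show False using tree by (auto simp: spanning_tree_on_def)
qed

lemma image_conn:
  assumes "F \<subseteq> {..<E}" "(pts ! u, y) \<in> ((\<lambda>(i, j). (pts ! i, pts ! j)) ` Gr F)\<^sup>*" "u < n"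
  shows "\<exists>v<n. y = pts ! v \<and> (u, v) \<in> (Gr F)\<^sup>*"
  using assms(2)
proof (induction rule: rtrancl_induct)
  case base
  then show ?case using assms by auto
next
  case (step y z)
  then obtain v where v: "v < n" "y = pts ! v" "(u, v) \<in> (Gr F)\<^sup>*" by auto
  from step obtain a b where ab: "(a, b) \<in> Gr F" "y = pts ! a" "z = pts ! b" by auto
  have "a = v" "b < n" using ab v Gr_lt[OF assms(1) ab(1)] pts_inj by auto
  moreover have "(u, b) \<in> (Gr F)\<^sup>*"
    using v(3) ab(1) \<open>a = v\<close> by (auto intro: rtrancl.rtrancl_into_rtrancl)
  ultimately show ?case using ab(3) by blast
qed

lemma conn_image:
  assumes "(u, v) \<in> (Gr F)\<^sup>*"
  shows "(pts ! u, pts ! v) \<in> ((\<lambda>(i, j). (pts ! i, pts ! j)) ` Gr F)\<^sup>*"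
  using assms
proof (induction rule: rtrancl_induct)
  case (step y z)
  have "(pts ! y, pts ! z) \<in> (\<lambda>(i, j). (pts ! i, pts ! j)) ` Gr F"
    using imageI[OF step(2), of "\<lambda>(i, j). (pts ! i, pts ! j)"] by simp
  then show ?case using step.IH by (rule rtrancl.rtrancl_into_rtrancl[rotated])
qed auto

lemma conn_all: "u < n \<Longrightarrow> v < n \<Longrightarrow> (u, v) \<in> (Gr {..<E})\<^sup>*"
proof -
  assume uv: "u < n" "v < n"
  then have "(pts ! u, pts ! v) \<in> T\<^sup>*" using tree nth_X by (auto simp: spanning_tree_on_def)
  then show ?thesis using image_conn[of "{..<E}" u "pts ! v"] uv pts_inj unfolding T_eq by auto
qed

text \<open>Each edge of a forest joins two distinct classes, so the number of classes plus the
  number of edges is invariant. For the whole tree this gives n - 1 edges.\<close>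

lemma labels:
  assumes "finite F" "F \<subseteq> {..<E}"
  shows "\<exists>lab :: nat \<Rightarrow> nat. (\<forall>u<n. \<forall>v<n. lab u = lab v \<longleftrightarrow> (u, v) \<in> (Gr F)\<^sup>*) \<and> card (lab ` {..<n}) + card F = n"
  using assms
proof (induction F rule: finite_induct)
  case empty
  show ?case by (intro exI[of _ "\<lambda>x. x"]) (auto simp: Gr_def)
next
  case (insert e F)
  then obtain lab :: "nat \<Rightarrow> nat" where lab: "\<And>u v. u < n \<Longrightarrow> v < n \<Longrightarrow> lab u = lab v \<longleftrightarrow> (u, v) \<in> (Gr F)\<^sup>*"
      "card (lab ` {..<n}) + card F = n" by auto
  have e: "e < E" using insert by simp
  let ?i = "ex e" and ?j = "ey e"
  have ij: "?i < n" "?j < n" "lab ?i \<noteq> lab ?j"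
    using e ex_lt ey_lt acyclic[OF e _ insert(2)] insert lab by auto
  define lab' where "lab' v = (if lab v = lab ?i then lab ?j else lab v)" for v
  have "lab' ` {..<n} = lab ` {..<n} - {lab ?i}"
    using ij by (auto simp: lab'_def image_iff)
  then have "card (lab' ` {..<n}) = card (lab ` {..<n}) - 1" using ij by (simp add: card_Diff_singleton)
  moreover have "card (lab ` {..<n}) \<noteq> 0" using ij by auto
  moreover have "card (insert e F) = Suc (card F)" using insert by simp
  ultimately have "card (lab' ` {..<n}) + card (insert e F) = n" using lab(2) by linarith
  moreover have "lab' u = lab' v \<longleftrightarrow> (u, v) \<in> (Gr (insert e F))\<^sup>*" if "u < n" "v < n" for u v
    unfolding conn_insert lab(1)[OF that, symmetric] lab(1)[OF that(1) ij(1), symmetric]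
      lab(1)[OF that(1) ij(2), symmetric] lab(1)[OF ij(1) that(2), symmetric] lab(1)[OF ij(2) that(2), symmetric]
    using ij(3) unfolding lab'_def by auto
  ultimately show ?case by blast
qed

lemma E_eq: "E = n - 1"
proof -
  obtain lab :: "nat \<Rightarrow> nat" where lab: "\<forall>u<n. \<forall>v<n. lab u = lab v \<longleftrightarrow> (u, v) \<in> (Gr {..<E})\<^sup>*"
      "card (lab ` {..<n}) + card {..<E} = n"
    using labels[of "{..<E}"] by auto
  have "lab u = lab 0" if "u < n" for u using lab(1) conn_all[of u 0] n_pos that by blast
  then have "lab ` {..<n} \<subseteq> {lab 0}" by blast
  moreover have "lab 0 \<in> lab ` {..<n}" using n_pos by simp
  ultimately have "lab ` {..<n} = {lab 0}" by blast
  then show ?thesis using lab(2) by simp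
qed

lemma lighter_eq:
  assumes "e < E" "{x, y} = {pts ! ex e, pts ! ey e}"
  shows "lighter_forest T x y = (\<lambda>(i, j). (pts ! i, pts ! j)) ` Gr {f. f < E \<and> wt f < wt e}"
proof -
  have s: "l2 (pts ! i) (pts ! j) = dd i j" for i j by (simp add: dd_def)
  have xy: "l2 x y = wt e" "l2 y x = wt e"
    using assms dd_sym[OF ex_lt ey_lt] by (auto simp: doubleton_eq_iff wt_def dd_def)
  have w: "dd (ey f) (ex f) = wt f" "dd (ex f) (ey f) = wt f" if "f < E" for f
    using that dd_sym ex_lt ey_lt by (auto simp: wt_def)
  show ?thesis
    unfolding lighter_forest_def T_eq Gr_def using xy
    by (auto simp: s w image_iff not_le)
qed

lemma component_eq:
  assumes "e < E" "{x, y} = {pts ! ex e, pts ! ey e}" "i < n"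
  shows "component (lighter_forest T x y) (pts ! i) = (!) pts ` comp e i"
  unfolding lighter_eq[OF assms(1,2)] component_def comp_def
  using image_conn[of "{f. f < E \<and> wt f < wt e}" i] conn_image assms(3) by fastforce

section \<open>Cut weights in terms of positions\<close>

definition cw :: "nat \<Rightarrow> real" where
  "cw e = Max {dd u v | u v. u \<in> comp e (ex e) \<and> v \<in> comp e (ey e)}"

lemma comp_lt: "u \<in> comp e x \<Longrightarrow> u < n"
  by (simp add: comp_def)

lemma finite_comp: "finite (comp e x)"
  by (rule finite_subset[of _ "{..<n}"]) (auto simp: comp_def)

lemma comp_self: "x < n \<Longrightarrow> x \<in> comp e x"
  by (simp add: comp_def)

lemma cut_weight_eq:
  assumes e: "e < E"
  shows "cut_weight T (pts ! ex e) (pts ! ey e) = cw e" "cut_weight T (pts ! ey e) (pts ! ex e) = cw e"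
proof -
  note c = component_eq[OF e _ ex_lt[OF e]] component_eq[OF e _ ey_lt[OF e]]
  have 1: "{l2 u v | u v. u \<in> (!) pts ` A \<and> v \<in> (!) pts ` B} = {dd u v | u v. u \<in> A \<and> v \<in> B}" for A B
    unfolding dd_def by blast
  have 2: "{dd u v | u v. u \<in> comp e x \<and> v \<in> comp e y} = {dd u v | u v. u \<in> comp e y \<and> v \<in> comp e x}" for x y
    using dd_sym comp_lt by (metis (no_types, lifting))
  show "cut_weight T (pts ! ex e) (pts ! ey e) = cw e"
    unfolding cut_weight_def cw_def c[OF refl] 1 ..
  have s: "{pts ! ey e, pts ! ex e} = {pts ! ex e, pts ! ey e}" by auto
  show "cut_weight T (pts ! ey e) (pts ! ex e) = cw e"
    unfolding cut_weight_def cw_def c[OF s] 1 by (rule arg_cong[OF 2])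
qed

lemma cw_set_finite: "finite {dd u v | u v. u \<in> comp e (ex e) \<and> v \<in> comp e (ey e)}"
proof -
  have "{dd u v | u v. u \<in> comp e (ex e) \<and> v \<in> comp e (ey e)} =
      (\<lambda>(u, v). dd u v) ` (comp e (ex e) \<times> comp e (ey e))" by auto
  then show ?thesis by (simp add: finite_comp)
qed

lemma dd_le_cw: "u \<in> comp e (ex e) \<Longrightarrow> v \<in> comp e (ey e) \<Longrightarrow> dd u v \<le> cw e"
  unfolding cw_def by (rule Max_ge[OF cw_set_finite]) auto

lemma cw_attained:
  assumes "e < E"
  shows "\<exists>u\<in>comp e (ex e). \<exists>v\<in>comp e (ey e). cw e = dd u v"
proof -
  have "cw e \<in> {dd u v | u v. u \<in> comp e (ex e) \<and> v \<in> comp e (ey e)}"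
    unfolding cw_def using comp_self ex_lt[OF assms] ey_lt[OF assms]
    by (intro Max_in[OF cw_set_finite]) blast
  then show ?thesis by auto
qed

lemma wt_le_cw: "e < E \<Longrightarrow> wt e \<le> cw e"
  unfolding wt_def by (intro dd_le_cw comp_self ex_lt ey_lt)

text \<open>A simple path has fewer than n edges, each of length at most w; the triangle inequality
  sums them.\<close>

lemma conn_dd:
  fixes w :: real
  assumes F: "F \<subseteq> {..<E}" "\<And>f. f \<in> F \<Longrightarrow> wt f \<le> w" and c: "(x, u) \<in> (Gr F)\<^sup>*" "x < n" and w: "0 \<le> w"
  shows "dd x u \<le> n * w"
proof -
  obtain p where p: "p \<noteq> []" "distinct p" "p ! 0 = x" "last p = u"
      "\<And>i. Suc i < length p \<Longrightarrow> (p ! i, p ! Suc i) \<in> Gr F"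
    using rtrancl_distinct_path[OF c(1)] by blast
  have k: "p ! k < n \<and> dd x (p ! k) \<le> k * w" if "k < length p" for k
    using that
  proof (induction k)
    case 0
    then show ?case using p c by (simp add: dd_def l2_def L2_set_def)
  next
    case (Suc k)
    have g: "(p ! k, p ! Suc k) \<in> Gr F" using p(5) Suc.prems by simp
    then obtain f where f: "f \<in> F" "f < E" "(p ! k = ex f \<and> p ! Suc k = ey f) \<or> (p ! k = ey f \<and> p ! Suc k = ex f)"
      using F by (auto simp: Gr_def)
    have "dd (p ! k) (p ! Suc k) = wt f" using f dd_sym ex_lt ey_lt by (auto simp: wt_def)
    then have "dd (p ! k) (p ! Suc k) \<le> w" using F f by simp
    moreover have "p ! Suc k < n" using Gr_lt[OF F(1) g] by simp
    ultimately show ?case using Suc dd_triangle[of x "p ! k" "p ! Suc k"] c by (simp add: algebra_simps)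
  qed
  have "set p \<subseteq> {..<n}" using k by (auto simp: in_set_conv_nth)
  then have "length p \<le> n" using p distinct_card[of p] card_mono[of "{..<n}" "set p"] by simp
  have "dd x u \<le> (length p - 1) * w" using k[of "length p - 1"] p by (simp add: last_conv_nth)
  also have "\<dots> \<le> n * w" using \<open>length p \<le> n\<close> w by (intro mult_right_mono) auto
  finally show ?thesis .
qed

text \<open>From u through both ends of e to v, along lighter paths on either side. The bound caps
  how often the best distance of e, which starts at \<open>wt e\<close>, can grow by a fixed
  factor.\<close>

lemma cw_le: "e < E \<Longrightarrow> cw e \<le> 3 * n * wt e"
proof -
  assume e: "e < E"
  obtain u v where uv: "u \<in> comp e (ex e)" "v \<in> comp e (ey e)" "cw e = dd u v"
    using cw_attained[OF e] by blast
  let ?F = "{f. f < E \<and> wt f < wt e}"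
  have F: "?F \<subseteq> {..<E}" "\<And>f. f \<in> ?F \<Longrightarrow> wt f \<le> wt e" by auto
  have "dd (ex e) u \<le> n * wt e" "dd (ey e) v \<le> n * wt e"
    using uv ex_lt[OF e] ey_lt[OF e] wt_pos[OF e] by (auto intro!: conn_dd[OF F] simp: comp_def)
  moreover have "dd u v \<le> dd (ex e) u + wt e + dd (ey e) v"
    using dd_triangle[of u "ex e" v] dd_triangle[of "ex e" "ey e" v] dd_sym[of u "ex e"]
      comp_lt uv ex_lt[OF e] ey_lt[OF e] by (force simp: wt_def)
  moreover have "wt e \<le> n * wt e" using n_pos wt_pos[OF e] by simp
  ultimately show "cw e \<le> 3 * n * wt e" using uv by simp
qed

lemma approximation_exists:
  assumes "\<And>e. e < E \<Longrightarrow> cw e \<le> rmem s 2 e \<and> rmem s 2 e \<le> \<alpha> * cw e"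
  shows "\<exists>ACW. outputs pts es s ACW \<and> approximates_cut_weights \<alpha> T ACW"
proof -
  \<comment> \<open>\<open>ACW\<close> takes pairs of points while the machine stores by edge
    position; the position can be recovered because no edge is listed twice.\<close>
  define idx where "idx S = (THE e. e < E \<and> S = {pts ! ex e, pts ! ey e})" for S
  have idx: "idx {pts ! ex e, pts ! ey e} = e" if "e < E" for e
    unfolding idx_def
  proof (rule the_equality)
    fix f assume f: "f < E \<and> {pts ! ex e, pts ! ey e} = {pts ! ex f, pts ! ey f}"
    then have "{ex e, ey e} = {ex f, ey f}"
      using that ex_lt ey_lt pts_inj by (auto simp: doubleton_eq_iff)
    then show "f = e" using edge_inj f that by blast
  qed (use that in auto)
  let ?A = "\<lambda>S. rmem s 2 (idx S)"
  have "outputs pts es s ?A"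
    using idx by (auto simp: outputs_def ex_def ey_def)
  moreover have "approximates_cut_weights \<alpha> T ?A"
    unfolding approximates_cut_weights_def T_eq Gr_def
    using assms idx cut_weight_eq[unfolded T_eq Gr_def] by (auto simp: insert_commute[of "pts ! ey _"])
  ultimately show ?thesis by blast
qed

end

section \<open>The program\<close>

abbreviation seq_com :: "com \<Rightarrow> com \<Rightarrow> com" (infixr ";;" 60) where "c1 ;; c2 \<equiv> Seq c1 c2"
abbreviation iadd (infixl "[+]" 65) where "a [+] b \<equiv> IBin IPlus a b"
abbreviation isub (infixl "[-]" 65) where "a [-] b \<equiv> IBin IMinus a b"
abbreviation imul (infixl "[*]" 70) where "a [*] b \<equiv> IBin ITimes a b"
abbreviation idiv (infixl "[div]" 70) where "a [div] b \<equiv> IBin IDivide a b"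
abbreviation radd (infixl "[+.]" 65) where "a [+.] b \<equiv> RBin RPlus a b"
abbreviation rsub (infixl "[-.]" 65) where "a [-.] b \<equiv> RBin RMinus a b"
abbreviation rmul (infixl "[*.]" 70) where "a [*.] b \<equiv> RBin RTimes a b"
abbreviation rdiv (infixl "['/.]" 70) where "a [/.] b \<equiv> RBin RDivide a b"
abbreviation RC :: "nat \<Rightarrow> rexp" where "RC k \<equiv> ROfNat (IConst k)"

text \<open>
  Integer banks: 0 and 1 input, 2 coins, 3 label of a vertex, 4 size of a label, 5 members of a
  label, 6 sorted positions, 7--10 label and size of the smaller and the larger side of an edge;
  the banks from 11 on are scalars. Real banks: 2 best distance found for an edge, 3 sort keys,
  4 projections; the banks from 5 on are scalars.
\<close>

abbreviation (input) "aES \<equiv> 1 :: nat"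
abbreviation (input) "aBit \<equiv> 2 :: nat"
abbreviation (input) "aLab \<equiv> 3 :: nat"
abbreviation (input) "aSz \<equiv> 4 :: nat"
abbreviation (input) "aArr \<equiv> 5 :: nat"
abbreviation (input) "aSrt \<equiv> 6 :: nat"
abbreviation (input) "aQA \<equiv> 7 :: nat"
abbreviation (input) "aQS \<equiv> 8 :: nat"
abbreviation (input) "aQB \<equiv> 9 :: nat"
abbreviation (input) "aQT \<equiv> 10 :: nat"
abbreviation (input) "vh \<equiv> 11 :: nat"
abbreviation (input) "vN \<equiv> 12 :: nat"
abbreviation (input) "vk \<equiv> 13 :: nat"
abbreviation (input) "vK \<equiv> 14 :: nat"
abbreviation (input) "vL \<equiv> 15 :: nat"
abbreviation (input) "vm \<equiv> 16 :: nat"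
abbreviation (input) "vrm \<equiv> 17 :: nat"
abbreviation (input) "vnb \<equiv> 18 :: nat"
abbreviation (input) "vbud0 \<equiv> 19 :: nat"
abbreviation (input) "vW \<equiv> 20 :: nat"
abbreviation (input) "vE \<equiv> 21 :: nat"
abbreviation (input) "vu \<equiv> 22 :: nat"
abbreviation (input) "vv \<equiv> 23 :: nat"
abbreviation (input) "vj \<equiv> 24 :: nat"
abbreviation (input) "vbs \<equiv> 25 :: nat"
abbreviation (input) "vlen \<equiv> 26 :: nat"
abbreviation (input) "vp \<equiv> 27 :: nat"
abbreviation (input) "vw \<equiv> 28 :: nat"
abbreviation (input) "vgo \<equiv> 29 :: nat"
abbreviation (input) "vl \<equiv> 30 :: nat"
abbreviation (input) "vr \<equiv> 31 :: nat"
abbreviation (input) "vle \<equiv> 32 :: nat"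
abbreviation (input) "vre \<equiv> 33 :: nat"
abbreviation (input) "vkk \<equiv> 34 :: nat"
abbreviation (input) "vjj \<equiv> 35 :: nat"
abbreviation (input) "ve \<equiv> 36 :: nat"
abbreviation (input) "vA \<equiv> 37 :: nat"
abbreviation (input) "vB \<equiv> 38 :: nat"
abbreviation (input) "vq \<equiv> 39 :: nat"
abbreviation (input) "vz \<equiv> 40 :: nat"
abbreviation (input) "vrep \<equiv> 41 :: nat"
abbreviation (input) "vi \<equiv> 42 :: nat"
abbreviation (input) "vx \<equiv> 43 :: nat"
abbreviation (input) "vy \<equiv> 44 :: nat"
abbreviation (input) "vlab \<equiv> 45 :: nat"
abbreviation (input) "vpp \<equiv> 46 :: nat"
abbreviation (input) "vee \<equiv> 47 :: nat"
abbreviation (input) "va \<equiv> 48 :: nat"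
abbreviation (input) "vd \<equiv> 49 :: nat"
abbreviation (input) "vww \<equiv> 50 :: nat"
abbreviation (input) "vgg \<equiv> 51 :: nat"
abbreviation (input) "vbase \<equiv> 52 :: nat"
abbreviation (input) "vt \<equiv> 53 :: nat"
abbreviation (input) "vbud \<equiv> 54 :: nat"
abbreviation (input) "vorg \<equiv> 55 :: nat"
abbreviation (input) "aBest \<equiv> 2 :: nat"
abbreviation (input) "aKey \<equiv> 3 :: nat"
abbreviation (input) "aVal \<equiv> 4 :: nat"
abbreviation (input) "rH \<equiv> 5 :: nat"
abbreviation (input) "rP \<equiv> 6 :: nat"
abbreviation (input) "racc \<equiv> 7 :: nat"
abbreviation (input) "rdist \<equiv> 8 :: nat"
abbreviation (input) "rT \<equiv> 9 :: nat"

abbreviation (input) "en \<equiv> IRead 0 (IConst 0)"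
abbreviation (input) "ed \<equiv> IRead 0 (IConst 1)"

definition DIST :: com where
  "DIST =
     rassign racc (RC 0) ;;
     For vj ed
       (rassign racc (RV racc [+.]
          ((RRead 1 (IV vu [*] ed [+] IV vj) [-.] RRead 1 (IV vv [*] ed [+] IV vj)) [*.]
           (RRead 1 (IV vu [*] ed [+] IV vj) [-.] RRead 1 (IV vv [*] ed [+] IV vj))))) ;;
     rassign rdist (RSqrt (RV racc))"

text \<open>Two squarings turn 131072 * h^4 into 2^68 * h^16, enough for the 2^68 * h^14 of the
  lower tail bound. As the machine cannot round, the ceiling in \<open>mm\<close> is found by
  counting \<open>vm\<close> up against the real value.\<close>

definition PARAMS :: "nat \<Rightarrow> nat \<Rightarrow> com" where
  "PARAMS C c =
     assign vh (IConst 0) ;; assign vN (IConst 1) ;;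
     Loop (ILess (IV vN) en) (assign vN (IV vN [*] IConst 2) ;; assign vh (IV vh [+] IConst 1)) ;;
     rassign rH (RC 0) ;; rassign rP (RC 1) ;;
     For vk en
       (rassign rH (RV rH [+.] (RC 1 [/.] ROfNat (IV vk [+] IConst 1))) ;;
        rassign rP (RV rP [*.] (RC 1 [+.] (RC 1 [/.] (RV 0 [*.] RV 0 [*.] ROfNat (IV vk [+] IConst 1)))))) ;;
     assign vK (IConst 131072 [*] IV vh [*] IV vh [*] IV vh [*] IV vh) ;;
     assign vK (IV vK [*] IV vK) ;; assign vK (IV vK [*] IV vK) ;;
     assign vL (ed [*] IV vK) ;;
     assign vm (IConst 0) ;;
     Loop (RLess (ROfNat (IV vm)) (ROfNat (IConst C [*] IV vh [*] IV vh [*] IV vh) [*.] RV rP))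
       (assign vm (IV vm [+] IConst 1)) ;;
     assign vrm (IConst c [*] IV vh) ;;
     assign vnb (IV vrm [*] (IV vm [*] IV vL)) ;;
     assign vbud0 (IConst 4 [*] IV vm [*] en [*] IV vh [+] en [*] (IConst 4 [*] IV vh [*] (IV vh [+] IConst 4)) [+] IConst 1) ;;
     assign vW (en [*] en) ;;
     assign vE (en [-] IConst 1) ;;
     rassign rT (RSqrt (ROfNat (IV vK)) [*.] (RC 1 [+.] (RC 1 [/.] ROfNat (IV vh))) [*.]
       RSqrt (RC 2 [*.] RV rH))"

text \<open>Sorting is by decreasing key, so negated weights give Kruskal's increasing
  order.\<close>

definition WEIGHTS :: com where
  "WEIGHTS =
     For ve (IV vE)
       (assign vu (IRead aES (IConst 2 [*] IV ve)) ;;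
        assign vv (IRead aES (IConst 2 [*] IV ve [+] IConst 1)) ;;
        DIST ;;
        RWrite aBest (IV ve) (RV rdist) ;;
        RWrite aKey (IV ve) (RC 0 [-.] RV rdist))"

text \<open>The minimum, by truncated subtraction.\<close>

abbreviation emin :: "iexp \<Rightarrow> iexp \<Rightarrow> iexp" where "emin a b \<equiv> a [-] (a [-] b)"

text \<open>Produces the element at output position \<open>vp\<close>, so a single loop over
  positions merges every pair of blocks of a level. The first test asks for
  \<open>vp mod (2 * w) = 0\<close>, where a new pair begins. Output goes \<open>vW\<close> cells
  further on, so that the old level survives.\<close>

definition MERGE :: com where
  "MERGE =
     Cond (ILess (IV vp [-] (IV vp [div] (IConst 2 [*] IV vw)) [*] (IConst 2 [*] IV vw)) (IConst 1))
       (assign vl (IV vp) ;;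
        assign vr (emin (IV vp [+] IV vw) (IV vlen)) ;;
        assign vle (IV vr) ;;
        assign vre (emin (IV vp [+] IConst 2 [*] IV vw) (IV vlen)))
       Skip ;;
     Cond (Conj (ILess (IV vl) (IV vle)) (Neg (Conj (ILess (IV vr) (IV vre))
         (RLess (RRead aKey (IRead aSrt (IV vgo [+] IV vbs [+] IV vl)))
                (RRead aKey (IRead aSrt (IV vgo [+] IV vbs [+] IV vr)))))))
       (IWrite aSrt (IV vgo [+] IV vW [+] IV vbs [+] IV vp) (IRead aSrt (IV vgo [+] IV vbs [+] IV vl)) ;;
        assign vl (IV vl [+] IConst 1))
       (IWrite aSrt (IV vgo [+] IV vW [+] IV vbs [+] IV vp) (IRead aSrt (IV vgo [+] IV vbs [+] IV vr)) ;;
        assign vr (IV vr [+] IConst 1))"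

text \<open>\<open>aSrt\<close> holds positions, not keys. At the end \<open>vgo\<close> is the
  offset of the last, fully sorted level, from which \<open>KRUSKAL\<close> reads.\<close>

definition SORT :: com where
  "SORT =
     For vp (IV vlen) (IWrite aSrt (IV vbs [+] IV vp) (IV vp)) ;;
     assign vw (IConst 1) ;; assign vgo (IConst 0) ;;
     Loop (ILess (IV vw) (IV vlen))
       (For vp (IV vlen) MERGE ;;
        assign vw (IConst 2 [*] IV vw) ;; assign vgo (IV vgo [+] IV vW))"

definition SIDES :: com where
  "SIDES =
     assign vA (IRead aLab (IRead aES (IConst 2 [*] IV ve))) ;;
     assign vB (IRead aLab (IRead aES (IConst 2 [*] IV ve [+] IConst 1))) ;;
     Cond (ILess (IRead aSz (IV vB)) (IRead aSz (IV vA)))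
       (assign vq (IV vA) ;; assign vA (IV vB) ;; assign vB (IV vq)) Skip"

text \<open>Two pointers run through the sorted edges: \<open>vjj\<close> records sides,
  \<open>vkk\<close> merges classes. An edge is recorded when the next edge to merge is not lighter,
  that is, after all strictly lighter edges and before any of equal weight, as the treatment of ties
  requires.\<close>

definition KRUSKAL :: com where
  "KRUSKAL =
     For vk en
       (IWrite aLab (IV vk) (IV vk) ;; IWrite aSz (IV vk) (IConst 1) ;; IWrite aArr (IV vk [*] en) (IV vk)) ;;
     assign vkk (IConst 0) ;; assign vjj (IConst 0) ;;
     Loop (ILess (IV vkk) (IV vE))
       (Cond (Conj (ILess (IV vjj) (IV vE))
           (Neg (RLess (RRead aBest (IRead aSrt (IV vgo [+] IV vkk))) (RRead aBest (IRead aSrt (IV vgo [+] IV vjj))))))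
         (assign ve (IRead aSrt (IV vgo [+] IV vjj)) ;; SIDES ;;
          IWrite aQA (IV ve) (IV vA) ;; IWrite aQS (IV ve) (IRead aSz (IV vA)) ;;
          IWrite aQB (IV ve) (IV vB) ;; IWrite aQT (IV ve) (IRead aSz (IV vB)) ;;
          assign vjj (IV vjj [+] IConst 1))
         (assign ve (IRead aSrt (IV vgo [+] IV vkk)) ;; SIDES ;;
          For vq (IRead aSz (IV vA))
            (assign vv (IRead aArr (IV vA [*] en [+] IV vq)) ;;
             IWrite aLab (IV vv) (IV vB) ;;
             IWrite aArr (IV vB [*] en [+] IRead aSz (IV vB) [+] IV vq) (IV vv)) ;;
          IWrite aSz (IV vB) (IRead aSz (IV vB) [+] IRead aSz (IV vA)) ;;
          assign vkk (IV vkk [+] IConst 1)))"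

definition FLIPS :: com where
  "FLIPS =
     assign vz (IConst 0) ;;
     Loop (ILess (IV vz) (IV vnb)) (Flip aBit (IV vz) ;; assign vz (IV vz [+] IConst 1))"

text \<open>Bit y signs coordinate y div K, so that each coordinate enters K times with independent
  signs; 2 * b - 1 turns a bit into a sign.\<close>

definition PROJECT :: com where
  "PROJECT =
     assign vorg ((IV vrep [*] IV vm [+] IV vi) [*] IV vL) ;;
     For vx en
       (rassign racc (RC 0) ;;
        For vy (IV vL)
          (rassign racc (RV racc [+.] (RRead 1 (IV vx [*] ed [+] IV vy [div] IV vK) [*.]
             (RC 2 [*.] ROfNat (IRead aBit (IV vorg [+] IV vy)) [-.] RC 1)))) ;;
        RWrite aVal (IV vx) (RV racc))"

definition SORTALL :: com where
  "SORTALL =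
     For vlab en
       (assign vbs (IV vlab [*] en) ;; assign vlen (IRead aSz (IV vlab)) ;;
        For vpp (IV vlen) (RWrite aKey (IV vpp) (RRead aVal (IRead aArr (IV vbs [+] IV vpp)))) ;;
        SORT)"

abbreviation (input) "eCand \<equiv> IRead aArr (IV vbs [+] IRead aSrt (IV vgg [+] IV vbs [+] IV vbase [+] IV vt))"

text \<open>The stopping threshold uses the current best distance and so tightens during the scan.
  Only the signed difference of the projections is tested, because one tail already gives the hit
  probability.\<close>

definition BLOCK :: com where
  "BLOCK =
     assign vt (IConst 0) ;;
     Loop (Conj (ILess (IV vt) (IV vww)) (Conj (ILess (IConst 0) (IV vbud))
         (Neg (RLess (RRead aVal eCand) (RRead aVal (IV vu) [+.] (RV rT [*.] RRead aBest (IV vee)))))))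
       (assign vv eCand ;; DIST ;;
        Cond (RLess (RRead aBest (IV vee)) (RV rdist)) (RWrite aBest (IV vee) (RV rdist)) Skip ;;
        assign vbud (IV vbud [-] IConst 1) ;;
        assign vt (IV vt [+] IConst 1))"

text \<open>Reads the binary digits of the prefix length: where a digit is 1, the last 2^g positions
  of the remaining prefix form an aligned block, and level g of the sort has it in order.\<close>

definition QUERY :: com where
  "QUERY =
     assign vd (IRead aQT (IV vee)) ;; assign vww (IConst 1) ;; assign vgg (IConst 0) ;;
     Loop (ILess (IConst 0) (IV vd))
       (Cond (ILess (IV vd [div] IConst 2 [*] IConst 2) (IV vd))
          (assign vbase ((IV vd [-] IConst 1) [*] IV vww) ;; BLOCK) Skip ;;
        assign vd (IV vd [div] IConst 2) ;;
        assign vww (IConst 2 [*] IV vww) ;; assign vgg (IV vgg [+] IV vW))"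

definition SEARCH :: com where
  "SEARCH =
     For vee (IV vE)
       (assign vbs (IRead aQB (IV vee) [*] en) ;;
        For va (IRead aQS (IV vee))
          (assign vu (IRead aArr (IRead aQA (IV vee) [*] en [+] IV va)) ;; QUERY))"

text \<open>Best distances persist across projections and repetitions, while the budget is renewed
  for each repetition.\<close>

definition MAIN :: com where
  "MAIN =
     For vrep (IV vrm)
       (assign vbud (IV vbud0) ;;
        For vi (IV vm) (PROJECT ;; SORTALL ;; SEARCH))"

definition SCALE :: com where
  "SCALE = For ve (IV vE) (RWrite aBest (IV ve) (RV 0 [*.] RRead aBest (IV ve)))"

definition INIT :: "nat \<Rightarrow> nat \<Rightarrow> com" where
  "INIT C c = PARAMS C c ;; WEIGHTS ;; assign vbs (IConst 0) ;; assign vlen (IV vE) ;; SORT ;; KRUSKAL"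

definition PROG :: "nat \<Rightarrow> nat \<Rightarrow> com" where
  "PROG C c = INIT C c ;; FLIPS ;; MAIN ;; SCALE"

lemma mods_DIST [simp]: "imods DIST = {vj}" "rmods DIST = {racc, rdist}"
  by (auto simp: DIST_def)

lemma mods_MERGE [simp]: "imods MERGE = {vl, vr, vle, vre, aSrt}" "rmods MERGE = {}"
  by (auto simp: MERGE_def)

lemma mods_SORT [simp]: "imods SORT = {vp, vl, vr, vle, vre, vw, vgo, aSrt}" "rmods SORT = {}"
  by (auto simp: SORT_def)

lemma mods_SIDES [simp]: "imods SIDES = {vA, vB, vq}" "rmods SIDES = {}"
  by (auto simp: SIDES_def)

lemma mods_BLOCK [simp]: "imods BLOCK = {vt, vv, vj, vbud}" "rmods BLOCK = {racc, rdist, aBest}"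
  by (auto simp: BLOCK_def)

lemma mods_QUERY [simp]:
  "imods QUERY = {vd, vww, vgg, vbase, vt, vv, vj, vbud}" "rmods QUERY = {racc, rdist, aBest}"
  by (auto simp: QUERY_def)

lemma mods_SEARCH [simp]:
  "imods SEARCH = {vee, vbs, va, vu, vd, vww, vgg, vbase, vt, vv, vj, vbud}" "rmods SEARCH = {racc, rdist, aBest}"
  by (auto simp: SEARCH_def)

lemma mods_PROJECT [simp]: "imods PROJECT = {vorg, vx, vy}" "rmods PROJECT = {racc, aVal}"
  by (auto simp: PROJECT_def)

lemma mods_SORTALL [simp]:
  "imods SORTALL = {vlab, vbs, vlen, vpp, vp, vl, vr, vle, vre, vw, vgo, aSrt}" "rmods SORTALL = {aKey}"
  by (auto simp: SORTALL_def)

lemma mods_WEIGHTS [simp]: "imods WEIGHTS = {ve, vu, vv, vj}" "rmods WEIGHTS = {racc, rdist, aBest, aKey}"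
  by (auto simp: WEIGHTS_def)

lemma mods_KRUSKAL [simp]:
  "imods KRUSKAL = {vk, aLab, aSz, aArr, vkk, vjj, ve, vA, vB, vq, aQA, aQS, aQB, aQT, vv}" "rmods KRUSKAL = {}"
  by (auto simp: KRUSKAL_def)

lemma mods_MAIN [simp]:
  "imods MAIN = {vrep, vbud, vi, vorg, vx, vy, vlab, vbs, vlen, vpp, vp, vl, vr, vle, vre, vw, vgo, aSrt,
     vee, va, vu, vd, vww, vgg, vbase, vt, vv, vj}" "rmods MAIN = {racc, aVal, aKey, rdist, aBest}"
  by (auto simp: MAIN_def)

context ram
begin

lemma ok_DIST:
  assumes "I 0 1 = d" "d \<le> M"
  shows "ok DIST I R T (\<lambda>I' R' T'.
    R' rdist 0 = sqrt (\<Sum>j<d. (R 1 (I vu 0 * d + j) - R 1 (I vv 0 * d + j))\<^sup>2) \<and> T' = T + (3 * d + 4))"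
  unfolding DIST_def
  apply (intro ok_Seq ok_RWrite)
  apply (rule ok_For[where len = d and P = "\<lambda>k I' R' T'. T' = T + 2 + 3 * k \<and>
     R' racc 0 = (\<Sum>j<k. (R 1 (I vu 0 * d + j) - R 1 (I vv 0 * d + j))\<^sup>2)"])
  using assms by (auto intro!: ok_RWrite simp: power2_eq_square)

end

section \<open>Parameters and merge sort\<close>

text \<open>
  Lacking logarithms and powers, the machine uses the harmonic number \<open>HH n\<close> for \<open>ln n\<close> and the
  product \<open>PP \<rho> n\<close>, of order \<open>n powr \<rho>\<close>, where \<open>\<rho> = 1 / \<alpha>\<^sup>2\<close>. Every coordinate is split into
  \<open>KK n\<close> copies; a repetition consists of \<open>mm \<rho> C n\<close> projections with search budget \<open>bud \<rho> C n\<close>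
  and threshold \<open>TT n\<close>, for \<open>\<epsilon> = 1 / hh n\<close>.
\<close>

definition hh :: "nat \<Rightarrow> nat" where "hh n = (LEAST h. n \<le> 2 ^ h)"
definition HH :: "nat \<Rightarrow> real" where "HH n = (\<Sum>k<n. 1 / (real k + 1))"
definition PP :: "real \<Rightarrow> nat \<Rightarrow> real" where "PP \<rho> n = (\<Prod>k<n. 1 + \<rho> / (real k + 1))"
definition KK :: "nat \<Rightarrow> nat" where "KK n = (131072 * hh n ^ 4) ^ 4"
definition mm :: "real \<Rightarrow> nat \<Rightarrow> nat \<Rightarrow> nat" where
  "mm \<rho> C n = nat \<lceil>real C * real (hh n) ^ 3 * PP \<rho> n\<rceil>"
definition bud :: "real \<Rightarrow> nat \<Rightarrow> nat \<Rightarrow> nat" where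
  "bud \<rho> C n = 4 * mm \<rho> C n * n * hh n + n * (4 * hh n * (hh n + 4)) + 1"
definition TT :: "nat \<Rightarrow> real" where
  "TT n = sqrt (KK n) * (1 + 1 / real (hh n)) * sqrt (2 * HH n)"

definition params :: "real \<Rightarrow> nat \<Rightarrow> nat \<Rightarrow> nat \<Rightarrow> nat \<Rightarrow> ipart \<Rightarrow> rpart \<Rightarrow> bool" where
  "params \<rho> C c n d I R \<longleftrightarrow>
     I vK 0 = KK n \<and> I vL 0 = d * KK n \<and> I vm 0 = mm \<rho> C n \<and> I vrm 0 = c * hh n \<and>
     I vnb 0 = c * hh n * (mm \<rho> C n * (d * KK n)) \<and> I vbud0 0 = bud \<rho> C n \<and>
     I vW 0 = n * n \<and> I vE 0 = n - 1 \<and> R rT 0 = TT n"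

lemma hh_ge: "n \<le> 2 ^ hh n"
  unfolding hh_def by (rule LeastI[of _ n]) simp

lemma hh_eqI: "n \<le> 2 ^ j \<Longrightarrow> j = 0 \<or> 2 ^ (j - 1) < n \<Longrightarrow> j = hh n"
  unfolding hh_def
proof (rule Least_equality[symmetric], assumption)
  fix y assume a: "j = 0 \<or> 2 ^ (j - 1) < n" "n \<le> 2 ^ y"
  show "j \<le> y"
  proof (rule ccontr)
    assume "\<not> j \<le> y"
    then have "(2::nat) ^ y \<le> 2 ^ (j - 1)" by (intro power_increasing) auto
    with a(2) have "n \<le> 2 ^ (j - 1)" by (rule le_trans)
    then show False using a(1) \<open>\<not> j \<le> y\<close> by linarith
  qed
qed

definition dst :: "rpart \<Rightarrow> nat \<Rightarrow> nat \<Rightarrow> nat \<Rightarrow> real" where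
  "dst R d u v = sqrt (\<Sum>j<d. (R 1 (u * d + j) - R 1 (v * d + j))\<^sup>2)"

context ram
begin

lemma ok_PARAMS:
  assumes n: "I 0 0 = n" "1 \<le> n" and d: "I 0 1 = d" and \<rho>: "\<rho> = 1 / (R 0 0)\<^sup>2"
    and b: "2 * n \<le> M" "n * n \<le> M" "hh n \<le> M" "KK n \<le> M" "d * KK n \<le> M" "mm \<rho> C n \<le> M"
      "c * hh n \<le> M" "c * hh n * (mm \<rho> C n * (d * KK n)) \<le> M" "bud \<rho> C n \<le> M"
  shows "ok (PARAMS C c) I R T (\<lambda>I' R' T'. params \<rho> C c n d I' R' \<and> T' \<le> T + 3 * hh n + 4 * n + 2 * mm \<rho> C n + 20)"
  unfolding PARAMS_def
  apply (intro ok_Seq ok_IWrite)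
  using M apply simp
  using M apply simp
  apply (rule ok_Loop[where mea = "\<lambda>I R. n - I vN 0" and Inv = "\<lambda>I' R' T'. T' = T + 2 + 3 * I' vh 0 \<and>
      I' vN 0 = 2 ^ I' vh 0 \<and> (I' vh 0 = 0 \<or> 2 ^ (I' vh 0 - 1) < n)"])
  subgoal by simp
  subgoal premises p for I' R' T'
  proof -
    have "2 ^ I' vh 0 < n" using p(1,2,4) n by simp
    moreover from less_exp this have "I' vh 0 < n" by (rule less_trans)
    moreover from calculation have "n - 2 ^ I' vh 0 * 2 < n - 2 ^ I' vh 0"
      by (intro diff_less_mono2) auto
    ultimately show ?thesis using p b n by (intro ok_Seq ok_IWrite) auto
  qed
  subgoal premises prem for I1 R1 T1
  proof -
    have I1: "\<And>a. a \<noteq> vN \<Longrightarrow> a \<noteq> vh \<Longrightarrow> I1 a = I a" and R1: "\<And>a. R1 a = R a"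
      using prem(4,5) by auto
    have h: "I1 vh 0 = hh n" using prem(1,2) n by (intro hh_eqI) (auto simp: I1)
    have T1: "T1 = T + 2 + 3 * hh n" using prem h by simp
    define A where "A = 131072 * hh n ^ 4"
    have K1: "131072 * hh n * hh n * hh n * hh n = A"
      by (simp add: A_def power4_eq_xxxx)
    have K2: "A * A * (A * A) = KK n"
      unfolding KK_def A_def[symmetric] by (simp only: power4_eq_xxxx mult.assoc)
    \<comment> \<open>The intermediate squares are bounded through the last one, since a natural
      number is at most its square.\<close>
    have sq: "x \<le> x * x" for x :: nat by simp
    have K3: "A * A \<le> M" using sq[of "A * A"] K2 b(4) by linarith
    have K4: "A \<le> M" using sq[of A] K3 by linarith
    let ?x = "real C * real (hh n) ^ 3 * PP \<rho> n"
    have x: "real (C * hh n * hh n * hh n) * PP \<rho> n = ?x" by (simp add: power3_eq_cube)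
    show ?thesis
      apply (intro ok_Seq ok_RWrite)
      apply (rule ok_For[where len = n and P = "\<lambda>k I' R' T'. T' = T1 + 3 + 1 + 4 * k \<and>
        R' rH 0 = HH k \<and> R' rP 0 = PP \<rho> k"])
      subgoal by simp
      subgoal for I' using n by (simp add: I1)
      subgoal using b by simp
      subgoal by (simp add: HH_def PP_def)
      subgoal for k I' R' T'
        apply (intro ok_Seq ok_RWrite)
        apply (simp add: HH_def PP_def R1 \<rho> power2_eq_square add.commute)
        done
      subgoal premises q for I2 R2 T2
      proof -
        have I2: "\<And>a. a \<noteq> vk \<Longrightarrow> I2 a = I1 a" and R2: "R2 0 = R 0" "R2 rP 0 = PP \<rho> n" "R2 rH 0 = HH n"
          using q(1,4,5) by (auto simp: R1)
        have v: "I2 vh 0 = hh n" "I2 0 0 = n" "I2 0 1 = d" "I2 0 (Suc 0) = d" using h n d by (auto simp: I2 I1)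
        show ?thesis
          apply (intro ok_Seq ok_IWrite)
          subgoal using K4 by (simp add: v K1)
          subgoal using K3 by (simp add: v K1)
          subgoal using b by (simp add: v K1 K2)
          subgoal using b by (simp add: v K1 K2)
          subgoal by simp
          apply (rule ok_Loop[where mea = "\<lambda>I R. mm \<rho> C n - I vm 0" and
             Inv = "\<lambda>I' R' T'. T' = Suc (T2 + 5) + 2 * I' vm 0 \<and> I' vm 0 \<le> mm \<rho> C n"])
          subgoal by simp
          subgoal premises r for I' R' T'
          proof -
            have "real (I' vm 0) < ?x" using r(2,4,5) by (simp add: v R2 x[symmetric])
            then have "I' vm 0 < mm \<rho> C n" unfolding mm_def by linarith
            then show ?thesis using r(1) b by (intro ok_IWrite) auto
          qed
          subgoal premises r for I' R' T'
          proof -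
            have "\<not> real (I' vm 0) < ?x" using r(2,4,5) by (simp add: v R2 x[symmetric])
            then have "mm \<rho> C n \<le> I' vm 0" unfolding mm_def by linarith
            then have m: "I' vm 0 = mm \<rho> C n" using r(1) by simp
            have I': "\<And>a. a \<noteq> vm \<Longrightarrow> a \<noteq> vK \<Longrightarrow> a \<noteq> vL \<Longrightarrow> I' a = I2 a" "I' vK 0 = KK n" "I' vL 0 = d * KK n"
              and R': "\<And>a. R' a = R2 a"
              using r(4,5) by (auto simp: v K1 K2)
            have w: "I' vh 0 = hh n" "I' 0 0 = n" "I' 0 1 = d" "I' 0 (Suc 0) = d" by (simp_all add: I' v)
            show ?thesis
              apply (intro ok_Seq ok_IWrite ok_RWrite)
              using b n(2) by (auto simp: v m I' R' R2 params_def bud_def TT_def T1 r(1) q(1) mult.assoc algebra_simps)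
          qed
          done
      qed
      done
  qed
  done

lemma ok_WEIGHTS:
  assumes "I 0 1 = d" "d \<le> M" "I vE 0 = E" "E \<le> M" "2 \<le> M"
  shows "ok WEIGHTS I R T (\<lambda>I' R' T'. T' \<le> T + 2 + E * (3 * d + 10) \<and>
    (\<forall>e<E. R' aBest e = dst R d (I 1 (2 * e)) (I 1 (2 * e + 1)) \<and> R' aKey e = - dst R d (I 1 (2 * e)) (I 1 (2 * e + 1))))"
  unfolding WEIGHTS_def
  apply (rule ok_For[where len = E and P = "\<lambda>k I' R' T'. T' = T + 1 + k * (3 * d + 10) \<and>
    (\<forall>e<k. R' aBest e = dst R d (I 1 (2 * e)) (I 1 (2 * e + 1)) \<and> R' aKey e = - dst R d (I 1 (2 * e)) (I 1 (2 * e + 1)))"])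
  subgoal by simp
  subgoal using assms by simp
  subgoal using assms by simp
  subgoal by simp
  subgoal premises p for k I' R' T'
    apply (intro ok_Seq ok_IWrite)
    subgoal using p(4) by (simp add: bnd_def)
    subgoal using p(4) by (simp add: bnd_def)
    apply (rule ok_conseq[OF ok_DIST[where d = d]])
    subgoal using assms p(5) by simp
    subgoal using assms by simp
    apply (intro ok_Seq ok_RWrite)
    using p(1,2,3) by (auto simp: less_Suc_eq dst_def p(5,6))
  subgoal by simp
  done

end

section \<open>Merge sort with all levels kept\<close>

definition blkok :: "(nat \<Rightarrow> real) \<Rightarrow> nat \<Rightarrow> nat \<Rightarrow> (nat \<Rightarrow> nat) \<Rightarrow> nat \<Rightarrow> bool" where
  "blkok \<kappa> len w s b \<longleftrightarrow> s ` {b..<min (b + w) len} = {b..<min (b + w) len} \<and>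
     (\<forall>p q. b \<le> p \<longrightarrow> p \<le> q \<longrightarrow> q < min (b + w) len \<longrightarrow> \<kappa> (s q) \<le> \<kappa> (s p))"

text \<open>Invariant of merging the blocks that start at \<open>b\<close> and \<open>bm\<close>:
  the output \<open>t\<close> is filled below \<open>k\<close>, and \<open>i\<close> and
  \<open>j\<close> are the next unread positions of \<open>s\<close>. The last clause, that no
  unread key exceeds an emitted one, is what keeps the output sorted.\<close>

definition part :: "(nat \<Rightarrow> real) \<Rightarrow> (nat \<Rightarrow> nat) \<Rightarrow> (nat \<Rightarrow> nat) \<Rightarrow> nat \<Rightarrow> nat \<Rightarrow> nat \<Rightarrow> nat \<Rightarrow> nat \<Rightarrow> nat \<Rightarrow> bool" where
  "part \<kappa> s t b bm be k i j \<longleftrightarrow> b \<le> i \<and> i \<le> bm \<and> bm \<le> j \<and> j \<le> be \<and> (i - b) + (j - bm) = k - b \<and> b \<le> k \<and>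
     t ` {b..<k} = s ` ({b..<i} \<union> {bm..<j}) \<and>
     (\<forall>p q. b \<le> p \<longrightarrow> p \<le> q \<longrightarrow> q < k \<longrightarrow> \<kappa> (t q) \<le> \<kappa> (t p)) \<and>
     (\<forall>q r. b \<le> q \<longrightarrow> q < k \<longrightarrow> i \<le> r \<and> r < bm \<or> j \<le> r \<and> r < be \<longrightarrow> \<kappa> (s r) \<le> \<kappa> (t q))"

lemma part_init: "b \<le> bm \<Longrightarrow> bm \<le> be \<Longrightarrow> part \<kappa> s t b bm be b b bm"
  by (simp add: part_def)

text \<open>The element at \<open>i\<close> tops the rest of its own block by sortedness, and the
  rest of the other block because it is not below the element at \<open>j\<close>.\<close>

lemma part_left:
  assumes p: "part \<kappa> s t b bm be k i j" and i: "i < bm" "\<not> (j < be \<and> \<kappa> (s i) < \<kappa> (s j))"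
    and s: "\<And>p q. b \<le> p \<Longrightarrow> p \<le> q \<Longrightarrow> q < bm \<Longrightarrow> \<kappa> (s q) \<le> \<kappa> (s p)"
      "\<And>p q. bm \<le> p \<Longrightarrow> p \<le> q \<Longrightarrow> q < be \<Longrightarrow> \<kappa> (s q) \<le> \<kappa> (s p)"
    and t: "t' k = s i" "\<And>q. q < k \<Longrightarrow> t' q = t q"
  shows "part \<kappa> s t' b bm be (Suc k) (Suc i) j"
proof -
  have b: "b \<le> i" "bm \<le> j" "b \<le> k" using p by (auto simp: part_def)
  have im: "t' ` {b..<Suc k} = insert (s i) (t ` {b..<k})"
    using t b by (auto simp: atLeastLessThanSuc image_def)
  have 1: "t' ` {b..<Suc k} = s ` ({b..<Suc i} \<union> {bm..<j})"
    unfolding im using p b by (auto simp: part_def atLeastLessThanSuc)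
  have 2: "\<kappa> (t' q) \<le> \<kappa> (t' p)" if "b \<le> p" "p \<le> q" "q < Suc k" for p q
  proof (cases "q < k")
    case True
    then show ?thesis using that p t by (simp add: part_def)
  next
    case False
    then have "q = k" using that by simp
    show ?thesis
    proof (cases "p = k")
      case False
      then have "p < k" using that by simp
      then show ?thesis using p that i b t \<open>q = k\<close> by (simp add: part_def)
    qed (use \<open>q = k\<close> in simp)
  qed
  have 3: "\<kappa> (s r) \<le> \<kappa> (t' q)" if "b \<le> q" "q < Suc k" "Suc i \<le> r \<and> r < bm \<or> j \<le> r \<and> r < be" for q r
  proof (cases "q < k")
    case True
    then show ?thesis using that p t by (auto simp: part_def)
  next
    case False
    then have "q = k" using that by simp
    have "\<kappa> (s r) \<le> \<kappa> (s i)"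
      using that(3)
    proof
      assume "Suc i \<le> r \<and> r < bm"
      then show ?thesis using b by (intro s(1)) auto
    next
      assume r: "j \<le> r \<and> r < be"
      then have "\<kappa> (s r) \<le> \<kappa> (s j)" using b by (intro s(2)) auto
      moreover have "\<kappa> (s j) \<le> \<kappa> (s i)" using i(2) r by auto
      ultimately show ?thesis by simp
    qed
    then show ?thesis using t \<open>q = k\<close> by simp
  qed
  show ?thesis unfolding part_def using 1 2 3 p i b by (auto simp: part_def)
qed

lemma part_right:
  assumes p: "part \<kappa> s t b bm be k i j" and i: "j < be" "i < bm \<Longrightarrow> \<kappa> (s i) < \<kappa> (s j)"
    and s: "\<And>p q. b \<le> p \<Longrightarrow> p \<le> q \<Longrightarrow> q < bm \<Longrightarrow> \<kappa> (s q) \<le> \<kappa> (s p)"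
      "\<And>p q. bm \<le> p \<Longrightarrow> p \<le> q \<Longrightarrow> q < be \<Longrightarrow> \<kappa> (s q) \<le> \<kappa> (s p)"
    and t: "t' k = s j" "\<And>q. q < k \<Longrightarrow> t' q = t q"
  shows "part \<kappa> s t' b bm be (Suc k) i (Suc j)"
proof -
  have b: "b \<le> i" "bm \<le> j" "b \<le> k" using p by (auto simp: part_def)
  have im: "t' ` {b..<Suc k} = insert (s j) (t ` {b..<k})"
    using t b by (auto simp: atLeastLessThanSuc image_def)
  have 1: "t' ` {b..<Suc k} = s ` ({b..<i} \<union> {bm..<Suc j})"
    unfolding im using p b by (auto simp: part_def atLeastLessThanSuc)
  have 2: "\<kappa> (t' q) \<le> \<kappa> (t' p)" if "b \<le> p" "p \<le> q" "q < Suc k" for p q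
  proof (cases "q < k")
    case True
    then show ?thesis using that p t by (simp add: part_def)
  next
    case False
    then have "q = k" using that by simp
    show ?thesis
    proof (cases "p = k")
      case False
      then have "p < k" using that by simp
      then show ?thesis using p that i b t \<open>q = k\<close> by (simp add: part_def)
    qed (use \<open>q = k\<close> in simp)
  qed
  have 3: "\<kappa> (s r) \<le> \<kappa> (t' q)" if "b \<le> q" "q < Suc k" "i \<le> r \<and> r < bm \<or> Suc j \<le> r \<and> r < be" for q r
  proof (cases "q < k")
    case True
    then show ?thesis using that p t by (auto simp: part_def)
  next
    case False
    then have "q = k" using that by simp
    have "\<kappa> (s r) \<le> \<kappa> (s j)"
      using that(3)
    proof
      assume r: "i \<le> r \<and> r < bm"
      then have "\<kappa> (s r) \<le> \<kappa> (s i)" using b by (intro s(1)) auto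
      moreover have "\<kappa> (s i) < \<kappa> (s j)" using i(2) r by auto
      ultimately show ?thesis by simp
    next
      assume "Suc j \<le> r \<and> r < be"
      then show ?thesis using b by (intro s(2)) auto
    qed
    then show ?thesis using t \<open>q = k\<close> by simp
  qed
  show ?thesis unfolding part_def using 1 2 3 p i b by (auto simp: part_def)
qed

lemma part_end:
  assumes p: "part \<kappa> s t b bm be be i j" and im: "s ` {b..<bm} = {b..<bm}" "s ` {bm..<be} = {bm..<be}"
    and be: "be = min (b + w) len"
  shows "blkok \<kappa> len w t b"
proof -
  have "i = bm" "j = be" "b \<le> bm" "bm \<le> be" using p by (auto simp: part_def)
  then have "t ` {b..<be} = s ` {b..<bm} \<union> s ` {bm..<be}" using p by (simp add: part_def image_Un)
  also have "\<dots> = {b..<be}" using im \<open>b \<le> bm\<close> \<open>bm \<le> be\<close> by auto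
  finally show ?thesis using p by (simp add: blkok_def part_def be[symmetric])
qed


context ram
begin

lemma ok_MERGE_level:
  assumes len: "I vlen 0 = len" "len \<le> W" and W: "I vW 0 = W" and w: "I vw 0 = w" "1 \<le> w"
    and b: "len + 2 * w \<le> M" "1 \<le> M"
    and s: "\<And>p. p < len \<Longrightarrow> s p = I aSrt (I vgo 0 + I vbs 0 + p)"
      "\<And>b. w dvd b \<Longrightarrow> blkok (R aKey) len w s b"
  shows "ok (For vp (IV vlen) MERGE) I R T (\<lambda>I' R' T'. T' \<le> T + 2 + 10 * len \<and>
     (\<forall>b. 2 * w dvd b \<longrightarrow> blkok (R aKey) len (2 * w) (\<lambda>p. I' aSrt (I vgo 0 + W + I vbs 0 + p)) b) \<and>
     (\<forall>x. (\<forall>p<len. x \<noteq> I vgo 0 + W + I vbs 0 + p) \<longrightarrow> I' aSrt x = I aSrt x))"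
proof -
  let ?o = "I vgo 0 + W + I vbs 0"
  let ?\<kappa> = "R aKey"
  \<comment> \<open>Blocks that end by position k are finished, and the one containing k is in
    progress. At a multiple of 2 * w the pointers still belong to the previous pair, so the last
    clause says nothing there; the next step resets them.\<close>
  define P where "P k I' R' T' \<longleftrightarrow> T' \<le> T + 1 + 10 * k \<and>
     (\<forall>x. (\<forall>p<len. x \<noteq> ?o + p) \<longrightarrow> I' aSrt x = I aSrt x) \<and>
     (\<forall>b. 2 * w dvd b \<longrightarrow> b < len \<longrightarrow> min (b + 2 * w) len \<le> k \<longrightarrow> blkok ?\<kappa> len (2 * w) (\<lambda>p. I' aSrt (?o + p)) b) \<and>
     (k < len \<longrightarrow> k mod (2 * w) \<noteq> 0 \<longrightarrow>
        I' vle 0 = min (k - k mod (2 * w) + w) len \<and> I' vre 0 = min (k - k mod (2 * w) + 2 * w) len \<and>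
        part ?\<kappa> s (\<lambda>p. I' aSrt (?o + p)) (k - k mod (2 * w)) (I' vle 0) (I' vre 0) k (I' vl 0) (I' vr 0))"
    for k :: nat and I' :: ipart and R' :: rpart and T' :: nat
  have big: "blkok \<kappa> len v t b" if "len \<le> b" for \<kappa> v t b
    using that by (simp add: blkok_def)
  show ?thesis
  proof (rule ok_For[where len = len and P = P])
    fix k :: nat and I' :: ipart and R' :: rpart and T' :: nat
    assume k: "k < len" and P: "P k I' R' T'" and vk: "I' vp 0 = k" and bnd: "bnd I'"
      and fr: "\<And>a. a \<noteq> vp \<Longrightarrow> a \<notin> imods MERGE \<Longrightarrow> I' a = I a" "\<And>a. a \<notin> rmods MERGE \<Longrightarrow> R' a = R a"
    let ?b = "k - k mod (2 * w)"
    define bm where "bm = min (?b + w) len"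
    define be where "be = min (?b + 2 * w) len"
    have w2: "0 < 2 * w" using w by simp
    have bd: "2 * w dvd ?b" "?b \<le> k" "k < ?b + 2 * w"
      using w2 mod_less_divisor[OF w2, of k] by (auto simp: dvd_minus_mod) 
    have bd': "w dvd ?b" using bd(1) by (rule dvd_mult_right)
    have mod: "k mod (2 * w) = k - k div (2 * w) * (2 * w)" by (simp add: minus_div_mult_eq_mod)
    have bb: "?b < len" "?b \<le> bm" "bm \<le> be" "k < be" "be \<le> len"
      using k bd w by (auto simp: bm_def be_def)
    have s1: "\<kappa>' = ?\<kappa> \<Longrightarrow> \<kappa>' (s q) \<le> \<kappa>' (s p)" if "?b \<le> p" "p \<le> q" "q < bm" for p q \<kappa>'
      using s(2)[OF bd'] that by (auto simp: blkok_def bm_def)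
    have s2: "?\<kappa> (s q) \<le> ?\<kappa> (s p)" if "bm \<le> p" "p \<le> q" "q < be" for p q
    proof (cases "?b + w \<le> len")
      case True
      have "blkok ?\<kappa> len w s (?b + w)" by (rule s(2)[OF dvd_add[OF bd' dvd_refl]])
      moreover have "bm = ?b + w" using True by (simp only: bm_def min_absorb1)
      moreover have "be = min (?b + w + w) len" by (simp only: be_def mult_2 add.assoc)
      ultimately show ?thesis using that by (auto simp: blkok_def)
    next
      case False
      then show ?thesis using that by (auto simp: bm_def be_def)
    qed
    have im1: "s ` {?b..<bm} = {?b..<bm}" using s(2)[OF bd'] by (simp add: blkok_def bm_def)
    have im2: "s ` {bm..<be} = {bm..<be}"
    proof (cases "?b + w \<le> len")
      case True
      have "blkok ?\<kappa> len w s (?b + w)" by (rule s(2)[OF dvd_add[OF bd' dvd_refl]])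
      moreover have "bm = ?b + w" using True by (simp only: bm_def min_absorb1)
      moreover have "be = min (?b + w + w) len" by (simp only: be_def mult_2 add.assoc)
      ultimately show ?thesis by (auto simp: blkok_def)
    next
      case False
      then show ?thesis by (auto simp: bm_def be_def)
    qed
    text \<open>After the conditional the pointers are in place, whether a new pair of blocks starts or not.\<close>
    let ?Q = "\<lambda>I'' R'' T''. T'' \<le> T' + 6 \<and> R'' = R' \<and> I'' aSrt = I' aSrt \<and>
       (\<forall>a. a \<noteq> vl \<longrightarrow> a \<noteq> vr \<longrightarrow> a \<noteq> vle \<longrightarrow> a \<noteq> vre \<longrightarrow> I'' a = I' a) \<and> I'' vle 0 = bm \<and> I'' vre 0 = be \<and>
       part ?\<kappa> s (\<lambda>p. I' aSrt (?o + p)) ?b bm be k (I'' vl 0) (I'' vr 0)"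
    let ?c1 = "Cond (ILess (IV vp [-] (IV vp [div] (IConst 2 [*] IV vw)) [*] (IConst 2 [*] IV vw)) (IConst 1))
       (assign vl (IV vp) ;;
        assign vr (emin (IV vp [+] IV vw) (IV vlen)) ;;
        assign vle (IV vr) ;;
        assign vre (emin (IV vp [+] IConst 2 [*] IV vw) (IV vlen)))
       Skip"
    have emin: "x - (x - y) = min x y" for x y :: nat by simp
    have vals: "I' vw 0 = w" "I' vlen 0 = len" "I' vgo 0 = I vgo 0" "I' vbs 0 = I vbs 0" "I' vW 0 = W"
      using w len W by (auto simp: fr)
    have c1: "ok ?c1 I' R' (Suc T') ?Q"
    proof (rule ok_Cond)
      assume "bv I' R' (ILess (IV vp [-] (IV vp [div] (IConst 2 [*] IV vw)) [*] (IConst 2 [*] IV vw)) (IConst 1))"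
      then have "k mod (2 * w) = 0" using vk vals by (simp add: mod)
      then have b0: "?b = k" by simp
      have "part ?\<kappa> s (\<lambda>p. I' aSrt (?o + p)) k bm be k k bm"
        using bb b0 by (intro part_init) auto
      then show "ok (assign vl (IV vp) ;; assign vr (emin (IV vp [+] IV vw) (IV vlen)) ;;
        assign vle (IV vr) ;; assign vre (emin (IV vp [+] IConst 2 [*] IV vw) (IV vlen))) I' R' (Suc (Suc T')) ?Q"
        using vk vals k b b0 by (intro ok_Seq ok_IWrite) (auto simp: emin bm_def be_def)
    next
      assume "\<not> bv I' R' (ILess (IV vp [-] (IV vp [div] (IConst 2 [*] IV vw)) [*] (IConst 2 [*] IV vw)) (IConst 1))"
      then have "k mod (2 * w) \<noteq> 0" using vk vals by (simp add: mod)
      then show "ok Skip I' R' (Suc (Suc T')) ?Q"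
        using P k unfolding P_def by (intro ok_Skip) (auto simp: bm_def be_def)
    qed
    show "ok MERGE I' R' (Suc T') (\<lambda>I'' R'' T''. P (Suc k) (I''(vp := (I'' vp)(0 := Suc k))) R'' (Suc T''))"
      unfolding MERGE_def
    proof (rule ok_Seq, rule ok_conseq[OF c1])
      fix I2 R2 T2
      assume Q: "?Q I2 R2 T2" and b2: "bnd I2"
      let ?i = "I2 vl 0" and ?j = "I2 vr 0"
      have p: "part ?\<kappa> s (\<lambda>p. I' aSrt (?o + p)) ?b bm be k ?i ?j" using Q by simp
      have ij: "?i \<le> bm" "bm \<le> ?j" "?j \<le> be" "?b \<le> ?i" "(?i - ?b) + (?j - bm) = k - ?b"
        using p by (auto simp: part_def)
      have v2: "I2 vp 0 = k" "I2 vW 0 = W" "I2 vgo 0 = I vgo 0" "I2 vbs 0 = I vbs 0" "R2 = R'" "I2 vle 0 = bm" "I2 vre 0 = be"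
        using Q vk vals by auto
      have R': "R' aKey = ?\<kappa>" by (simp add: fr)
      have sr: "I2 aSrt (I vgo 0 + I vbs 0 + p) = s p" if "p < len" for p
      proof -
        have "\<forall>q<len. I vgo 0 + I vbs 0 + p \<noteq> ?o + q" using that len(2) by auto
        then show ?thesis using P Q s(1)[OF that] unfolding P_def by simp
      qed
      have si: "I2 aSrt (I vgo 0 + I vbs 0 + ?i) = s ?i" if "?i < bm" using that bb by (intro sr) auto
      have sj: "I2 aSrt (I vgo 0 + I vbs 0 + ?j) = s ?j" if "?j < be" using that bb by (intro sr) auto
      have fin: "P (Suc k) I3 R3 T3"
        if t: "\<And>q. q < k \<Longrightarrow> I3 aSrt (?o + q) = I' aSrt (?o + q)" "\<And>x. x \<noteq> ?o + k \<Longrightarrow> I3 aSrt x = I' aSrt x"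
          and p3: "part ?\<kappa> s (\<lambda>p. I3 aSrt (?o + p)) ?b bm be (Suc k) (I3 vl 0) (I3 vr 0)"
          and v3: "I3 vle 0 = bm" "I3 vre 0 = be" "T3 \<le> T' + 10" for I3 R3 T3
        unfolding P_def
      proof (intro conjI allI impI)
        show "T3 \<le> T + 1 + 10 * Suc k" using v3 P unfolding P_def by simp
      next
        fix x assume "\<forall>p<len. x \<noteq> ?o + p"
        then show "I3 aSrt x = I aSrt x" using t(2)[of x] k P unfolding P_def by simp
      next
        fix b assume b: "2 * w dvd b" "b < len" "min (b + 2 * w) len \<le> Suc k"
        show "blkok ?\<kappa> len (2 * w) (\<lambda>p. I3 aSrt (?o + p)) b"
        proof (cases "min (b + 2 * w) len \<le> k")
          case True
          then have "blkok ?\<kappa> len (2 * w) (\<lambda>p. I' aSrt (?o + p)) b" using P b unfolding P_def by blast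
          moreover have "I3 aSrt (?o + p) = I' aSrt (?o + p)" if "p < min (b + 2 * w) len" for p
            using that True by (intro t(1)) auto
          ultimately show ?thesis by (auto simp: blkok_def image_def cong: conj_cong bex_cong)
        next
          case False
          then have e: "min (b + 2 * w) len = Suc k" using b by simp
          \<comment> \<open>Both are multiples of 2 * w, and both blocks contain position k.\<close>
          have "b = ?b"
          proof -
            obtain x where x: "b = 2 * w * x" using b(1) by (auto simp: dvd_def)
            obtain y where y: "?b = 2 * w * y" using bd(1) by (auto simp: dvd_def)
            have "b < Suc k" "Suc k \<le> b + 2 * w" using e b w by auto
            then have "2 * w * x < 2 * w * Suc y" "2 * w * y < 2 * w * Suc x" using x y bd by auto
            then have "x < Suc y" "y < Suc x" unfolding mult_less_cancel1 by blast+
            then have "x = y" by simp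
            then show ?thesis using x y by simp
          qed
          then have "be = Suc k" using e by (simp add: be_def)
          then have "part ?\<kappa> s (\<lambda>p. I3 aSrt (?o + p)) ?b bm be be (I3 vl 0) (I3 vr 0)" using p3 by simp
          then show ?thesis unfolding \<open>b = ?b\<close> by (rule part_end[OF _ im1 im2]) (simp add: be_def)
        qed
      next
        assume "Suc k < len" "Suc k mod (2 * w) \<noteq> 0"
        then have "Suc k - Suc k mod (2 * w) = ?b" by (simp add: mod_Suc split: if_splits)
        then show "I3 vle 0 = min (Suc k - Suc k mod (2 * w) + w) len" "I3 vre 0 = min (Suc k - Suc k mod (2 * w) + 2 * w) len"
          "part ?\<kappa> s (\<lambda>p. I3 aSrt (?o + p)) (Suc k - Suc k mod (2 * w)) (I3 vle 0) (I3 vre 0) (Suc k) (I3 vl 0) (I3 vr 0)"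
          using p3 v3 by (auto simp: bm_def be_def)
      qed
      have Ms: "I2 aSrt x \<le> M" for x using b2 by (simp add: bnd_def)
      show "ok (Cond (Conj (ILess (IV vl) (IV vle)) (Neg (Conj (ILess (IV vr) (IV vre))
         (RLess (RRead aKey (IRead aSrt (IV vgo [+] IV vbs [+] IV vl)))
                (RRead aKey (IRead aSrt (IV vgo [+] IV vbs [+] IV vr)))))))
       (IWrite aSrt (IV vgo [+] IV vW [+] IV vbs [+] IV vp) (IRead aSrt (IV vgo [+] IV vbs [+] IV vl)) ;;
        assign vl (IV vl [+] IConst 1))
       (IWrite aSrt (IV vgo [+] IV vW [+] IV vbs [+] IV vp) (IRead aSrt (IV vgo [+] IV vbs [+] IV vr)) ;;
        assign vr (IV vr [+] IConst 1))) I2 R2 T2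
        (\<lambda>I'' R'' T''. P (Suc k) (I''(vp := (I'' vp)(0 := Suc k))) R'' (Suc T''))" (is "ok (Cond ?g _ _) _ _ _ _")
        apply (rule ok_Cond)
        subgoal premises g
        proof -
          have g': "?i < bm" "\<not> (?j < be \<and> ?\<kappa> (s ?i) < ?\<kappa> (s ?j))"
            using g si sj by (auto simp: v2 R')
          have p': "part ?\<kappa> s (\<lambda>p. ((I' aSrt)(?o + k := s ?i)) (?o + p)) ?b bm be (Suc k) (Suc ?i) ?j"
            using s1[OF _ _ _ refl] s2 by (intro part_left[OF p g']) auto
          have sM: "s ?i \<le> M" using si[OF g'(1)] Ms by metis
          show ?thesis
            apply (intro ok_Seq ok_IWrite fin)
            using Q g'(1) bb b si vk v2 sM p' by (auto simp: ac_simps)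
        qed
        subgoal premises g
        proof -
          have g': "?j < be" "?i < bm \<Longrightarrow> ?\<kappa> (s ?i) < ?\<kappa> (s ?j)"
            using g si sj ij bb by (auto simp: v2 R')
          have p': "part ?\<kappa> s (\<lambda>p. ((I' aSrt)(?o + k := s ?j)) (?o + p)) ?b bm be (Suc k) ?i (Suc ?j)"
            using s1[OF _ _ _ refl] s2 by (intro part_right[OF p g']) auto
          have sM: "s ?j \<le> M" using sj[OF g'(1)] Ms by metis
          show ?thesis
            apply (intro ok_Seq ok_IWrite fin)
            using Q g'(1) bb b sj vk v2 sM p' by (auto simp: ac_simps)
        qed
        done
    qed
  next
    fix I' R' T'
    assume P: "P len I' R' T'"
    have "blkok ?\<kappa> len (2 * w) (\<lambda>p. I' aSrt (?o + p)) b" if "2 * w dvd b" for b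
      using P that by (cases "b < len") (auto simp: P_def big)
    then show "Suc T' \<le> T + 2 + 10 * len \<and>
       (\<forall>b. 2 * w dvd b \<longrightarrow> blkok ?\<kappa> len (2 * w) (\<lambda>p. I' aSrt (?o + p)) b) \<and>
       (\<forall>x. (\<forall>p<len. x \<noteq> ?o + p) \<longrightarrow> I' aSrt x = I aSrt x)"
      using P by (auto simp: P_def)
  qed (use len b w in \<open>auto simp: big P_def\<close>)
qed

lemma blkok_cong:
  assumes "\<And>p. p < len \<Longrightarrow> s p = t p"
  shows "blkok \<kappa> len w s b = blkok \<kappa> len w t b"
proof -
  have "s ` {b..<min (b + w) len} = t ` {b..<min (b + w) len}" using assms by (intro image_cong) auto
  then show ?thesis using assms by (auto simp: blkok_def)
qed

text \<open>The last clause confines the writes to this array's segment on each level, so that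
  arrays sorted earlier into the same bank survive.\<close>

lemma ok_SORT:
  assumes len: "I vlen 0 = len" "len \<le> W" "len \<le> 2 ^ h" and W: "I vW 0 = W" and bs: "I vbs 0 = bs"
    and b: "3 * len \<le> M" "(h + 1) * W \<le> M" "1 \<le> M"
  shows "ok SORT I R T (\<lambda>I' R' T'. T' \<le> T + 3 * len + 6 + (h + 1) * (10 * len + 6) \<and>
     (\<exists>G. I' vgo 0 = G * W \<and> len \<le> 2 ^ G \<and>
       (\<forall>g\<le>G. \<forall>b. 2 ^ g dvd b \<longrightarrow> blkok (R aKey) len (2 ^ g) (\<lambda>p. I' aSrt (g * W + bs + p)) b)) \<and>
     (\<forall>x. (\<forall>g p. p < len \<longrightarrow> x \<noteq> g * W + bs + p) \<longrightarrow> I' aSrt x = I aSrt x))"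
proof -
  let ?\<kappa> = "R aKey"
  define fr where "fr I' \<longleftrightarrow> (\<forall>x. (\<forall>g p. p < len \<longrightarrow> x \<noteq> g * W + bs + p) \<longrightarrow> I' aSrt x = I aSrt x)" for I' :: ipart
  define Inv where "Inv I' R' T' \<longleftrightarrow> fr I' \<and> (\<exists>G. I' vw 0 = 2 ^ G \<and> I' vgo 0 = G * W \<and> G \<le> h \<and>
      T' \<le> T + 5 + 3 * len + G * (10 * len + 6) \<and>
      (\<forall>g\<le>G. \<forall>b. 2 ^ g dvd b \<longrightarrow> blkok ?\<kappa> len (2 ^ g) (\<lambda>p. I' aSrt (g * W + bs + p)) b))"
    for I' :: ipart and R' :: rpart and T' :: nat
  show ?thesis
    unfolding SORT_def fr_def[symmetric]
    apply (rule ok_Seq)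
    apply (rule ok_For[where len = len and P = "\<lambda>k I' R' T'. T' = T + 1 + 3 * k \<and> fr I' \<and> (\<forall>p<k. I' aSrt (bs + p) = p)"])
    subgoal by simp
    subgoal using len by simp
    subgoal using b by simp
    subgoal by (simp add: fr_def)
    subgoal premises p for k I' R' T'
    proof (rule ok_IWrite)
      have "x \<noteq> bs + k" if "\<forall>g p. p < len \<longrightarrow> x \<noteq> g * W + bs + p" for x
        using that[rule_format, of k 0] p(1) by simp
      then show "Suc (Suc (Suc T')) = T + 1 + 3 * Suc k \<and>
         fr ((I'(aSrt := (I' aSrt)(iv I' (IV vbs [+] IV vp) := iv I' (IV vp))))(vp := ((I'(aSrt := (I' aSrt)(iv I' (IV vbs [+] IV vp) := iv I' (IV vp)))) vp)(0 := Suc k))) \<and>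
         (\<forall>p<Suc k. ((I'(aSrt := (I' aSrt)(iv I' (IV vbs [+] IV vp) := iv I' (IV vp))))(vp := ((I'(aSrt := (I' aSrt)(iv I' (IV vbs [+] IV vp) := iv I' (IV vp)))) vp)(0 := Suc k))) aSrt (bs + p) = p)"
        using p bs by (auto simp: fr_def less_Suc_eq)
      show "iv I' (IV vp) \<le> M" using p b by simp
    qed
    subgoal premises p for I1 R1 T1
      apply (intro ok_Seq ok_IWrite)
      subgoal using b by simp
      subgoal by simp
      apply (rule ok_Loop[where Inv = Inv and mea = "\<lambda>I R. len - I vw 0"])
      subgoal
      proof -
        have "blkok ?\<kappa> len 1 (\<lambda>p. I1 aSrt (bs + p)) b" for b
        proof (subst blkok_cong[where t = "\<lambda>p. p"])
          have "?\<kappa> q \<le> ?\<kappa> p" if "b \<le> p" "p \<le> q" "q < Suc b" for p q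
          proof -
            have "p = q" using that by simp
            then show ?thesis by simp
          qed
          then show "blkok ?\<kappa> len 1 (\<lambda>p. p) b" by (auto simp: blkok_def)
        qed (use p(1) in auto)
        then show ?thesis
          unfolding Inv_def using p(1) by (intro conjI exI[of _ 0]) (auto simp: fr_def)
      qed
      subgoal premises q for I2 R2 T2
      proof -
        obtain G where G: "I2 vw 0 = 2 ^ G" "I2 vgo 0 = G * W" "G \<le> h" "T2 \<le> T + 5 + 3 * len + G * (10 * len + 6)"
            "\<And>g b. g \<le> G \<Longrightarrow> 2 ^ g dvd b \<Longrightarrow> blkok ?\<kappa> len (2 ^ g) (\<lambda>p. I2 aSrt (g * W + bs + p)) b"
          using q(1) unfolding Inv_def by blast
        have v: "I2 vlen 0 = len" "I2 vbs 0 = bs" "I2 vW 0 = W" "R2 aKey = ?\<kappa>"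
          using q(4,5) p(4,5) len W bs by auto
        have lt: "2 ^ G < len" using q(2) by (simp add: v G)
        have Gh: "G < h"
        proof -
          have "(2::nat) ^ G < 2 ^ h" using lt len(3) by (rule less_le_trans)
          then show ?thesis by simp
        qed
        have "ok (For vp (IV vlen) MERGE) I2 R2 (Suc T2) (\<lambda>I' R' T'. T' \<le> Suc T2 + 2 + 10 * len \<and>
           (\<forall>b. 2 * 2 ^ G dvd b \<longrightarrow> blkok (R2 aKey) len (2 * 2 ^ G) (\<lambda>p. I' aSrt (I2 vgo 0 + W + I2 vbs 0 + p)) b) \<and>
           (\<forall>x. (\<forall>p<len. x \<noteq> I2 vgo 0 + W + I2 vbs 0 + p) \<longrightarrow> I' aSrt x = I2 aSrt x))"
          using lt b len(2) by (intro ok_MERGE_level[where s = "\<lambda>p. I2 aSrt (I2 vgo 0 + I2 vbs 0 + p)"])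
            (auto simp: v G(1,2) intro: G(5))
        then show ?thesis
          apply (intro ok_Seq)
          apply (erule ok_conseq)
          subgoal premises r for I3 R3 T3
          proof -
            have f3: "I3 vw 0 = 2 ^ G" "I3 vgo 0 = G * W" "I3 vW 0 = W" using r(3) by (auto simp: G v)
            have old: "I3 aSrt (g * W + bs + p) = I2 aSrt (g * W + bs + p)" if "g \<le> G" "p < len" for g p
            proof -
              have "g * W + p < Suc g * W" using that len by simp
              also have "\<dots> \<le> Suc G * W" using that by (intro mult_le_mono1) simp
              finally have "g * W + bs + p < G * W + W + bs" by simp
              then show ?thesis using r(1) by (simp add: G v)
            qed
            have new: "blkok ?\<kappa> len (2 ^ Suc G) (\<lambda>p. I3 aSrt (Suc G * W + bs + p)) b" if "2 ^ Suc G dvd b" for b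
              using r(1) that by (simp add: G v add.commute add.left_commute)
            have fr3: "fr I3"
              unfolding fr_def
            proof (intro allI impI)
              fix x assume x: "\<forall>g p. p < len \<longrightarrow> x \<noteq> g * W + bs + p"
              have "x \<noteq> G * W + W + bs + p" if "p < len" for p
                using x[rule_format, OF that, of "Suc G"] by (simp add: add.commute)
              then have "I3 aSrt x = I2 aSrt x" using r(1) by (simp add: G v)
              also have "\<dots> = I aSrt x" using q(1) x by (auto simp: Inv_def fr_def)
              finally show "I3 aSrt x = I aSrt x" .
            qed
            have "Suc G * W \<le> (h + 1) * W" using Gh by (intro mult_le_mono1) simp
            then have bM: "Suc G * W \<le> M" using b(2) by linarith
            have all: "blkok ?\<kappa> len (2 ^ g) (\<lambda>p. I3 aSrt (g * W + bs + p)) b" if "g \<le> Suc G" "2 ^ g dvd b" for g b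
            proof (cases "g = Suc G")
              case True
              then show ?thesis using new that by simp
            next
              case False
              then have g: "g \<le> G" using that by simp
              show ?thesis by (subst blkok_cong[OF old[OF g]]) (use G(5)[OF g that(2)] in auto)
            qed
            have meas: "len - 2 * 2 ^ G < len - 2 ^ G" using lt by (intro diff_less_mono2) auto
            have T3: "Suc (Suc T3) \<le> T + 5 + 3 * len + Suc G * (10 * len + 6)" using r(1) G(4) by simp
            show ?thesis
              apply (intro ok_Seq ok_IWrite)
              subgoal using lt b by (simp add: f3)
              subgoal using bM by (simp add: f3)
              subgoal
                unfolding Inv_def using fr3 all meas T3 Gh
                by (intro conjI exI[of _ "Suc G"]) (auto simp: f3 G fr_def)
              done
          qed
          done
      qed
      subgoal premises q for I2 R2 T2
      proof -
        obtain G where G: "I2 vw 0 = 2 ^ G" "I2 vgo 0 = G * W" "G \<le> h" "T2 \<le> T + 5 + 3 * len + G * (10 * len + 6)"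
            "\<And>g b. g \<le> G \<Longrightarrow> 2 ^ g dvd b \<Longrightarrow> blkok ?\<kappa> len (2 ^ g) (\<lambda>p. I2 aSrt (g * W + bs + p)) b"
          using q(1) unfolding Inv_def by blast
        have "I2 vlen 0 = len" using q(4) p(4) len by auto
        then have "len \<le> 2 ^ G" using q(2) by (simp add: G)
        moreover have "G * (10 * len + 6) \<le> (h + 1) * (10 * len + 6)" using G(3) by (intro mult_le_mono1) simp
        then have "Suc T2 \<le> T + 3 * len + 6 + (h + 1) * (10 * len + 6)" using G(4) by linarith
        ultimately show ?thesis using G q(1) unfolding Inv_def by blast
      qed
      done
    done
qed

end

section \<open>Collecting the components\<close>

lemma decode_eq:
  fixes n :: nat
  assumes "B * n + p = B' * n + p'" "p < n" "p' < n"
  shows "B = B' \<and> p = p'"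
proof -
  have "(B * n + p) div n = B" "(B' * n + p') div n = B'" using assms(2,3) by simp_all
  then have "B = B'" using assms(1) by metis
  then show ?thesis using assms(1) by simp
qed

context tree_instance
begin

definition cls :: "(nat \<Rightarrow> nat) \<Rightarrow> nat \<Rightarrow> nat set" where
  "cls lab B = {v. v < n \<and> lab v = B}"

text \<open>
  Invariant of Kruskal's algorithm after the first \<open>k\<close> edges in the order \<open>\<sigma>\<close>. The ghost variable
  \<open>r\<close> counts the relabellings of a vertex, each of which at least doubles the size of its class.
\<close>

definition kinv :: "(nat \<Rightarrow> nat) \<Rightarrow> nat \<Rightarrow> (nat \<Rightarrow> nat) \<Rightarrow> (nat \<Rightarrow> nat) \<Rightarrow> (nat \<Rightarrow> nat) \<Rightarrow> (nat \<Rightarrow> nat) \<Rightarrow> bool" where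
  "kinv \<sigma> k lab sz arr r \<longleftrightarrow>
     (\<forall>u<n. \<forall>v<n. lab u = lab v \<longleftrightarrow> (u, v) \<in> (Gr (\<sigma> ` {..<k}))\<^sup>*) \<and> (\<forall>v<n. lab v < n) \<and>
     (\<forall>B<n. sz B \<le> n \<and> inj_on (\<lambda>p. arr (B * n + p)) {..<sz B} \<and> (\<forall>p<sz B. arr (B * n + p) < n)) \<and>
     (\<forall>v<n. (\<lambda>p. arr (lab v * n + p)) ` {..<sz (lab v)} = cls lab (lab v)) \<and>
     (\<forall>v<n. 2 ^ r v \<le> sz (lab v)) \<and> (\<Sum>B<n. sz B) = n + (\<Sum>v<n. r v)"

lemma kinvD:
  assumes "kinv \<sigma> k lab sz arr r"
  shows "\<And>u v. u < n \<Longrightarrow> v < n \<Longrightarrow> lab u = lab v \<longleftrightarrow> (u, v) \<in> (Gr (\<sigma> ` {..<k}))\<^sup>*" "\<And>v. v < n \<Longrightarrow> lab v < n"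
    "\<And>B. B < n \<Longrightarrow> sz B \<le> n" "\<And>B. B < n \<Longrightarrow> inj_on (\<lambda>p. arr (B * n + p)) {..<sz B}"
    "\<And>B p. B < n \<Longrightarrow> p < sz B \<Longrightarrow> arr (B * n + p) < n"
    "\<And>v. v < n \<Longrightarrow> (\<lambda>p. arr (lab v * n + p)) ` {..<sz (lab v)} = cls lab (lab v)"
    "\<And>v. v < n \<Longrightarrow> 2 ^ r v \<le> sz (lab v)" "(\<Sum>B<n. sz B) = n + (\<Sum>v<n. r v)"
  using assms unfolding kinv_def by simp_all

lemma kinv_init:
  assumes "\<And>v. v < n \<Longrightarrow> lab v = v \<and> sz v = 1 \<and> arr (v * n) = v"
  shows "kinv \<sigma> 0 lab sz arr (\<lambda>_. 0)"
  using assms n_pos unfolding kinv_def Gr_def cls_def by (auto simp: lessThan_Suc)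

lemma kinv_card:
  assumes "kinv \<sigma> k lab sz arr r" "v < n"
  shows "card (cls lab (lab v)) = sz (lab v)"
proof -
  have "inj_on (\<lambda>p. arr (lab v * n + p)) {..<sz (lab v)}" "(\<lambda>p. arr (lab v * n + p)) ` {..<sz (lab v)} = cls lab (lab v)"
    using kinvD(4)[OF assms(1) kinvD(2)[OF assms]] kinvD(6)[OF assms] by auto
  then show ?thesis using card_image by fastforce
qed

lemma finite_cls: "finite (cls lab B)"
  by (simp add: cls_def)

text \<open>A class of size at least 2^r has at most n \<le> 2^h members, so every vertex is
  relabelled at most h times.\<close>

lemma kinv_r_le:
  assumes "kinv \<sigma> k lab sz arr r" "n \<le> 2 ^ h"
  shows "(\<Sum>v<n. r v) \<le> n * h"
proof -
  have "r v \<le> h" if "v < n" for v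
  proof -
    have "2 ^ r v \<le> sz (lab v)" "sz (lab v) \<le> n" using kinvD(7)[OF assms(1) that] kinvD(3)[OF assms(1) kinvD(2)[OF assms(1) that]] by auto
    then have "(2::nat) ^ r v \<le> 2 ^ h" using assms(2) by linarith
    then show ?thesis by simp
  qed
  then have "(\<Sum>v<n. r v) \<le> (\<Sum>v<n. h)" by (intro sum_mono) auto
  then show ?thesis by simp
qed

text \<open>The row of the absorbed class A is kept as it is and row B grows only at its end; by the
  last conclusion all earlier prefixes keep their contents. Hence the row lengths add up to n plus
  the number of relabellings.\<close>

lemma kinv_merge:
  assumes inv: "kinv \<sigma> k lab sz arr r" and e: "\<sigma> k < E" "\<sigma> k \<notin> \<sigma> ` {..<k}" "\<sigma> ` {..<k} \<subseteq> {..<E}"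
    and AB: "{A, B} = {lab (ex (\<sigma> k)), lab (ey (\<sigma> k))}" "sz A \<le> sz B"
    and lab': "\<And>v. v < n \<Longrightarrow> lab' v = (if lab v = A then B else lab v)"
    and sz': "sz' = sz(B := sz B + sz A)"
    and arr': "\<And>p. p < sz A \<Longrightarrow> arr' (B * n + sz B + p) = arr (A * n + p)"
      "\<And>x. (\<And>p. p < sz A \<Longrightarrow> x \<noteq> B * n + sz B + p) \<Longrightarrow> arr' x = arr x"
    and r': "r' = (\<lambda>v. if lab v = A then Suc (r v) else r v)"
  shows "kinv \<sigma> (Suc k) lab' sz' arr' r'" "(\<Sum>v<n. r' v) = (\<Sum>v<n. r v) + sz A"
    "sz A + sz B \<le> n" "A \<noteq> B" "A < n" "B < n"
    "\<And>C p. C < n \<Longrightarrow> p < sz C \<Longrightarrow> arr' (C * n + p) = arr (C * n + p)"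
proof -
  let ?x = "ex (\<sigma> k)" and ?y = "ey (\<sigma> k)"
  have xy: "?x < n" "?y < n" using e ex_lt ey_lt by auto
  note conn = kinvD(1)[OF inv]
  have neq: "lab ?x \<noteq> lab ?y" using conn[OF xy] acyclic[OF e(1) e(3) e(2)] by simp
  then show ABn: "A \<noteq> B" using AB by (auto simp: doubleton_eq_iff)
  obtain a b where ab: "a < n" "b < n" "A = lab a" "B = lab b"
    using AB xy by (auto simp: doubleton_eq_iff)
  show A: "A < n" and B: "B < n" using kinvD(2)[OF inv] ab by auto
  have cA: "card (cls lab A) = sz A" and cB: "card (cls lab B) = sz B"
    using kinv_card[OF inv ab(1)] kinv_card[OF inv ab(2)] ab by auto
  have dis: "cls lab A \<inter> cls lab B = {}" using ABn by (auto simp: cls_def)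
  have "card (cls lab A \<union> cls lab B) \<le> card {..<n}" by (intro card_mono) (auto simp: cls_def)
  then show le: "sz A + sz B \<le> n" using dis cA cB by (simp add: card_Un_disjoint finite_cls)
  show old: "arr' (C * n + p) = arr (C * n + p)" if "C < n" "p < sz C" for C p
  proof (rule arr'(2))
    fix q assume q: "q < sz A"
    show "C * n + p \<noteq> B * n + sz B + q"
    proof
      assume eq: "C * n + p = B * n + sz B + q"
      moreover have "p < n" using kinvD(3)[OF inv that(1)] that(2) by simp
      ultimately have "C = B \<and> p = sz B + q" using q le by (intro decode_eq[of _ n]) auto
      then show False using that by simp
    qed
  qed
  have imA: "(\<lambda>p. arr (A * n + p)) ` {..<sz A} = cls lab A" and imB: "(\<lambda>p. arr (B * n + p)) ` {..<sz B} = cls lab B"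
    using kinvD(6)[OF inv] ab by auto
  have r2: "(\<Sum>v<n. r' v) = (\<Sum>v<n. r v) + sz A"
  proof -
    have "(\<Sum>v<n. r' v) = (\<Sum>v<n. r v + (if lab v = A then 1 else 0))" by (intro sum.cong) (auto simp: r')
    also have "\<dots> = (\<Sum>v<n. r v) + card {v \<in> {..<n}. lab v = A}" by (simp add: sum.distrib sum.If_cases Int_def)
    also have "{v \<in> {..<n}. lab v = A} = cls lab A" by (auto simp: cls_def)
    finally show ?thesis by (simp add: cA)
  qed
  then show "(\<Sum>v<n. r' v) = (\<Sum>v<n. r v) + sz A" .
  have F: "\<sigma> ` {..<Suc k} = insert (\<sigma> k) (\<sigma> ` {..<k})" by (auto simp: lessThan_Suc)
  \<comment> \<open>Either endpoint may carry the absorbed label A, since merging is symmetric in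
    the two labels.\<close>
  have gen: "(if a = A then B else a) = (if b = A then B else b) \<longleftrightarrow> a = b \<or> a = p \<and> q = b \<or> a = q \<and> p = b"
    if "{A, B} = {p, q}" "p \<noteq> q" for a b p q :: nat
    using that unfolding doubleton_eq_iff by auto
  have K1: "lab' u = lab' v \<longleftrightarrow> (u, v) \<in> (Gr (\<sigma> ` {..<Suc k}))\<^sup>*" if "u < n" "v < n" for u v
    unfolding F conn_insert conn[OF that, symmetric] conn[OF that(1) xy(1), symmetric]
      conn[OF that(1) xy(2), symmetric] conn[OF xy(1) that(2), symmetric] conn[OF xy(2) that(2), symmetric]
      lab'[OF that(1)] lab'[OF that(2)] by (rule gen[OF AB(1) neq])
  have K2: "lab' v < n" if "v < n" for v using that lab' kinvD(2)[OF inv] B by simp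
  have split: "(\<lambda>p. arr' (B * n + p)) ` {..<sz B + sz A} = cls lab A \<union> cls lab B"
  proof -
    have "{..<sz B + sz A} = {..<sz B} \<union> (\<lambda>p. sz B + p) ` {..<sz A}"
    proof (intro set_eqI iffI)
      fix x assume x: "x \<in> {..<sz B + sz A}"
      show "x \<in> {..<sz B} \<union> (\<lambda>p. sz B + p) ` {..<sz A}"
      proof (cases "x < sz B")
        case False
        then have "x = sz B + (x - sz B)" "x - sz B < sz A" using x by auto
        then show ?thesis by blast
      qed simp
    qed auto
    then have "(\<lambda>p. arr' (B * n + p)) ` {..<sz B + sz A} =
        (\<lambda>p. arr' (B * n + p)) ` {..<sz B} \<union> (\<lambda>p. arr' (B * n + sz B + p)) ` {..<sz A}"
      by (simp add: image_Un image_image add.assoc)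
    also have "(\<lambda>p. arr' (B * n + p)) ` {..<sz B} = (\<lambda>p. arr (B * n + p)) ` {..<sz B}"
      using old[OF B] by (intro image_cong) auto
    also have "(\<lambda>p. arr' (B * n + sz B + p)) ` {..<sz A} = (\<lambda>p. arr (A * n + p)) ` {..<sz A}"
      using arr'(1) by (intro image_cong) auto
    finally show ?thesis using imA imB by auto
  qed
  have K3: "sz' C \<le> n \<and> inj_on (\<lambda>p. arr' (C * n + p)) {..<sz' C} \<and> (\<forall>p<sz' C. arr' (C * n + p) < n)" if "C < n" for C
  proof (cases "C = B")
    case True
    have "card ((\<lambda>p. arr' (B * n + p)) ` {..<sz B + sz A}) = card {..<sz B + sz A}"
      unfolding split using dis cA cB by (simp add: card_Un_disjoint finite_cls)
    then have "inj_on (\<lambda>p. arr' (B * n + p)) {..<sz B + sz A}" by (intro eq_card_imp_inj_on) auto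
    moreover have "arr' (B * n + p) < n" if "p < sz B + sz A" for p
    proof -
      have "arr' (B * n + p) \<in> cls lab A \<union> cls lab B" unfolding split[symmetric] using that by auto
      then show ?thesis by (auto simp: cls_def)
    qed
    ultimately show ?thesis using True le by (auto simp: sz')
  next
    case False
    have "inj_on (\<lambda>p. arr' (C * n + p)) {..<sz C} = inj_on (\<lambda>p. arr (C * n + p)) {..<sz C}"
      using old[OF that] by (intro inj_on_cong) auto
    then show ?thesis using False kinvD(3-5)[OF inv that] old[OF that] by (simp add: sz')
  qed
  have K4: "(\<lambda>p. arr' (lab' v * n + p)) ` {..<sz' (lab' v)} = cls lab' (lab' v)" if v: "v < n" for v
  proof (cases "lab' v = B")
    case True
    have "cls lab' B = cls lab A \<union> cls lab B" by (auto simp: cls_def lab' split: if_splits)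
    then show ?thesis using split True by (simp add: sz')
  next
    case False
    then have l: "lab' v = lab v" "lab v \<noteq> A" "lab v \<noteq> B" using lab'[OF v] by (auto split: if_splits)
    have "lab v < n" using kinvD(2)[OF inv v] .
    then have "(\<lambda>p. arr' (lab v * n + p)) ` {..<sz (lab v)} = (\<lambda>p. arr (lab v * n + p)) ` {..<sz (lab v)}"
      using old by (intro image_cong) auto
    also have "\<dots> = cls lab (lab v)" using kinvD(6)[OF inv v] .
    also have "\<dots> = cls lab' (lab v)" using l by (auto simp: cls_def lab' split: if_splits)
    finally show ?thesis using l by (simp add: sz')
  qed
  have K5: "2 ^ r' v \<le> sz' (lab' v)" if v: "v < n" for v
  proof -
    have "2 ^ r v \<le> sz (lab v)" using kinvD(7)[OF inv v] .
    then show ?thesis using lab'[OF v] ABn AB(2) by (auto simp: sz' r')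
  qed
  have K6: "(\<Sum>C<n. sz' C) = n + (\<Sum>v<n. r' v)"
  proof -
    have "(\<Sum>C<n. sz' C) = (\<Sum>C<n. sz C + (if C = B then sz A else 0))" by (intro sum.cong) (auto simp: sz')
    also have "\<dots> = (\<Sum>C<n. sz C) + sz A" using B by (simp add: sum.distrib)
    finally show ?thesis using r2 kinvD(8)[OF inv] by simp
  qed
  show "kinv \<sigma> (Suc k) lab' sz' arr' r'"
    unfolding kinv_def by (intro conjI allI impI K1 K2 K3 K4 K5 K6)
qed

text \<open>Prefix lengths are stored because the rows may grow later. The disjunction reflects that
  the smaller side may belong to either endpoint.\<close>

definition recd :: "nat \<Rightarrow> (nat \<Rightarrow> nat) \<Rightarrow> (nat \<Rightarrow> nat) \<Rightarrow> nat \<Rightarrow> nat \<Rightarrow> nat \<Rightarrow> nat \<Rightarrow> bool" where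
  "recd e sz arr QA QS QB QT \<longleftrightarrow> QA < n \<and> QB < n \<and> QS \<le> sz QA \<and> QT \<le> sz QB \<and> QS \<le> QT \<and>
     inj_on (\<lambda>p. arr (QA * n + p)) {..<QS} \<and> inj_on (\<lambda>p. arr (QB * n + p)) {..<QT} \<and>
     ((\<lambda>p. arr (QA * n + p)) ` {..<QS} = comp e (ex e) \<and> (\<lambda>p. arr (QB * n + p)) ` {..<QT} = comp e (ey e) \<or>
      (\<lambda>p. arr (QA * n + p)) ` {..<QS} = comp e (ey e) \<and> (\<lambda>p. arr (QB * n + p)) ` {..<QT} = comp e (ex e))"

lemma recd_mono:
  assumes "recd e sz arr QA QS QB QT" "\<And>C. sz C \<le> sz' C"
    and "\<And>C p. C < n \<Longrightarrow> p < sz C \<Longrightarrow> arr' (C * n + p) = arr (C * n + p)"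
  shows "recd e sz' arr' QA QS QB QT"
proof -
  have QA: "arr' (QA * n + p) = arr (QA * n + p)" if "p < QS" for p
    using assms(1) that by (intro assms(3)) (auto simp: recd_def)
  have QB: "arr' (QB * n + p) = arr (QB * n + p)" if "p < QT" for p
    using assms(1) that by (intro assms(3)) (auto simp: recd_def)
  have "inj_on (\<lambda>p. arr' (QA * n + p)) {..<QS} = inj_on (\<lambda>p. arr (QA * n + p)) {..<QS}"
    "inj_on (\<lambda>p. arr' (QB * n + p)) {..<QT} = inj_on (\<lambda>p. arr (QB * n + p)) {..<QT}"
    using QA QB by (auto intro!: inj_on_cong)
  moreover have "(\<lambda>p. arr' (QA * n + p)) ` {..<QS} = (\<lambda>p. arr (QA * n + p)) ` {..<QS}"
    "(\<lambda>p. arr' (QB * n + p)) ` {..<QT} = (\<lambda>p. arr (QB * n + p)) ` {..<QT}"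
    using QA QB by (auto intro!: image_cong)
  moreover have "QS \<le> sz' QA" "QT \<le> sz' QB"
    using assms(1) assms(2)[of QA] assms(2)[of QB] by (auto simp: recd_def)
  ultimately show ?thesis using assms(1) unfolding recd_def by simp
qed

lemma recd_card:
  assumes "recd e sz arr QA QS QB QT"
  shows "QS \<le> card (comp e (ex e))" "QS \<le> card (comp e (ey e))"
proof -
  have "card ((\<lambda>p. arr (QA * n + p)) ` {..<QS}) = QS" "card ((\<lambda>p. arr (QB * n + p)) ` {..<QT}) = QT" "QS \<le> QT"
    using assms by (auto simp: recd_def card_image)
  moreover have "(\<lambda>p. arr (QA * n + p)) ` {..<QS} = comp e (ex e) \<and> (\<lambda>p. arr (QB * n + p)) ` {..<QT} = comp e (ey e) \<or>
      (\<lambda>p. arr (QA * n + p)) ` {..<QS} = comp e (ey e) \<and> (\<lambda>p. arr (QB * n + p)) ` {..<QT} = comp e (ex e)"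
    using assms by (simp add: recd_def)
  ultimately show "QS \<le> card (comp e (ex e))" "QS \<le> card (comp e (ey e))" by auto
qed

lemma cls_eq_comp:
  assumes inv: "kinv \<sigma> k lab sz arr r" and F: "\<sigma> ` {..<k} = {f. f < E \<and> wt f < wt e}" and x: "x < n"
  shows "cls lab (lab x) = comp e x"
proof -
  have "lab v = lab x \<longleftrightarrow> (x, v) \<in> (Gr (\<sigma> ` {..<k}))\<^sup>*" if "v < n" for v
    using kinvD(1)[OF inv x that] eq_commute[of "lab v" "lab x"] by simp
  then show ?thesis unfolding cls_def comp_def F[symmetric] by blast
qed

text \<open>When e itself is merged, edges of equal weight may already have been merged, so the
  classes can exceed the components. Inclusion is enough to compare sizes.\<close>

lemma comp_subset_cls:
  assumes inv: "kinv \<sigma> k lab sz arr r" and F: "{f. f < E \<and> wt f < wt e} \<subseteq> \<sigma> ` {..<k}" and x: "x < n"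
  shows "comp e x \<subseteq> cls lab (lab x)"
proof
  fix v assume "v \<in> comp e x"
  then have v: "v < n" "(x, v) \<in> (Gr {f. f < E \<and> wt f < wt e})\<^sup>*" by (auto simp: comp_def)
  have "Gr {f. f < E \<and> wt f < wt e} \<subseteq> Gr (\<sigma> ` {..<k})" unfolding Gr_def by (rule UN_mono[OF F order_refl])
  from subsetD[OF rtrancl_mono[OF this] v(2)] have "lab x = lab v" using kinvD(1)[OF inv x v(1)] by simp
  then show "v \<in> cls lab (lab x)" using v(1) by (simp add: cls_def)
qed

end

locale ram_tree = ram Z M + tree_instance d n pts es X T
  for Z M d n pts es X T
begin

definition edges_in :: "ipart \<Rightarrow> bool" where
  "edges_in I \<longleftrightarrow> I 0 0 = n \<and> I 0 1 = d \<and> (\<forall>e<E. I 1 (2 * e) = ex e \<and> I 1 (2 * e + 1) = ey e)"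

lemma ok_SIDES:
  assumes e: "I ve 0 = e" "I 1 (2 * e) = x" "I 1 (2 * e + 1) = y"
  shows "ok SIDES I R T0 (\<lambda>I' R' T'. T' \<le> T0 + 6 \<and> I aSz (I' vA 0) \<le> I aSz (I' vB 0) \<and>
     (I' vA 0 = I aLab x \<and> I' vB 0 = I aLab y \<or> I' vA 0 = I aLab y \<and> I' vB 0 = I aLab x))"
proof (rule ok_bnd)
  assume b: "bnd I"
  show ?thesis
    unfolding SIDES_def
    apply (intro ok_Seq ok_IWrite ok_Cond ok_Skip)
    using b e by (auto simp: bnd_def)
qed

text \<open>Every advance of a pointer costs at most 15 steps, plus 5 per relabelled vertex. The
  size of the smaller side recorded for an edge is charged to the relabellings made when that edge
  is merged, so these sizes sum to at most n * h.\<close>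

lemma ok_KRUSKAL:
  assumes inp: "edges_in I" and E': "I vE 0 = E" and wt: "\<And>e. e < E \<Longrightarrow> R aBest e = wt e"
    and \<sigma>: "\<And>k. \<sigma> k = I aSrt (I vgo 0 + k)" "\<sigma> ` {..<E} = {..<E}"
      "\<And>p q. p \<le> q \<Longrightarrow> q < E \<Longrightarrow> wt (\<sigma> p) \<le> wt (\<sigma> q)"
    and b: "n \<le> 2 ^ h" "n \<le> M"
  shows "ok KRUSKAL I R T0 (\<lambda>I' R' T'. T' \<le> T0 + 5 * n + 30 * E + 5 * (n * h) + 5 \<and>
     (\<forall>e<E. recd e (I' aSz) (I' aArr) (I' aQA e) (I' aQS e) (I' aQB e) (I' aQT e)) \<and>
     (\<Sum>e<E. I' aQS e) \<le> n * h \<and> (\<Sum>B<n. I' aSz B) \<le> n + n * h \<and> (\<forall>B<n. I' aSz B \<le> n) \<and>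
     (\<forall>B<n. \<forall>p<I' aSz B. I' aArr (B * n + p) < n))"
proof -
  have inj: "inj_on \<sigma> {..<E}" by (rule eq_card_imp_inj_on) (auto simp: \<sigma>(2))
  have \<sigma>E: "\<sigma> k < E" if "k < E" for k using that \<sigma>(2) by blast
  have En: "E < n" using E_eq n_pos by simp
  define T1 where "T1 = T0 + 5 * n + 4"
  define Inv where "Inv I' R' T' \<longleftrightarrow> (\<exists>k j r. I' vkk 0 = k \<and> I' vjj 0 = j \<and> k \<le> j \<and> j \<le> E \<and>
      kinv \<sigma> k (I' aLab) (I' aSz) (I' aArr) r \<and>
      (\<forall>p<j. recd (\<sigma> p) (I' aSz) (I' aArr) (I' aQA (\<sigma> p)) (I' aQS (\<sigma> p)) (I' aQB (\<sigma> p)) (I' aQT (\<sigma> p))) \<and>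
      (\<forall>i<k. \<forall>i'. j \<le> i' \<longrightarrow> i' < E \<longrightarrow> wt (\<sigma> i) < wt (\<sigma> i')) \<and>
      (\<Sum>i<k. I' aQS (\<sigma> i)) \<le> (\<Sum>v<n. r v) \<and> T' \<le> T1 + 15 * (j + k) + 5 * (\<Sum>v<n. r v))"
    for I' :: ipart and R' :: rpart and T' :: nat
  have \<sigma>inj: "\<sigma> p \<noteq> \<sigma> q" if "p < q" "q < E" for p q
    using inj that by (auto simp: inj_on_def)
  let ?frame = "\<lambda>I' R'. R' = R \<and> I' 0 = I 0 \<and> I' 1 = I 1 \<and> I' vE = I vE \<and> I' aSrt = I aSrt \<and> I' vgo = I vgo"
  have recording: "ok (assign ve (IRead aSrt (IV vgo [+] IV vjj)) ;; SIDES ;;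
          IWrite aQA (IV ve) (IV vA) ;; IWrite aQS (IV ve) (IRead aSz (IV vA)) ;;
          IWrite aQB (IV ve) (IV vB) ;; IWrite aQT (IV ve) (IRead aSz (IV vB)) ;;
          assign vjj (IV vjj [+] IConst 1)) I' R' (Suc (Suc T'))
          (\<lambda>I'' R'' T''. Inv I'' R'' T'' \<and> 2 * E - (I'' vkk 0 + I'' vjj 0) < 2 * E - (I' vkk 0 + I' vjj 0))"
    if inv: "Inv I' R' T'" and bI: "bnd I'" and fr: "?frame I' R'" and g: "I' vkk 0 < E" "I' vjj 0 < E"
      "\<not> wt (\<sigma> (I' vkk 0)) < wt (\<sigma> (I' vjj 0))" for I' R' T'
  proof -
    obtain k j r where kj: "I' vkk 0 = k" "I' vjj 0 = j" "k \<le> j" "j \<le> E"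
        and K: "kinv \<sigma> k (I' aLab) (I' aSz) (I' aArr) r"
        and rc: "\<forall>p<j. recd (\<sigma> p) (I' aSz) (I' aArr) (I' aQA (\<sigma> p)) (I' aQS (\<sigma> p)) (I' aQB (\<sigma> p)) (I' aQT (\<sigma> p))"
        and lt: "\<forall>i<k. \<forall>i'. j \<le> i' \<longrightarrow> i' < E \<longrightarrow> wt (\<sigma> i) < wt (\<sigma> i')"
        and su: "(\<Sum>i<k. I' aQS (\<sigma> i)) \<le> (\<Sum>v<n. r v)" and T': "T' \<le> T1 + 15 * (j + k) + 5 * (\<Sum>v<n. r v)"
      using inv unfolding Inv_def by blast
    have jE: "j < E" using g kj by simp
    let ?e = "\<sigma> j"
    have e: "?e < E" using jE \<sigma>E by simp
    have F: "\<sigma> ` {..<k} = {f. f < E \<and> wt f < wt ?e}"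
    proof (intro set_eqI iffI)
      fix f assume "f \<in> \<sigma> ` {..<k}"
      then show "f \<in> {f. f < E \<and> wt f < wt ?e}" using lt jE kj \<sigma>E by auto
    next
      fix f assume f: "f \<in> {f. f < E \<and> wt f < wt ?e}"
      then have "f \<in> \<sigma> ` {..<E}" using \<sigma>(2) by simp
      then obtain i where i: "i < E" "f = \<sigma> i" by auto
      have "i < k"
      proof (rule ccontr)
        assume "\<not> i < k"
        then have "wt (\<sigma> k) \<le> wt (\<sigma> i)" using i by (intro \<sigma>(3)) auto
        then show False using f i g(3) kj by simp
      qed
      then show "f \<in> \<sigma> ` {..<k}" using i by simp
    qed
    have xy: "ex ?e < n" "ey ?e < n" using e ex_lt ey_lt by auto
    note cx = cls_eq_comp[OF K F xy(1)] and cy = cls_eq_comp[OF K F xy(2)]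
    have inp': "I' 1 (2 * ?e) = ex ?e" "I' 1 (2 * ?e + 1) = ey ?e" using inp fr e by (auto simp: edges_in_def)
    have rest: "Inv I'' R'' T'' \<and> 2 * E - (I'' vkk 0 + I'' vjj 0) < 2 * E - (I' vkk 0 + I' vjj 0)"
      if A: "A = I' aLab (ex ?e) \<and> B = I' aLab (ey ?e) \<or> A = I' aLab (ey ?e) \<and> B = I' aLab (ex ?e)"
          "I' aSz A \<le> I' aSz B"
        and I'': "I'' vkk = I' vkk" "I'' vjj 0 = Suc j" "I'' aLab = I' aLab" "I'' aSz = I' aSz" "I'' aArr = I' aArr"
          "I'' aQA = (I' aQA)(?e := A)" "I'' aQS = (I' aQS)(?e := I' aSz A)"
          "I'' aQB = (I' aQB)(?e := B)" "I'' aQT = (I' aQT)(?e := I' aSz B)" "T'' \<le> T' + 15"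
      for A B I'' R'' T''
    proof -
      have AB: "A < n" "B < n" using A kinvD(2)[OF K] xy by auto
      have "recd ?e (I' aSz) (I' aArr) A (I' aSz A) B (I' aSz B)"
        unfolding recd_def
        using AB A kinvD(4)[OF K] kinvD(6)[OF K xy(1)] kinvD(6)[OF K xy(2)] cx cy by auto
      then have "recd (\<sigma> p) (I'' aSz) (I'' aArr) (I'' aQA (\<sigma> p)) (I'' aQS (\<sigma> p)) (I'' aQB (\<sigma> p)) (I'' aQT (\<sigma> p))" if "p < Suc j" for p
        using rc \<sigma>inj[of p j] jE that I'' by (auto simp: less_Suc_eq)
      moreover have "(\<Sum>i<k. I'' aQS (\<sigma> i)) = (\<Sum>i<k. I' aQS (\<sigma> i))"
        using \<sigma>inj[of _ j] kj jE I'' by (intro sum.cong) auto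
      ultimately have "Inv I'' R'' T''"
        unfolding Inv_def using kj K lt su T' jE I''
        by (intro exI[of _ k] exI[of _ "Suc j"] exI[of _ r]) auto
      then show ?thesis using I'' kj jE by simp
    qed
    show ?thesis
      apply (intro ok_Seq ok_IWrite)
      subgoal using bI by (simp add: bnd_def)
      apply (rule ok_conseq[OF ok_SIDES[where e = ?e and x = "ex ?e" and y = "ey ?e"]])
      subgoal using fr kj by (simp add: \<sigma>(1))
      subgoal using inp' by simp
      subgoal using inp' by simp
      subgoal premises p for I2 R2 T2
      proof -
        have s: "I2 aSz = I' aSz" "I2 aLab = I' aLab" "I2 aArr = I' aArr" "I2 vjj = I' vjj" "I2 vkk = I' vkk"
            "I2 aQA = I' aQA" "I2 aQB = I' aQB" "I2 aQS = I' aQS" "I2 aQT = I' aQT" "I2 ve 0 = ?e"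
          using p(3) fr kj by (auto simp: \<sigma>(1))
        show ?thesis
          apply (intro ok_Seq ok_IWrite rest[where A = "I2 vA 0" and B = "I2 vB 0"])
          using p(1,2) bI s kj jE En b by (auto simp: bnd_def)
      qed
      done
  qed
  have merging: "ok (assign ve (IRead aSrt (IV vgo [+] IV vkk)) ;; SIDES ;;
          For vq (IRead aSz (IV vA))
            (assign vv (IRead aArr (IV vA [*] en [+] IV vq)) ;;
             IWrite aLab (IV vv) (IV vB) ;;
             IWrite aArr (IV vB [*] en [+] IRead aSz (IV vB) [+] IV vq) (IV vv)) ;;
          IWrite aSz (IV vB) (IRead aSz (IV vB) [+] IRead aSz (IV vA)) ;;
          assign vkk (IV vkk [+] IConst 1)) I' R' (Suc (Suc T'))
          (\<lambda>I'' R'' T''. Inv I'' R'' T'' \<and> 2 * E - (I'' vkk 0 + I'' vjj 0) < 2 * E - (I' vkk 0 + I' vjj 0))"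
    if inv: "Inv I' R' T'" and bI: "bnd I'" and fr: "?frame I' R'" and g: "I' vkk 0 < E"
      "I' vjj 0 < E \<Longrightarrow> wt (\<sigma> (I' vkk 0)) < wt (\<sigma> (I' vjj 0))" for I' R' T'
  proof -
    obtain k j r where kj: "I' vkk 0 = k" "I' vjj 0 = j" "k \<le> j" "j \<le> E"
        and K: "kinv \<sigma> k (I' aLab) (I' aSz) (I' aArr) r"
        and rc: "\<forall>p<j. recd (\<sigma> p) (I' aSz) (I' aArr) (I' aQA (\<sigma> p)) (I' aQS (\<sigma> p)) (I' aQB (\<sigma> p)) (I' aQT (\<sigma> p))"
        and lt: "\<forall>i<k. \<forall>i'. j \<le> i' \<longrightarrow> i' < E \<longrightarrow> wt (\<sigma> i) < wt (\<sigma> i')"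
        and su: "(\<Sum>i<k. I' aQS (\<sigma> i)) \<le> (\<Sum>v<n. r v)" and T': "T' \<le> T1 + 15 * (j + k) + 5 * (\<Sum>v<n. r v)"
      using inv unfolding Inv_def by blast
    have kE: "k < E" using g kj by simp
    \<comment> \<open>At k = j the guard compares an edge with itself and cannot be strict, so every
      edge is recorded before it is merged.\<close>
    have "k < j" using g kj kE by (cases "k = j") auto
    let ?e = "\<sigma> k"
    have e: "?e < E" "?e \<notin> \<sigma> ` {..<k}" "\<sigma> ` {..<k} \<subseteq> {..<E}"
      using kE \<sigma>E \<sigma>inj by fastforce+
    have xy: "ex ?e < n" "ey ?e < n" using e ex_lt ey_lt by auto
    have inp': "I' 1 (2 * ?e) = ex ?e" "I' 1 (2 * ?e + 1) = ey ?e" "I' 0 0 = n" using inp fr e by (auto simp: edges_in_def)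
    have F: "{f. f < E \<and> wt f < wt ?e} \<subseteq> \<sigma> ` {..<k}"
    proof
      fix f assume f: "f \<in> {f. f < E \<and> wt f < wt ?e}"
      then have "f \<in> \<sigma> ` {..<E}" using \<sigma>(2) by simp
      then obtain i where i: "i < E" "f = \<sigma> i" by auto
      have "i < k"
      proof (rule ccontr)
        assume "\<not> i < k"
        then have "wt (\<sigma> k) \<le> wt (\<sigma> i)" using i by (intro \<sigma>(3)) auto
        then show False using f i by simp
      qed
      then show "f \<in> \<sigma> ` {..<k}" using i by simp
    qed
    have QS: "I' aQS ?e \<le> I' aSz (I' aLab x)" if "x = ex ?e \<or> x = ey ?e" for x
    proof -
      have "I' aQS ?e \<le> card (comp ?e x)" using rc \<open>k < j\<close> recd_card that by blast
      also have "\<dots> \<le> card (cls (I' aLab) (I' aLab x))"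
        using that xy by (intro card_mono finite_cls comp_subset_cls[OF K F]) auto
      also have "\<dots> = I' aSz (I' aLab x)" using that xy by (intro kinv_card[OF K]) auto
      finally show ?thesis .
    qed
    show ?thesis
      apply (intro ok_Seq ok_IWrite)
      subgoal using bI by (simp add: bnd_def)
      apply (rule ok_conseq[OF ok_SIDES[where e = ?e and x = "ex ?e" and y = "ey ?e"]])
      subgoal using fr kj by (simp add: \<sigma>(1))
      subgoal using inp' by simp
      subgoal using inp' by simp
      subgoal premises p for I2 R2 T2
      proof -
        define A where "A = I2 vA 0"
        define B where "B = I2 vB 0"
        have s: "I2 aSz = I' aSz" "I2 aLab = I' aLab" "I2 aArr = I' aArr" "I2 vjj = I' vjj" "I2 vkk = I' vkk"
            "I2 aQA = I' aQA" "I2 aQB = I' aQB" "I2 aQS = I' aQS" "I2 aQT = I' aQT" "I2 ve 0 = ?e" "I2 0 0 = n"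
          using p(3) fr kj inp' by (auto simp: \<sigma>(1))
        have T2: "T2 \<le> T' + 9" using p(1) by simp
        have AB: "A = I' aLab (ex ?e) \<and> B = I' aLab (ey ?e) \<or> A = I' aLab (ey ?e) \<and> B = I' aLab (ex ?e)"
            "I' aSz A \<le> I' aSz B" using p(1) by (auto simp: A_def B_def)
        then have ABs: "{A, B} = {I' aLab (ex ?e), I' aLab (ey ?e)}" by auto
        have An: "A < n" using AB kinvD(2)[OF K] xy by auto
        let ?r = "\<lambda>v. if I' aLab v = A then Suc (r v) else r v"
        let ?sz = "(I' aSz)(B := I' aSz B + I' aSz A)"
        note KM = kinv_merge[OF K e ABs AB(2) _ refl _ _ refl]
        \<comment> \<open>A model of the arrays after the merge; it yields distinctness of the
          labels and the size bounds before the relabelling loop has run.\<close>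
        define lb where "lb v = (if I' aLab v = A then B else I' aLab v)" for v
        define ar where "ar x = (if \<exists>p<I' aSz A. x = B * n + I' aSz B + p then I' aArr (A * n + (x - (B * n + I' aSz B))) else I' aArr x)" for x
        have ar1: "ar (B * n + I' aSz B + p) = I' aArr (A * n + p)" if "p < I' aSz A" for p
          using that by (auto simp: ar_def)
        have ar2: "ar x = I' aArr x" if "\<And>p. p < I' aSz A \<Longrightarrow> x \<noteq> B * n + I' aSz B + p" for x
          using that by (auto simp: ar_def)
        note KL = KM[of lb ar, OF lb_def ar1 ar2]
        have ne: "A \<noteq> B" and le: "I' aSz A + I' aSz B \<le> n" and Bn: "B < n" using KL(3,4,6) by auto
        have imA: "(\<lambda>p. I' aArr (A * n + p)) ` {..<I' aSz A} = cls (I' aLab) A"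
          using AB kinvD(6)[OF K xy(1)] kinvD(6)[OF K xy(2)] by auto
        have arlt: "I' aArr (A * n + q) < n" if "q < I' aSz A" for q using kinvD(5)[OF K An that] .
        \<comment> \<open>The loop reads row A while it appends to row B, so its reads are not
          disturbed.\<close>
        have idx: "A * n + q \<noteq> B * n + I' aSz B + p" if "q < I' aSz A" "p < I' aSz A" for p q
        proof
          assume "A * n + q = B * n + I' aSz B + p"
          then have "A = B \<and> q = I' aSz B + p" using that le by (intro decode_eq[of _ n]) auto
          then show False using ne by simp
        qed
        let ?P = "\<lambda>q I3 (R3 :: rpart) T3. T3 \<le> T2 + 1 + 5 * q \<and>
           (\<forall>v<n. I3 aLab v = (if v \<in> (\<lambda>p. I' aArr (A * n + p)) ` {..<q} then B else I' aLab v)) \<and>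
           (\<forall>p<q. I3 aArr (B * n + I' aSz B + p) = I' aArr (A * n + p)) \<and>
           (\<forall>x. (\<forall>p<q. x \<noteq> B * n + I' aSz B + p) \<longrightarrow> I3 aArr x = I' aArr x)"
        show ?thesis
          apply (rule ok_Seq)
          apply (rule ok_For[where len = "I' aSz A" and P = ?P])
          subgoal by simp
          subgoal for I3 using s by (simp add: A_def)
          subgoal using le b by simp
          subgoal using s by simp
          subgoal premises q for q I3 R3 T3
          proof -
            have s3: "I3 vA 0 = A" "I3 vB 0 = B" "I3 0 0 = n" "I3 aSz = I' aSz" "I3 vq 0 = q"
              using q(5) s q(3) by (auto simp: A_def B_def)
            have rd: "I3 aArr (A * n + q) = I' aArr (A * n + q)"
              using q(1,2) idx[OF q(1)] by auto
            have lt3: "I' aArr (A * n + q) < n" by (rule arlt[OF q(1)])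
            show ?thesis
              apply (intro ok_Seq ok_IWrite)
              subgoal using lt3 b by (simp add: s3 rd)
              subgoal using Bn b by (simp add: s3)
              subgoal using lt3 b by (simp add: s3 rd)
              subgoal
                using q(2) lt3 by (auto simp: s3 rd less_Suc_eq lessThan_Suc)
              done
          qed
          subgoal premises q for I3 R3 T3
          proof -
            have s3: "I3 vA 0 = A" "I3 vB 0 = B" "I3 aSz = I' aSz" "I3 vkk 0 = k" "I3 vjj 0 = j"
                "I3 aQA = I' aQA" "I3 aQB = I' aQB" "I3 aQS = I' aQS" "I3 aQT = I' aQT"
              using q(4) s kj by (auto simp: A_def B_def)
            have lab3: "I3 aLab v = (if I' aLab v = A then B else I' aLab v)" if "v < n" for v
              using q(1) that unfolding imA by (auto simp: cls_def)
            have a3: "\<And>p. p < I' aSz A \<Longrightarrow> I3 aArr (B * n + I' aSz B + p) = I' aArr (A * n + p)"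
              "\<And>x. (\<And>p. p < I' aSz A \<Longrightarrow> x \<noteq> B * n + I' aSz B + p) \<Longrightarrow> I3 aArr x = I' aArr x"
              using q(1) by auto
            have K31: "kinv \<sigma> (Suc k) (I3 aLab) ?sz (I3 aArr) ?r"
              using lab3 a3 by (rule KM(1))
            have K32: "(\<Sum>v<n. ?r v) = (\<Sum>v<n. r v) + I' aSz A"
              using lab3 a3 by (rule KM(2))
            have rc3: "recd (\<sigma> p) ?sz (I3 aArr) (I' aQA (\<sigma> p)) (I' aQS (\<sigma> p)) (I' aQB (\<sigma> p)) (I' aQT (\<sigma> p))" if "p < j" for p
            proof (rule recd_mono[of _ "I' aSz" "I' aArr"])
              show "recd (\<sigma> p) (I' aSz) (I' aArr) (I' aQA (\<sigma> p)) (I' aQS (\<sigma> p)) (I' aQB (\<sigma> p)) (I' aQT (\<sigma> p))"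
                using rc that by blast
              show "I' aSz C \<le> ?sz C" for C by simp
              show "I3 aArr (C * n + p) = I' aArr (C * n + p)" if "C < n" "p < I' aSz C" for C p
                using lab3 a3 that by (rule KM(7))
            qed
            have lt3: "wt (\<sigma> i) < wt (\<sigma> i')" if "i < Suc k" "j \<le> i'" "i' < E" for i i'
            proof (cases "i = k")
              case True
              have "j < E" using that by simp
              then have "wt (\<sigma> k) < wt (\<sigma> j)" using g(2) kj by simp
              also have "\<dots> \<le> wt (\<sigma> i')" using that by (intro \<sigma>(3)) auto
              finally show ?thesis using True by simp
            qed (use lt that in auto)
            have su3: "(\<Sum>i<Suc k. I' aQS (\<sigma> i)) \<le> (\<Sum>v<n. ?r v)"
              unfolding K32 using su QS[of "ex ?e"] QS[of "ey ?e"] AB by auto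
            have T3: "T3 + 3 \<le> T1 + 15 * (j + Suc k) + 5 * (\<Sum>v<n. ?r v)"
              unfolding K32 using q(1) T2 T' by auto
            show ?thesis
              apply (intro ok_Seq ok_IWrite)
              subgoal using le b by (simp add: s3)
              subgoal using kE En b by (simp add: s3)
              subgoal
                unfolding Inv_def
                using K31 rc3 lt3 su3 T3 \<open>k < j\<close> kj(3,4) kE kj(1,2)
                by (intro conjI exI[of _ "Suc k"] exI[of _ j] exI[of _ ?r]) (auto simp: s3)
              done
          qed
          done
      qed
      done
  qed
  show ?thesis
    unfolding KRUSKAL_def
    apply (rule ok_Seq)
    apply (rule ok_For[where len = n and P = "\<lambda>k I' R' T'. T' = T0 + 1 + 5 * k \<and> (\<forall>v<k. I' aLab v = v \<and> I' aSz v = 1 \<and> I' aArr (v * n) = v)"])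
    subgoal by simp
    subgoal using inp by (simp add: edges_in_def)
    subgoal using b by simp
    subgoal by simp
    subgoal premises p for k I' R' T'
    proof -
      have "I' 0 0 = n" using p(5) inp by (simp add: edges_in_def)
      then show ?thesis
        apply (intro ok_Seq ok_IWrite)
        using p(1,2,3) b M by (auto simp: less_Suc_eq)
    qed
    subgoal premises p for I1 R1 T1'
    proof -
      have f1: "\<And>a. a \<noteq> vk \<Longrightarrow> a \<noteq> aLab \<Longrightarrow> a \<noteq> aSz \<Longrightarrow> a \<noteq> aArr \<Longrightarrow> I1 a = I a" "R1 = R" using p(4,5) by auto
      show ?thesis
        apply (intro ok_Seq ok_IWrite)
        subgoal by simp
        subgoal by simp
        apply (rule ok_Loop[where Inv = Inv and mea = "\<lambda>I' R'. 2 * E - (I' vkk 0 + I' vjj 0)"])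
        subgoal
        proof -
          have "kinv \<sigma> 0 (I1 aLab) (I1 aSz) (I1 aArr) (\<lambda>_. 0)" using p(1) by (intro kinv_init) auto
          then show ?thesis unfolding Inv_def using p(1)
            by (intro exI[of _ 0] exI[of _ "\<lambda>_. 0"]) (auto simp: T1_def)
        qed
        subgoal premises q for I' R' T'
        proof -
          have fr: "?frame I' R'" using q(4,5) f1 by auto
          have g: "I' vkk 0 < E" using q(2) fr E' by simp
          have bv: "R' aBest (I' aSrt (I' vgo 0 + p)) = wt (\<sigma> p)" if "p < E" for p
            using fr wt \<sigma>E[OF that] by (simp add: \<sigma>(1))
          show ?thesis
            apply (rule ok_Cond)
            subgoal premises c
              using c g fr E' bv by (intro recording q(1,3) fr) auto
            subgoal premises c
              using c g fr E' bv by (intro merging q(1,3) fr) auto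
            done
        qed
        subgoal premises q for I' R' T'
        proof -
          have fr: "?frame I' R'" using q(4,5) f1 by auto
          have g: "\<not> I' vkk 0 < E" using q(2) fr E' by simp
          obtain k j r where kj: "I' vkk 0 = k" "I' vjj 0 = j" "k \<le> j" "j \<le> E"
            and K: "kinv \<sigma> k (I' aLab) (I' aSz) (I' aArr) r"
            and rc: "\<forall>p<j. recd (\<sigma> p) (I' aSz) (I' aArr) (I' aQA (\<sigma> p)) (I' aQS (\<sigma> p)) (I' aQB (\<sigma> p)) (I' aQT (\<sigma> p))"
            and su: "(\<Sum>i<k. I' aQS (\<sigma> i)) \<le> (\<Sum>v<n. r v)" and T': "T' \<le> T1 + 15 * (j + k) + 5 * (\<Sum>v<n. r v)"
            using q(1) unfolding Inv_def by blast
          have kj': "k = E" "j = E" using kj g by auto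
          have r: "(\<Sum>v<n. r v) \<le> n * h" by (rule kinv_r_le[OF K b(1)])
          have "(\<Sum>i<E. I' aQS (\<sigma> i)) = (\<Sum>e\<in>\<sigma> ` {..<E}. I' aQS e)" using inj by (simp add: sum.reindex)
          then have "(\<Sum>e<E. I' aQS e) \<le> n * h" using su r kj' \<sigma>(2) by simp
          moreover have "recd e (I' aSz) (I' aArr) (I' aQA e) (I' aQS e) (I' aQB e) (I' aQT e)" if "e < E" for e
          proof -
            have "e \<in> \<sigma> ` {..<E}" using that \<sigma>(2) by simp
            then show ?thesis using rc kj' by auto
          qed
          ultimately show ?thesis
            using r kinvD(3,5,8)[OF K] T' kj' by (auto simp: T1_def)
        qed
        done
    qed
    done
qed

end

section \<open>Coins and projections\<close>

lemma measure_bind_spmf_eq: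
  "measure (measure_spmf (bind_spmf p f)) A = (\<integral>x. measure (measure_spmf (f x)) A \<partial>measure_spmf p)"
  by (simp add: measure_spmf_bind o_def measure_spmf.measure_bind[where N = "count_space UNIV"])

lemma measure_bind_coin:
  "measure (measure_spmf (bind_spmf coin_spmf f)) A =
     (measure (measure_spmf (f True)) A + measure (measure_spmf (f False)) A) / 2"
  unfolding measure_bind_spmf_eq integral_spmf_of_set by (simp add: UNIV_bool)

definition coins :: "nat \<Rightarrow> ipart \<Rightarrow> nat \<Rightarrow> bool" where
  "coins N I = (\<lambda>q. q < N \<and> I aBit q = 1)"

context ram
begin

abbreviation flip_body :: com where
  "flip_body \<equiv> Flip aBit (IV vz) ;; assign vz (IV vz [+] IConst 1)"

abbreviation flip_loop :: "state \<Rightarrow> state spmf" where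
  "flip_loop \<equiv> loop_spmf (\<lambda>t. bval t (ILess (IV vz) (IV vnb)))
     (\<lambda>t. exec flip_body (charge (bcost t (ILess (IV vz) (IV vnb))) t))"

text \<open>\<open>ok\<close> speaks of point masses and has no rule for \<open>Flip\<close>, so the
  body of the coin loop is executed by hand: it is the image of one coin under a function.\<close>

lemma exec_flip_body:
  assumes Z: "cwt flip_body \<le> Z" and b: "bnd (imem s)" and k: "imem s vz 0 = k" "k < M"
  shows "\<exists>f. exec flip_body s = map_spmf f coin_spmf \<and>
    (\<forall>x. stp flip_body s T (f x) (Suc (Suc T)) \<and> rmem (f x) = rmem s \<and>
      imem (f x) = (imem s)(aBit := (imem s aBit)(k := of_bool x), vz := (imem s vz)(0 := Suc k)))"
proof -
  define g where "g x = charge (icost s (IV vz) + nat_len (ival s (IV vz)) + 1) (write_nat aBit (ival s (IV vz)) (of_bool x) s)" for x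
  have b': "imem s a i \<le> M" for a i using b by (simp add: bnd_def)
  have ig: "imem (g x) = (imem s)(aBit := (imem s aBit)(k := of_bool x))" "rmem (g x) = rmem s" for x
    using k by (auto simp: g_def charge_def write_nat_def update_peak_def)
  have sg: "stp flip_body s T (g x) (Suc T)" for x
  proof -
    let ?t = "icost s (IV vz) + nat_len (ival s (IV vz)) + 1"
    have "?t \<le> (iwt (IV vz) + isz (IV vz) + 1) * nat_len M"
      using icost_le[OF b' M, of "IV vz"] nat_len_ival[OF b' M, of "IV vz"] nat_len_ge_1[of M]
      by (simp add: algebra_simps)
    also have "\<dots> \<le> Z * nat_len M" using Z by (intro mult_le_mono1) simp
    finally have t: "?t \<le> Z * nat_len M" .
    have "nat_len (of_bool x) \<le> 1" by (cases x) (simp_all add: nat_len_def floorlog_def)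
    then have "space_ok A (g x)" if "space_ok A s" for A
      unfolding g_def using that by (intro space_ok_write_nat) auto
    then show ?thesis using t b M ig
      by (auto simp: stp_def bnd_def g_def charge_def write_nat_def update_peak_def)
  qed
  have "\<exists>t. exec (assign vz (IV vz [+] IConst 1)) (g x) = return_spmf t \<and>
      stp flip_body (g x) (Suc T) t (Suc (Suc T)) \<and> rmem t = rmem s \<and>
      imem t = (imem s)(aBit := (imem s aBit)(k := of_bool x), vz := (imem s vz)(0 := Suc k))" for x
  proof -
    have "bnd (imem (g x))" using sg by (simp add: stp_def)
    moreover have "ok (assign vz (IV vz [+] IConst 1)) (imem (g x)) (rmem (g x)) (Suc T)
      (\<lambda>I' R' T'. R' = rmem s \<and> T' = Suc (Suc T) \<and>
        I' = (imem s)(aBit := (imem s aBit)(k := of_bool x), vz := (imem s vz)(0 := Suc k)))"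
      using k by (intro ok_IWrite) (auto simp: ig)
    moreover have "cwt (assign vz (IV vz [+] IConst 1)) \<le> Z" using Z by simp
    ultimately obtain t T' where t: "exec (assign vz (IV vz [+] IConst 1)) (g x) = return_spmf t"
        "stp (assign vz (IV vz [+] IConst 1)) (g x) (Suc T) t (Suc (Suc T))" "rmem t = rmem s"
        "imem t = (imem s)(aBit := (imem s aBit)(k := of_bool x), vz := (imem s vz)(0 := Suc k))"
      unfolding ok_def by blast
    have "stp flip_body (g x) (Suc T) t (Suc (Suc T))" using t(2) by (rule stp_mono) auto
    then show ?thesis using t by blast
  qed
  then obtain f where f: "\<And>x. exec (assign vz (IV vz [+] IConst 1)) (g x) = return_spmf (f x)"
      "\<And>x. stp flip_body (g x) (Suc T) (f x) (Suc (Suc T))" "\<And>x. rmem (f x) = rmem s"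
      "\<And>x. imem (f x) = (imem s)(aBit := (imem s aBit)(k := of_bool x), vz := (imem s vz)(0 := Suc k))"
    by metis
  have "exec flip_body s = bind_spmf (map_spmf g coin_spmf) (exec (assign vz (IV vz [+] IConst 1)))"
    by (simp only: exec.simps g_def[abs_def])
  also have "\<dots> = bind_spmf coin_spmf (\<lambda>x. return_spmf (f x))"
    unfolding bind_map_spmf o_def f ..
  also have "\<dots> = map_spmf f coin_spmf" by (simp add: map_spmf_conv_bind_spmf)
  finally show ?thesis using stp_trans[OF sg f(2)] f by blast
qed

text \<open>Induction on the bits still to be flipped: the first k bits are in memory, the others
  are averaged over, and one coin splits the average as the recursion of \<open>avg\<close> does.
  Each round takes 3 steps. That all cells stay at most 1 lets a bit later act as a sign.\<close>

lemma flip_loop: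
  assumes Z: "cwt (Loop (ILess (IV vz) (IV vnb)) flip_body) \<le> Z" and "N \<le> M"
    and "imem s vnb 0 = N" "imem s vz 0 = k" "k \<le> N" "bnd (imem s)"
  shows "lossless_spmf (flip_loop s) \<and>
     (\<forall>t\<in>set_spmf (flip_loop s). stp flip_body s T t (T + 3 * (N - k)) \<and> rmem t = rmem s \<and>
       ((\<forall>q. imem s aBit q \<le> 1) \<longrightarrow> (\<forall>q. imem t aBit q \<le> 1))) \<and>
     avg (N - k) (\<lambda>b. of_bool (G (\<lambda>q. if q < k then imem s aBit q = 1 else b (q - k))))
       \<le> measure (measure_spmf (flip_loop s)) {t. G (coins N (imem t))}"
  using assms(3-)
proof (induction "N - k" arbitrary: k s T)
  case 0
  then have k: "k = N" by simp
  have l: "flip_loop s = return_spmf s" using 0 k by (subst loop_spmf.simps) (simp add: ival_eq)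
  have "(\<lambda>q. if q < N then imem s aBit q = 1 else False) = coins N (imem s)"
    by (auto simp: coins_def)
  then show ?case using 0 k unfolding l by (simp add: measure_spmf_return_spmf measure_return stp_def indicator_def)
next
  case (Suc m)
  have kN: "k < N" using Suc.hyps(2) by simp
  define s' where "s' = charge (bcost s (ILess (IV vz) (IV vnb))) s"
  have s': "imem s' = imem s" "rmem s' = rmem s" by (auto simp: s'_def charge_def)
  have "bcost s (ILess (IV vz) (IV vnb)) \<le> bwt (ILess (IV vz) (IV vnb)) * nat_len M"
    using Suc.prems M by (intro bcost_le) (auto simp: bnd_def)
  also have "\<dots> \<le> Z * nat_len M" using Z by (intro mult_le_mono1) simp
  finally have st: "stp flip_body s T s' (Suc T)" unfolding s'_def using Suc.prems by (intro stp_charge)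
  obtain f where f: "exec flip_body s' = map_spmf f coin_spmf"
      "\<And>x. stp flip_body s' (Suc T) (f x) (Suc (Suc (Suc T)))" "\<And>x. rmem (f x) = rmem s"
      "\<And>x. imem (f x) = (imem s)(aBit := (imem s aBit)(k := of_bool x), vz := (imem s vz)(0 := Suc k))"
    using exec_flip_body[of s' k "Suc T"] Z Suc.prems kN \<open>N \<le> M\<close> unfolding s' by auto
  have g: "bval s (ILess (IV vz) (IV vnb)) = True" using Suc.prems kN by (simp add: ival_eq)
  have "flip_loop s = bind_spmf (exec flip_body s') flip_loop"
    unfolding s'_def by (subst loop_spmf.simps) (simp only: g if_True)
  then have l: "flip_loop s = bind_spmf coin_spmf (\<lambda>x. flip_loop (f x))"
    by (simp only: f(1) bind_map_spmf o_def)
  have IH: "lossless_spmf (flip_loop (f x)) \<and>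
     (\<forall>t\<in>set_spmf (flip_loop (f x)). stp flip_body (f x) (T + 3) t (T + 3 + 3 * (N - Suc k)) \<and> rmem t = rmem (f x) \<and>
       ((\<forall>q. imem (f x) aBit q \<le> 1) \<longrightarrow> (\<forall>q. imem t aBit q \<le> 1))) \<and>
     avg (N - Suc k) (\<lambda>b. of_bool (G (\<lambda>q. if q < Suc k then imem (f x) aBit q = 1 else b (q - Suc k))))
       \<le> measure (measure_spmf (flip_loop (f x))) {t. G (coins N (imem t))}" for x
  proof (rule Suc.hyps(1))
    show "m = N - Suc k" using Suc.hyps(2) by simp
    show "bnd (imem (f x))" using f(2)[of x] by (simp add: stp_def)
  qed (use Suc.prems kN in \<open>auto simp: f(4)\<close>)
  have "lossless_spmf (flip_loop s)" unfolding l using IH by (simp del: exec.simps bval.simps bcost.simps)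
  moreover have "stp flip_body s T t (T + 3 * (N - k)) \<and> rmem t = rmem s \<and>
       ((\<forall>q. imem s aBit q \<le> 1) \<longrightarrow> (\<forall>q. imem t aBit q \<le> 1))" if t0: "t \<in> set_spmf (flip_loop s)" for t
  proof -
    obtain x where tx: "t \<in> set_spmf (flip_loop (f x))" using t0 unfolding l set_bind_spmf
      by (auto simp: Set.bind_def simp del: exec.simps bval.simps bcost.simps)
    note IHt = bspec[OF IH[THEN conjunct2, THEN conjunct1] tx]
    have t: "stp flip_body (f x) (T + 3) t (T + 3 + 3 * (N - Suc k))" "rmem t = rmem (f x)"
      using IHt by simp_all
    have "\<forall>q. imem t aBit q \<le> 1" if s1: "\<forall>q. imem s aBit q \<le> 1"
    proof -
      have "\<forall>q. imem (f x) aBit q \<le> 1" using s1 by (simp add: f(4))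
      then show ?thesis by (rule mp[OF conjunct2[OF conjunct2[OF IHt]]])
    qed
    note bits = impI[OF this]
    have "T + 3 + 3 * (N - Suc k) = T + 3 * (N - k)" using kN by simp
    moreover have "stp flip_body s T (f x) (T + 3)"
      using stp_trans[OF st f(2)[of x]] by (simp add: numeral_3_eq_3)
    ultimately have "stp flip_body s T t (T + 3 * (N - k)) \<and> rmem t = rmem s" using stp_trans t f(3) by metis
    then show ?thesis using bits by blast
  qed
  moreover have "avg (N - k) (\<lambda>b. of_bool (G (\<lambda>q. if q < k then imem s aBit q = 1 else b (q - k))))
       \<le> measure (measure_spmf (flip_loop s)) {t. G (coins N (imem t))}"
  proof -
    have e: "(\<lambda>q. if q < k then imem s aBit q = 1 else (case q - k of 0 \<Rightarrow> x | Suc q' \<Rightarrow> b q')) =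
        (\<lambda>q. if q < Suc k then imem (f x) aBit q = 1 else b (q - Suc k))" for x b
    proof (rule ext)
      fix q
      show "(if q < k then imem s aBit q = 1 else (case q - k of 0 \<Rightarrow> x | Suc q' \<Rightarrow> b q')) =
        (if q < Suc k then imem (f x) aBit q = 1 else b (q - Suc k))"
      proof (cases "k < q")
        case True
        then have "q - k = Suc (q - Suc k)" by simp
        then show ?thesis using True by (simp add: f(4))
      qed (auto simp: f(4))
    qed
    have "N - k = Suc (N - Suc k)" using kN by simp
    then have "avg (N - k) (\<lambda>b. of_bool (G (\<lambda>q. if q < k then imem s aBit q = 1 else b (q - k)))) =
        (avg (N - Suc k) (\<lambda>b. of_bool (G (\<lambda>q. if q < Suc k then imem (f True) aBit q = 1 else b (q - Suc k)))) +
         avg (N - Suc k) (\<lambda>b. of_bool (G (\<lambda>q. if q < Suc k then imem (f False) aBit q = 1 else b (q - Suc k))))) / 2"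
      by (simp add: e)
    also have "\<dots> \<le> measure (measure_spmf (flip_loop s)) {t. G (coins N (imem t))}"
      unfolding l measure_bind_coin
      by (intro divide_right_mono add_mono IH[THEN conjunct2, THEN conjunct2]) simp
    finally show ?thesis .
  qed
  ultimately show ?case by blast
qed

lemma exec_FLIPS:
  assumes Z: "cwt FLIPS \<le> Z" and N: "N \<le> M" and s: "imem s vnb 0 = N" "bnd (imem s)"
  shows "lossless_spmf (exec FLIPS s)"
    "\<And>t. t \<in> set_spmf (exec FLIPS s) \<Longrightarrow> stp FLIPS s T t (T + 3 * N + 2) \<and> rmem t = rmem s \<and>
      ((\<forall>q. imem s aBit q \<le> 1) \<longrightarrow> (\<forall>q. imem t aBit q \<le> 1))"
    "avg N (\<lambda>b. of_bool (G b)) \<le> measure (measure_spmf (exec FLIPS s)) {t. G (coins N (imem t))}"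
proof -
  let ?b = "ILess (IV vz) (IV vnb)"
  have "ok (assign vz (IConst 0)) (imem s) (rmem s) T (\<lambda>I' R' T'. R' = rmem s \<and> T' = Suc T \<and> I' vz 0 = 0 \<and> I' vnb 0 = N \<and> I' aBit = imem s aBit)"
    using s by (intro ok_IWrite) auto
  moreover have "cwt (assign vz (IConst 0)) \<le> Z" using Z by (simp add: FLIPS_def)
  ultimately obtain s1 where s1: "exec (assign vz (IConst 0)) s = return_spmf s1"
      "stp (assign vz (IConst 0)) s T s1 (Suc T)" "rmem s1 = rmem s" "imem s1 vz 0 = 0" "imem s1 vnb 0 = N" "imem s1 aBit = imem s aBit"
    using s unfolding ok_def by metis
  have b1: "bnd (imem s1)" using s1 by (simp add: stp_def)
  have Zl: "cwt (Loop ?b flip_body) \<le> Z" using Z by (simp add: FLIPS_def)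
  have e: "exec FLIPS s = map_spmf (\<lambda>t. charge (bcost t ?b) t) (flip_loop s1)"
    unfolding FLIPS_def using s1(1) by simp
  note fl = flip_loop[OF Zl N s1(5) s1(4) le0 b1]
  show "lossless_spmf (exec FLIPS s)"
    unfolding e using fl by (simp del: exec.simps bval.simps bcost.simps)
  show "stp FLIPS s T t (T + 3 * N + 2) \<and> rmem t = rmem s \<and>
      ((\<forall>q. imem s aBit q \<le> 1) \<longrightarrow> (\<forall>q. imem t aBit q \<le> 1))" if t0: "t \<in> set_spmf (exec FLIPS s)" for t
  proof -
    obtain u where u: "u \<in> set_spmf (flip_loop s1)" "t = charge (bcost u ?b) u"
      using t0 unfolding e set_map_spmf by blast
    note su0 = bspec[OF fl[where T = "Suc T", THEN conjunct2, THEN conjunct1] u(1)]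
    have su: "stp flip_body s1 (Suc T) u (Suc T + 3 * (N - 0))" "rmem u = rmem s1" using su0 by simp_all
    have bits: "(\<forall>q. imem s aBit q \<le> 1) \<longrightarrow> (\<forall>q. imem t aBit q \<le> 1)"
      using conjunct2[OF conjunct2[OF su0]] u(2) s1(6) by (simp add: charge_def)
    have bu: "bnd (imem u)" using su by (simp add: stp_def)
    have "bcost u ?b \<le> bwt ?b * nat_len M"
      using bu M by (intro bcost_le) (auto simp: bnd_def)
    also have "\<dots> \<le> Z * nat_len M" using Zl by (intro mult_le_mono1) simp
    finally have "stp FLIPS u (Suc T + 3 * (N - 0)) t (T + 3 * N + 2)"
      unfolding u(2) using stp_charge[OF _ bu] by (simp add: add.commute)
    moreover have "stp FLIPS s1 (Suc T) u (Suc T + 3 * (N - 0))"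
      using su(1) by (rule stp_mono) (auto simp: FLIPS_def)
    moreover have "stp FLIPS s T s1 (Suc T)" using s1(2) by (rule stp_mono) (auto simp: FLIPS_def)
    ultimately have "stp FLIPS s T t (T + 3 * N + 2)" using stp_trans by blast
    then show ?thesis using su s1(3) u(2) bits by (simp add: charge_def)
  qed
  have "(\<lambda>t. charge (bcost t ?b) t) -` {t. G (coins N (imem t))} = {t. G (coins N (imem t))}"
    by (auto simp: charge_def)
  then have "measure (measure_spmf (exec FLIPS s)) {t. G (coins N (imem t))} =
      measure (measure_spmf (flip_loop s1)) {t. G (coins N (imem t))}"
    unfolding e measure_map_spmf by (simp only:)
  then show "avg N (\<lambda>b. of_bool (G b)) \<le> measure (measure_spmf (exec FLIPS s)) {t. G (coins N (imem t))}"
    using fl[THEN conjunct2, THEN conjunct2, of G] by (simp del: exec.simps bval.simps bcost.simps)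
qed

section \<open>Projecting and sorting the points\<close>

lemma ok_PROJECT:
  assumes n: "I 0 0 = n" "I 0 1 = d" "I vK 0 = K" "I vL 0 = L" "I vm 0 = m"
    and b: "n \<le> M" "L \<le> M" "(I vrep 0 * m + I vi 0) * L \<le> M"
  shows "ok PROJECT I R T (\<lambda>I' R' T'. T' \<le> T + 3 + n * (3 * L + 6) \<and>
    (\<forall>v<n. R' aVal v = (\<Sum>q<L. R 1 (v * d + q div K) * (2 * real (I aBit ((I vrep 0 * m + I vi 0) * L + q)) - 1))))"
proof -
  define org where "org = (I vrep 0 * m + I vi 0) * L"
  let ?p = "\<lambda>v L. \<Sum>q<L. R 1 (v * d + q div K) * (2 * real (I aBit (org + q)) - 1)"
  show ?thesis
    unfolding PROJECT_def org_def[symmetric]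
    apply (intro ok_Seq ok_IWrite)
    subgoal using b n by simp
    apply (rule ok_For[where len = n and P = "\<lambda>k I' R' T'. T' \<le> T + 2 + k * (3 * L + 6) \<and> (\<forall>v<k. R' aVal v = ?p v L)"])
    subgoal by simp
    subgoal using n by simp
    subgoal using b by simp
    subgoal by simp
    subgoal premises p for k I' R' T'
      apply (intro ok_Seq ok_RWrite)
      apply (rule ok_For[where len = L and P = "\<lambda>q I2 R2 T2. T2 \<le> Suc (Suc (Suc T')) + 3 * q \<and> R2 racc 0 = ?p k q"])
      subgoal by simp
      subgoal using n p(5) by simp
      subgoal using b by simp
      subgoal by simp
      subgoal premises q for q I2 R2 T2
      proof -
        have v: "I2 vx 0 = k" "I2 0 0 = n" "I2 0 (Suc 0) = d" "I2 vK 0 = K" "I2 vorg 0 = org" "I2 aBit = I aBit" "R2 1 = R 1" "R2 (Suc 0) = R (Suc 0)"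
          using q(5,6) p(3,5,6) n by (auto simp: org_def)
        show ?thesis
          apply (intro ok_RWrite)
          using q(2,3) v by auto
      qed
      subgoal premises q for I2 R2 T2
      proof -
        have v: "I2 vx 0 = k" "R2 aVal = R' aVal" using q(4,5) p(3) by auto
        show ?thesis
          apply (intro ok_RWrite)
          using q(1) p(2) v by (auto simp: less_Suc_eq)
      qed
      done
    subgoal by simp
    done
qed

end

text \<open>A block permutation stays below \<open>len\<close>, so only those keys matter. This is
  needed because the key bank is overwritten for every class.\<close>

lemma blkok_key:
  assumes "blkok \<kappa> len w s b" "\<And>p. p < len \<Longrightarrow> \<kappa> p = \<kappa>' p"
  shows "blkok \<kappa>' len w s b"
proof -
  have "s q < len" if "b \<le> q" "q < min (b + w) len" for q
  proof -
    have "s q \<in> s ` {b..<min (b + w) len}" using that by auto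
    then show ?thesis using assms(1) by (auto simp: blkok_def)
  qed
  note lt = this
  have "\<kappa>' (s q) \<le> \<kappa>' (s p)" if pq: "b \<le> p" "p \<le> q" "q < min (b + w) len" for p q
  proof -
    have "\<kappa> (s q) \<le> \<kappa> (s p)" using assms(1) pq unfolding blkok_def by blast
    moreover have "s q < len" "s p < len" using pq by (auto intro!: lt)
    ultimately show ?thesis using assms(2) by simp
  qed
  moreover have "s ` {b..<min (b + w) len} = {b..<min (b + w) len}" using assms(1) by (simp add: blkok_def)
  ultimately show ?thesis by (simp add: blkok_def)
qed

context ram
begin

text \<open>Rows of absorbed classes are sorted too, because recorded sides may be prefixes of them.
  The cost is governed by the total row length, which the relabelling count controls.\<close>

lemma ok_SORTALL:
  assumes n: "I 0 0 = n" "1 \<le> n" "n \<le> 2 ^ h" and W: "I vW 0 = n * n" and sz: "\<And>B. B < n \<Longrightarrow> I aSz B \<le> n"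
    and b: "3 * n \<le> M" "(h + 1) * (n * n) \<le> M" "1 \<le> M"
  shows "ok SORTALL I R T (\<lambda>I' R' T'. T' \<le> T + 2 + (h + 2) * (16 * (\<Sum>B<n. I aSz B) + 20 * n) \<and>
    (\<forall>B<n. \<forall>g b. 2 ^ g \<le> I aSz B \<longrightarrow> 2 ^ g dvd b \<longrightarrow>
       blkok (\<lambda>p. R aVal (I aArr (B * n + p))) (I aSz B) (2 ^ g) (\<lambda>p. I' aSrt (g * (n * n) + B * n + p)) b))"
proof -
  let ?\<kappa> = "\<lambda>B p. R aVal (I aArr (B * n + p))"
  let ?P = "\<lambda>k I' R' T'. T' \<le> T + 1 + (h + 2) * (16 * (\<Sum>B<k. I aSz B) + 20 * k) \<and>
    (\<forall>B<k. \<forall>g b. 2 ^ g \<le> I aSz B \<longrightarrow> 2 ^ g dvd b \<longrightarrow>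
       blkok (?\<kappa> B) (I aSz B) (2 ^ g) (\<lambda>p. I' aSrt (g * (n * n) + B * n + p)) b)"
  show ?thesis
    unfolding SORTALL_def
    apply (rule ok_For[where len = n and P = ?P])
    subgoal by simp
    subgoal using n by simp
    subgoal using b by simp
    subgoal by simp
    subgoal premises p for k I1 R1 T1
    proof -
      have v1: "I1 0 0 = n" "I1 aSz = I aSz" "I1 vW 0 = n * n" "I1 aArr = I aArr" "R1 aVal = R aVal" "I1 vlab 0 = k"
        using p(3,5,6) n W by auto
      let ?len = "I aSz k"
      have len: "?len \<le> n" using sz p(1) by simp
      have nn: "n \<le> n * n" by simp
      have "k * n \<le> n * n" using p(1) by simp
      also have "\<dots> \<le> (h + 1) * (n * n)" by simp
      finally have kn: "k * n \<le> M" using b(2) by simp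
      show ?thesis
        apply (intro ok_Seq ok_IWrite)
        subgoal using kn v1 by simp
        subgoal using v1 len b by simp
        apply (rule ok_For[where len = ?len and P = "\<lambda>q I2 R2 T2. T2 = T1 + 4 + 3 * q \<and> (\<forall>p<q. R2 aKey p = ?\<kappa> k p)"])
        subgoal by simp
        subgoal using v1 by simp
        subgoal using len b by simp
        subgoal by simp
        subgoal premises q for q I2 R2 T2
        proof -
          have "I2 vbs 0 = k * n" "I2 aArr = I aArr" "R2 aVal = R aVal" using q(5,6) v1 by auto
          then show ?thesis
            apply (intro ok_RWrite)
            using q(2,3) by (auto simp: less_Suc_eq)
        qed
        subgoal premises q for I2 R2 T2
        proof -
          have v2: "I2 vlen 0 = ?len" "I2 vW 0 = n * n" "I2 vbs 0 = k * n" "I2 aSrt = I1 aSrt" using q(4) v1 by auto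
          show ?thesis
            apply (rule ok_conseq[OF ok_SORT[where len = ?len and W = "n * n" and h = h and bs = "k * n"]])
            subgoal by (rule v2)
            subgoal using len nn by linarith
            subgoal using len n by linarith
            subgoal by (rule v2)
            subgoal by (rule v2)
            subgoal using len b by simp
            subgoal by (rule b)
            subgoal by (rule b)
            subgoal premises r for I3 R3 T3
            proof -
              obtain G where G: "?len \<le> 2 ^ G"
                  "\<And>g b. g \<le> G \<Longrightarrow> 2 ^ g dvd b \<Longrightarrow> blkok (R2 aKey) ?len (2 ^ g) (\<lambda>p. I3 aSrt (g * (n * n) + k * n + p)) b"
                using r(1) by blast
              have new: "blkok (?\<kappa> k) ?len (2 ^ g) (\<lambda>p. I3 aSrt (g * (n * n) + k * n + p)) b"
                if "2 ^ g \<le> ?len" "2 ^ g dvd b" for g b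
              proof -
                have "(2::nat) ^ g \<le> 2 ^ G" using that(1) G(1) by (rule le_trans)
                then have "g \<le> G" by simp
                then show ?thesis using that q(1) by (intro blkok_key[OF G(2)]) auto
              qed
              \<comment> \<open>Level offsets are multiples of n^2 and row offsets multiples of n,
                so cells of different classes differ in a base-n digit.\<close>
              have old: "I3 aSrt (g * (n * n) + B * n + p) = I1 aSrt (g * (n * n) + B * n + p)" if "B < k" "p < I aSz B" for g B p
              proof -
                have "g * (n * n) + B * n + p \<noteq> g' * (n * n) + k * n + p'" if "p' < ?len" for g' p'
                proof
                  assume "g * (n * n) + B * n + p = g' * (n * n) + k * n + p'"
                  then have eq: "(g * n + B) * n + p = (g' * n + k) * n + p'" by (simp add: algebra_simps)
                  have "B < n" "p < n" "p' < n" using \<open>B < k\<close> \<open>p < I aSz B\<close> that len p(1) sz[of B] by auto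
                  then have "g * n + B = g' * n + k" using decode_eq[OF eq] by simp
                  then show False using decode_eq[of g n B g' k] \<open>B < n\<close> p(1) \<open>B < k\<close> by auto
                qed
                then show ?thesis using r(1) v2 by auto
              qed
              have all: "blkok (?\<kappa> B) (I aSz B) (2 ^ g) (\<lambda>p. I3 aSrt (g * (n * n) + B * n + p)) b"
                if "B < Suc k" "2 ^ g \<le> I aSz B" "2 ^ g dvd b" for B g b
              proof (cases "B = k")
                case True
                then show ?thesis using new that by simp
              next
                case False
                then have Bk: "B < k" using that by simp
                show ?thesis by (subst blkok_cong[OF old[OF Bk]]) (use p(2) Bk that in auto)
              qed
              have "T3 \<le> T1 + 5 + 6 * ?len + 6 + (h + 1) * (10 * ?len + 6)" using r(1) q(1) by simp
              also have "\<dots> \<le> T1 + (h + 2) * (16 * ?len + 18)" by (simp add: algebra_simps)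
              finally have "Suc T3 \<le> T + 1 + (h + 2) * (16 * (\<Sum>B<Suc k. I aSz B) + 20 * Suc k)"
                using p(2) by (simp add: algebra_simps)
              then show ?thesis using all by simp
            qed
            done
        qed
        done
    qed
    subgoal by simp
    done
qed

end

section \<open>The search\<close>

text \<open>The logarithm to base 1 + \<epsilon>, used as a potential that rises by 1 with each
  improvement by that factor.\<close>

definition Lam :: "real \<Rightarrow> real \<Rightarrow> real" where "Lam \<epsilon> x = ln x / ln (1 + \<epsilon>)"

lemma Lam_mono: "0 < \<epsilon> \<Longrightarrow> 0 < x \<Longrightarrow> x \<le> y \<Longrightarrow> Lam \<epsilon> x \<le> Lam \<epsilon> y"
  unfolding Lam_def by (intro divide_right_mono) auto

lemma Lam_step:
  assumes "0 < \<epsilon>" "0 < x" "(1 + \<epsilon>) * x \<le> y"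
  shows "Lam \<epsilon> x + 1 \<le> Lam \<epsilon> y"
proof -
  have p: "0 < (1 + \<epsilon>) * x" using assms by (intro mult_pos_pos) auto
  have "ln (1 + \<epsilon>) + ln x = ln ((1 + \<epsilon>) * x)" using assms by (simp add: ln_mult)
  also have "\<dots> \<le> ln y" using p assms by (intro ln_mono) auto
  finally have "ln (1 + \<epsilon>) + ln x \<le> ln y" .
  moreover have L: "0 < ln (1 + \<epsilon>)" using assms by simp
  ultimately have "(ln (1 + \<epsilon>) + ln x) / ln (1 + \<epsilon>) \<le> ln y / ln (1 + \<epsilon>)" by (intro divide_right_mono) auto
  then show ?thesis unfolding Lam_def using L by (simp add: add_divide_distrib)
qed

text \<open>
  Effect of examining the pairs \<open>p j\<close>, \<open>j \<in> J\<close>, in order of decreasing projected distance, with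
  best distance \<open>\<beta>\<close> and budget \<open>b\<close>. Every unit of budget spent is paid for either by an
  increase of the best distance by the factor \<open>1 + \<epsilon>\<close> or by a pair whose projected distance is
  exceptionally large.
\<close>

definition badpair :: "real \<Rightarrow> real \<Rightarrow> (nat \<Rightarrow> nat \<Rightarrow> real) \<Rightarrow> (nat \<Rightarrow> real) \<Rightarrow> nat \<times> nat \<Rightarrow> bool" where
  "badpair \<epsilon> \<tau> D f p \<longleftrightarrow> f (fst p) + \<tau> / (1 + \<epsilon>) * D (fst p) (snd p) \<le> f (snd p)"

definition eff :: "real \<Rightarrow> real \<Rightarrow> (nat \<Rightarrow> nat \<Rightarrow> real) \<Rightarrow> (nat \<Rightarrow> real) \<Rightarrow> 'i set \<Rightarrow> ('i \<Rightarrow> nat \<times> nat) \<Rightarrow>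
    real \<Rightarrow> nat \<Rightarrow> real \<Rightarrow> nat \<Rightarrow> bool" where
  "eff \<epsilon> \<tau> D f J p \<beta> b \<beta>' b' \<longleftrightarrow> \<beta> \<le> \<beta>' \<and> b' \<le> b \<and>
     (\<forall>x\<ge>\<beta>. (\<forall>j\<in>J. D (fst (p j)) (snd (p j)) \<le> x) \<longrightarrow> \<beta>' \<le> x) \<and>
     real b - real b' \<le> real (card {j \<in> J. badpair \<epsilon> \<tau> D f (p j)}) + Lam \<epsilon> \<beta>' - Lam \<epsilon> \<beta> \<and>
     (b' = 0 \<or> (\<forall>j\<in>J. f (snd (p j)) < f (fst (p j)) + \<tau> * \<beta>' \<or> D (fst (p j)) (snd (p j)) \<le> \<beta>'))"

lemma eff_empty: "eff \<epsilon> \<tau> D f {} p \<beta> b \<beta> b"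
  by (simp add: eff_def)

text \<open>The threshold \<tau> * \<beta> grows with \<beta>, so verdicts reached for J remain
  valid for the later best distance. Spending and potential telescope, and the exceptional pairs add
  up because J and J' are disjoint.\<close>

lemma eff_Un:
  assumes 1: "eff \<epsilon> \<tau> D f J p \<beta> b \<beta>1 b1" and 2: "eff \<epsilon> \<tau> D f J' p \<beta>1 b1 \<beta>2 b2"
    and fin: "finite J" "finite J'" "J \<inter> J' = {}" and \<tau>: "0 \<le> \<tau>"
  shows "eff \<epsilon> \<tau> D f (J \<union> J') p \<beta> b \<beta>2 b2"
  unfolding eff_def
proof (intro conjI)
  show "\<beta> \<le> \<beta>2" "b2 \<le> b" using 1 2 by (auto simp: eff_def)
  have b12: "\<beta>1 \<le> \<beta>2" "b2 \<le> b1" using 2 by (auto simp: eff_def)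
  show "\<forall>x\<ge>\<beta>. (\<forall>j\<in>J \<union> J'. D (fst (p j)) (snd (p j)) \<le> x) \<longrightarrow> \<beta>2 \<le> x"
    using 1 2 unfolding eff_def by (meson UnI1 UnI2)
  have "{j \<in> J \<union> J'. badpair \<epsilon> \<tau> D f (p j)} = {j \<in> J. badpair \<epsilon> \<tau> D f (p j)} \<union> {j \<in> J'. badpair \<epsilon> \<tau> D f (p j)}"
    by auto
  also have "card \<dots> = card {j \<in> J. badpair \<epsilon> \<tau> D f (p j)} + card {j \<in> J'. badpair \<epsilon> \<tau> D f (p j)}"
    using fin by (intro card_Un_disjoint) auto
  finally show "real b - real b2 \<le> real (card {j \<in> J \<union> J'. badpair \<epsilon> \<tau> D f (p j)}) + Lam \<epsilon> \<beta>2 - Lam \<epsilon> \<beta>"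
    using 1 2 by (simp add: eff_def)
  have "\<tau> * \<beta>1 \<le> \<tau> * \<beta>2" using b12 \<tau> by (intro mult_left_mono)
  then have old: "f (snd (p j)) < f (fst (p j)) + \<tau> * \<beta>2 \<or> D (fst (p j)) (snd (p j)) \<le> \<beta>2"
    if "f (snd (p j)) < f (fst (p j)) + \<tau> * \<beta>1 \<or> D (fst (p j)) (snd (p j)) \<le> \<beta>1" for j
    using that b12 by linarith
  show "b2 = 0 \<or> (\<forall>j\<in>J \<union> J'. f (snd (p j)) < f (fst (p j)) + \<tau> * \<beta>2 \<or> D (fst (p j)) (snd (p j)) \<le> \<beta>2)"
  proof (cases "b2 = 0")
    case False
    then have "b1 \<noteq> 0" using b12 by simp
    then have "\<forall>j\<in>J. f (snd (p j)) < f (fst (p j)) + \<tau> * \<beta>1 \<or> D (fst (p j)) (snd (p j)) \<le> \<beta>1"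
      using 1 by (simp add: eff_def)
    moreover have "\<forall>j\<in>J'. f (snd (p j)) < f (fst (p j)) + \<tau> * \<beta>2 \<or> D (fst (p j)) (snd (p j)) \<le> \<beta>2"
      using 2 False by (simp add: eff_def)
    ultimately show ?thesis using old by blast
  qed simp
qed

text \<open>The summary does not depend on the order of examination, so it can be moved from sorted
  positions to positions in the class array.\<close>

lemma eff_reindex:
  assumes e: "eff \<epsilon> \<tau> D f J p \<beta> b \<beta>' b'" and g: "g ` J' = J" "inj_on g J'" and p': "\<And>j. j \<in> J' \<Longrightarrow> p' j = p (g j)"
  shows "eff \<epsilon> \<tau> D f J' p' \<beta> b \<beta>' b'"
proof -
  have "{j \<in> J. badpair \<epsilon> \<tau> D f (p j)} = g ` {j \<in> J'. badpair \<epsilon> \<tau> D f (p' j)}"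
    using g p' by auto
  then have c: "card {j \<in> J. badpair \<epsilon> \<tau> D f (p j)} = card {j \<in> J'. badpair \<epsilon> \<tau> D f (p' j)}"
    using g(2) by (simp add: card_image inj_on_subset)
  have q: "(\<forall>j\<in>J. Q (p j)) \<longleftrightarrow> (\<forall>j\<in>J'. Q (p' j))" for Q using g p' by auto
  show ?thesis
    using e unfolding eff_def c q[of "\<lambda>p. D (fst p) (snd p) \<le> _"]
      q[of "\<lambda>p. f (snd p) < f (fst p) + \<tau> * \<beta>' \<or> D (fst p) (snd p) \<le> \<beta>'"] .
qed

context ram
begin

text \<open>Time plus remaining budget times 3 * d + 14 acts as a potential: one examined candidate
  costs at most 3 * d + 14 steps and one unit of budget.\<close>

lemma ok_BLOCK:
  fixes \<epsilon> \<tau> :: real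
  assumes d: "I 0 1 = d" "d \<le> M" and T: "R rT 0 = \<tau>" "0 \<le> \<tau>" and \<epsilon>: "0 < \<epsilon>"
    and v: "I vu 0 = u" "I vww 0 = w" "I vee 0 = e" "w \<le> M"
    and c: "\<And>z. z < w \<Longrightarrow> c z = I aArr (I vbs 0 + I aSrt (I vgg 0 + I vbs 0 + I vbase 0 + z))"
    and srt: "\<And>p q. p \<le> q \<Longrightarrow> q < w \<Longrightarrow> R aVal (c q) \<le> R aVal (c p)" and pos: "0 < R aBest e"
  shows "ok BLOCK I R T0 (\<lambda>I' R' T'. T' + I' vbud 0 * (3 * d + 14) \<le> T0 + 2 + I vbud 0 * (3 * d + 14) \<and>
    (\<forall>e'. e' \<noteq> e \<longrightarrow> R' aBest e' = R aBest e') \<and>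
    eff \<epsilon> \<tau> (dst R d) (R aVal) {..<w} (\<lambda>z. (u, c z)) (R aBest e) (I vbud 0) (R' aBest e) (I' vbud 0))"
proof -
  let ?D = "dst R d" and ?f = "R aVal"
  let ?bad = "\<lambda>t. {z \<in> {..<t}. badpair \<epsilon> \<tau> ?D ?f (u, c z)}"
  define Inv where "Inv I' R' T' \<longleftrightarrow> I' vt 0 \<le> w \<and> I' vbud 0 + I' vt 0 = I vbud 0 \<and> (\<forall>e'. e' \<noteq> e \<longrightarrow> R' aBest e' = R aBest e') \<and>
      T' + I' vbud 0 * (3 * d + 14) \<le> T0 + 1 + I vbud 0 * (3 * d + 14) \<and> R aBest e \<le> R' aBest e \<and>
      (\<forall>x\<ge>R aBest e. (\<forall>z<w. ?D u (c z) \<le> x) \<longrightarrow> R' aBest e \<le> x) \<and>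
      real (I' vt 0) \<le> real (card (?bad (I' vt 0))) + Lam \<epsilon> (R' aBest e) - Lam \<epsilon> (R aBest e) \<and>
      (\<forall>z<I' vt 0. ?D u (c z) \<le> R' aBest e)"
    for I' :: ipart and R' :: rpart and T' :: nat
  show ?thesis
    unfolding BLOCK_def
    apply (intro ok_Seq ok_IWrite)
    subgoal by simp
    apply (rule ok_Loop[where Inv = Inv and mea = "\<lambda>I' R'. w - I' vt 0"])
    subgoal by (simp add: Inv_def)
    subgoal premises p for I1 R1 T1
    proof -
      have fr: "I1 aArr = I aArr" "I1 aSrt = I aSrt" "I1 vbs = I vbs" "I1 vgg = I vgg" "I1 vbase = I vbase"
          "I1 0 = I 0" "I1 vu 0 = u" "I1 vww 0 = w" "I1 vee 0 = e" "R1 1 = R 1" "R1 (Suc 0) = R (Suc 0)" "R1 aVal = R aVal" "R1 rT 0 = \<tau>"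
        using p(4,5) v T by auto
      define t where "t = I1 vt 0"
      define \<beta> where "\<beta> = R1 aBest e"
      have inv: "I1 vbud 0 + t = I vbud 0" "\<And>e'. e' \<noteq> e \<Longrightarrow> R1 aBest e' = R aBest e'"
          "T1 + I1 vbud 0 * (3 * d + 14) \<le> T0 + 1 + I vbud 0 * (3 * d + 14)" "R aBest e \<le> \<beta>"
          "\<And>x. R aBest e \<le> x \<Longrightarrow> (\<And>z. z < w \<Longrightarrow> ?D u (c z) \<le> x) \<Longrightarrow> \<beta> \<le> x"
          "real t \<le> real (card (?bad t)) + Lam \<epsilon> \<beta> - Lam \<epsilon> (R aBest e)" "\<And>z. z < t \<Longrightarrow> ?D u (c z) \<le> \<beta>"
        using p(1) unfolding Inv_def t_def \<beta>_def by auto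
      have g: "t < w" "0 < I1 vbud 0" using p(2) fr by (auto simp: t_def)
      have ct: "I1 aArr (I1 vbs 0 + I1 aSrt (I1 vgg 0 + I1 vbs 0 + I1 vbase 0 + I1 vt 0)) = c t"
        using c[OF g(1)] fr by (simp add: t_def)
      have far: "?f u + \<tau> * \<beta> \<le> ?f (c t)" using p(2) fr ct by (simp add: \<beta>_def)
      have cM: "c t \<le> M" using p(3) ct by (metis bnd_def)
      define \<beta>' where "\<beta>' = max \<beta> (?D u (c t))"
      have \<beta>p: "0 < \<beta>" using inv(4) pos by simp
      \<comment> \<open>Passing the test means a projected distance of at least \<tau> * \<beta>.
        Either the true distance reaches (1 + \<epsilon>) * \<beta> and raises the potential by 1,
        or the pair is exceptional.\<close>
      have step: "real (Suc t) \<le> real (card (?bad (Suc t))) + Lam \<epsilon> \<beta>' - Lam \<epsilon> (R aBest e)"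
      proof (cases "(1 + \<epsilon>) * \<beta> \<le> ?D u (c t)")
        case True
        then have "Lam \<epsilon> \<beta> + 1 \<le> Lam \<epsilon> \<beta>'" using \<epsilon> \<beta>p by (intro Lam_step) (auto simp: \<beta>'_def)
        moreover have "card (?bad t) \<le> card (?bad (Suc t))" by (intro card_mono) auto
        ultimately show ?thesis using inv(6) by simp
      next
        case False
        have "\<tau> / (1 + \<epsilon>) * ?D u (c t) \<le> \<tau> / (1 + \<epsilon>) * ((1 + \<epsilon>) * \<beta>)"
          using False T \<epsilon> by (intro mult_left_mono) auto
        also have "\<dots> = \<tau> * \<beta>" using \<epsilon> by simp
        finally have "badpair \<epsilon> \<tau> ?D ?f (u, c t)" using far by (simp add: badpair_def)
        then have "?bad (Suc t) = insert t (?bad t)" by (auto simp: less_Suc_eq)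
        then have "card (?bad (Suc t)) = Suc (card (?bad t))" by simp
        moreover have "Lam \<epsilon> \<beta> \<le> Lam \<epsilon> \<beta>'" using \<epsilon> \<beta>p by (intro Lam_mono) (auto simp: \<beta>'_def)
        ultimately show ?thesis using inv(6) by simp
      qed
      have fin: "Inv I3 R3 T3 \<and> w - I3 vt 0 < w - I1 vt 0"
        if "I3 vt 0 = Suc t" "I3 vbud 0 = I1 vbud 0 - 1" "R3 aBest = (R1 aBest)(e := \<beta>')" "T3 \<le> T1 + (3 * d + 14)"
        for I3 R3 T3
      proof -
        have "I1 vbud 0 * (3 * d + 14) = (I1 vbud 0 - 1) * (3 * d + 14) + (3 * d + 14)"
          using g(2) by (cases "I1 vbud 0") auto
        then have "T3 + I3 vbud 0 * (3 * d + 14) \<le> T0 + 1 + I vbud 0 * (3 * d + 14)" using that inv(3) by simp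
        moreover have "\<beta>' \<le> x" if "R aBest e \<le> x" "\<forall>z<w. ?D u (c z) \<le> x" for x
          using inv(5)[OF that(1)] that g(1) by (simp add: \<beta>'_def)
        moreover have "?D u (c z) \<le> \<beta>'" if "z < Suc t" for z
          using inv(7)[of z] that by (cases "z = t") (auto simp: \<beta>'_def)
        moreover have "I3 vbud 0 + Suc t = I vbud 0" using that g(2) inv(1) by simp
        ultimately show ?thesis
          unfolding Inv_def using that g step inv(2,4) by (auto simp: t_def[symmetric] \<beta>'_def)
      qed
      show ?thesis
        apply (intro ok_Seq ok_IWrite)
        subgoal using ct cM by (simp add: fr[symmetric] del: fr)
        apply (rule ok_conseq[OF ok_DIST[where d = d]])
        subgoal using d fr by simp
        subgoal by (rule d)
        subgoal premises q for I2 R2 T2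
        proof -
          have D: "R2 rdist 0 = ?D u (c t)" using q(1) ct fr by (simp add: dst_def)
          have f2: "I2 vee 0 = e" "I2 vbud 0 = I1 vbud 0" "I2 vt 0 = t" "R2 aBest = R1 aBest"
            using q(3,4) fr by (auto simp: t_def)
          have bM: "I1 vbud 0 \<le> M" using p(3) by (simp add: bnd_def)
          show ?thesis
            apply (intro ok_Seq ok_Cond ok_IWrite ok_RWrite ok_Skip fin)
            using D f2 q(1) bM g(1) v(4) by (auto simp: \<beta>'_def \<beta>_def)
        qed
        done
    qed
    subgoal premises p for I1 R1 T1
    proof -
      have fr: "I1 aArr = I aArr" "I1 aSrt = I aSrt" "I1 vbs = I vbs" "I1 vgg = I vgg" "I1 vbase = I vbase"
          "I1 vu 0 = u" "I1 vww 0 = w" "I1 vee 0 = e" "R1 aVal = R aVal" "R1 rT 0 = \<tau>"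
        using p(4,5) v T by auto
      define t where "t = I1 vt 0"
      define \<beta> where "\<beta> = R1 aBest e"
      have inv: "t \<le> w" "I1 vbud 0 + t = I vbud 0" "\<And>e'. e' \<noteq> e \<Longrightarrow> R1 aBest e' = R aBest e'"
          "T1 + I1 vbud 0 * (3 * d + 14) \<le> T0 + 1 + I vbud 0 * (3 * d + 14)" "R aBest e \<le> \<beta>"
          "\<And>x. R aBest e \<le> x \<Longrightarrow> (\<And>z. z < w \<Longrightarrow> ?D u (c z) \<le> x) \<Longrightarrow> \<beta> \<le> x"
          "real t \<le> real (card (?bad t)) + Lam \<epsilon> \<beta> - Lam \<epsilon> (R aBest e)" "\<And>z. z < t \<Longrightarrow> ?D u (c z) \<le> \<beta>"
        using p(1) unfolding Inv_def t_def \<beta>_def by auto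
      have cM: "card (?bad t) \<le> card (?bad w)" using inv(1) by (intro card_mono) auto
      have last: "I1 vbud 0 = 0 \<or> (\<forall>z<w. ?f (c z) < ?f u + \<tau> * \<beta> \<or> ?D u (c z) \<le> \<beta>)"
      proof (cases "t = w \<or> I1 vbud 0 = 0")
        case True
        then show ?thesis using inv(8) by auto
      next
        case False
        then have t: "t < w" "0 < I1 vbud 0" using inv(1) by auto
        have ct: "I1 aArr (I1 vbs 0 + I1 aSrt (I1 vgg 0 + I1 vbs 0 + I1 vbase 0 + I1 vt 0)) = c t"
          using c[OF t(1)] fr by (simp add: t_def)
        \<comment> \<open>With budget and candidates left, the scan can only have stopped at the
          threshold; by the decreasing order all later candidates fail it too.\<close>
        have "?f (c t) < ?f u + \<tau> * \<beta>" using p(2) t fr ct by (simp add: \<beta>_def t_def)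
        then have "?f (c z) < ?f u + \<tau> * \<beta>" if "t \<le> z" "z < w" for z using srt[OF that] by linarith
        then show ?thesis using inv(8) by (meson not_le)
      qed
      show ?thesis
        unfolding eff_def using inv cM last by (auto simp: \<beta>_def[symmetric])
    qed
    done
qed

lemma ok_QUERY:
  fixes \<epsilon> \<tau> :: real
  assumes d: "I 0 1 = d" "d \<le> M" and T: "R rT 0 = \<tau>" "0 \<le> \<tau>" and \<epsilon>: "0 < \<epsilon>"
    and v: "I vu 0 = u" "I vee 0 = e" "I vW 0 = W" "I vbs 0 = bs" "I aQT e = r" "r \<le> len" "len \<le> 2 ^ h"
    and b: "4 * 2 ^ h \<le> M" "(h + 2) * W \<le> M"
    and srt: "\<And>g b. 2 ^ g \<le> len \<Longrightarrow> 2 ^ g dvd b \<Longrightarrow>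
       blkok (\<lambda>p. R aVal (I aArr (bs + p))) len (2 ^ g) (\<lambda>p. I aSrt (g * W + bs + p)) b"
    and pos: "0 < R aBest e"
  shows "ok QUERY I R T0 (\<lambda>I' R' T'. T' + I' vbud 0 * (3 * d + 14) \<le> T0 + 5 + (h + 1) * 9 + I vbud 0 * (3 * d + 14) \<and>
    (\<forall>e'. e' \<noteq> e \<longrightarrow> R' aBest e' = R aBest e') \<and>
    eff \<epsilon> \<tau> (dst R d) (R aVal) {..<r} (\<lambda>p. (u, I aArr (bs + p))) (R aBest e) (I vbud 0) (R' aBest e) (I' vbud 0))"
proof -
  let ?D = "dst R d" and ?f = "R aVal" and ?p = "\<lambda>p. (u, I aArr (bs + p))"
  \<comment> \<open>The prefix of length q * 2^g is still to be searched, and the positions from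
    there up to r are done.\<close>
  define Inv where "Inv I' R' T' \<longleftrightarrow> (\<exists>g q. I' vd 0 = q \<and> I' vww 0 = 2 ^ g \<and> I' vgg 0 = g * W \<and> q * 2 ^ g \<le> r \<and> g \<le> h + 1 \<and>
      (\<forall>e'. e' \<noteq> e \<longrightarrow> R' aBest e' = R aBest e') \<and>
      T' + I' vbud 0 * (3 * d + 14) \<le> T0 + 3 + g * 9 + I vbud 0 * (3 * d + 14) \<and>
      eff \<epsilon> \<tau> ?D ?f {q * 2 ^ g..<r} ?p (R aBest e) (I vbud 0) (R' aBest e) (I' vbud 0))"
    for I' :: ipart and R' :: rpart and T' :: nat
  have h2: "(2::nat) ^ h \<le> M" "1 \<le> M" using b(1) one_le_power[of "2::nat" h] by linarith+
  show ?thesis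
    unfolding QUERY_def
    apply (intro ok_Seq ok_IWrite)
    subgoal using v h2 by simp
    subgoal using h2 by simp
    subgoal by simp
    apply (rule ok_Loop[where Inv = Inv and mea = "\<lambda>I' R'. I' vd 0"])
    subgoal unfolding Inv_def using v by (intro exI[of _ 0] exI[of _ r]) (simp add: eff_empty)
    subgoal premises p for I1 R1 T1
    proof -
      obtain g q where inv: "I1 vd 0 = q" "I1 vww 0 = 2 ^ g" "I1 vgg 0 = g * W" "q * 2 ^ g \<le> r"
          "\<And>e'. e' \<noteq> e \<Longrightarrow> R1 aBest e' = R aBest e'"
          "T1 + I1 vbud 0 * (3 * d + 14) \<le> T0 + 3 + g * 9 + I vbud 0 * (3 * d + 14)"
          "eff \<epsilon> \<tau> ?D ?f {q * 2 ^ g..<r} ?p (R aBest e) (I vbud 0) (R1 aBest e) (I1 vbud 0)"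
        using p(1) unfolding Inv_def by blast
      have fr: "I1 aArr = I aArr" "I1 aSrt = I aSrt" "I1 vbs 0 = bs" "I1 vW 0 = W" "I1 0 = I 0" "I1 vu 0 = u" "I1 vee 0 = e"
          "R1 (Suc 0) = R (Suc 0)" "R1 aVal = R aVal" "R1 rT 0 = \<tau>"
        using p(4,5) v T by auto
      have q0: "0 < q" using p(2) inv(1) by simp
      have gr: "2 ^ g \<le> r" using q0 inv(4) by (metis le_trans mult_le_mono1 nat_mult_1 One_nat_def Suc_leI)
      then have "(2::nat) ^ g \<le> 2 ^ h" using v(6,7) by linarith
      then have gh: "g \<le> h" by simp
      have posb: "0 < R1 aBest e" using inv(7) pos by (simp add: eff_def)
      have rM: "q * 2 ^ g \<le> M" using inv(4) v(6,7) h2 by linarith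
      have D1: "dst R1 d = ?D" by (simp add: dst_def fr fun_eq_iff)
      have rest: "ok (assign vd (IV vd [div] IConst 2) ;; assign vww (IConst 2 [*] IV vww) ;; assign vgg (IV vgg [+] IV vW)) I2 R2 T2
          (\<lambda>I3 R3 T3. Inv I3 R3 T3 \<and> I3 vd 0 < I1 vd 0)"
        if "I2 vd 0 = q" "I2 vww 0 = 2 ^ g" "I2 vgg 0 = g * W" "I2 vW 0 = W" "\<And>e'. e' \<noteq> e \<Longrightarrow> R2 aBest e' = R aBest e'"
          "T2 + I2 vbud 0 * (3 * d + 14) \<le> T0 + 9 + g * 9 + I vbud 0 * (3 * d + 14)"
          "eff \<epsilon> \<tau> ?D ?f {(q div 2) * 2 ^ Suc g..<r} ?p (R aBest e) (I vbud 0) (R2 aBest e) (I2 vbud 0)" for I2 R2 T2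
      proof -
        have 1: "2 * 2 ^ g \<le> M" using gr v(6,7) b(1) by linarith
        have "Suc g * W \<le> (h + 2) * W" using gh by (intro mult_le_mono1) simp
        then have 2: "Suc g * W \<le> M" using b(2) by linarith
        have "q div 2 * 2 \<le> q" by simp
        then have "q div 2 * 2 * 2 ^ g \<le> q * 2 ^ g" by (rule mult_le_mono1)
        then have 3: "q div 2 * 2 ^ Suc g \<le> r"
          using inv(4) unfolding power_Suc mult.assoc[symmetric] by (rule le_trans)
        have 4: "q \<le> M"
        proof -
          have "q * 1 \<le> q * 2 ^ g" by (intro mult_le_mono2) simp
          then show ?thesis using rM unfolding mult_1_right by (rule le_trans)
        qed
        show ?thesis
          apply (intro ok_Seq ok_IWrite)
          subgoal using that 4 by simp
          subgoal using that 1 by simp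
          subgoal using that 2 by simp
          subgoal unfolding Inv_def using that 3 gh q0 inv(1)
            by (intro conjI exI[of _ "Suc g"] exI[of _ "q div 2"]) auto
          done
      qed
      show ?thesis
        apply (rule ok_Seq)
        apply (rule ok_Cond)
        subgoal premises odd
        proof -
          have "q div 2 * 2 < q" using odd inv(1) by (simp only: bv.simps iv.simps iop_val.simps)
          then have odd': "q div 2 * 2 = q - 1"
            using div_mult_mod_eq[of q 2] mod_less_divisor[of 2 q] by linarith
          define base where "base = (q - 1) * 2 ^ g"
          have base: "base + 2 ^ g = q * 2 ^ g"
            using q0 by (cases q) (auto simp: base_def)
          have baseM: "base \<le> M" using base rM by linarith
          have base': "q div 2 * 2 ^ Suc g = base"
            unfolding base_def odd'[symmetric] by (simp only: power_Suc mult.assoc)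
          have dv: "2 ^ g dvd base" by (simp add: base_def)
          have gl: "2 ^ g \<le> len" using gr v(6) by simp
          let ?s = "\<lambda>p. I aSrt (g * W + bs + p)"
          have bl: "blkok (\<lambda>p. ?f (I aArr (bs + p))) len (2 ^ g) ?s base" by (rule srt[OF gl dv])
          have mn: "min (base + 2 ^ g) len = base + 2 ^ g" using base inv(4) v(6) by simp
          have im: "?s ` {base..<base + 2 ^ g} = {base..<base + 2 ^ g}" using bl by (simp add: blkok_def mn)
          have injs: "inj_on ?s {base..<base + 2 ^ g}" by (rule eq_card_imp_inj_on) (simp_all add: im)
          let ?c = "\<lambda>z. I aArr (bs + ?s (base + z))"
          have srt': "?f (?c y) \<le> ?f (?c x)" if "x \<le> y" "y < 2 ^ g" for x y
            using bl that unfolding blkok_def mn by simp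
          show ?thesis
            apply (intro ok_Seq ok_IWrite)
            subgoal using baseM inv(1,2) by (simp add: base_def)
            apply (rule ok_conseq[OF ok_BLOCK[where d = d and \<tau> = \<tau> and \<epsilon> = \<epsilon> and u = u and w = "2 ^ g" and e = e and c = ?c]])
            subgoal using d fr by simp
            subgoal by (rule d)
            subgoal using fr by simp
            subgoal by (rule T)
            subgoal by (rule \<epsilon>)
            subgoal using fr by simp
            subgoal using inv by simp
            subgoal using fr by simp
            subgoal using gl v(7) h2 by linarith
            subgoal using fr inv by (simp add: base_def add.assoc)
            subgoal using srt' fr by simp
            subgoal using posb by simp
            subgoal premises r for I2 R2 T2
            proof (rule rest)
              have fr2: "I2 vd = I1 vd" "I2 vww = I1 vww" "I2 vgg = I1 vgg" "I2 vW = I1 vW"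
                using r(3) by auto
              show "I2 vd 0 = q" "I2 vww 0 = 2 ^ g" "I2 vgg 0 = g * W" "I2 vW 0 = W" using fr2 inv fr by auto
              show "R2 aBest e' = R aBest e'" if "e' \<noteq> e" for e' using r(1) inv(5) that by simp
              show "T2 + I2 vbud 0 * (3 * d + 14) \<le> T0 + 9 + g * 9 + I vbud 0 * (3 * d + 14)" using r(1) inv(6) by simp
              have "eff \<epsilon> \<tau> ?D ?f {..<2 ^ g} (\<lambda>z. (u, ?c z)) (R1 aBest e) (I1 vbud 0) (R2 aBest e) (I2 vbud 0)"
                using r(1) fr D1 by simp
              then have e2: "eff \<epsilon> \<tau> ?D ?f {base..<base + 2 ^ g} ?p (R1 aBest e) (I1 vbud 0) (R2 aBest e) (I2 vbud 0)"
              proof (rule eff_reindex)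
                \<comment> \<open>The inverse of the block's sorting permutation, shifted to start
                  at 0.\<close>
                let ?g = "\<lambda>x. inv_into {base..<base + 2 ^ g} ?s x - base"
                have ii: "inv_into {base..<base + 2 ^ g} ?s x \<in> {base..<base + 2 ^ g}" if "x \<in> {base..<base + 2 ^ g}" for x
                  using inv_into_into[of x ?s "{base..<base + 2 ^ g}"] that im by simp
                have si: "?s (inv_into {base..<base + 2 ^ g} ?s x) = x" if "x \<in> {base..<base + 2 ^ g}" for x
                  using f_inv_into_f[of x ?s "{base..<base + 2 ^ g}"] that im by simp
                have add: "base + ?g x = inv_into {base..<base + 2 ^ g} ?s x" if "x \<in> {base..<base + 2 ^ g}" for x
                  using ii[OF that] by simp
                show in2: "inj_on ?g {base..<base + 2 ^ g}"
                  by (rule inj_onI) (metis add si)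
                have "?g ` {base..<base + 2 ^ g} \<subseteq> {..<2 ^ g}" using ii by fastforce
                then show "?g ` {base..<base + 2 ^ g} = {..<2 ^ g}"
                  by (rule card_subset_eq[rotated]) (simp_all add: card_image[OF in2])
                show "?p x = (u, ?c (?g x))" if "x \<in> {base..<base + 2 ^ g}" for x
                  using add[OF that] si[OF that] by simp
              qed
              have "eff \<epsilon> \<tau> ?D ?f ({q * 2 ^ g..<r} \<union> {base..<base + 2 ^ g}) ?p (R aBest e) (I vbud 0) (R2 aBest e) (I2 vbud 0)"
                by (rule eff_Un[OF inv(7) e2]) (use base T in auto)
              also have "{q * 2 ^ g..<r} \<union> {base..<base + 2 ^ g} = {base..<r}" using base inv(4) by auto
              finally show "eff \<epsilon> \<tau> ?D ?f {(q div 2) * 2 ^ Suc g..<r} ?p (R aBest e) (I vbud 0) (R2 aBest e) (I2 vbud 0)"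
                unfolding base' .
            qed
            done
        qed
        subgoal premises even
        proof (rule ok_Skip, rule rest)
          have "\<not> q div 2 * 2 < q" using even inv(1) by (simp only: bv.simps iv.simps iop_val.simps simp_thms)
          then have "q div 2 * 2 = q" using div_mult_mod_eq[of q 2] by linarith
          then have eq: "q div 2 * 2 ^ Suc g = q * 2 ^ g" by (metis mult.assoc power_Suc)
          show "eff \<epsilon> \<tau> ?D ?f {(q div 2) * 2 ^ Suc g..<r} ?p (R aBest e) (I vbud 0) (R1 aBest e) (I1 vbud 0)"
            unfolding eq by (rule inv(7))
        qed (use inv fr in auto)
        done
    qed
    subgoal premises p for I1 R1 T1
    proof -
      obtain g q where inv: "I1 vd 0 = q" "g \<le> h + 1"
          "\<And>e'. e' \<noteq> e \<Longrightarrow> R1 aBest e' = R aBest e'"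
          "T1 + I1 vbud 0 * (3 * d + 14) \<le> T0 + 3 + g * 9 + I vbud 0 * (3 * d + 14)"
          "eff \<epsilon> \<tau> ?D ?f {q * 2 ^ g..<r} ?p (R aBest e) (I vbud 0) (R1 aBest e) (I1 vbud 0)"
        using p(1) unfolding Inv_def by blast
      have "q = 0" using p(2) inv(1) by simp
      then show ?thesis using inv by (auto simp: lessThan_atLeast0)
    qed
    done
qed

text \<open>The sequence \<open>bb\<close> lists the budget at the start of each edge, so that
  spending can later be summed over the edges by telescoping.\<close>

lemma ok_SEARCH:
  fixes \<epsilon> \<tau> :: real
  assumes d: "I 0 0 = n" "I 0 1 = d" "d \<le> M" and T: "R rT 0 = \<tau>" "0 \<le> \<tau>" and \<epsilon>: "0 < \<epsilon>"
    and v: "I vW 0 = n * n" "I vE 0 = E" "E \<le> M" "n \<le> 2 ^ h" "n \<le> M" "n * n \<le> M"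
    and Q: "\<And>e. e < E \<Longrightarrow> I aQB e < n \<and> I aQS e \<le> n \<and> I aQT e \<le> I aSz (I aQB e) \<and> I aSz (I aQB e) \<le> n"
    and b: "4 * 2 ^ h \<le> M" "(h + 2) * (n * n) \<le> M"
    and srt: "\<And>B g b. B < n \<Longrightarrow> 2 ^ g \<le> I aSz B \<Longrightarrow> 2 ^ g dvd b \<Longrightarrow>
       blkok (\<lambda>p. R aVal (I aArr (B * n + p))) (I aSz B) (2 ^ g) (\<lambda>p. I aSrt (g * (n * n) + B * n + p)) b"
    and pos: "\<And>e. e < E \<Longrightarrow> 0 < R aBest e"
  shows "ok SEARCH I R T0 (\<lambda>I' R' T'.
    T' + I' vbud 0 * (3 * d + 14) \<le> T0 + 2 + (\<Sum>e<E. 6 + I aQS e * (20 + 9 * h)) + I vbud 0 * (3 * d + 14) \<and>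
    (\<exists>bb. bb 0 = I vbud 0 \<and> bb E = I' vbud 0 \<and> (\<forall>e<E. eff \<epsilon> \<tau> (dst R d) (R aVal) ({..<I aQS e} \<times> {..<I aQT e})
       (\<lambda>(a, b). (I aArr (I aQA e * n + a), I aArr (I aQB e * n + b))) (R aBest e) (bb e) (R' aBest e) (bb (Suc e)))))"
proof -
  let ?D = "dst R d" and ?f = "R aVal"
  let ?p = "\<lambda>e (a, b). (I aArr (I aQA e * n + a), I aArr (I aQB e * n + b))"
  let ?P = "\<lambda>k I' R' T'.
    T' + I' vbud 0 * (3 * d + 14) \<le> T0 + 1 + (\<Sum>e<k. 6 + I aQS e * (20 + 9 * h)) + I vbud 0 * (3 * d + 14) \<and>
    (\<forall>e. k \<le> e \<longrightarrow> R' aBest e = R aBest e) \<and>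
    (\<exists>bb. bb 0 = I vbud 0 \<and> bb k = I' vbud 0 \<and> (\<forall>e<k. eff \<epsilon> \<tau> ?D ?f ({..<I aQS e} \<times> {..<I aQT e})
       (?p e) (R aBest e) (bb e) (R' aBest e) (bb (Suc e))))"
  show ?thesis
    unfolding SEARCH_def
    apply (rule ok_For[where len = E and P = ?P])
    subgoal by simp
    subgoal using v by simp
    subgoal using v by simp
    subgoal by (auto intro!: exI[of _ "\<lambda>_. I vbud 0"])
    subgoal premises p for e I1 R1 T1
    proof -
      obtain bb where bb: "bb 0 = I vbud 0" "bb e = I1 vbud 0" "\<And>e'. e' < e \<Longrightarrow> eff \<epsilon> \<tau> ?D ?f ({..<I aQS e'} \<times> {..<I aQT e'})
          (?p e') (R aBest e') (bb e') (R1 aBest e') (bb (Suc e'))"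
        using p(2) by blast
      have f1: "I1 0 = I 0" "I1 aQB = I aQB" "I1 aQA = I aQA" "I1 aQS = I aQS" "I1 aQT = I aQT" "I1 aArr = I aArr"
          "I1 aSrt = I aSrt" "I1 vW = I vW" "I1 vee 0 = e" "I1 aSz = I aSz" using p(3,5) by auto
      have r1: "R1 aVal = R aVal" "R1 (Suc 0) = R (Suc 0)" "R1 rT = R rT" using p(6) by auto
      note q = Q[OF p(1)]
      have "I aQB e * n \<le> n * n" using q by (intro mult_le_mono1) simp
      then have qM: "I aQB e * n \<le> M" using v by linarith
      let ?PP = "\<lambda>a I2 R2 T2.
        T2 + I2 vbud 0 * (3 * d + 14) \<le> T1 + 3 + a * (20 + 9 * h) + I1 vbud 0 * (3 * d + 14) \<and>
        (\<forall>e'. e' \<noteq> e \<longrightarrow> R2 aBest e' = R1 aBest e') \<and>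
        eff \<epsilon> \<tau> ?D ?f ({..<a} \<times> {..<I aQT e}) (?p e) (R1 aBest e) (I1 vbud 0) (R2 aBest e) (I2 vbud 0)"
      show ?thesis
        apply (intro ok_Seq ok_IWrite)
        subgoal using qM f1 d by simp
        apply (rule ok_For[where len = "I aQS e" and P = ?PP])
        subgoal by simp
        subgoal using f1 by simp
        subgoal using q v by simp
        subgoal by (simp add: eff_empty)
        subgoal premises s for a I2 R2 T2
        proof -
          have f2: "I2 0 = I 0" "I2 aQB = I aQB" "I2 aQA = I aQA" "I2 aQS = I aQS" "I2 aQT = I aQT" "I2 aArr = I aArr"
              "I2 aSrt = I aSrt" "I2 vW = I vW" "I2 vee 0 = e" "I2 vbs 0 = I aQB e * n" "I2 va 0 = a"
            using s(3,5) f1 d by auto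
          have r2: "R2 aVal = R aVal" "R2 (Suc 0) = R (Suc 0)" "R2 rT = R rT" using s(6) r1 by auto
          have D2: "dst R2 d = ?D" by (simp add: dst_def r2 fun_eq_iff)
          have arM: "I aArr x \<le> M" for x using s(4) f2(6) by (metis bnd_def)
          have "0 < R1 aBest e" using p(2) pos[OF p(1)] by simp
          then have pos2: "0 < R2 aBest e" using s(2) by (simp add: eff_def)
          define u where "u = I aArr (I aQA e * n + a)"
          show ?thesis
            apply (intro ok_Seq ok_IWrite)
            subgoal using f2 arM by simp
            apply (rule ok_conseq[OF ok_QUERY[where d = d and \<tau> = \<tau> and \<epsilon> = \<epsilon> and u = u and e = e and W = "n * n"
                and bs = "I aQB e * n" and r = "I aQT e" and len = "I aSz (I aQB e)" and h = h]])
            subgoal using f2 d by simp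
            subgoal by (rule d)
            subgoal using r2 T by simp
            subgoal by (rule T)
            subgoal by (rule \<epsilon>)
            subgoal using f2 d by (simp add: u_def)
            subgoal using f2 by simp
            subgoal using f2 v by simp
            subgoal using f2 by simp
            subgoal using f2 by simp
            subgoal using q by simp
            subgoal using q v by linarith
            subgoal by (rule b)
            subgoal by (rule b)
            subgoal using srt[of "I aQB e"] q f2 r2 by simp
            subgoal using pos2 by simp
            subgoal premises r for I3 R3 T3
            proof -
              have "eff \<epsilon> \<tau> ?D ?f {..<I aQT e} (\<lambda>p. (u, I aArr (I aQB e * n + p))) (R2 aBest e) (I2 vbud 0) (R3 aBest e) (I3 vbud 0)"
                using r(1) by (simp add: D2 f2 r2)
              then have "eff \<epsilon> \<tau> ?D ?f ({a} \<times> {..<I aQT e}) (?p e) (R2 aBest e) (I2 vbud 0) (R3 aBest e) (I3 vbud 0)"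
                by (rule eff_reindex[where g = snd]) (auto simp: u_def inj_on_def)
              then have "eff \<epsilon> \<tau> ?D ?f (({..<a} \<times> {..<I aQT e}) \<union> ({a} \<times> {..<I aQT e})) (?p e) (R1 aBest e) (I1 vbud 0) (R3 aBest e) (I3 vbud 0)"
                using s(2) T by (intro eff_Un[where ?b1.0 = "I2 vbud 0" and ?\<beta>1.0 = "R2 aBest e"]) auto
              moreover have "({..<a} \<times> {..<I aQT e}) \<union> ({a} \<times> {..<I aQT e}) = {..<Suc a} \<times> {..<I aQT e}"
                by (auto simp: less_Suc_eq)
              ultimately have "eff \<epsilon> \<tau> ?D ?f ({..<Suc a} \<times> {..<I aQT e}) (?p e) (R1 aBest e) (I1 vbud 0) (R3 aBest e) (I3 vbud 0)" by simp
              then show ?thesis using r(1) s(2) by (simp add: f2 algebra_simps)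
            qed
            done
        qed
        subgoal premises s for I2 R2 T2
        proof -
          have e1: "R1 aBest e = R aBest e" using p(2) by simp
          let ?bb = "bb(Suc e := I2 vbud 0)"
          have "eff \<epsilon> \<tau> ?D ?f ({..<I aQS e'} \<times> {..<I aQT e'}) (?p e') (R aBest e') (?bb e') (R2 aBest e') (?bb (Suc e'))"
            if "e' < Suc e" for e'
          proof (cases "e' = e")
            case True
            then show ?thesis using s(1) bb(2) e1 by simp
          next
            case False
            then show ?thesis using s(1) bb(3)[of e'] that by simp
          qed
          moreover have "Suc T2 + I2 vbud 0 * (3 * d + 14) \<le> T0 + 1 + (\<Sum>e<Suc e. 6 + I aQS e * (20 + 9 * h)) + I vbud 0 * (3 * d + 14)"
            using s(1) p(2) by simp
          ultimately show ?thesis using s(1) p(2) bb(1) by (auto intro!: exI[of _ ?bb])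
        qed
        done
    qed
    subgoal by auto
    done
qed

end

context tree_instance
begin

text \<open>The sides are disjoint, since a common vertex would connect the ends of e by lighter
  edges. Distances are symmetric, so the possible swap of the sides is harmless.\<close>

lemma recd_pairs:
  assumes r: "recd e sz arr QA QS QB QT" and e: "e < E"
  shows "\<And>a b. a < QS \<Longrightarrow> b < QT \<Longrightarrow> arr (QA * n + a) < n \<and> arr (QB * n + b) < n \<and> arr (QA * n + a) \<noteq> arr (QB * n + b) \<and>
      dd (arr (QA * n + a)) (arr (QB * n + b)) \<le> cw e"
    "\<exists>a<QS. \<exists>b<QT. dd (arr (QA * n + a)) (arr (QB * n + b)) = cw e"
proof -
  let ?A = "\<lambda>p. arr (QA * n + p)" and ?B = "\<lambda>p. arr (QB * n + p)"
  have c: "?A ` {..<QS} = comp e (ex e) \<and> ?B ` {..<QT} = comp e (ey e) \<or> ?A ` {..<QS} = comp e (ey e) \<and> ?B ` {..<QT} = comp e (ex e)"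
    using r by (simp add: recd_def)
  have dis: "u \<noteq> v" if "u \<in> comp e (ex e)" "v \<in> comp e (ey e)" for u v
  proof
    let ?F = "{f. f < E \<and> wt f < wt e}"
    assume "u = v"
    then have "(ex e, u) \<in> (Gr ?F)\<^sup>*" "(ey e, u) \<in> (Gr ?F)\<^sup>*" using that by (auto simp: comp_def)
    then have "(ex e, ey e) \<in> (Gr ?F)\<^sup>*" by (meson conn_sym rtrancl_trans)
    moreover have "?F \<subseteq> {..<E}" "e \<notin> ?F" by auto
    ultimately show False using acyclic[OF e] by blast
  qed
  show "?A a < n \<and> ?B b < n \<and> ?A a \<noteq> ?B b \<and> dd (?A a) (?B b) \<le> cw e" if ab: "a < QS" "b < QT" for a b
  proof -
    have "?A a \<in> ?A ` {..<QS}" "?B b \<in> ?B ` {..<QT}" using ab by auto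
    then have "?A a \<in> comp e (ex e) \<and> ?B b \<in> comp e (ey e) \<or> ?A a \<in> comp e (ey e) \<and> ?B b \<in> comp e (ex e)"
      using c by auto
    then show ?thesis
    proof
      assume "?A a \<in> comp e (ex e) \<and> ?B b \<in> comp e (ey e)"
      then show ?thesis using dd_le_cw comp_lt dis by blast
    next
      assume a: "?A a \<in> comp e (ey e) \<and> ?B b \<in> comp e (ex e)"
      then have "dd (?B b) (?A a) \<le> cw e" "?B b \<noteq> ?A a" using dd_le_cw dis by blast+
      then show ?thesis using a comp_lt dd_sym by metis
    qed
  qed
  obtain u v where uv: "u \<in> comp e (ex e)" "v \<in> comp e (ey e)" "cw e = dd u v" using cw_attained[OF e] by blast
  show "\<exists>a<QS. \<exists>b<QT. dd (?A a) (?B b) = cw e"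
    using c
  proof
    assume "?A ` {..<QS} = comp e (ex e) \<and> ?B ` {..<QT} = comp e (ey e)"
    then have "u \<in> ?A ` {..<QS}" "v \<in> ?B ` {..<QT}" using uv by auto
    then show ?thesis using uv(3) by auto
  next
    assume "?A ` {..<QS} = comp e (ey e) \<and> ?B ` {..<QT} = comp e (ex e)"
    then have "v \<in> ?A ` {..<QS}" "u \<in> ?B ` {..<QT}" using uv by auto
    moreover have "dd v u = cw e" using uv dd_sym comp_lt by metis
    ultimately show ?thesis by auto
  qed
qed

end

text \<open>Memory contents agree with the geometric quantities only at genuine vertices, and all
  examined pairs consist of such.\<close>

lemma eff_cong:
  assumes e: "eff \<epsilon> \<tau> D f J p \<beta> b \<beta>' b'" and N: "\<And>j. j \<in> J \<Longrightarrow> fst (p j) < N \<and> snd (p j) < N"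
    and f: "\<And>v. v < N \<Longrightarrow> f v = f' v" and D: "\<And>u v. u < N \<Longrightarrow> v < N \<Longrightarrow> D u v = D' u v"
  shows "eff \<epsilon> \<tau> D' f' J p \<beta> b \<beta>' b'"
proof -
  have 1: "D' (fst (p j)) (snd (p j)) = D (fst (p j)) (snd (p j))" "f' (fst (p j)) = f (fst (p j))" "f' (snd (p j)) = f (snd (p j))"
    if "j \<in> J" for j using N[OF that] f D by auto
  have 2: "{j \<in> J. badpair \<epsilon> \<tau> D' f' (p j)} = {j \<in> J. badpair \<epsilon> \<tau> D f (p j)}"
    using 1 by (auto simp: badpair_def)
  show ?thesis using e 1 unfolding eff_def 2 by simp
qed

text \<open>The budget never grows, so if some is left at the end it was never exhausted, and every
  edge delivers its verdict on all its pairs.\<close>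

lemma eff_chain:
  assumes "0 \<le> \<tau>" "\<And>e. e < m \<Longrightarrow> eff \<epsilon> \<tau> D f (J e) (p e) (\<beta> e) (bb e) (\<beta>' e) (bb (Suc e))"
  shows "bb m \<le> bb 0 \<and>
    real (bb 0) - real (bb m) \<le> (\<Sum>e<m. real (card {j \<in> J e. badpair \<epsilon> \<tau> D f (p e j)})) + (\<Sum>e<m. Lam \<epsilon> (\<beta>' e) - Lam \<epsilon> (\<beta> e)) \<and>
    (bb m = 0 \<or> (\<forall>e<m. \<forall>j\<in>J e. f (snd (p e j)) < f (fst (p e j)) + \<tau> * \<beta>' e \<or> D (fst (p e j)) (snd (p e j)) \<le> \<beta>' e))"
  using assms(2)
proof (induction m)
  case (Suc m)
  have IH: "bb m \<le> bb 0"
    "real (bb 0) - real (bb m) \<le> (\<Sum>e<m. real (card {j \<in> J e. badpair \<epsilon> \<tau> D f (p e j)})) + (\<Sum>e<m. Lam \<epsilon> (\<beta>' e) - Lam \<epsilon> (\<beta> e))"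
    "bb m = 0 \<or> (\<forall>e<m. \<forall>j\<in>J e. f (snd (p e j)) < f (fst (p e j)) + \<tau> * \<beta>' e \<or> D (fst (p e j)) (snd (p e j)) \<le> \<beta>' e)"
    using Suc.IH Suc.prems by simp_all
  have e: "bb (Suc m) \<le> bb m"
    "real (bb m) - real (bb (Suc m)) \<le> real (card {j \<in> J m. badpair \<epsilon> \<tau> D f (p m j)}) + Lam \<epsilon> (\<beta>' m) - Lam \<epsilon> (\<beta> m)"
    "bb (Suc m) = 0 \<or> (\<forall>j\<in>J m. f (snd (p m j)) < f (fst (p m j)) + \<tau> * \<beta>' m \<or> D (fst (p m j)) (snd (p m j)) \<le> \<beta>' m)"
    using Suc.prems[of m] by (simp_all add: eff_def)
  show ?case
  proof (intro conjI)
    show "bb (Suc m) = 0 \<or> (\<forall>e<Suc m. \<forall>j\<in>J e. f (snd (p e j)) < f (fst (p e j)) + \<tau> * \<beta>' e \<or> D (fst (p e j)) (snd (p e j)) \<le> \<beta>' e)"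
    proof (cases "bb (Suc m) = 0")
      case False
      then have "bb m \<noteq> 0" using e(1) by simp
      then show ?thesis using IH(3) e(3) False by (auto simp: less_Suc_eq)
    qed simp
  qed (use IH e in auto)
qed simp

context ram_tree
begin

definition prj :: "ipart \<Rightarrow> rpart \<Rightarrow> nat \<Rightarrow> nat \<Rightarrow> nat \<Rightarrow> nat \<Rightarrow> real" where
  "prj I R L K org v = (\<Sum>q<L. R 1 (v * d + q div K) * (2 * real (I aBit (org + q)) - 1))"

definition prs :: "ipart \<Rightarrow> nat \<Rightarrow> nat \<times> nat \<Rightarrow> nat \<times> nat" where
  "prs I e = (\<lambda>(a, b). (I aArr (I aQA e * n + a), I aArr (I aQB e * n + b)))"

definition idx :: "ipart \<Rightarrow> nat \<Rightarrow> (nat \<times> nat) set" where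
  "idx I e = {..<I aQS e} \<times> {..<I aQT e}"

text \<open>Neither clause mentions the best distances, which depend on earlier repetitions. The
  event is thus decided by the coins of one repetition alone, and different repetitions are
  independent.\<close>

definition goodrep :: "real \<Rightarrow> real \<Rightarrow> real \<Rightarrow> nat \<Rightarrow> nat \<Rightarrow> nat \<Rightarrow> nat \<Rightarrow> ipart \<Rightarrow> rpart \<Rightarrow> nat \<Rightarrow> bool" where
  "goodrep \<epsilon> \<tau> \<alpha> S m L K I R \<rho> \<longleftrightarrow>
     (\<forall>e<E. \<forall>j\<in>idx I e. \<exists>i<m. prj I R L K ((\<rho> * m + i) * L) (fst (prs I e j)) + \<tau> / \<alpha> * dd (fst (prs I e j)) (snd (prs I e j))
        \<le> prj I R L K ((\<rho> * m + i) * L) (snd (prs I e j))) \<and>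
     (\<Sum>i<m. \<Sum>e<E. card {j \<in> idx I e. badpair \<epsilon> \<tau> dd (prj I R L K ((\<rho> * m + i) * L)) (prs I e j)}) \<le> S"

definition recd_all :: "ipart \<Rightarrow> bool" where
  "recd_all I \<longleftrightarrow> (\<forall>e<E. recd e (I aSz) (I aArr) (I aQA e) (I aQS e) (I aQB e) (I aQT e)) \<and> (\<forall>B<n. I aSz B \<le> n)"

definition coords :: "rpart \<Rightarrow> bool" where
  "coords R \<longleftrightarrow> (\<forall>v<n. \<forall>j<d. R 1 (v * d + j) = pts ! v ! j)"

lemma dst_eq_dd: "coords R \<Longrightarrow> u < n \<Longrightarrow> v < n \<Longrightarrow> dst R d u v = dd u v"
  by (simp add: dst_def dd_def l2_def L2_set_def length_pt coords_def)

text \<open>Steps for one projection with its sorts and searches, apart from the examined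
  candidates, which are paid for by the budget.\<close>

definition iter_cost :: "nat \<Rightarrow> nat \<Rightarrow> nat" where
  "iter_cost L h = 9 + n * (3 * L + 6) + (h + 2) * (16 * (n + n * h) + 20 * n) + 6 * n + n * h * (20 + 9 * h)"

text \<open>In a good repetition the spending is at most S plus the total potential, hence below B0.
  With budget left, consider the projection that hits the furthest pair of e: either the cut weight
  is at most the best distance, or the pair fell below the threshold, so that \<tau> / \<alpha> * cw
  e < \<tau> * best.\<close>

lemma ok_MAIN:
  fixes \<epsilon> \<tau> \<alpha> :: real
  assumes inp: "edges_in I" "coords R" and rc: "recd_all I" "(\<Sum>e<E. I aQS e) \<le> n * h" "(\<Sum>B<n. I aSz B) \<le> n + n * h"
    and v: "I vK 0 = K" "I vL 0 = L" "I vm 0 = m" "I vrm 0 = reps" "I vbud0 0 = B0" "I vW 0 = n * n" "I vE 0 = E"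
    and T: "R rT 0 = \<tau>" "E > 0 \<Longrightarrow> 0 < \<tau>" "0 \<le> \<tau>" and \<epsilon>: "0 < \<epsilon>" and \<alpha>: "1 \<le> \<alpha>"
    and best: "\<And>e. e < E \<Longrightarrow> R aBest e = wt e"
    and b: "3 * n \<le> M" "4 * 2 ^ h \<le> M" "(h + 2) * (n * n) \<le> M" "d \<le> M" "L \<le> M" "m \<le> M" "reps \<le> M" "B0 \<le> M"
      "reps * m * L \<le> M" "n \<le> 2 ^ h"
    and B0: "real S + (\<Sum>e<E. Lam \<epsilon> (cw e) - Lam \<epsilon> (wt e)) < real B0"
  shows "ok MAIN I R T0 (\<lambda>I' R' T'. T' \<le> T0 + 2 + reps * (5 + m * iter_cost L h + B0 * (3 * d + 14)) \<and>
    (\<forall>e<E. wt e \<le> R' aBest e \<and> R' aBest e \<le> cw e) \<and>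
    ((\<exists>\<rho><reps. goodrep \<epsilon> \<tau> \<alpha> S m L K I R \<rho>) \<longrightarrow> (\<forall>e<E. cw e \<le> \<alpha> * R' aBest e)))"
proof -
  have n0: "I 0 0 = n" "I 0 1 = d" using inp by (auto simp: edges_in_def)
  have En: "E \<le> n" using E_eq by simp
  have pairs: "fst (prs I e j) < n \<and> snd (prs I e j) < n \<and> dd (fst (prs I e j)) (snd (prs I e j)) \<le> cw e"
    if "e < E" "j \<in> idx I e" for e j
    using recd_pairs(1)[of e "I aSz" "I aArr"] rc(1) that by (auto simp: recd_all_def idx_def prs_def)
  have nn: "n * n \<le> M"
  proof -
    have "1 * (n * n) \<le> (h + 2) * (n * n)" by (intro mult_le_mono1) simp
    then show ?thesis using b(3) by linarith
  qed
  let ?f = "\<lambda>\<rho> i. prj I R L K ((\<rho> * m + i) * L)"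
  let ?bad = "\<lambda>\<rho> i e. card {j \<in> idx I e. badpair \<epsilon> \<tau> dd (?f \<rho> i) (prs I e j)}"
  let ?done = "\<lambda>\<rho> i R' e. \<forall>j\<in>idx I e. ?f \<rho> i (snd (prs I e j)) < ?f \<rho> i (fst (prs I e j)) + \<tau> * R' aBest e \<or>
      dd (fst (prs I e j)) (snd (prs I e j)) \<le> R' aBest e"
  let ?C = "5 + m * iter_cost L h + B0 * (3 * d + 14)"
  define P where "P \<rho> I' R' T' \<longleftrightarrow> T' \<le> T0 + 1 + \<rho> * ?C \<and> (\<forall>e<E. wt e \<le> R' aBest e \<and> R' aBest e \<le> cw e) \<and>
    ((\<exists>\<rho>'<\<rho>. goodrep \<epsilon> \<tau> \<alpha> S m L K I R \<rho>') \<longrightarrow> (\<forall>e<E. cw e \<le> \<alpha> * R' aBest e))"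
    for \<rho> :: nat and I' :: ipart and R' :: rpart and T' :: nat
  show ?thesis
    unfolding MAIN_def
    apply (rule ok_For[where len = reps and P = P])
    subgoal by simp
    subgoal using v by simp
    subgoal using b by simp
    subgoal unfolding P_def using best wt_le_cw by simp
    subgoal premises p for \<rho> I1 R1 T1
    proof -
      define PP where "PP i I' R' T' \<longleftrightarrow> T' + I' vbud 0 * (3 * d + 14) \<le> T1 + 3 + i * iter_cost L h + B0 * (3 * d + 14) \<and>
          (\<forall>e<E. wt e \<le> R' aBest e \<and> R' aBest e \<le> cw e \<and> R1 aBest e \<le> R' aBest e) \<and> I' vbud 0 \<le> B0 \<and>
          real B0 - real (I' vbud 0) \<le> real (\<Sum>i'<i. \<Sum>e<E. ?bad \<rho> i' e) + (\<Sum>e<E. Lam \<epsilon> (R' aBest e) - Lam \<epsilon> (wt e)) \<and>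
          (I' vbud 0 = 0 \<or> (\<forall>i'<i. \<forall>e<E. ?done \<rho> i' R' e))"
        for i :: nat and I' :: ipart and R' :: rpart and T' :: nat
      have f1: "I1 0 = I 0" "I1 aQB = I aQB" "I1 aQA = I aQA" "I1 aQS = I aQS" "I1 aQT = I aQT" "I1 aArr = I aArr"
          "I1 vW = I vW" "I1 vE = I vE" "I1 aSz = I aSz" "I1 vK = I vK" "I1 vL = I vL" "I1 vm = I vm" "I1 vbud0 = I vbud0"
          "I1 aBit = I aBit" "I1 vrep 0 = \<rho>" using p(3,5) by auto
      have r1: "R1 (Suc 0) = R (Suc 0)" "R1 rT = R rT" using p(6) by auto
      have p2: "\<And>e. e < E \<Longrightarrow> wt e \<le> R1 aBest e \<and> R1 aBest e \<le> cw e" using p(2) by (simp add: P_def)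
      show ?thesis
        apply (intro ok_Seq ok_IWrite)
        subgoal using f1 v b by simp
        apply (rule ok_For[where len = m and P = PP])
        subgoal by simp
        subgoal using f1 v by simp
        subgoal using b by simp
        subgoal
        proof -
          \<comment> \<open>The potential is counted from \<open>wt e\<close> instead of the best
            distance at the start of the repetition; by monotonicity this only weakens the bound on
            the spending.\<close>
          have "0 \<le> (\<Sum>e<E. Lam \<epsilon> (R1 aBest e) - Lam \<epsilon> (wt e))"
            using p2 wt_pos \<epsilon> by (intro sum_nonneg) (auto intro!: Lam_mono)
          then show ?thesis unfolding PP_def using p2 f1 v by simp
        qed
        subgoal premises s for i I2 R2 T2
        proof -
          have f2: "I2 0 = I 0" "I2 aQB = I aQB" "I2 aQA = I aQA" "I2 aQS = I aQS" "I2 aQT = I aQT" "I2 aArr = I aArr"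
              "I2 vW = I vW" "I2 vE = I vE" "I2 aSz = I aSz" "I2 vK = I vK" "I2 vL = I vL" "I2 vm = I vm"
              "I2 aBit = I aBit" "I2 vrep 0 = \<rho>" "I2 vi 0 = i" using s(3,5) f1 by auto
          have r2: "R2 (Suc 0) = R (Suc 0)" "R2 rT = R rT" using s(6) r1 by auto
          have s2: "T2 + I2 vbud 0 * (3 * d + 14) \<le> T1 + 3 + i * iter_cost L h + B0 * (3 * d + 14)"
              "\<And>e. e < E \<Longrightarrow> wt e \<le> R2 aBest e \<and> R2 aBest e \<le> cw e \<and> R1 aBest e \<le> R2 aBest e" "I2 vbud 0 \<le> B0"
              "real B0 - real (I2 vbud 0) \<le> real (\<Sum>i'<i. \<Sum>e<E. ?bad \<rho> i' e) + (\<Sum>e<E. Lam \<epsilon> (R2 aBest e) - Lam \<epsilon> (wt e))"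
              "I2 vbud 0 = 0 \<or> (\<forall>i'<i. \<forall>e<E. ?done \<rho> i' R2 e)"
            using s(2) unfolding PP_def by blast+
          have "\<rho> * m + i \<le> Suc \<rho> * m" using s(1) by simp
          also have "\<dots> \<le> reps * m" using p(1) by (intro mult_le_mono1) simp
          finally have "(\<rho> * m + i) * L \<le> reps * m * L" by (rule mult_le_mono1)
          then have orgM: "(\<rho> * m + i) * L \<le> M" using b(9) by linarith
          have posw: "0 < R2 aBest e" if "e < E" for e using s2(2)[OF that] wt_pos[OF that] by linarith
          have iM: "I2 aArr x \<le> M" for x using s(4) by (simp add: bnd_def)
          show ?thesis
            apply (intro ok_Seq)
            apply (rule ok_conseq[OF ok_PROJECT[where n = n and d = d and K = K and L = L and m = m]])
            subgoal using f2 n0 by simp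
            subgoal using f2 n0 by simp
            subgoal using f2 v by simp
            subgoal using f2 v by simp
            subgoal using f2 v by simp
            subgoal using b by simp
            subgoal by (rule b)
            subgoal using orgM f2 by simp
            subgoal premises t for I3 R3 T3
            proof -
              have f3: "I3 0 = I 0" "I3 aQB = I aQB" "I3 aQA = I aQA" "I3 aQS = I aQS" "I3 aQT = I aQT" "I3 aArr = I aArr"
                  "I3 vW = I vW" "I3 vE = I vE" "I3 aSz = I aSz" "I3 vbud = I2 vbud" using t(3) f2 by auto
              have r3: "R3 (Suc 0) = R (Suc 0)" "R3 rT = R rT" "R3 aBest = R2 aBest" using t(4) r2 by auto
              have val: "R3 aVal x = ?f \<rho> i x" if "x < n" for x
                using t(1) that by (simp add: prj_def f2 r2)
              show ?thesis
                apply (rule ok_Seq)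
                apply (rule ok_conseq[OF ok_SORTALL[where n = n and h = h]])
                subgoal using f3 n0 by simp
                subgoal using n_pos by simp
                subgoal by (rule b)
                subgoal using f3 v by simp
                subgoal using f3 rc(1) by (simp add: recd_all_def)
                subgoal by (rule b)
                subgoal using b(3) by simp
                subgoal using M by simp
                subgoal premises x for I4 R4 T4
                proof -
                  have f4: "I4 0 = I 0" "I4 aQB = I aQB" "I4 aQA = I aQA" "I4 aQS = I aQS" "I4 aQT = I aQT" "I4 aArr = I aArr"
                      "I4 vW = I vW" "I4 vE = I vE" "I4 aSz = I aSz" "I4 vbud = I2 vbud" using x(3) f3 by auto
                  have r4: "R4 (Suc 0) = R (Suc 0)" "R4 rT = R rT" "R4 aBest = R2 aBest" "R4 aVal = R3 aVal" using x(4) r3 by auto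
                  have q: "I aQB e < n \<and> I aQS e \<le> n \<and> I aQT e \<le> I aSz (I aQB e) \<and> I aSz (I aQB e) \<le> n" if "e < E" for e
                    using rc(1) that unfolding recd_all_def recd_def by (meson le_trans)
                  show ?thesis
                    apply (rule ok_conseq[OF ok_SEARCH[where n = n and d = d and \<tau> = \<tau> and \<epsilon> = \<epsilon> and E = E and h = h]])
                    subgoal using f4 n0 by simp
                    subgoal using f4 n0 by simp
                    subgoal by (rule b)
                    subgoal using r4 T by simp
                    subgoal by (rule T)
                    subgoal by (rule \<epsilon>)
                    subgoal using f4 v by simp
                    subgoal using f4 v by simp
                    subgoal using En b by simp
                    subgoal by (rule b)
                    subgoal using b by simp
                    subgoal by (rule nn)
                    subgoal using q f4 by simp
                    subgoal by (rule b)
                    subgoal by (rule b)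
                    subgoal using x(1) by (simp add: f4 f3 r4)
                    subgoal using posw r4 by simp
                    subgoal premises y for I5 R5 T5
                    proof -
                      obtain bb where bb: "bb 0 = I2 vbud 0" "bb E = I5 vbud 0"
                          "\<And>e. e < E \<Longrightarrow> eff \<epsilon> \<tau> (dst R4 d) (R4 aVal) (idx I e) (prs I e) (R2 aBest e) (bb e) (R5 aBest e) (bb (Suc e))"
                        using y(1) unfolding f4 r4 idx_def prs_def by blast
                      have eff: "eff \<epsilon> \<tau> dd (?f \<rho> i) (idx I e) (prs I e) (R2 aBest e) (bb e) (R5 aBest e) (bb (Suc e))" if "e < E" for e
                      proof (rule eff_cong[OF bb(3)[OF that], where N = n])
                        show "fst (prs I e j) < n \<and> snd (prs I e j) < n" if "j \<in> idx I e" for j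
                          using pairs[OF \<open>e < E\<close> that] by simp
                        show "R4 aVal v = ?f \<rho> i v" if "v < n" for v using val[OF that] r4 by simp
                        show "dst R4 d u v = dd u v" if "u < n" "v < n" for u v
                          using dst_eq_dd[of R4] that inp(2) r4 by (simp add: coords_def)
                      qed
                      note ch = eff_chain[OF T(3), of E \<epsilon> dd "?f \<rho> i" "idx I" "prs I" "R2 aBest" bb "R5 aBest", OF eff]
                      have up: "R2 aBest e \<le> R5 aBest e" "R5 aBest e \<le> cw e" if "e < E" for e
                      proof -
                        show "R2 aBest e \<le> R5 aBest e" using eff[OF that] by (simp add: eff_def)
                        have "\<forall>j\<in>idx I e. dd (fst (prs I e j)) (snd (prs I e j)) \<le> cw e" using pairs[OF that] by blast
                        then show "R5 aBest e \<le> cw e" using eff[OF that] s2(2)[OF that] unfolding eff_def by blast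
                      qed
                      have sumL: "(\<Sum>e<E. Lam \<epsilon> (R5 aBest e) - Lam \<epsilon> (wt e)) =
                          (\<Sum>e<E. Lam \<epsilon> (R5 aBest e) - Lam \<epsilon> (R2 aBest e)) + (\<Sum>e<E. Lam \<epsilon> (R2 aBest e) - Lam \<epsilon> (wt e))"
                        by (simp add: sum.distrib[symmetric])
                      have done': "?done \<rho> i' R5 e" if "?done \<rho> i' R2 e" "e < E" for i' e
                      proof
                        fix j assume j: "j \<in> idx I e"
                        have "\<tau> * R2 aBest e \<le> \<tau> * R5 aBest e" using up(1)[OF that(2)] T(3) by (intro mult_left_mono)
                        then show "?f \<rho> i' (snd (prs I e j)) < ?f \<rho> i' (fst (prs I e j)) + \<tau> * R5 aBest e \<or>
                            dd (fst (prs I e j)) (snd (prs I e j)) \<le> R5 aBest e"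
                          using bspec[OF that(1) j] up(1)[OF that(2)] by linarith
                      qed
                      have dn: "I5 vbud 0 = 0 \<or> (\<forall>i'<Suc i. \<forall>e<E. ?done \<rho> i' R5 e)"
                      proof (cases "I5 vbud 0 = 0")
                        case False
                        then have "I2 vbud 0 \<noteq> 0" using ch bb by simp
                        then have old: "\<forall>i'<i. \<forall>e<E. ?done \<rho> i' R2 e" using s2(5) by simp
                        have "\<forall>e<E. ?done \<rho> i R5 e" using ch False bb(2) by simp
                        then show ?thesis using old done' by (auto simp: less_Suc_eq)
                      qed simp
                      have cnt: "real B0 - real (I5 vbud 0) \<le> real (\<Sum>i'<Suc i. \<Sum>e<E. ?bad \<rho> i' e) + (\<Sum>e<E. Lam \<epsilon> (R5 aBest e) - Lam \<epsilon> (wt e))"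
                        using s2(4) ch bb(1,2) unfolding sumL by simp
                      have "(\<Sum>e<E. 6 + I aQS e * (20 + 9 * h)) = 6 * E + (\<Sum>e<E. I aQS e) * (20 + 9 * h)"
                        by (simp add: sum.distrib sum_distrib_right)
                      also have "\<dots> \<le> 6 * n + n * h * (20 + 9 * h)" using rc(2) En by (intro add_mono mult_le_mono) auto
                      finally have c1: "(\<Sum>e<E. 6 + I aQS e * (20 + 9 * h)) \<le> 6 * n + n * h * (20 + 9 * h)" .
                      have c2: "(h + 2) * (16 * (\<Sum>B<n. I aSz B) + 20 * n) \<le> (h + 2) * (16 * (n + n * h) + 20 * n)"
                        using rc(3) by (intro mult_le_mono2) simp
                      have c3: "T5 + I5 vbud 0 * (3 * d + 14) \<le> T4 + 2 + (\<Sum>e<E. 6 + I aQS e * (20 + 9 * h)) + I2 vbud 0 * (3 * d + 14)"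
                        using y(1) by (simp add: f4)
                      have c4: "T4 \<le> T3 + 2 + (h + 2) * (16 * (\<Sum>B<n. I aSz B) + 20 * n)" using x(1) by (simp add: f3)
                      have c5: "T3 \<le> Suc T2 + 3 + n * (3 * L + 6)" using t(1) by simp
                      have "Suc T5 + I5 vbud 0 * (3 * d + 14) \<le> T2 + I2 vbud 0 * (3 * d + 14) + iter_cost L h"
                        unfolding iter_cost_def using c1 c2 c3 c4 c5 by linarith
                      then have time: "Suc T5 + I5 vbud 0 * (3 * d + 14) \<le> T1 + 3 + Suc i * iter_cost L h + B0 * (3 * d + 14)"
                        using s2(1) by simp
                      have bl: "I5 vbud 0 \<le> B0" using ch bb s2(3) by linarith
                      have mono: "wt e \<le> R5 aBest e \<and> R5 aBest e \<le> cw e \<and> R1 aBest e \<le> R5 aBest e" if "e < E" for e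
                        using up[OF that] s2(2)[OF that] by linarith
                      show ?thesis
                        unfolding PP_def using time mono bl cnt dn by simp
                    qed
                    done
                qed
                done
            qed
            done
        qed
        subgoal premises s for I2 R2 T2
        proof -
          have s2: "T2 + I2 vbud 0 * (3 * d + 14) \<le> T1 + 3 + m * iter_cost L h + B0 * (3 * d + 14)"
              "\<And>e. e < E \<Longrightarrow> wt e \<le> R2 aBest e \<and> R2 aBest e \<le> cw e \<and> R1 aBest e \<le> R2 aBest e" "I2 vbud 0 \<le> B0"
              "real B0 - real (I2 vbud 0) \<le> real (\<Sum>i'<m. \<Sum>e<E. ?bad \<rho> i' e) + (\<Sum>e<E. Lam \<epsilon> (R2 aBest e) - Lam \<epsilon> (wt e))"
              "I2 vbud 0 = 0 \<or> (\<forall>i'<m. \<forall>e<E. ?done \<rho> i' R2 e)"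
            using s(1) unfolding PP_def by blast+
          have good: "cw e \<le> \<alpha> * R2 aBest e" if g: "goodrep \<epsilon> \<tau> \<alpha> S m L K I R \<rho>" and e: "e < E" for e
          proof -
            have "(\<Sum>e<E. Lam \<epsilon> (R2 aBest e) - Lam \<epsilon> (wt e)) \<le> (\<Sum>e<E. Lam \<epsilon> (cw e) - Lam \<epsilon> (wt e))"
            proof (rule sum_mono)
              fix e assume "e \<in> {..<E}"
              then have "Lam \<epsilon> (R2 aBest e) \<le> Lam \<epsilon> (cw e)"
                using s2(2)[of e] wt_pos[of e] \<epsilon> by (intro Lam_mono) auto
              then show "Lam \<epsilon> (R2 aBest e) - Lam \<epsilon> (wt e) \<le> Lam \<epsilon> (cw e) - Lam \<epsilon> (wt e)" by simp
            qed
            moreover have "real (\<Sum>i'<m. \<Sum>e<E. ?bad \<rho> i' e) \<le> real S"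
              using g unfolding goodrep_def of_nat_le_iff by blast
            ultimately have "0 < real (I2 vbud 0)" using s2(4) B0 by linarith
            then have dn: "\<And>i'. i' < m \<Longrightarrow> ?done \<rho> i' R2 e" using s2(5) e by simp
            have "recd e (I aSz) (I aArr) (I aQA e) (I aQS e) (I aQB e) (I aQT e)" using rc(1) e by (simp add: recd_all_def)
            from recd_pairs(2)[OF this e] obtain a b where ab: "a < I aQS e" "b < I aQT e"
                "dd (I aArr (I aQA e * n + a)) (I aArr (I aQB e * n + b)) = cw e" by blast
            have j: "(a, b) \<in> idx I e" "dd (fst (prs I e (a, b))) (snd (prs I e (a, b))) = cw e"
              using ab by (auto simp: idx_def prs_def)
            from g e j(1) obtain i where i: "i < m"
                "?f \<rho> i (fst (prs I e (a, b))) + \<tau> / \<alpha> * cw e \<le> ?f \<rho> i (snd (prs I e (a, b)))"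
              unfolding goodrep_def j(2)[symmetric] by blast
            have bp: "0 < R2 aBest e" using s2(2)[OF e] wt_pos[OF e] by linarith
            have \<tau>p: "0 < \<tau>" by (rule T(2)) (rule le_less_trans[OF le0 e])
            from bspec[OF dn[OF i(1)] j(1)] show ?thesis
            proof
              assume "?f \<rho> i (snd (prs I e (a, b))) < ?f \<rho> i (fst (prs I e (a, b))) + \<tau> * R2 aBest e"
              then have "\<tau> / \<alpha> * cw e < \<tau> * R2 aBest e" using i(2) by linarith
              then have "\<tau> * cw e < \<tau> * (\<alpha> * R2 aBest e)" using \<alpha> by (simp add: field_simps)
              then show ?thesis using \<tau>p by simp
            next
              assume "dd (fst (prs I e (a, b))) (snd (prs I e (a, b))) \<le> R2 aBest e"
              moreover have "1 * R2 aBest e \<le> \<alpha> * R2 aBest e" using \<alpha> bp by (intro mult_right_mono) auto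
              ultimately show ?thesis using j(2) by simp
            qed
          qed
          have "cw e \<le> \<alpha> * R2 aBest e" if "\<rho>' < Suc \<rho>" "goodrep \<epsilon> \<tau> \<alpha> S m L K I R \<rho>'" "e < E" for \<rho>' e
          proof (cases "\<rho>' = \<rho>")
            case True
            then show ?thesis using good that by simp
          next
            case False
            then have "\<rho>' < \<rho>" using that by simp
            then have "cw e \<le> \<alpha> * R1 aBest e" using p(2) that unfolding P_def by blast
            also have "\<dots> \<le> \<alpha> * R2 aBest e" using s2(2)[OF that(3)] \<alpha> by (intro mult_left_mono) auto
            finally show ?thesis .
          qed
          moreover have "Suc (Suc T2) \<le> T0 + 1 + Suc \<rho> * ?C"
          proof -
            have "T1 \<le> T0 + 1 + \<rho> * ?C" using p(2) by (simp add: P_def)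
            moreover have "T2 \<le> T1 + 3 + m * iter_cost L h + B0 * (3 * d + 14)" using s2(1) by linarith
            moreover have "Suc \<rho> * ?C = \<rho> * ?C + ?C" by simp
            ultimately show ?thesis by linarith
          qed
          ultimately show ?thesis using s2(2) unfolding P_def by (auto simp del: mult_Suc)
        qed
        done
    qed
    subgoal unfolding P_def by auto
    done
qed

lemma ok_SCALE:
  assumes "I vE 0 = E" "E \<le> M" "R 0 0 = \<alpha>"
  shows "ok SCALE I R T0 (\<lambda>I' R' T'. T' \<le> T0 + 2 + 3 * E \<and> (\<forall>e<E. R' aBest e = \<alpha> * R aBest e))"
  unfolding SCALE_def
  apply (rule ok_For[where len = E and P = "\<lambda>k I' R' T'. T' = T0 + 1 + 3 * k \<and>
     (\<forall>e. R' aBest e = (if e < k then \<alpha> * R aBest e else R aBest e))"])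
  subgoal by simp
  subgoal using assms by simp
  subgoal using assms by simp
  subgoal by simp
  subgoal premises p for k I' R' T'
    apply (rule ok_RWrite)
    using p(1,2,3) assms p(6)[of 0] by auto
  subgoal by simp
  done

end

section \<open>Success probability\<close>

definition rademacher :: "nat \<Rightarrow> nat \<Rightarrow> (nat \<Rightarrow> nat \<Rightarrow> real) \<Rightarrow> (nat \<Rightarrow> bool) \<Rightarrow> nat \<Rightarrow> real" where
  "rademacher d K x b v = (\<Sum>q<d * K. x v (q div K) * sgb (b q))"

lemma sum_div: "(\<Sum>q<d * K. f (q div K)) = real K * (\<Sum>j<d. f j :: real)"
proof -
  have "(\<Sum>q\<in>{j * K..<j * K + K}. f (q div K)) = real K * f j" for j
  proof -
    have "q div K = j" if "q \<in> {j * K..<j * K + K}" for q using that by (intro div_nat_eqI) (auto simp: algebra_simps)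
    then have "(\<Sum>q\<in>{j * K..<j * K + K}. f (q div K)) = (\<Sum>q\<in>{j * K..<j * K + K}. f j)" by (intro sum.cong) auto
    then show ?thesis by simp
  qed
  then show ?thesis using sum.nat_group[of "\<lambda>q. f (q div K)" K d] by (simp add: sum_distrib_left)
qed

context
  fixes d K :: nat and x :: "nat \<Rightarrow> nat \<Rightarrow> real" and u v :: nat and D :: real
  assumes D: "D = sqrt (\<Sum>j<d. (x v j - x u j)\<^sup>2)" and Dp: "0 < D" and K: "0 < K"
begin

abbreviation (input) gap where "gap q \<equiv> x v (q div K) - x u (q div K)"

lemma rademacher_diff: "rademacher d K x b v - rademacher d K x b u = (\<Sum>q<d * K. gap q * sgb (b q))"
  by (simp add: rademacher_def sum_subtractf left_diff_distrib)

lemma gap_squares: "(\<Sum>q<d * K. (gap q)\<^sup>2) = real K * D\<^sup>2"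
  using sum_div[of "\<lambda>j. (x v j - x u j)\<^sup>2"] by (simp add: D sum_nonneg)

text \<open>The purpose of splitting coordinates: every squared coefficient is at most D^2, a
  fraction 1 / K of the total K * D^2, which is the smallness that \<open>avg_tail_ge\<close>
  demands.\<close>

lemma gap_le: "q < d * K \<Longrightarrow> (gap q)\<^sup>2 \<le> real K * D\<^sup>2 / real K"
proof -
  assume "q < d * K"
  then have "q div K < d" by (simp add: less_mult_imp_div_less)
  then have "(gap q)\<^sup>2 \<le> (\<Sum>j<d. (x v j - x u j)\<^sup>2)"
    by (intro member_le_sum[of "q div K" _ "\<lambda>j. (x v j - x u j)\<^sup>2"]) auto
  then show ?thesis using K by (simp add: D sum_nonneg)
qed

lemma rademacher_tail_le:
  assumes "0 \<le> a"
  shows "avg (d * K) (\<lambda>b. of_bool (rademacher d K x b u + a * sqrt K * D \<le> rademacher d K x b v)) \<le> exp (- (a\<^sup>2 / 2))"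
proof -
  have "rademacher d K x b u + a * sqrt K * D \<le> rademacher d K x b v \<longleftrightarrow> a * sqrt K * D \<le> (\<Sum>q<d * K. gap q * sgb (b q))" for b
    using rademacher_diff[of b] by linarith
  moreover have "avg (d * K) (\<lambda>b. of_bool (a * sqrt K * D \<le> (\<Sum>q<d * K. gap q * sgb (b q)))) \<le>
      exp (- (a * sqrt K * D)\<^sup>2 / (2 * (real K * D\<^sup>2)))"
    using assms Dp K by (intro avg_tail_le gap_squares) auto
  moreover have "(a * sqrt K * D)\<^sup>2 / (2 * (real K * D\<^sup>2)) = a\<^sup>2 / 2"
    using Dp K by (simp add: power_mult_distrib)
  ultimately show ?thesis by simp
qed

lemma rademacher_tail_ge:
  assumes h: "1 \<le> h" and t: "0 \<le> t" "t \<le> 4 * h" "t\<^sup>2 / 2 \<le> 8 * h" and Kh: "2 ^ 68 * h ^ 14 \<le> real K"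
  shows "exp (- (t\<^sup>2 / 2)) / (2048 * h\<^sup>2) \<le>
    avg (d * K) (\<lambda>b. of_bool (rademacher d K x b u + t * sqrt K * D \<le> rademacher d K x b v))"
proof -
  have s: "t * sqrt (real K * D\<^sup>2) = t * sqrt K * D" using Dp by (simp add: real_sqrt_mult)
  have "rademacher d K x b u + t * sqrt K * D \<le> rademacher d K x b v \<longleftrightarrow> t * sqrt K * D \<le> (\<Sum>q<d * K. gap q * sgb (b q))" for b
    using rademacher_diff[of b] by linarith
  then show ?thesis
    using avg_tail_ge[OF h t Kh gap_squares _ gap_le] Dp K unfolding s by simp
qed

end

lemma harmonic_bounds:
  assumes n: "1 \<le> n"
  shows "ln n \<le> HH n" "HH n \<le> 1 + ln n"
proof -
  have "HH n = harm n"
    unfolding HH_def by (induction n) (simp_all add: harm_Suc harm_expand(1) inverse_eq_divide add.commute)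
  moreover have "ln (real n) \<le> ln (real n + 1)" using n by simp
  ultimately show "ln n \<le> HH n" using ln_le_harm[of n] by simp
  show "HH n \<le> 1 + ln n" using n
  proof (induction n rule: nat_induct_at_least)
    case (Suc n)
    have "ln (real n / (real n + 1)) \<le> real n / (real n + 1) - 1" using Suc by (intro ln_le_minus_one) simp
    also have "\<dots> = - 1 / (real n + 1)" by (simp add: field_simps)
    finally have "1 / (real n + 1) \<le> ln (real n + 1) - ln (real n)" using Suc by (simp add: ln_div)
    then show ?case using Suc by (simp add: HH_def add.commute)
  qed (simp add: HH_def)
qed

lemma ln_le_hh: "1 \<le> n \<Longrightarrow> ln (real n) \<le> real (hh n)"
proof -
  assume n: "1 \<le> n"
  have "real n \<le> 2 ^ hh n" using hh_ge[of n] by (metis of_nat_le_iff of_nat_numeral of_nat_power)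
  also have "\<dots> \<le> exp 1 ^ hh n" using exp_ge_add_one_self[of 1] by (intro power_mono) auto
  also have "\<dots> = exp (real (hh n))" by (simp flip: exp_of_nat_mult)
  finally have "ln (real n) \<le> ln (exp (real (hh n)))" using n by (subst ln_le_cancel_iff) auto
  then show ?thesis by simp
qed

lemma hh_pos: "2 \<le> n \<Longrightarrow> 1 \<le> hh n"
  using hh_ge[of n] by (cases "hh n") auto

text \<open>From ln (1 + x) \<ge> x - x^2 and a sum of inverse squares of at most 2 follows ln (PP
  \<rho> n) \<ge> \<rho> * HH n - 2; and e^2 \<le> 9.\<close>

lemma exp_HH_le:
  assumes \<rho>: "0 \<le> \<rho>" "\<rho> \<le> 1"
  shows "exp (\<rho> * HH n) \<le> 9 * PP \<rho> n"
proof -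
  \<comment> \<open>Telescoping with 1 / k^2 \<le> 1 / (k - 1) - 1 / k; \<open>max 1 n\<close> takes
    care of n = 0.\<close>
  have "(\<Sum>k<n. 1 / (real k + 1)\<^sup>2) \<le> 2 - 1 / real (max 1 n)"
  proof (induction n)
    case (Suc n)
    show ?case
    proof (cases "n = 0")
      case False
      then have "1 / ((real n + 1) * (real n + 1)) \<le> 1 / (real n * (real n + 1))"
        by (intro divide_left_mono mult_right_mono) auto
      also have "\<dots> = 1 / real n - 1 / (real n + 1)" using False by (simp add: field_simps)
      finally have "1 / (real n + 1)\<^sup>2 \<le> 1 / real n - 1 / (real n + 1)" by (simp add: power2_eq_square)
      then show ?thesis using Suc False by (simp add: max_def add.commute)
    qed simp
  qed simp
  then have sq: "(\<Sum>k<n. 1 / (real k + 1)\<^sup>2) \<le> 2" by (rule order_trans) simp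
  have P: "0 < 1 + \<rho> / (real k + 1)" for k using \<rho> by (simp add: add_pos_nonneg)
  have "\<rho> * HH n - 2 \<le> (\<Sum>k<n. \<rho> / (real k + 1)) - (\<Sum>k<n. 1 / (real k + 1)\<^sup>2)"
    using sq by (simp add: HH_def sum_distrib_left)
  also have "\<dots> \<le> (\<Sum>k<n. ln (1 + \<rho> / (real k + 1)))"
    unfolding sum_subtractf[symmetric]
  proof (rule sum_mono)
    fix k
    have r: "0 \<le> \<rho> / (real k + 1)" "\<rho> / (real k + 1) \<le> 1" using \<rho> by auto
    have "(\<rho> / (real k + 1))\<^sup>2 \<le> (1 / (real k + 1))\<^sup>2" using \<rho> by (intro power_mono divide_right_mono) auto
    then show "\<rho> / (real k + 1) - 1 / (real k + 1)\<^sup>2 \<le> ln (1 + \<rho> / (real k + 1))"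
      using ln_one_plus_pos_lower_bound[OF r] by (simp add: power_divide)
  qed
  also have "\<dots> = ln (PP \<rho> n)" unfolding PP_def by (intro ln_prod[symmetric]) (use P in \<open>auto simp: less_imp_neq[THEN not_sym]\<close>)
  finally have "exp (\<rho> * HH n) \<le> exp (2 + ln (PP \<rho> n))" by simp
  also have "\<dots> = exp 1 ^ 2 * PP \<rho> n" using P by (simp add: exp_add PP_def prod_pos flip: exp_of_nat_mult)
  also have "\<dots> \<le> 3 ^ 2 * PP \<rho> n"
    using P exp_le by (intro mult_right_mono power_mono) (auto simp: PP_def prod_nonneg less_imp_le)
  finally show ?thesis by simp
qed

text \<open>
  The constant is \<open>4 * 2048 * 9 * 3 ^ 6\<close>: the factors come from \<open>rademacher_tail_ge\<close>,
  \<open>exp_HH_le\<close> and the bound \<open>3 ^ 6\<close> on \<open>exp 6\<close>, and 4 makes the product of the hit probability and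
  the number of projections at least \<open>4 * hh n\<close>.
\<close>

lemma good_prob_ge_half:
  fixes J :: "'j set" and p :: "'j \<Rightarrow> nat \<times> nat" and x :: "nat \<Rightarrow> nat \<Rightarrow> real" and D :: "nat \<Rightarrow> nat \<Rightarrow> real"
  defines "\<epsilon> \<equiv> \<lambda>n. 1 / real (hh n)" and "m \<equiv> \<lambda>\<alpha> n. mm (1 / \<alpha>\<^sup>2) 53747712 n"
  assumes n: "2 \<le> n" and \<alpha>: "1 \<le> \<alpha>" and J: "finite J" "card J \<le> n * n * hh n"
    and p: "\<And>z. z \<in> J \<Longrightarrow> fst (p z) < n \<and> snd (p z) < n \<and> 0 < D (fst (p z)) (snd (p z))"
    and D: "\<And>u v. u < n \<Longrightarrow> v < n \<Longrightarrow> D u v = sqrt (\<Sum>j<d. (x v j - x u j)\<^sup>2)"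
  shows "1 / 2 \<le> avg (m \<alpha> n * (d * KK n)) (\<lambda>b. of_bool (
    (\<forall>z\<in>J. \<exists>i<m \<alpha> n. rademacher d (KK n) x (blk (d * KK n) i b) (fst (p z)) + TT n / \<alpha> * D (fst (p z)) (snd (p z))
        \<le> rademacher d (KK n) x (blk (d * KK n) i b) (snd (p z))) \<and>
    (\<Sum>i<m \<alpha> n. card {z \<in> J. badpair (\<epsilon> n) (TT n) D (rademacher d (KK n) x (blk (d * KK n) i b)) (p z)}) \<le> 4 * m \<alpha> n * n * hh n))"
proof -
  define h where "h = real (hh n)"
  define \<rho> where "\<rho> = 1 / \<alpha>\<^sup>2"
  define K where "K = KK n"
  define L where "L = d * K"
  define M where "M = m \<alpha> n"
  define H where "H = HH n"
  define S where "S = 4 * M * n * hh n"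
  define g where "g b v = rademacher d K x b v" for b v
  define hit where "hit b z \<longleftrightarrow> g b (fst z) + TT n / \<alpha> * D (fst z) (snd z) \<le> g b (snd z)" for b z
  define bad where "bad b z \<longleftrightarrow> badpair (\<epsilon> n) (TT n) D (g b) z" for b z
  have h1: "1 \<le> h" using hh_pos[OF n] by (simp add: h_def)
  have \<rho>: "0 \<le> \<rho>" "\<rho> \<le> 1" using \<alpha> by (auto simp: \<rho>_def)
  have Hn: "ln (real n) \<le> H" "H \<le> 2 * h" using harmonic_bounds[of n] ln_le_hh[of n] n h1 by (auto simp: H_def h_def)
  have H0: "0 \<le> H" using Hn n by (intro order_trans[OF _ Hn(1)]) simp
  have Kp: "0 < K" using hh_pos[OF n] by (simp add: K_def KK_def)
  have Kh: "2 ^ 68 * h ^ 14 \<le> real K"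
  proof -
    have "2 ^ 68 * h ^ 14 \<le> 2 ^ 68 * h ^ 16" using h1 by (intro mult_left_mono power_increasing) auto
    then show ?thesis by (simp add: K_def KK_def h_def power_mult_distrib flip: power_mult)
  qed
  have m0: "1 \<le> PP \<rho> n" unfolding PP_def using \<rho> by (intro prod_ge_1) auto
  have Mr: "53747712 * h ^ 3 * PP \<rho> n \<le> real M"
    using real_nat_ceiling_ge[of "real 53747712 * real (hh n) ^ 3 * PP \<rho> n"] by (simp add: M_def m_def mm_def \<rho>_def h_def)
  have Mp: "0 < M"
  proof -
    have "0 < 53747712 * h ^ 3 * PP \<rho> n" using h1 m0 by (intro mult_pos_pos) auto
    then show ?thesis using Mr by linarith
  qed
  \<comment> \<open>The threshold TT n / \<alpha> * D in units of the standard deviation sqrt K *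
    D.\<close>
  define t where "t = (1 + 1 / h) * sqrt (2 * H) / \<alpha>"
  have t2: "t\<^sup>2 / 2 = (1 + 1 / h)\<^sup>2 * (\<rho> * H)" using H0 by (simp add: t_def power_mult_distrib power_divide \<rho>_def)
  have rH: "0 \<le> \<rho> * H" "\<rho> * H \<le> 2 * h"
    using \<rho> H0 Hn mult_right_mono[OF \<rho>(2) H0] by auto
  have hi: "0 < 1 / h" "1 / h \<le> 1" using h1 by auto
  \<comment> \<open>Since \<rho> * H \<le> 2 * h, squaring the slack factor 1 + 1 / h adds at most
    (3 / h) * 2 * h = 6 to the exponent.\<close>
  have t2a: "t\<^sup>2 / 2 \<le> \<rho> * H + 6"
  proof -
    have "(1 + 1 / h)\<^sup>2 * (\<rho> * H) = \<rho> * H + (2 / h + 1 / h * (1 / h)) * (\<rho> * H)"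
      by (simp add: power2_eq_square algebra_simps)
    also have "\<dots> \<le> \<rho> * H + (2 / h + 1 / h * 1) * (2 * h)"
      using rH hi h1 by (intro add_left_mono mult_mono[OF add_left_mono[OF mult_left_mono[OF hi(2)]] rH(2)]) auto
    also have "\<dots> = \<rho> * H + 6" using h1 by (simp add: field_simps)
    finally show ?thesis unfolding t2 .
  qed
  have t2b: "t\<^sup>2 / 2 \<le> 8 * h"
  proof -
    have "(1 + 1 / h)\<^sup>2 * (\<rho> * H) \<le> (1 + 1)\<^sup>2 * (2 * h)"
      using hi rH h1 by (intro mult_mono[OF power_mono[OF add_left_mono[OF hi(2)]] rH(2)]) auto
    then show ?thesis unfolding t2 by simp
  qed
  have t0: "0 \<le> t" using h1 \<alpha> H0 by (simp add: t_def)
  have t4: "t \<le> 4 * h"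
  proof (rule power2_le_imp_le)
    have "t\<^sup>2 \<le> 16 * h" using t2b by simp
    also have "\<dots> \<le> (4 * h)\<^sup>2" using h1 by (simp add: power2_eq_square)
    finally show "t\<^sup>2 \<le> (4 * h)\<^sup>2" .
  qed (use h1 in simp)
  have TTa: "TT n / \<alpha> * y = t * sqrt K * y" for y
    by (simp add: TT_def t_def h_def H_def K_def)
  have TTe: "TT n / (1 + \<epsilon> n) * y = sqrt (2 * H) * sqrt K * y" for y
  proof -
    have "1 + 1 / h \<noteq> 0" using hi by linarith
    then have "A * (1 + 1 / h) * B / (1 + 1 / h) * y = B * A * y" for A B :: real by simp
    then show ?thesis unfolding TT_def \<epsilon>_def H_def K_def h_def[symmetric] .
  qed
  define pr where "pr = exp (- (t\<^sup>2 / 2)) / (2048 * h\<^sup>2)"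
  have hit_ge: "pr \<le> avg L (\<lambda>b. of_bool (hit b z))" if z: "fst z < n" "snd z < n" "0 < D (fst z) (snd z)" for z
    unfolding hit_def g_def TTa pr_def L_def
    by (rule rademacher_tail_ge[OF D[OF z(1,2)] z(3) Kp h1 t0 t4 t2b Kh])
  have bad_le: "avg L (\<lambda>b. of_bool (bad b z)) \<le> 1 / real n" if z: "fst z < n" "snd z < n" "0 < D (fst z) (snd z)" for z
  proof -
    have "avg L (\<lambda>b. of_bool (bad b z)) \<le> exp (- ((sqrt (2 * H))\<^sup>2 / 2))"
      unfolding bad_def badpair_def g_def TTe L_def
      using H0 by (intro rademacher_tail_le[OF D[OF z(1,2)] z(3) Kp]) simp
    also have "\<dots> \<le> exp (- ln (real n))" using Hn H0 by simp
    also have "\<dots> = 1 / real n" using n by (simp add: exp_minus inverse_eq_divide)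
    finally show ?thesis .
  qed
  have pm: "4 * h \<le> pr * real M"
  proof -
    have "exp (t\<^sup>2 / 2) \<le> exp (\<rho> * H) * exp 1 ^ 6"
      using t2a by (simp flip: exp_add exp_of_nat_mult)
    also have "\<dots> \<le> (9 * PP \<rho> n) * 3 ^ 6"
      using exp_HH_le[OF \<rho>, of n] exp_le m0 by (intro mult_mono power_mono) (auto simp: H_def)
    finally have e: "exp (t\<^sup>2 / 2) \<le> 6561 * PP \<rho> n" by simp
    have "4 * h * (2048 * h\<^sup>2) * exp (t\<^sup>2 / 2) \<le> 4 * h * (2048 * h\<^sup>2) * (6561 * PP \<rho> n)"
      using e h1 by (intro mult_left_mono) auto
    also have "\<dots> = 53747712 * h ^ 3 * PP \<rho> n" by (simp add: power3_eq_cube power2_eq_square)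
    also have "\<dots> \<le> real M" by (rule Mr)
    finally show ?thesis using h1 by (simp add: pr_def exp_minus field_simps)
  qed
  have pr01: "pr \<le> 1"
  proof -
    have "exp (- (t\<^sup>2 / 2)) \<le> 1" by simp
    moreover have "1 \<le> 2048 * h\<^sup>2" using one_le_power[OF h1, of 2] by simp
    ultimately show ?thesis unfolding pr_def by (subst divide_le_eq_1) linarith
  qed
  \<comment> \<open>By independence the probability is at most (1 - pr)^M \<le> exp (- 4 * h). Two
    of the four factors exp h are at least n, the other two at least 2.\<close>
  have miss: "avg (M * L) (\<lambda>b. of_bool (\<forall>i<M. \<not> hit (blk L i b) z)) \<le> 1 / (4 * real n * real n)"
    if z: "fst z < n" "snd z < n" "0 < D (fst z) (snd z)" for z
  proof -
    have "avg (M * L) (\<lambda>b. of_bool (\<forall>i<M. \<not> hit (blk L i b) z)) = avg (M * L) (\<lambda>b. \<Prod>i<M. 1 - of_bool (hit (blk L i b) z))"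
    proof (rule avg_cong)
      fix b :: "nat \<Rightarrow> bool"
      show "of_bool (\<forall>i<M. \<not> hit (blk L i b) z) = (\<Prod>i<M. 1 - (of_bool (hit (blk L i b) z) :: real))"
        by (cases "\<forall>i<M. \<not> hit (blk L i b) z") (auto intro!: prod_zero[symmetric])
    qed
    also have "\<dots> = (\<Prod>i<M. avg L (\<lambda>b. 1 - of_bool (hit b z)))" by (rule avg_prod)
    also have "\<dots> \<le> (\<Prod>i<M. 1 - pr)"
    proof (rule prod_mono)
      have s: "avg L (\<lambda>b. 1 - of_bool (hit b z)) + avg L (\<lambda>b. of_bool (hit b z)) = 1"
        unfolding avg_add[symmetric] by simp
      have "avg L (\<lambda>b. 0) \<le> avg L (\<lambda>b. 1 - of_bool (hit b z))" by (rule avg_mono) simp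
      then show "0 \<le> avg L (\<lambda>b. 1 - of_bool (hit b z)) \<and> avg L (\<lambda>b. 1 - of_bool (hit b z)) \<le> 1 - pr" for i
        using s hit_ge[OF z] by simp
    qed
    also have "\<dots> \<le> exp (- pr) ^ M"
      using exp_ge_add_one_self[of "- pr"] pr01 by (simp add: power_mono)
    also have "\<dots> = exp (- (pr * real M))" by (simp add: mult.commute flip: exp_of_nat_mult)
    also have "\<dots> \<le> exp (- (4 * h))" using pm by simp
    also have "\<dots> = 1 / (exp h * exp h * (exp h * exp h))" by (simp add: exp_minus inverse_eq_divide flip: exp_add)
    also have "\<dots> \<le> 1 / ((2 * 2) * (real n * real n))"
    proof -
      have "ln (real n) \<le> h" unfolding h_def using n by (intro ln_le_hh) simp
      then have "exp (ln (real n)) \<le> exp h" by simp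
      then have "real n \<le> exp h" using n by simp
      moreover have "2 \<le> exp h" using exp_ge_add_one_self[of h] h1 by linarith
      ultimately have "(2 * 2) * (real n * real n) \<le> exp h * exp h * (exp h * exp h)" by (intro mult_mono) auto
      then show ?thesis using n by (intro divide_left_mono) auto
    qed
    finally show ?thesis by (simp add: mult.assoc)
  qed
  \<comment> \<open>The union bound runs over distinct vertex pairs, of which there are at most n^2,
    while J may hold the same pair for several edges.\<close>
  define W where "W = p ` J"
  have W: "finite W" "card W \<le> n * n" "\<And>z. z \<in> W \<Longrightarrow> fst z < n \<and> snd z < n \<and> 0 < D (fst z) (snd z)"
  proof -
    show "finite W" using J by (simp add: W_def)
    show w: "fst z < n \<and> snd z < n \<and> 0 < D (fst z) (snd z)" if "z \<in> W" for z using that p by (auto simp: W_def)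
    have "W \<subseteq> {..<n} \<times> {..<n}" using w by (auto simp: mem_Times_iff)
    then show "card W \<le> n * n" using card_mono[of "{..<n} \<times> {..<n}" W] by simp
  qed
  have missing: "avg (M * L) (\<lambda>b. \<Sum>z\<in>W. of_bool (\<forall>i<M. \<not> hit (blk L i b) z)) \<le> 1 / 4"
  proof -
    have "avg (M * L) (\<lambda>b. \<Sum>z\<in>W. of_bool (\<forall>i<M. \<not> hit (blk L i b) z)) =
        (\<Sum>z\<in>W. avg (M * L) (\<lambda>b. of_bool (\<forall>i<M. \<not> hit (blk L i b) z)))" by (rule avg_sum[OF W(1)])
    also have "\<dots> \<le> (\<Sum>z\<in>W. 1 / (4 * real n * real n))" using W(3) by (intro sum_mono miss) auto
    also have "\<dots> \<le> real (n * n) * (1 / (4 * real n * real n))"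
      using W(2) by (simp only: sum_constant) (intro mult_right_mono, auto simp del: of_nat_mult)
    also have "\<dots> = 1 / 4" using n by simp
    finally show ?thesis .
  qed
  define cnt where "cnt b = (\<Sum>i<M. card {z \<in> J. bad (blk L i b) (p z)})" for b
  \<comment> \<open>Linearity of expectation: at most n^2 * h indices, each exceptional with
    probability at most 1 / n in each of the M projections.\<close>
  have cnt: "avg (M * L) (\<lambda>b. real (cnt b)) \<le> real (M * n * hh n)"
  proof -
    have rc: "real (cnt b) = (\<Sum>i<M. \<Sum>z\<in>J. of_bool (bad (blk L i b) (p z)))" for b
      unfolding cnt_def using J(1) by (simp add: sum.If_cases Int_def of_bool_def)
    have "avg (M * L) (\<lambda>b. real (cnt b)) = (\<Sum>i<M. \<Sum>z\<in>J. avg (M * L) (\<lambda>b. of_bool (bad (blk L i b) (p z))))"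
      unfolding rc by (simp only: avg_sum finite_lessThan J(1))
    also have "\<dots> = (\<Sum>i<M. \<Sum>z\<in>J. avg L (\<lambda>b. of_bool (bad b (p z))))"
      by (intro sum.cong refl avg_blk[where F = "\<lambda>b. of_bool (bad b (p _))"]) auto
    also have "\<dots> \<le> (\<Sum>i<M. \<Sum>z\<in>J. 1 / real n)" using p by (intro sum_mono bad_le) auto
    also have "\<dots> = real M * (real (card J) / real n)" by simp
    also have "\<dots> \<le> real M * (real (n * n * hh n) / real n)"
      using J(2) by (intro mult_left_mono divide_right_mono) (auto simp del: of_nat_mult)
    also have "\<dots> = real (M * n * hh n)" using n by simp
    finally show ?thesis .
  qed
  have Sp: "0 < S" using Mp n hh_pos[OF n] by (simp add: S_def)
  define ms where "ms b = (\<Sum>z\<in>W. of_bool (\<forall>i<M. \<not> hit (blk L i b) z) :: real)" for b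
  define succ where "succ b \<longleftrightarrow> (\<forall>z\<in>W. \<exists>i<M. hit (blk L i b) z) \<and> cnt b \<le> S" for b
  \<comment> \<open>Union bound and Markov's inequality in one pointwise estimate. S is four times
    the bound on the mean of \<open>cnt\<close>, so each kind of failure has weight at most 1 /
    4.\<close>
  have "1 - ms b - real (cnt b) * (1 / real S) \<le> of_bool (succ b)" for b
  proof -
    have nn: "0 \<le> ms b" "0 \<le> real (cnt b) * (1 / real S)" by (simp_all add: ms_def sum_nonneg)
    show ?thesis
    proof (cases "succ b")
      case True
      then have "of_bool (succ b) = (1::real)" by simp
      then show ?thesis using nn by linarith
    next
      case False
      then have o: "of_bool (succ b) = (0::real)" by simp
      from False consider z where "z \<in> W" "\<forall>i<M. \<not> hit (blk L i b) z" | "S < cnt b"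
        by (fastforce simp: succ_def not_le)
      then show ?thesis
      proof cases
        case (1 z)
        have "of_bool (\<forall>i<M. \<not> hit (blk L i b) z) \<le> ms b"
          unfolding ms_def using W(1) 1 by (intro member_le_sum) auto
        then have "1 \<le> ms b" using 1(2) by simp
        then show ?thesis using nn o by linarith
      next
        case 2
        then have "1 \<le> real (cnt b) * (1 / real S)" using Sp by simp
        then show ?thesis using nn o by linarith
      qed
    qed
  qed
  then have "avg (M * L) (\<lambda>b. 1 - ms b - real (cnt b) * (1 / real S)) \<le>
      avg (M * L) (\<lambda>b. of_bool (succ b))" by (rule avg_mono)
  moreover have "avg (M * L) (\<lambda>b. 1 - ms b - real (cnt b) * (1 / real S)) =
      1 - avg (M * L) (\<lambda>b. ms b) - avg (M * L) (\<lambda>b. real (cnt b)) * (1 / real S)"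
  proof -
    have "avg (M * L) (\<lambda>b. (1 - ms b - real (cnt b) * (1 / real S)) +
      (ms b + real (cnt b) * (1 / real S))) = 1" by simp
    then show ?thesis unfolding avg_add avg_multc by linarith
  qed
  moreover have "avg (M * L) (\<lambda>b. real (cnt b)) * (1 / real S) \<le> 1 / 4"
  proof -
    have "avg (M * L) (\<lambda>b. real (cnt b)) * (1 / real S) \<le> real (M * n * hh n) * (1 / real S)"
      using cnt by (intro mult_right_mono) auto
    also have "\<dots> = 1 / 4" using Mp n hh_pos[OF n] by (simp add: S_def)
    finally show ?thesis .
  qed
  ultimately have "1 / 2 \<le> avg (M * L) (\<lambda>b. of_bool (succ b))"
    using missing unfolding ms_def[symmetric] by linarith
  then show ?thesis
    unfolding succ_def W_def ball_simps cnt_def S_def M_def L_def K_def hit_def bad_def g_def by simp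
qed

text \<open>All c * hh n independent repetitions fail with probability at most 2^(- c * hh n), and
  2^(hh n) \<ge> n.\<close>

lemma repeat_prob:
  assumes half: "1 / 2 \<le> avg N (\<lambda>b. of_bool (G b))" and n: "1 \<le> n"
  shows "1 - 1 / real n ^ c \<le> avg (c * hh n * N) (\<lambda>b. of_bool (\<exists>\<rho><c * hh n. G (blk N \<rho> b)))"
proof -
  define r where "r = c * hh n"
  have e: "of_bool (\<exists>\<rho><r. G (blk N \<rho> b)) = 1 - (\<Prod>\<rho><r. 1 - (of_bool (G (blk N \<rho> b)) :: real))" for b
    by (cases "\<exists>\<rho><r. G (blk N \<rho> b)") (auto intro!: prod_zero)
  have s: "avg N (\<lambda>b. 1 - of_bool (G b)) + avg N (\<lambda>b. of_bool (G b)) = 1"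
    unfolding avg_add[symmetric] by simp
  have z: "avg N (\<lambda>b. 0) \<le> avg N (\<lambda>b. 1 - of_bool (G b))" by (rule avg_mono) simp
  have "avg (r * N) (\<lambda>b. \<Prod>\<rho><r. 1 - of_bool (G (blk N \<rho> b))) = (\<Prod>\<rho><r. avg N (\<lambda>b. 1 - of_bool (G b)))" by (rule avg_prod)
  also have "\<dots> \<le> (\<Prod>\<rho><r. 1 / 2)" using half s z by (intro prod_mono) auto
  also have "\<dots> = 1 / (2 ^ hh n) ^ c" by (simp add: power_one_over r_def mult.commute flip: power_mult)
  also have "\<dots> \<le> 1 / real n ^ c"
  proof -
    have "real n \<le> 2 ^ hh n" using hh_ge[of n] by (metis of_nat_le_iff of_nat_numeral of_nat_power)
    then show ?thesis using n by (intro divide_left_mono power_mono) auto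
  qed
  finally have le: "avg (r * N) (\<lambda>b. \<Prod>\<rho><r. 1 - of_bool (G (blk N \<rho> b))) \<le> 1 / real n ^ c" .
  have "avg (r * N) (\<lambda>b. 1 - (\<Prod>\<rho><r. 1 - of_bool (G (blk N \<rho> b))) + (\<Prod>\<rho><r. 1 - of_bool (G (blk N \<rho> b)))) = 1" by simp
  then show ?thesis unfolding r_def[symmetric] e avg_add using le by linarith
qed

section \<open>The whole program\<close>

definition coin_count :: "real \<Rightarrow> nat \<Rightarrow> nat \<Rightarrow> nat \<Rightarrow> nat \<Rightarrow> nat" where
  "coin_count \<rho> C c n d = c * hh n * (mm \<rho> C n * (d * KK n))"

text \<open>A sum instead of a maximum: every summand is bounded by it at once, and its growth can
  be estimated termwise.\<close>

definition max_word :: "real \<Rightarrow> nat \<Rightarrow> nat \<Rightarrow> nat \<Rightarrow> nat \<Rightarrow> nat" where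
  "max_word \<rho> C c n d = 8 + 3 * n + 4 * 2 ^ hh n + (hh n + 2) * (n * n) + hh n + KK n + d + d * KK n + mm \<rho> C n +
     c * hh n + coin_count \<rho> C c n d + bud \<rho> C n"

definition init_steps :: "real \<Rightarrow> nat \<Rightarrow> nat \<Rightarrow> nat \<Rightarrow> nat" where
  "init_steps \<rho> C n d = 3 * hh n + 4 * n + 2 * mm \<rho> C n + 20 + (2 + n * (3 * d + 10)) + 2 +
     (3 * n + 6 + (hh n + 1) * (10 * n + 6)) + (5 * n + 30 * n + 5 * (n * hh n) + 5)"

definition main_steps :: "real \<Rightarrow> nat \<Rightarrow> nat \<Rightarrow> nat \<Rightarrow> nat \<Rightarrow> nat" where
  "main_steps \<rho> C c n d = 2 + c * hh n * (5 + mm \<rho> C n * (9 + n * (3 * (d * KK n) + 6) +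
       (hh n + 2) * (16 * (n + n * hh n) + 20 * n) + 6 * n + n * hh n * (20 + 9 * hh n)) +
     bud \<rho> C n * (3 * d + 14)) + (2 + 3 * n)"

definition total_steps :: "real \<Rightarrow> nat \<Rightarrow> nat \<Rightarrow> nat \<Rightarrow> nat \<Rightarrow> nat" where
  "total_steps \<rho> C c n d = init_steps \<rho> C n d + (3 * coin_count \<rho> C c n d + 2) + main_steps \<rho> C c n d"

text \<open>For n = 1 one has hh n = 0, and 1 / 0 = 0 would not be the positive \<epsilon> that the
  search requires; 1 serves as a default.\<close>

definition search_eps :: "nat \<Rightarrow> real" where "search_eps n = (if n = 1 then 1 else 1 / real (hh n))"

lemma mods_PARAMS: "a < 11 \<Longrightarrow> a \<notin> imods (PARAMS C c)" "a < 2 \<Longrightarrow> a \<notin> rmods (PARAMS C c)"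
  by (auto simp: PARAMS_def)

context ram_tree
begin

lemma word_bounds:
  assumes "max_word \<rho> C c n d \<le> M"
  shows "3 * n \<le> M" "4 * 2 ^ hh n \<le> M" "(hh n + 2) * (n * n) \<le> M" "hh n \<le> M" "KK n \<le> M" "d \<le> M" "d * KK n \<le> M"
    "mm \<rho> C n \<le> M" "c * hh n \<le> M" "coin_count \<rho> C c n d \<le> M" "bud \<rho> C n \<le> M" "n * n \<le> M" "(hh n + 1) * (n * n) \<le> M"
proof -
  show *: "3 * n \<le> M" "4 * 2 ^ hh n \<le> M" "(hh n + 2) * (n * n) \<le> M" "hh n \<le> M" "KK n \<le> M" "d \<le> M" "d * KK n \<le> M"
    "mm \<rho> C n \<le> M" "c * hh n \<le> M" "coin_count \<rho> C c n d \<le> M" "bud \<rho> C n \<le> M"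
    using assms unfolding max_word_def by linarith+
  have "1 * (n * n) \<le> (hh n + 2) * (n * n)" "(hh n + 1) * (n * n) \<le> (hh n + 2) * (n * n)" by (intro mult_le_mono1; simp)+
  then show "n * n \<le> M" "(hh n + 1) * (n * n) \<le> M" using *(3) by linarith+
qed

lemma E_le: "E \<le> n" "E \<le> n * n" "3 * E \<le> 3 * n"
proof -
  show "E \<le> n" using E_eq by simp
  moreover have "n * 1 \<le> n * n" using n_pos by (intro mult_le_mono) auto
  ultimately show "E \<le> n * n" "3 * E \<le> 3 * n" by linarith+
qed

lemma ok_INIT:
  assumes inp: "edges_in I" "coords R" and \<alpha>: "R 0 0 = \<alpha>" "\<rho> = 1 / \<alpha>\<^sup>2" and b: "max_word \<rho> C c n d \<le> M"
  shows "ok (INIT C c) I R T0 (\<lambda>I' R' T'. params \<rho> C c n d I' R' \<and> recd_all I' \<and> (\<Sum>e<E. I' aQS e) \<le> n * hh n \<and>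
    (\<Sum>B<n. I' aSz B) \<le> n + n * hh n \<and> (\<forall>e<E. R' aBest e = wt e) \<and> T' \<le> T0 + init_steps \<rho> C n d)"
proof -
  note B = word_bounds[OF b]
  have n0: "I 0 0 = n" "I 0 1 = d" "\<And>e. e < E \<Longrightarrow> I 1 (2 * e) = ex e \<and> I 1 (2 * e + 1) = ey e"
    using inp by (auto simp: edges_in_def)
  have En: "E \<le> M" "n \<le> M" "2 * n \<le> M" using E_le(1) B(1) by linarith+
  have 1: "ok (PARAMS C c) I R T0 (\<lambda>I' R' T'. params \<rho> C c n d I' R' \<and> T' \<le> T0 + 3 * hh n + 4 * n + 2 * mm \<rho> C n + 20)"
  proof (rule ok_PARAMS[where I = I and n = n and d = d, OF n0(1) _ n0(2) _ En(3) B(12) B(4) B(5) B(7) B(8) B(9) B(10)[unfolded coin_count_def] B(11)])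
    show "1 \<le> n" using n_pos by simp
    show "\<rho> = 1 / (R 0 0)\<^sup>2" using \<alpha> by simp
  qed
  show ?thesis
    unfolding INIT_def
  proof (rule ok_Seq, rule ok_conseq[OF 1])
    fix I1 R1 T1
    assume p1: "params \<rho> C c n d I1 R1 \<and> T1 \<le> T0 + 3 * hh n + 4 * n + 2 * mm \<rho> C n + 20"
      and fi: "\<And>a. a \<notin> imods (PARAMS C c) \<Longrightarrow> I1 a = I a" and fr: "\<And>a. a \<notin> rmods (PARAMS C c) \<Longrightarrow> R1 a = R a"
    have f1: "I1 0 = I 0" "I1 1 = I 1" "R1 1 = R 1" "R1 0 = R 0"
      by (rule fi[OF mods_PARAMS(1)] fr[OF mods_PARAMS(2)]; simp)+
    have v1: "I1 vE 0 = E" "I1 vW 0 = n * n" using p1 E_eq by (auto simp: params_def)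
    have 2: "ok WEIGHTS I1 R1 T1 (\<lambda>I' R' T'. T' \<le> T1 + 2 + E * (3 * d + 10) \<and>
        (\<forall>e<E. R' aBest e = dst R1 d (I1 1 (2 * e)) (I1 1 (2 * e + 1)) \<and> R' aKey e = - dst R1 d (I1 1 (2 * e)) (I1 1 (2 * e + 1))))"
      by (rule ok_WEIGHTS[where I = I1 and d = d, OF _ B(6) v1(1) En(1) M]) (simp only: f1 n0)
    have dw: "dst R1 d (I1 1 (2 * e)) (I1 1 (2 * e + 1)) = wt e" if e: "e < E" for e
    proof -
      have "coords R1" using inp(2) by (simp only: coords_def f1)
      then show ?thesis by (simp only: f1 n0(3)[OF e] dst_eq_dd ex_lt[OF e] ey_lt[OF e] wt_def)
    qed
    show "ok (WEIGHTS ;; assign vbs (IConst 0) ;; assign vlen (IV vE) ;; SORT ;; KRUSKAL) I1 R1 T1 (\<lambda>I' R' T'.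
        params \<rho> C c n d I' R' \<and> recd_all I' \<and> (\<Sum>e<E. I' aQS e) \<le> n * hh n \<and>
        (\<Sum>B<n. I' aSz B) \<le> n + n * hh n \<and> (\<forall>e<E. R' aBest e = wt e) \<and> T' \<le> T0 + init_steps \<rho> C n d)"
    proof (rule ok_Seq, rule ok_conseq[OF 2])
      fix I2 R2 T2
      assume p2: "T2 \<le> T1 + 2 + E * (3 * d + 10) \<and>
          (\<forall>e<E. R2 aBest e = dst R1 d (I1 1 (2 * e)) (I1 1 (2 * e + 1)) \<and> R2 aKey e = - dst R1 d (I1 1 (2 * e)) (I1 1 (2 * e + 1)))"
        and fi2: "\<And>a. a \<notin> imods WEIGHTS \<Longrightarrow> I2 a = I1 a" and fr2: "\<And>a. a \<notin> rmods WEIGHTS \<Longrightarrow> R2 a = R1 a"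
      have w2: "\<And>e. e < E \<Longrightarrow> R2 aBest e = wt e" "\<And>e. e < E \<Longrightarrow> R2 aKey e = - wt e" using p2 dw by auto
      have f2: "I2 0 = I 0" "I2 1 = I 1" "R2 rT = R1 rT" "\<And>v. v \<in> {vK, vL, vm, vrm, vnb, vbud0, vW, vE} \<Longrightarrow> I2 v = I1 v"
        using fi2 fr2 f1 by (auto simp del: One_nat_def)
      define I3 where "I3 = I2(vbs := (I2 vbs)(0 := 0), vlen := (I2 vlen)(0 := E))"
      have 3: "ok SORT I3 R2 (Suc (Suc T2)) (\<lambda>I' R' T'. T' \<le> Suc (Suc T2) + 3 * E + 6 + (hh n + 1) * (10 * E + 6) \<and>
         (\<exists>G. I' vgo 0 = G * (n * n) \<and> E \<le> 2 ^ G \<and>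
           (\<forall>g\<le>G. \<forall>b. 2 ^ g dvd b \<longrightarrow> blkok (R2 aKey) E (2 ^ g) (\<lambda>p. I' aSrt (g * (n * n) + 0 + p)) b)) \<and>
         (\<forall>x. (\<forall>g p. p < E \<longrightarrow> x \<noteq> g * (n * n) + 0 + p) \<longrightarrow> I' aSrt x = I3 aSrt x))"
      proof (rule ok_SORT)
        show "E \<le> 2 ^ hh n" using E_le(1) hh_ge[of n] by (rule le_trans)
        show "3 * E \<le> M" using E_le(3) B(1) by (rule le_trans)
      qed (use v1 f2(4) B(13) E_le(2) M in \<open>simp_all add: I3_def\<close>)
      have 4: "ok (SORT ;; KRUSKAL) I3 R2 (Suc (Suc T2)) (\<lambda>I' R' T'.
        params \<rho> C c n d I' R' \<and> recd_all I' \<and> (\<Sum>e<E. I' aQS e) \<le> n * hh n \<and>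
        (\<Sum>B<n. I' aSz B) \<le> n + n * hh n \<and> (\<forall>e<E. R' aBest e = wt e) \<and> T' \<le> T0 + init_steps \<rho> C n d)"
      proof (rule ok_Seq, rule ok_conseq[OF 3])
        fix I4 R4 T4
        assume p4: "T4 \<le> Suc (Suc T2) + 3 * E + 6 + (hh n + 1) * (10 * E + 6) \<and>
         (\<exists>G. I4 vgo 0 = G * (n * n) \<and> E \<le> 2 ^ G \<and>
           (\<forall>g\<le>G. \<forall>b. 2 ^ g dvd b \<longrightarrow> blkok (R2 aKey) E (2 ^ g) (\<lambda>p. I4 aSrt (g * (n * n) + 0 + p)) b)) \<and>
         (\<forall>x. (\<forall>g p. p < E \<longrightarrow> x \<noteq> g * (n * n) + 0 + p) \<longrightarrow> I4 aSrt x = I3 aSrt x)"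
          and fi4: "\<And>a. a \<notin> imods SORT \<Longrightarrow> I4 a = I3 a" and fr4: "\<And>a. a \<notin> rmods SORT \<Longrightarrow> R4 a = R2 a"
        have f4: "I4 0 = I 0" "I4 1 = I 1" "R4 = R2" "\<And>v. v \<in> {vK, vL, vm, vrm, vnb, vbud0, vW, vE} \<Longrightarrow> I4 v = I1 v"
          using fi4 fr4 f2 by (auto simp: I3_def fun_eq_iff[of R4 R2] simp del: One_nat_def)
        from p4 obtain G where G: "I4 vgo 0 = G * (n * n)" "E \<le> 2 ^ G"
            "\<forall>g\<le>G. \<forall>b. 2 ^ g dvd b \<longrightarrow> blkok (R2 aKey) E (2 ^ g) (\<lambda>p. I4 aSrt (g * (n * n) + 0 + p)) b"
          by (elim conjE exE)
        define \<sigma> where "\<sigma> k = I4 aSrt (I4 vgo 0 + k)" for k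
        have "blkok (R2 aKey) E (2 ^ G) (\<lambda>p. I4 aSrt (G * (n * n) + 0 + p)) 0"
          using G(3) by (rule allE) (drule mp, rule le_refl, drule spec, erule mp, rule dvd_0_right)
        then have bl: "blkok (R2 aKey) E (2 ^ G) \<sigma> 0" by (simp add: \<sigma>_def[abs_def] G(1))
        have mn: "min (0 + 2 ^ G) E = E" using G(2) by simp
        from bl have s: "\<sigma> ` {..<E} = {..<E}" "\<And>p q. p \<le> q \<Longrightarrow> q < E \<Longrightarrow> R2 aKey (\<sigma> q) \<le> R2 aKey (\<sigma> p)"
          unfolding blkok_def mn atLeast0LessThan by simp_all
        have s': "wt (\<sigma> p) \<le> wt (\<sigma> q)" if "p \<le> q" "q < E" for p q
        proof -
          have "\<sigma> p \<in> \<sigma> ` {..<E}" "\<sigma> q \<in> \<sigma> ` {..<E}" using that by auto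
          then have "\<sigma> p < E" "\<sigma> q < E" unfolding s(1) by auto
          then show ?thesis using s(2)[OF that] w2(2) by simp
        qed
        have 5: "ok KRUSKAL I4 R4 T4 (\<lambda>I' R' T'. T' \<le> T4 + 5 * n + 30 * E + 5 * (n * hh n) + 5 \<and>
           (\<forall>e<E. recd e (I' aSz) (I' aArr) (I' aQA e) (I' aQS e) (I' aQB e) (I' aQT e)) \<and>
           (\<Sum>e<E. I' aQS e) \<le> n * hh n \<and> (\<Sum>B<n. I' aSz B) \<le> n + n * hh n \<and> (\<forall>B<n. I' aSz B \<le> n) \<and>
           (\<forall>B<n. \<forall>p<I' aSz B. I' aArr (B * n + p) < n))"
        proof (rule ok_KRUSKAL[OF _ _ _ \<sigma>_def s(1) s' hh_ge En(2)])
          show "edges_in I4" using inp(1) unfolding edges_in_def f4 .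
          show "I4 vE 0 = E" using f4(4) v1 by simp
          show "R4 aBest e = wt e" if "e < E" for e using w2(1)[OF that] f4(3) by simp
        qed
        show "ok KRUSKAL I4 R4 T4 (\<lambda>I' R' T'.
          params \<rho> C c n d I' R' \<and> recd_all I' \<and> (\<Sum>e<E. I' aQS e) \<le> n * hh n \<and>
          (\<Sum>B<n. I' aSz B) \<le> n + n * hh n \<and> (\<forall>e<E. R' aBest e = wt e) \<and> T' \<le> T0 + init_steps \<rho> C n d)"
        proof (rule ok_conseq[OF 5])
          fix I5 R5 T5
          assume p5: "T5 \<le> T4 + 5 * n + 30 * E + 5 * (n * hh n) + 5 \<and>
             (\<forall>e<E. recd e (I5 aSz) (I5 aArr) (I5 aQA e) (I5 aQS e) (I5 aQB e) (I5 aQT e)) \<and>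
             (\<Sum>e<E. I5 aQS e) \<le> n * hh n \<and> (\<Sum>B<n. I5 aSz B) \<le> n + n * hh n \<and> (\<forall>B<n. I5 aSz B \<le> n) \<and>
             (\<forall>B<n. \<forall>p<I5 aSz B. I5 aArr (B * n + p) < n)"
            and fi5: "\<And>a. a \<notin> imods KRUSKAL \<Longrightarrow> I5 a = I4 a" and fr5: "\<And>a. a \<notin> rmods KRUSKAL \<Longrightarrow> R5 a = R4 a"
          have f5: "\<And>v. v \<in> {vK, vL, vm, vrm, vnb, vbud0, vW, vE} \<Longrightarrow> I5 v = I1 v" "R5 = R2"
            using fi5 fr5 f4 by (auto simp: fun_eq_iff[of R5 R2])
          have par: "params \<rho> C c n d I5 R5" using p1 f5 f2(3) by (simp add: params_def)
          have "E * (3 * d + 10) \<le> n * (3 * d + 10)" "(hh n + 1) * (10 * E + 6) \<le> (hh n + 1) * (10 * n + 6)"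
            "3 * E \<le> 3 * n" "30 * E \<le> 30 * n"
            using E_le(1) by (intro mult_le_mono add_le_mono le_refl; simp)+
          then have "T5 \<le> T0 + init_steps \<rho> C n d"
            using p1 p2 p4 p5 unfolding init_steps_def by linarith
          then show "params \<rho> C c n d I5 R5 \<and> recd_all I5 \<and> (\<Sum>e<E. I5 aQS e) \<le> n * hh n \<and>
            (\<Sum>B<n. I5 aSz B) \<le> n + n * hh n \<and> (\<forall>e<E. R5 aBest e = wt e) \<and> T5 \<le> T0 + init_steps \<rho> C n d"
            using p5 par w2(1) f5(2) by (simp add: recd_all_def)
        qed
      qed
      show "ok (assign vbs (IConst 0) ;; assign vlen (IV vE) ;; SORT ;; KRUSKAL) I2 R2 T2 (\<lambda>I' R' T'.
        params \<rho> C c n d I' R' \<and> recd_all I' \<and> (\<Sum>e<E. I' aQS e) \<le> n * hh n \<and>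
        (\<Sum>B<n. I' aSz B) \<le> n + n * hh n \<and> (\<forall>e<E. R' aBest e = wt e) \<and> T' \<le> T0 + init_steps \<rho> C n d)"
      proof (rule ok_Seq, rule ok_IWrite, simp, rule ok_Seq, rule ok_IWrite)
        have E2: "I2 vE 0 = E" using f2(4) v1 by simp
        then show "iv (I2(vbs := (I2 vbs)(iv I2 (IConst 0) := iv I2 (IConst 0)))) (IV vE) \<le> M" using En by simp
        have "(I2(vbs := (I2 vbs)(iv I2 (IConst 0) := iv I2 (IConst 0))))(vlen := ((I2(vbs := (I2 vbs)(iv I2 (IConst 0) := iv I2 (IConst 0)))) vlen)
            (iv (I2(vbs := (I2 vbs)(iv I2 (IConst 0) := iv I2 (IConst 0)))) (IConst 0) :=
             iv (I2(vbs := (I2 vbs)(iv I2 (IConst 0) := iv I2 (IConst 0)))) (IV vE))) = I3"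
          using E2 by (simp add: I3_def)
        then show "ok (SORT ;; KRUSKAL) ((I2(vbs := (I2 vbs)(iv I2 (IConst 0) := iv I2 (IConst 0))))(vlen := ((I2(vbs := (I2 vbs)(iv I2 (IConst 0) := iv I2 (IConst 0)))) vlen)
            (iv (I2(vbs := (I2 vbs)(iv I2 (IConst 0) := iv I2 (IConst 0)))) (IConst 0) :=
             iv (I2(vbs := (I2 vbs)(iv I2 (IConst 0) := iv I2 (IConst 0)))) (IV vE)))) R2 (Suc (Suc T2)) (\<lambda>I' R' T'.
          params \<rho> C c n d I' R' \<and> recd_all I' \<and> (\<Sum>e<E. I' aQS e) \<le> n * hh n \<and>
          (\<Sum>B<n. I' aSz B) \<le> n + n * hh n \<and> (\<forall>e<E. R' aBest e = wt e) \<and> T' \<le> T0 + init_steps \<rho> C n d)"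
          using 4 by (simp only:)
      qed
    qed
  qed
qed

text \<open>As cw e \<le> 3 * n * wt e, the logarithms differ by at most 2 + h. With ln (1 + 1 / h)
  \<ge> 1 / (h + 1), one edge has potential at most (2 + h) * (h + 1) \<le> 4 * h * (h + 4), the
  amount reserved in \<open>bud\<close>, whose final 1 makes the inequality strict.\<close>

lemma Lam_budget:
  "real (4 * mm \<rho> C n * n * hh n) + (\<Sum>e<E. Lam (search_eps n) (cw e) - Lam (search_eps n) (wt e)) < real (bud \<rho> C n)"
proof -
  define h where "h = real (hh n)"
  have "Lam (search_eps n) (cw e) - Lam (search_eps n) (wt e) \<le> 4 * h * (h + 4)" if e: "e < E" for e
  proof -
    have n2: "2 \<le> n" using e E_eq by linarith
    have h1: "1 \<le> h" using hh_pos[OF n2] by (simp add: h_def)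
    have \<epsilon>: "search_eps n = 1 / h" using n2 by (simp add: search_eps_def h_def)
    have x: "0 < h / (h + 1)" using h1 by simp
    have "ln (h / (h + 1)) \<le> h / (h + 1) - 1" by (rule ln_le_minus_one[OF x])
    also have "\<dots> = - (1 / (h + 1))" using h1 by (simp add: field_simps)
    finally have "1 / (h + 1) \<le> - ln (h / (h + 1))" by simp
    also have "- ln (h / (h + 1)) = ln (inverse (h / (h + 1)))" using x by (subst ln_inverse) auto
    also have "inverse (h / (h + 1)) = 1 + 1 / h" using h1 by (simp add: field_simps)
    finally have l: "1 / (h + 1) \<le> ln (1 + 1 / h)" .
    have w: "0 < wt e" "wt e \<le> cw e" "cw e \<le> 3 * n * wt e" using wt_pos[OF e] wt_le_cw[OF e] cw_le[OF e] by auto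
    have "ln (cw e) \<le> ln (3 * real n * wt e)" using w by (subst ln_le_cancel_iff) auto
    also have "\<dots> = ln 3 + ln (real n) + ln (wt e)" using w n2 by (simp add: ln_mult)
    also have "\<dots> \<le> 2 + h + ln (wt e)"
      using ln_le_hh[of n] n2 ln_le_minus_one[of 3] by (simp add: h_def)
    finally have "ln (cw e) - ln (wt e) \<le> 2 + h" by simp
    then have "(ln (cw e) - ln (wt e)) / ln (1 + 1 / h) \<le> (2 + h) / (1 / (h + 1))"
      using l h1 by (intro frac_le) auto
    also have "\<dots> = (2 + h) * (h + 1)" by simp
    also have "\<dots> \<le> (h + 4) * (4 * h)" using h1 by (intro mult_mono) auto
    finally show ?thesis unfolding Lam_def \<epsilon> by (simp add: diff_divide_distrib mult_ac)
  qed
  then have "(\<Sum>e<E. Lam (search_eps n) (cw e) - Lam (search_eps n) (wt e)) \<le> (\<Sum>e<E. 4 * h * (h + 4))" by (intro sum_mono) simp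
  also have "\<dots> \<le> real n * (4 * h * (h + 4))" using E_le(1) by (simp add: h_def mult_right_mono)
  finally show ?thesis by (simp add: bud_def h_def)
qed

text \<open>\<open>goodrep\<close> as a statement about a bit string. The pairs of all edges are
  collected in one \<open>Sigma\<close> set, so that a single probability bound covers them.\<close>

definition good_coins :: "real \<Rightarrow> nat \<Rightarrow> ipart \<Rightarrow> (nat \<Rightarrow> bool) \<Rightarrow> bool" where
  "good_coins \<alpha> m I b \<longleftrightarrow>
    (\<forall>z\<in>Sigma {..<E} (idx I). \<exists>i<m. rademacher d (KK n) (\<lambda>v j. pts ! v ! j) (blk (d * KK n) i b) (fst (prs I (fst z) (snd z))) +
        TT n / \<alpha> * dd (fst (prs I (fst z) (snd z))) (snd (prs I (fst z) (snd z)))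
        \<le> rademacher d (KK n) (\<lambda>v j. pts ! v ! j) (blk (d * KK n) i b) (snd (prs I (fst z) (snd z)))) \<and>
    (\<Sum>i<m. card {z \<in> Sigma {..<E} (idx I). badpair (1 / real (hh n)) (TT n) dd
       (rademacher d (KK n) (\<lambda>v j. pts ! v ! j) (blk (d * KK n) i b)) (prs I (fst z) (snd z))}) \<le> 4 * m * n * hh n"

text \<open>The cross pairs of all edges number at most n times the total size of the smaller sides,
  hence n^2 * hh n.\<close>

lemma good_coins_prob:
  assumes n2: "2 \<le> n" and \<alpha>: "1 \<le> \<alpha>" and rc: "recd_all I" "(\<Sum>e<E. I aQS e) \<le> n * hh n"
  shows "1 / 2 \<le> avg (mm (1 / \<alpha>\<^sup>2) 53747712 n * (d * KK n)) (\<lambda>b. of_bool (good_coins \<alpha> (mm (1 / \<alpha>\<^sup>2) 53747712 n) I b))"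
  unfolding good_coins_def
proof (rule good_prob_ge_half[OF n2 \<alpha>, where p = "\<lambda>z. prs I (fst z) (snd z)"])
  have fin: "finite (idx I e)" for e by (simp add: idx_def)
  then show "finite (Sigma {..<E} (idx I))" by simp
  have "card (Sigma {..<E} (idx I)) = (\<Sum>e<E. I aQS e * I aQT e)"
    using fin by (simp add: card_SigmaI idx_def)
  also have "\<dots> \<le> (\<Sum>e<E. I aQS e * n)"
  proof (intro sum_mono mult_le_mono2)
    fix e assume "e \<in> {..<E}"
    then have "I aQT e \<le> I aSz (I aQB e)" "I aQB e < n" using rc(1) by (auto simp: recd_all_def recd_def)
    then show "I aQT e \<le> n" using rc(1) by (meson recd_all_def le_trans)
  qed
  also have "\<dots> \<le> n * hh n * n" unfolding sum_distrib_right[symmetric] using rc(2) by (rule mult_le_mono1)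
  finally show "card (Sigma {..<E} (idx I)) \<le> n * n * hh n" by (simp add: mult_ac)
  show "fst (prs I (fst z) (snd z)) < n \<and> snd (prs I (fst z) (snd z)) < n \<and>
      0 < dd (fst (prs I (fst z) (snd z))) (snd (prs I (fst z) (snd z)))" if z: "z \<in> Sigma {..<E} (idx I)" for z
  proof -
    obtain e a b where z': "z = (e, a, b)" "e < E" "a < I aQS e" "b < I aQT e" using z by (auto simp: idx_def)
    have "recd e (I aSz) (I aArr) (I aQA e) (I aQS e) (I aQB e) (I aQT e)" using rc(1) z' by (simp add: recd_all_def)
    from recd_pairs(1)[OF this z'(2-4)] show ?thesis using dd_pos by (simp add: z'(1) prs_def)
  qed
  show "dd u v = sqrt (\<Sum>j<d. (pts ! v ! j - pts ! u ! j)\<^sup>2)" if "u < n" "v < n" for u v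
    using that by (simp add: dd_def l2_def L2_set_def length_pt power2_commute)
qed

text \<open>Bit q of projection i in repetition \<rho> sits in cell (\<rho> * m + i) * L + q, which
  is block i within block \<rho>. The event is stated for the memory I0 before the flips, which does
  not depend on the coins; J says that the recorded pairs have not changed since.\<close>

lemma goodrep_of_coins:
  assumes "coords R" and bit: "\<And>q. I aBit q \<le> 1" and \<rho>: "\<rho> < reps" and n2: "2 \<le> n" and rc: "recd_all I"
    and J: "idx I0 = idx I" "prs I0 = prs I"
    and g: "good_coins \<alpha> m I0 (blk (m * (d * KK n)) \<rho> (coins (reps * (m * (d * KK n))) I))"
  shows "goodrep (1 / real (hh n)) (TT n) \<alpha> (4 * m * n * hh n) m (d * KK n) (KK n) I R \<rho>"
proof -
  define K where "K = KK n"
  define L where "L = d * K"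
  define B where "B i = blk L i (blk (m * L) \<rho> (coins (reps * (m * L)) I))" for i
  let ?x = "\<lambda>v j. pts ! v ! j"
  have pr: "prj I R L K ((\<rho> * m + i) * L) v = rademacher d K ?x (B i) v" if i: "i < m" and v: "v < n" for i v
    unfolding prj_def rademacher_def L_def[symmetric]
  proof (rule sum.cong[OF refl])
    fix q assume "q \<in> {..<L}"
    then have q: "q < L" by simp
    then have "q div K < d" by (simp add: L_def less_mult_imp_div_less)
    then have c: "R 1 (v * d + q div K) = pts ! v ! (q div K)" using assms(1) v by (simp add: coords_def)
    have "Suc i * L \<le> m * L" using i by (intro mult_le_mono1) simp
    then have iq: "i * L + q < m * L" using q by simp
    have "Suc \<rho> * (m * L) \<le> reps * (m * L)" using \<rho> by (intro mult_le_mono1) simp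
    then have "\<rho> * (m * L) + (i * L + q) < reps * (m * L)" using iq by simp
    moreover have e: "\<rho> * (m * L) + (i * L + q) = (\<rho> * m + i) * L + q" by (simp add: algebra_simps)
    ultimately have "B i q \<longleftrightarrow> I aBit ((\<rho> * m + i) * L + q) = 1"
      unfolding B_def blk_def coins_def e using q iq by simp
    moreover have "I aBit ((\<rho> * m + i) * L + q) = 0 \<or> I aBit ((\<rho> * m + i) * L + q) = 1"
      using bit[of "(\<rho> * m + i) * L + q"] by linarith
    ultimately have "2 * real (I aBit ((\<rho> * m + i) * L + q)) - 1 = sgb (B i q)" by (auto simp: sgb_def)
    then show "R 1 (v * d + q div K) * (2 * real (I aBit ((\<rho> * m + i) * L + q)) - 1) = pts ! v ! (q div K) * sgb (B i q)"
      by (simp only: c)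
  qed
  have lt: "fst (prs I e j) < n \<and> snd (prs I e j) < n" if ej: "e < E" "j \<in> idx I e" for e j
    using recd_pairs(1)[of e "I aSz" "I aArr"] rc ej by (auto simp: recd_all_def idx_def prs_def)
  have fin: "finite {j \<in> idx I e. P j}" for e P
    by (rule finite_subset[of _ "idx I e"]) (auto simp: idx_def)
  have "(\<Sum>i<m. \<Sum>e<E. card {j \<in> idx I e. badpair (1 / real (hh n)) (TT n) dd (prj I R L K ((\<rho> * m + i) * L)) (prs I e j)})
      = (\<Sum>i<m. card {z \<in> Sigma {..<E} (idx I). badpair (1 / real (hh n)) (TT n) dd (rademacher d K ?x (B i)) (prs I (fst z) (snd z))})"
  proof (rule sum.cong[OF refl])
    fix i assume "i \<in> {..<m}"
    then have i: "i < m" by simp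
    have eq: "{z \<in> Sigma {..<E} (idx I). badpair (1 / real (hh n)) (TT n) dd (rademacher d K ?x (B i)) (prs I (fst z) (snd z))} =
        Sigma {..<E} (\<lambda>e. {j \<in> idx I e. badpair (1 / real (hh n)) (TT n) dd (rademacher d K ?x (B i)) (prs I e j)})" by auto
    have "card {z \<in> Sigma {..<E} (idx I). badpair (1 / real (hh n)) (TT n) dd (rademacher d K ?x (B i)) (prs I (fst z) (snd z))} = (\<Sum>e<E. card {j \<in> idx I e. badpair (1 / real (hh n)) (TT n) dd (rademacher d K ?x (B i)) (prs I e j)})"
      unfolding eq by (rule card_SigmaI) (use fin in simp_all)
    also have "\<dots> = (\<Sum>e<E. card {j \<in> idx I e. badpair (1 / real (hh n)) (TT n) dd (prj I R L K ((\<rho> * m + i) * L)) (prs I e j)})"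
    proof (rule sum.cong[OF refl], rule arg_cong[where f = card], rule Collect_cong, rule conj_cong[OF refl])
      fix e j assume "e \<in> {..<E}" "j \<in> idx I e"
      then have "fst (prs I e j) < n \<and> snd (prs I e j) < n" by (intro lt) simp_all
      then show "badpair (1 / real (hh n)) (TT n) dd (rademacher d K ?x (B i)) (prs I e j) =
          badpair (1 / real (hh n)) (TT n) dd (prj I R L K ((\<rho> * m + i) * L)) (prs I e j)"
        unfolding badpair_def by (simp only: pr[OF i])
    qed
    finally show "(\<Sum>e<E. card {j \<in> idx I e. badpair (1 / real (hh n)) (TT n) dd (prj I R L K ((\<rho> * m + i) * L)) (prs I e j)}) =
      card {z \<in> Sigma {..<E} (idx I). badpair (1 / real (hh n)) (TT n) dd (rademacher d K ?x (B i)) (prs I (fst z) (snd z))}" ..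
  qed
  moreover have "\<exists>i<m. prj I R L K ((\<rho> * m + i) * L) (fst (prs I e j)) + TT n / \<alpha> * dd (fst (prs I e j)) (snd (prs I e j))
        \<le> prj I R L K ((\<rho> * m + i) * L) (snd (prs I e j))" if ej: "e < E" "j \<in> idx I e" for e j
  proof -
    have "(e, j) \<in> Sigma {..<E} (idx I)" using ej by simp
    from bspec[OF g[unfolded good_coins_def J, THEN conjunct1] this]
    obtain i where i: "i < m" "rademacher d K ?x (B i) (fst (prs I e j)) + TT n / \<alpha> * dd (fst (prs I e j)) (snd (prs I e j))
        \<le> rademacher d K ?x (B i) (snd (prs I e j))"
      unfolding fst_conv snd_conv K_def[symmetric] L_def[symmetric] B_def[symmetric] by blast
    show ?thesis using i lt[OF ej] by (intro exI[of _ i]) (simp only: pr simp_thms)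
  qed
  ultimately show ?thesis
    using g[unfolded good_coins_def J, THEN conjunct2, folded K_def, folded L_def, folded B_def]
    unfolding goodrep_def K_def[symmetric] L_def[symmetric] by simp
qed

end

lemma mods_INIT: "a < 3 \<Longrightarrow> a \<notin> imods (INIT C c)" "a < 2 \<Longrightarrow> a \<notin> rmods (INIT C c)"
  using mods_PARAMS[of a C c] by (auto simp: INIT_def)

lemma mods_FLIPS: "imods FLIPS = {aBit, vz}"
  by (auto simp: FLIPS_def)

lemma concat_pairs_nth:
  "e < length xs \<Longrightarrow> concat (map (\<lambda>(i, j). [i, j]) xs) ! (2 * e) = fst (xs ! e) \<and>
     concat (map (\<lambda>(i, j). [i, j]) xs) ! (2 * e + 1) = snd (xs ! e)"
proof (induction xs arbitrary: e)
  case (Cons x xs)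
  then show ?case by (cases e) (auto simp: case_prod_unfold)
qed simp

lemma length_concat_pairs: "length (concat (map (\<lambda>(i, j). [i, j]) xs)) = 2 * length xs"
  by (induction xs) auto

lemma concat_points_nth:
  "\<forall>x\<in>set xs. length x = d \<Longrightarrow> v < length xs \<Longrightarrow> j < d \<Longrightarrow> concat xs ! (v * d + j) = xs ! v ! j"
proof (induction xs arbitrary: v)
  case (Cons x xs)
  then show ?case by (cases v) (auto simp: nth_append add.assoc)
qed simp

lemma length_concat_points: "\<forall>x\<in>set xs. length x = d \<Longrightarrow> length (concat xs) = length xs * d"
  by (induction xs) auto

context ram_tree
begin

text \<open>For n = 1 there are no edges and the guarantee is vacuous; this case is separated
  because the probability bound assumes n \<ge> 2.\<close>

lemma ok_FINISH:
  assumes inp: "edges_in I" "coords R" "R 0 0 = \<alpha>" and \<alpha>: "1 \<le> \<alpha>" and par: "params \<rho> C c n d I R"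
    and rc: "recd_all I" "(\<Sum>e<E. I aQS e) \<le> n * hh n" "(\<Sum>B<n. I aSz B) \<le> n + n * hh n"
    and best: "\<And>e. e < E \<Longrightarrow> R aBest e = wt e" and b: "max_word \<rho> C c n d \<le> M"
  shows "ok (MAIN ;; SCALE) I R T0 (\<lambda>I' R' T'. T' \<le> T0 + main_steps \<rho> C c n d \<and>
    (n = 1 \<or> (\<exists>r<c * hh n. goodrep (1 / real (hh n)) (TT n) \<alpha> (4 * mm \<rho> C n * n * hh n) (mm \<rho> C n) (d * KK n) (KK n) I R r) \<longrightarrow>
     (\<forall>e<E. cw e \<le> R' aBest e \<and> R' aBest e \<le> \<alpha> * cw e)))"
proof -
  note B = word_bounds[OF b]
  have v: "I vK 0 = KK n" "I vL 0 = d * KK n" "I vm 0 = mm \<rho> C n" "I vrm 0 = c * hh n" "I vbud0 0 = bud \<rho> C n"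
    "I vW 0 = n * n" "I vE 0 = E" "R rT 0 = TT n"
    using par E_eq by (simp_all add: params_def)
  have K0: "0 \<le> HH n" unfolding HH_def by (intro sum_nonneg) simp
  have T0: "0 \<le> TT n" unfolding TT_def using K0 by simp
  have Tp: "0 < TT n" if "0 < E"
  proof -
    have n2: "2 \<le> n" using that E_eq by linarith
    have "ln 2 \<le> ln (real n)" using n2 by (subst ln_le_cancel_iff) auto
    also have "\<dots> \<le> HH n" using n2 by (intro harmonic_bounds) simp
    finally have "0 < HH n" using ln_gt_zero[of "2 :: real"] by linarith
    moreover have "0 < KK n" using hh_pos[OF n2] by (simp add: KK_def)
    ultimately show ?thesis unfolding TT_def by (intro mult_pos_pos) (auto simp: add_pos_nonneg)
  qed
  have ep: "0 < search_eps n"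
  proof (cases "n = 1")
    case False
    then have "1 \<le> hh n" using n_pos by (intro hh_pos) simp
    then show ?thesis using False by (simp add: search_eps_def)
  qed (simp add: search_eps_def)
  have 1: "ok MAIN I R T0 (\<lambda>I' R' T'. T' \<le> T0 + 2 + c * hh n * (5 + mm \<rho> C n * iter_cost (d * KK n) (hh n) + bud \<rho> C n * (3 * d + 14)) \<and>
    (\<forall>e<E. wt e \<le> R' aBest e \<and> R' aBest e \<le> cw e) \<and>
    ((\<exists>r<c * hh n. goodrep (search_eps n) (TT n) \<alpha> (4 * mm \<rho> C n * n * hh n) (mm \<rho> C n) (d * KK n) (KK n) I R r) \<longrightarrow>
      (\<forall>e<E. cw e \<le> \<alpha> * R' aBest e)))"
  proof (rule ok_MAIN[OF inp(1,2) rc v(1-8) Tp T0 ep \<alpha> best B(1-3) B(6) B(7) B(8) B(9) B(11) _ hh_ge Lam_budget])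
    show "c * hh n * mm \<rho> C n * (d * KK n) \<le> M" using B(10) by (simp only: coin_count_def mult.assoc)
  qed
  show ?thesis
  proof (rule ok_Seq, rule ok_conseq[OF 1])
    fix I1 R1 T1
    assume p: "T1 \<le> T0 + 2 + c * hh n * (5 + mm \<rho> C n * iter_cost (d * KK n) (hh n) + bud \<rho> C n * (3 * d + 14)) \<and>
      (\<forall>e<E. wt e \<le> R1 aBest e \<and> R1 aBest e \<le> cw e) \<and>
      ((\<exists>r<c * hh n. goodrep (search_eps n) (TT n) \<alpha> (4 * mm \<rho> C n * n * hh n) (mm \<rho> C n) (d * KK n) (KK n) I R r) \<longrightarrow>
        (\<forall>e<E. cw e \<le> \<alpha> * R1 aBest e))"
      and fi: "\<And>a. a \<notin> imods MAIN \<Longrightarrow> I1 a = I a" and fr: "\<And>a. a \<notin> rmods MAIN \<Longrightarrow> R1 a = R a"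
    have EM: "E \<le> M" using E_le(1) B(1) by linarith
    have f: "I1 vE 0 = E" "R1 0 0 = \<alpha>" using fi[of vE] fr[of 0] v inp(3) by simp_all
    show "ok SCALE I1 R1 T1 (\<lambda>I' R' T'. T' \<le> T0 + main_steps \<rho> C c n d \<and>
      (n = 1 \<or> (\<exists>r<c * hh n. goodrep (1 / real (hh n)) (TT n) \<alpha> (4 * mm \<rho> C n * n * hh n) (mm \<rho> C n) (d * KK n) (KK n) I R r) \<longrightarrow>
       (\<forall>e<E. cw e \<le> R' aBest e \<and> R' aBest e \<le> \<alpha> * cw e)))"
    proof (rule ok_conseq[OF ok_SCALE[where I = I1 and R = R1 and \<alpha> = \<alpha>, OF f(1) EM f(2)]])
      fix I2 R2 T2
      assume q: "T2 \<le> T1 + 2 + 3 * E \<and> (\<forall>e<E. R2 aBest e = \<alpha> * R1 aBest e)"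
      have "T2 \<le> T0 + main_steps \<rho> C c n d"
        using p q E_le(3) unfolding main_steps_def iter_cost_def by linarith
      moreover have "cw e \<le> R2 aBest e \<and> R2 aBest e \<le> \<alpha> * cw e"
        if g: "n = 1 \<or> (\<exists>r<c * hh n. goodrep (1 / real (hh n)) (TT n) \<alpha> (4 * mm \<rho> C n * n * hh n) (mm \<rho> C n) (d * KK n) (KK n) I R r)"
          and e: "e < E" for e
      proof -
        have "n \<noteq> 1" using e E_eq by auto
        then have "\<exists>r<c * hh n. goodrep (search_eps n) (TT n) \<alpha> (4 * mm \<rho> C n * n * hh n) (mm \<rho> C n) (d * KK n) (KK n) I R r"
          using g by (simp only: search_eps_def if_False simp_thms)
        then have "\<forall>e<E. cw e \<le> \<alpha> * R1 aBest e" by (rule mp[OF conjunct2[OF conjunct2[OF p]]])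
        then have "cw e \<le> \<alpha> * R1 aBest e" using e by simp
        moreover have "\<alpha> * R1 aBest e \<le> \<alpha> * cw e" using p e \<alpha> by (intro mult_left_mono) auto
        moreover have "R2 aBest e = \<alpha> * R1 aBest e" using q e by simp
        ultimately show ?thesis by simp
      qed
      ultimately show "T2 \<le> T0 + main_steps \<rho> C c n d \<and>
        (n = 1 \<or> (\<exists>r<c * hh n. goodrep (1 / real (hh n)) (TT n) \<alpha> (4 * mm \<rho> C n * n * hh n) (mm \<rho> C n) (d * KK n) (KK n) I R r) \<longrightarrow>
         (\<forall>e<E. cw e \<le> R2 aBest e \<and> R2 aBest e \<le> \<alpha> * cw e))" by (metis (no_types, lifting))
    qed
  qed
qed

text \<open>Initialisation and search are point masses, so the whole run is the image of the coin
  distribution under a function. Resource bounds hold for each outcome, and the success probability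
  is at least that of a good coin string.\<close>

lemma exec_PROG:
  fixes \<alpha> :: real
  defines "\<rho> \<equiv> 1 / \<alpha>\<^sup>2" and "C \<equiv> 53747712 :: nat"
  assumes Z: "cwt (PROG C c) \<le> Z" and \<alpha>: "1 \<le> \<alpha>" and b: "max_word \<rho> C c n d \<le> M"
    and s0: "edges_in (imem s0)" "coords (rmem s0)" "rmem s0 0 0 = \<alpha>" "bnd (imem s0)" "\<And>q. imem s0 aBit q \<le> 1"
      "space_ok A s0" "run_time s0 = 0"
  shows "lossless_spmf (exec (PROG C c) s0)"
    "\<And>u. u \<in> set_spmf (exec (PROG C c) s0) \<Longrightarrow> run_time u \<le> Z * nat_len M * total_steps \<rho> C c n d \<and>
       peak_space u \<le> A + Z * nat_len M * total_steps \<rho> C c n d"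
    "1 - 1 / real n ^ c \<le> measure (measure_spmf (exec (PROG C c) s0))
       {s. \<exists>ACW. outputs pts es s ACW \<and> approximates_cut_weights \<alpha> T ACW}"
proof -
  note B = word_bounds[OF b]
  define m where "m = mm \<rho> C n"
  define N where "N = coin_count \<rho> C c n d"
  define W where "W = Z * nat_len M"
  have Zs: "cwt (INIT C c) \<le> Z" "cwt FLIPS \<le> Z" "cwt (MAIN ;; SCALE) \<le> Z" using Z by (simp_all add: PROG_def)
  have "ok (INIT C c) (imem s0) (rmem s0) 0 (\<lambda>I' R' T'. params \<rho> C c n d I' R' \<and> recd_all I' \<and> (\<Sum>e<E. I' aQS e) \<le> n * hh n \<and>
    (\<Sum>B<n. I' aSz B) \<le> n + n * hh n \<and> (\<forall>e<E. R' aBest e = wt e) \<and> T' \<le> 0 + init_steps \<rho> C n d)"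
    by (rule ok_INIT[OF s0(1-3) _ b]) (simp add: \<rho>_def)
  then obtain s1 T1 where s1: "exec (INIT C c) s0 = return_spmf s1" "stp (INIT C c) s0 0 s1 T1" "params \<rho> C c n d (imem s1) (rmem s1)"
      "recd_all (imem s1)" "(\<Sum>e<E. imem s1 aQS e) \<le> n * hh n" "(\<Sum>B<n. imem s1 aSz B) \<le> n + n * hh n"
      "\<forall>e<E. rmem s1 aBest e = wt e" "T1 \<le> init_steps \<rho> C n d"
    unfolding ok_def using Zs(1) s0(4) by auto
  have fi: "imem s1 a = imem s0 a" if "a < 3" for a using s1(2) mods_INIT(1)[OF that] by (simp add: stp_def)
  have fr: "rmem s1 a = rmem s0 a" if "a < 2" for a using s1(2) mods_INIT(2)[OF that] by (simp add: stp_def)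
  have s1i: "edges_in (imem s1)" "coords (rmem s1)" "rmem s1 0 0 = \<alpha>" "bnd (imem s1)" "\<forall>q. imem s1 aBit q \<le> 1"
    using s0 s1(2) fi[of 0] fi[of 1] fi[of 2] fr[of 0] fr[of 1]
    unfolding edges_in_def coords_def stp_def by simp_all
  have vN: "imem s1 vnb 0 = N" using s1(3) by (simp add: params_def N_def coin_count_def)
  note F = exec_FLIPS[OF Zs(2) B(10)[folded N_def] vN s1i(4)]
  define G where "G b \<longleftrightarrow> n = 1 \<or> (\<exists>r<c * hh n. good_coins \<alpha> m (imem s1) (blk (m * (d * KK n)) r b))" for b
  have ex_u: "\<exists>u T'. exec (MAIN ;; SCALE) t = return_spmf u \<and> stp (MAIN ;; SCALE) t (T1 + 3 * N + 2) u T' \<and>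
      T' \<le> T1 + 3 * N + 2 + main_steps \<rho> C c n d \<and>
      (G (coins N (imem t)) \<longrightarrow> (\<forall>e<E. cw e \<le> rmem u aBest e \<and> rmem u aBest e \<le> \<alpha> * cw e))"
    if t: "t \<in> set_spmf (exec FLIPS s1)" for t
  proof -
    have st: "stp FLIPS s1 T1 t (T1 + 3 * N + 2)" "rmem t = rmem s1" and bit: "\<forall>q. imem t aBit q \<le> 1"
      using F(2)[OF t, of T1] s1i(5) by auto
    have ft: "imem t a = imem s1 a" if "a \<noteq> aBit" "a \<noteq> vz" for a using st(1) that by (simp add: stp_def mods_FLIPS)
    have banks: "imem t 0 = imem s1 0" "imem t 1 = imem s1 1" "imem t aQA = imem s1 aQA" "imem t aQS = imem s1 aQS" "imem t aQB = imem s1 aQB"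
      "imem t aQT = imem s1 aQT" "imem t aArr = imem s1 aArr" "imem t aSz = imem s1 aSz"
      "imem t vK = imem s1 vK" "imem t vL = imem s1 vL" "imem t vm = imem s1 vm" "imem t vrm = imem s1 vrm" "imem t vnb = imem s1 vnb"
      "imem t vbud0 = imem s1 vbud0" "imem t vW = imem s1 vW" "imem t vE = imem s1 vE"
      by (rule ft; simp)+
    have e: "edges_in (imem t)" using s1i(1) unfolding edges_in_def banks .
    have par: "params \<rho> C c n d (imem t) (rmem t)" using s1(3) unfolding params_def banks st(2) .
    have rt: "recd_all (imem t)" using s1(4) unfolding recd_all_def banks .
    have J: "idx (imem s1) = idx (imem t)" "prs (imem s1) = prs (imem t)" unfolding idx_def prs_def banks by simp_all
    have ct: "coords (rmem t)" "rmem t 0 0 = \<alpha>" unfolding st(2) by (rule s1i(2), rule s1i(3))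
    have bt: "bnd (imem t)" using st(1) by (simp add: stp_def)
    have "ok (MAIN ;; SCALE) (imem t) (rmem t) (T1 + 3 * N + 2) (\<lambda>I' R' T'. T' \<le> T1 + 3 * N + 2 + main_steps \<rho> C c n d \<and>
      (n = 1 \<or> (\<exists>r<c * hh n. goodrep (1 / real (hh n)) (TT n) \<alpha> (4 * mm \<rho> C n * n * hh n) (mm \<rho> C n) (d * KK n) (KK n) (imem t) (rmem t) r) \<longrightarrow>
       (\<forall>e<E. cw e \<le> R' aBest e \<and> R' aBest e \<le> \<alpha> * cw e)))"
      by (rule ok_FINISH[OF e ct \<alpha> par rt _ _ _ b]) (simp_all add: banks s1 st(2))
    then obtain u T' where u: "exec (MAIN ;; SCALE) t = return_spmf u" "stp (MAIN ;; SCALE) t (T1 + 3 * N + 2) u T'"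
        "T' \<le> T1 + 3 * N + 2 + main_steps \<rho> C c n d"
        "n = 1 \<or> (\<exists>r<c * hh n. goodrep (1 / real (hh n)) (TT n) \<alpha> (4 * mm \<rho> C n * n * hh n) (mm \<rho> C n) (d * KK n) (KK n) (imem t) (rmem t) r) \<longrightarrow>
           (\<forall>e<E. cw e \<le> rmem u aBest e \<and> rmem u aBest e \<le> \<alpha> * cw e)"
      unfolding ok_def using Zs(3) bt by blast
    have "n = 1 \<or> (\<exists>r<c * hh n. goodrep (1 / real (hh n)) (TT n) \<alpha> (4 * mm \<rho> C n * n * hh n) (mm \<rho> C n) (d * KK n) (KK n) (imem t) (rmem t) r)"
      if g: "G (coins N (imem t))"
    proof (cases "n = 1")
      case False
      then have n2: "2 \<le> n" using n_pos by simp
      obtain r where r: "r < c * hh n" "good_coins \<alpha> m (imem s1) (blk (m * (d * KK n)) r (coins N (imem t)))"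
        using g False unfolding G_def by blast
      have "goodrep (1 / real (hh n)) (TT n) \<alpha> (4 * m * n * hh n) m (d * KK n) (KK n) (imem t) (rmem t) r"
        using bit by (intro goodrep_of_coins[OF ct(1) _ r(1) n2 rt J r(2)[unfolded N_def coin_count_def m_def[symmetric]]]) blast
      then show ?thesis using r(1) unfolding m_def by blast
    qed simp
    then show ?thesis using u by blast
  qed
  then obtain Fu Tu where U: "\<And>t. t \<in> set_spmf (exec FLIPS s1) \<Longrightarrow> exec (MAIN ;; SCALE) t = return_spmf (Fu t) \<and>
      stp (MAIN ;; SCALE) t (T1 + 3 * N + 2) (Fu t) (Tu t) \<and> Tu t \<le> T1 + 3 * N + 2 + main_steps \<rho> C c n d \<and>
      (G (coins N (imem t)) \<longrightarrow> (\<forall>e<E. cw e \<le> rmem (Fu t) aBest e \<and> rmem (Fu t) aBest e \<le> \<alpha> * cw e))"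
    by metis
  have "exec (PROG C c) s0 = bind_spmf (exec FLIPS s1) (exec (MAIN ;; SCALE))"
    unfolding PROG_def exec.simps(5)[of "INIT C c"] s1(1) return_bind_spmf exec.simps(5)[of FLIPS] ..
  also have "\<dots> = bind_spmf (exec FLIPS s1) (\<lambda>t. return_spmf (Fu t))"
    using U by (intro bind_spmf_cong refl) blast
  finally have ex: "exec (PROG C c) s0 = map_spmf Fu (exec FLIPS s1)" by (simp only: map_spmf_conv_bind_spmf)
  show "lossless_spmf (exec (PROG C c) s0)" unfolding ex using F(1) by (simp only: lossless_map_spmf)
  show "run_time u \<le> Z * nat_len M * total_steps \<rho> C c n d \<and> peak_space u \<le> A + Z * nat_len M * total_steps \<rho> C c n d"
    if u: "u \<in> set_spmf (exec (PROG C c) s0)" for u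
  proof -
    obtain t where t: "t \<in> set_spmf (exec FLIPS s1)" "u = Fu t" using u unfolding ex set_map_spmf by blast
    define X where "X = T1 + 3 * N + 2"
    have r: "run_time s1 + W * 0 \<le> run_time s0 + W * T1" "run_time t + W * T1 \<le> run_time s1 + W * X"
        "run_time u + W * X \<le> run_time t + W * Tu t"
      using s1(2) conjunct1[OF F(2)[OF t(1), of T1]] U[OF t(1)] unfolding stp_def W_def X_def t(2) by blast+
    have "Tu t \<le> total_steps \<rho> C c n d"
      using U[OF t(1)] s1(8) unfolding total_steps_def N_def by linarith
    then have "W * Tu t \<le> W * total_steps \<rho> C c n d" by (rule mult_le_mono2)
    then have rt: "run_time u \<le> W * total_steps \<rho> C c n d" using r s0(7) by linarith
    have "space_ok A u"
      using s1(2) conjunct1[OF F(2)[OF t(1), of T1]] U[OF t(1)] s0(6) unfolding stp_def t(2) by blast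
    then show ?thesis using rt by (auto simp: space_ok_def W_def)
  qed
  have N: "N = c * hh n * (m * (d * KK n))" by (simp only: N_def coin_count_def m_def)
  have "1 - 1 / real n ^ c \<le> avg N (\<lambda>b. of_bool (G b))"
  proof (cases "n = 1")
    case False
    then have n2: "2 \<le> n" using n_pos by simp
    have "1 / 2 \<le> avg (m * (d * KK n)) (\<lambda>b. of_bool (good_coins \<alpha> m (imem s1) b))"
      unfolding m_def \<rho>_def C_def by (rule good_coins_prob[OF n2 \<alpha> s1(4,5)])
    from repeat_prob[OF this, of n c] show ?thesis unfolding N G_def using n2 by simp
  qed (simp add: G_def)
  also have "\<dots> \<le> measure (measure_spmf (exec FLIPS s1)) {t. G (coins N (imem t))}" by (rule F(3))
  also have "\<dots> \<le> measure (measure_spmf (exec FLIPS s1)) (Fu -` {s. \<exists>ACW. outputs pts es s ACW \<and> approximates_cut_weights \<alpha> T ACW})"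
  proof (rule measure_spmf.finite_measure_mono_AE)
    have "t \<in> Fu -` {s. \<exists>ACW. outputs pts es s ACW \<and> approximates_cut_weights \<alpha> T ACW}"
      if t: "t \<in> set_spmf (exec FLIPS s1)" "G (coins N (imem t))" for t
    proof -
      have "\<exists>ACW. outputs pts es (Fu t) ACW \<and> approximates_cut_weights \<alpha> T ACW"
        using U[OF t(1)] t(2) by (intro approximation_exists) blast
      then show ?thesis by simp
    qed
    then show "AE t in measure_spmf (exec FLIPS s1). t \<in> {t. G (coins N (imem t))} \<longrightarrow>
        t \<in> Fu -` {s. \<exists>ACW. outputs pts es s ACW \<and> approximates_cut_weights \<alpha> T ACW}"
      unfolding AE_measure_spmf_iff mem_Collect_eq by blast
  qed simp
  finally show "1 - 1 / real n ^ c \<le> measure (measure_spmf (exec (PROG C c) s0))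
       {s. \<exists>ACW. outputs pts es s ACW \<and> approximates_cut_weights \<alpha> T ACW}"
    unfolding ex measure_map_spmf .
qed

lemmas ram_M = M

text \<open>The input occupies at most 3 + 2 * n + n * d cells. An index is at most M^2 and so has
  at most twice the bits of M; the contents add that number once more.\<close>

lemma input_ok:
  fixes \<alpha> :: real
  defines "s0 \<equiv> input_state \<alpha> d pts es"
  assumes Mb: "d \<le> M" "3 * n \<le> M"
  shows "edges_in (imem s0)" "coords (rmem s0)" "rmem s0 0 0 = \<alpha>" "bnd (imem s0)" "imem s0 aBit q \<le> 1"
    "space_ok ((3 + 2 * n + n * d) * (3 * nat_len M)) s0" "run_time s0 = 0"
proof -
  have len: "\<forall>x\<in>set pts. length x = d" using pts X by (auto simp: euclid_def)
  have lc: "length (concat pts) = n * d" using length_concat_points[OF len] pts by simp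
  have im: "imem s0 = (\<lambda>_ _. 0)(0 := bank [length pts, d], 1 := bank (concat (map (\<lambda>(i, j). [i, j]) es)))"
    and rm: "rmem s0 = (\<lambda>_ _. 0)(0 := bank [\<alpha>], 1 := bank (concat pts))"
    and ic: "icells s0 = {0} \<times> {..<2} \<union> {1} \<times> {..<2 * length es}"
    and rc: "rcells s0 = {0} \<times> {..<1} \<union> {1} \<times> {..<n * d}"
    and tm: "run_time s0 = 0"
    unfolding lc[symmetric] by (simp_all add: s0_def input_state_def update_peak_def)
  have pk: "peak_space s0 = mem_size s0"
    by (simp add: s0_def input_state_def update_peak_def mem_size_def)
  show "run_time s0 = 0" by (rule tm)
  show "edges_in (imem s0)"
    unfolding edges_in_def im using concat_pairs_nth[of _ es] pts
    by (simp add: bank_def length_concat_pairs ex_def ey_def)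
  have "v * d + j < n * d" if "v < n" "j < d" for v j
  proof -
    have "Suc v * d \<le> n * d" using that by (intro mult_le_mono1) simp
    then show ?thesis using that by simp
  qed
  then show "coords (rmem s0)"
    unfolding coords_def rm using concat_points_nth[OF len] pts by (simp add: bank_def lc)
  show "rmem s0 0 0 = \<alpha>" by (simp add: rm bank_def)
  show "imem s0 aBit q \<le> 1" by (simp add: im)
  have b1: "bank xs i \<le> M" if "\<forall>x\<in>set xs. x \<le> M" for xs :: "nat list" and i
    using that by (simp add: bank_def)
  have "fst z \<le> M \<and> snd z \<le> M" if z: "z \<in> set es" for z
  proof -
    obtain e where "e < E" "z = es ! e" using z by (auto simp: in_set_conv_nth)
    then have "fst z < n" "snd z < n" using ex_lt[of e] ey_lt[of e] by (auto simp: ex_def ey_def)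
    then show ?thesis using Mb by linarith
  qed
  then have "\<forall>x\<in>set (concat (map (\<lambda>(i, j). [i, j]) es)). x \<le> M" by fastforce
  then have e1: "bank (concat (map (\<lambda>(i, j). [i, j]) es)) i \<le> M" for i by (rule b1)
  have "bank [length pts, d] i \<le> M" for i using Mb pts by (intro b1) auto
  then show bn: "bnd (imem s0)" unfolding bnd_def im using e1 by simp
  have mM: "nat_len (imem s0 a i) \<le> nat_len M" for a i
    using nat_len_pow_le[of "imem s0 a i" M 1] bn ram_M by (simp add: bnd_def)
  have il: "nat_len i \<le> 2 * nat_len M" if "i < 3 * n \<or> i < n * d \<or> i < 2" for i
  proof (rule nat_len_pow_le)
    have "n * d \<le> M * M" using Mb by (intro mult_le_mono) auto
    moreover have "M * 1 \<le> M * M" using ram_M by (intro mult_le_mono) auto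
    ultimately show "i \<le> M ^ 2" using that Mb ram_M unfolding power2_eq_square by linarith
  qed (use ram_M in auto)
  have L1: "1 \<le> nat_len M" by (rule nat_len_ge_1)
  have fin: "finite (icells s0)" "finite (rcells s0)" by (simp_all add: ic rc)
  have "card (icells s0) = 2 + 2 * E" unfolding ic by (subst card_Un_disjoint) (auto simp: card_cartesian_product)
  then have ci: "card (icells s0) \<le> 2 + 2 * n" using E_le by simp
  have cr: "card (rcells s0) = 1 + n * d" unfolding rc by (subst card_Un_disjoint) (auto simp: card_cartesian_product)
  have "(\<Sum>(a, i)\<in>icells s0. nat_len i + nat_len (imem s0 a i)) \<le> card (icells s0) * (3 * nat_len M)"
  proof (rule sum_bounded_above[where 'a = nat, simplified])
    fix z assume z: "z \<in> icells s0"
    then have "nat_len (snd z) \<le> 2 * nat_len M" using E_le by (intro il) (auto simp: ic)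
    then show "(case z of (a, i) \<Rightarrow> nat_len i + nat_len (imem s0 a i)) \<le> 3 * nat_len M"
      using mM[of "fst z" "snd z"] by (simp add: case_prod_unfold)
  qed
  moreover have "(\<Sum>(a, i)\<in>rcells s0. nat_len i + 1) \<le> card (rcells s0) * (3 * nat_len M)"
  proof (rule sum_bounded_above[where 'a = nat, simplified])
    fix z assume z: "z \<in> rcells s0"
    then have "nat_len (snd z) \<le> 2 * nat_len M" by (intro il) (auto simp: rc)
    then show "(case z of (a, i) \<Rightarrow> nat_len i + 1) \<le> 3 * nat_len M" using L1 by (simp add: case_prod_unfold)
  qed
  ultimately have "mem_size s0 \<le> card (icells s0) * (3 * nat_len M) + card (rcells s0) * (3 * nat_len M)"
    unfolding mem_size_def by (rule add_mono)
  also have "\<dots> = (card (icells s0) + card (rcells s0)) * (3 * nat_len M)" by (simp only: add_mult_distrib)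
  also have "\<dots> \<le> (3 + 2 * n + n * d) * (3 * nat_len M)" using ci cr by (intro mult_le_mono1) simp
  finally show "space_ok ((3 + 2 * n + n * d) * (3 * nat_len M)) s0" using fin pk by (simp add: space_ok_def)
qed

end

section \<open>Asymptotics\<close>

abbreviation soft_powr :: "real \<Rightarrow> (nat \<Rightarrow> real) set" where
  "soft_powr a \<equiv> soft_O (\<lambda>n. real n powr a)"

lemma soft_powrI: "f \<in> O(\<lambda>n. real n powr a * ln (real n) ^ k) \<Longrightarrow> f \<in> soft_powr a"
  unfolding soft_O_def by blast

lemma soft_powrE:
  assumes "f \<in> soft_powr a"
  obtains k where "f \<in> O(\<lambda>n. real n powr a * ln (real n) ^ k)"
  using assms unfolding soft_O_def by blast

lemma soft_powr_mult:
  assumes "f \<in> soft_powr a" "g \<in> soft_powr b"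
  shows "(\<lambda>n. f n * g n) \<in> soft_powr (a + b)"
proof -
  obtain k where k: "f \<in> O(\<lambda>n. real n powr a * ln (real n) ^ k)" using assms(1) by (rule soft_powrE)
  obtain l where l: "g \<in> O(\<lambda>n. real n powr b * ln (real n) ^ l)" using assms(2) by (rule soft_powrE)
  have "(\<lambda>n. f n * g n) \<in> O(\<lambda>n. (real n powr a * ln (real n) ^ k) * (real n powr b * ln (real n) ^ l))"
    by (rule landau_o.big.mult[OF k l])
  also have "(\<lambda>n. (real n powr a * ln (real n) ^ k) * (real n powr b * ln (real n) ^ l)) =
      (\<lambda>n. real n powr (a + b) * ln (real n) ^ (k + l))"
    by (simp add: powr_add power_add mult_ac)
  finally show ?thesis by (rule soft_powrI)
qed

text \<open>From n = 3 on the logarithm is at least 1, so raising its exponent can only enlarge the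
  bound.\<close>

lemma log_power_mono:
  assumes "a \<le> b" "k \<le> l"
  shows "(\<lambda>n. real n powr a * ln (real n) ^ k) \<in> O(\<lambda>n. real n powr b * ln (real n) ^ l)"
proof (rule bigoI[where c = 1])
  show "\<forall>\<^sub>F n in sequentially. norm (real n powr a * ln (real n) ^ k) \<le> 1 * norm (real n powr b * ln (real n) ^ l)"
  proof (rule eventually_mono[OF eventually_ge_at_top[of 3]])
    fix n :: nat assume n: "3 \<le> n"
    have "exp 1 \<le> real n" using exp_le n by linarith
    then have "1 \<le> ln (real n)" using n by (subst ln_ge_iff) auto
    then have "real n powr a * ln (real n) ^ k \<le> real n powr b * ln (real n) ^ l"
      using n assms by (intro mult_mono powr_mono power_increasing) auto
    moreover have "0 \<le> real n powr a * ln (real n) ^ k" using \<open>1 \<le> ln (real n)\<close> by simp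
    ultimately show "norm (real n powr a * ln (real n) ^ k) \<le> 1 * norm (real n powr b * ln (real n) ^ l)" by simp
  qed
qed

lemma soft_powr_mono: "f \<in> soft_powr a \<Longrightarrow> a \<le> b \<Longrightarrow> f \<in> soft_powr b"
  by (erule soft_powrE, rule soft_powrI, erule landau_o.big_trans) (rule log_power_mono, auto)

lemma soft_powr_add:
  assumes "f \<in> soft_powr a" "g \<in> soft_powr a"
  shows "(\<lambda>n. f n + g n) \<in> soft_powr a"
proof -
  obtain k where k: "f \<in> O(\<lambda>n. real n powr a * ln (real n) ^ k)" using assms(1) by (rule soft_powrE)
  obtain l where l: "g \<in> O(\<lambda>n. real n powr a * ln (real n) ^ l)" using assms(2) by (rule soft_powrE)
  have "f \<in> O(\<lambda>n. real n powr a * ln (real n) ^ max k l)" "g \<in> O(\<lambda>n. real n powr a * ln (real n) ^ max k l)"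
    by (rule landau_o.big_trans[OF k log_power_mono], simp, simp) (rule landau_o.big_trans[OF l log_power_mono], simp, simp)
  then show ?thesis by (intro soft_powrI[of _ a "max k l"] sum_in_bigo)
qed

lemma soft_powr_le:
  assumes "g \<in> soft_powr a" "\<And>n. 1 \<le> n \<Longrightarrow> 0 \<le> f n \<and> f n \<le> g n"
  shows "f \<in> soft_powr a"
proof -
  have "f \<in> O(g)"
    by (rule bigoI[where c = 1], rule eventually_mono[OF eventually_ge_at_top[of 1]]) (use assms(2) in force)
  with assms(1) show ?thesis
    by (elim soft_powrE) (rule soft_powrI, erule (1) landau_o.big_trans)
qed

lemma soft_powr_const: "0 \<le> a \<Longrightarrow> (\<lambda>n. x) \<in> soft_powr a"
  by (rule soft_powr_mono[of _ 0], rule soft_powrI[of _ _ 0]) real_asymp+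

lemma soft_powr_id: "(\<lambda>n. real n) \<in> soft_powr 1"
  by (rule soft_powrI[of _ _ 0]) (rule bigoI[of _ 1], simp)

lemma soft_powr_power: "f \<in> soft_powr 0 \<Longrightarrow> (\<lambda>n. f n ^ j) \<in> soft_powr 0"
proof (induction j)
  case 0
  show ?case unfolding power_0 by (rule soft_powr_const) simp
next
  case (Suc j)
  from soft_powr_mult[OF Suc.prems Suc.IH[OF Suc.prems]] show ?case unfolding power_Suc add_0_left .
qed

lemma soft_powr_multl: "f \<in> soft_powr 0 \<Longrightarrow> g \<in> soft_powr a \<Longrightarrow> (\<lambda>n. f n * g n) \<in> soft_powr a"
  using soft_powr_mult[of f 0 g a] unfolding add_0_left .

lemma soft_powr_multr: "f \<in> soft_powr a \<Longrightarrow> g \<in> soft_powr 0 \<Longrightarrow> (\<lambda>n. f n * g n) \<in> soft_powr a"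
  using soft_powr_mult[of f a g 0] unfolding add_0_right .

lemma two_pow_hh: "1 \<le> n \<Longrightarrow> 2 ^ hh n \<le> 2 * n"
proof (cases "hh n")
  case (Suc j)
  have "\<not> n \<le> 2 ^ j" using not_less_Least[of j "\<lambda>h. n \<le> 2 ^ h"] Suc by (simp add: hh_def)
  then show ?thesis using Suc by simp
qed simp

lemma soft_hh: "(\<lambda>n. real (hh n)) \<in> soft_powr 0"
proof (rule soft_powr_le)
  show "(\<lambda>n. 1 + ln (real n) / ln 2) \<in> soft_powr 0"
    by (rule soft_powrI[of _ _ 1]) real_asymp
  show "0 \<le> real (hh n) \<and> real (hh n) \<le> 1 + ln (real n) / ln 2" if n: "1 \<le> n" for n
  proof -
    have "(2::real) ^ hh n \<le> 2 * real n" using two_pow_hh[OF n] by (metis of_nat_le_iff of_nat_mult of_nat_numeral of_nat_power)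
    then have "ln ((2::real) ^ hh n) \<le> ln (2 * real n)" using n by (subst ln_le_cancel_iff) auto
    then have "real (hh n) * ln 2 \<le> ln 2 + ln (real n)" using n by (simp add: ln_realpow ln_mult)
    then show ?thesis by (simp add: field_simps)
  qed
qed

lemma soft_two_pow_hh: "(\<lambda>n. 2 ^ hh n) \<in> soft_powr 1"
proof (rule soft_powr_le)
  show "(\<lambda>n. 2 * real n) \<in> soft_powr 1" by (intro soft_powr_multl soft_powr_const soft_powr_id order_refl)
  show "0 \<le> (2::real) ^ hh n \<and> 2 ^ hh n \<le> 2 * real n" if n: "1 \<le> n" for n
    using two_pow_hh[OF n] by (metis of_nat_le_iff of_nat_mult of_nat_numeral of_nat_power zero_le_numeral zero_le_power)
qed

lemma soft_KK: "(\<lambda>n. real (KK n)) \<in> soft_powr 0"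
  unfolding KK_def of_nat_power of_nat_mult
  by (intro soft_powr_power soft_powr_multl soft_hh soft_powr_const order_refl)

text \<open>The estimate 1 + x \<le> e^x gives PP \<rho> n \<le> exp (\<rho> * HH n) \<le> exp
  \<rho> * n powr \<rho>, the counterpart of \<open>exp_HH_le\<close>.\<close>

lemma soft_mm:
  assumes \<rho>: "0 \<le> \<rho>"
  shows "(\<lambda>n. real (mm \<rho> C n)) \<in> soft_powr \<rho>"
proof (rule soft_powr_le)
  show "(\<lambda>n. real C * real (hh n) ^ 3 * (exp \<rho> * real n powr \<rho>) + 1) \<in> soft_powr \<rho>"
    by (intro soft_powr_add soft_powr_multl[of "\<lambda>n. real C * real (hh n) ^ 3"] soft_powr_multl[of "\<lambda>n. real C"]
        soft_powr_multl[of "\<lambda>n. exp \<rho>"] soft_powr_power soft_hh soft_powr_const order_refl \<rho> soft_powrI[of _ _ 0]) simp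
  fix n :: nat assume n: "1 \<le> n"
  have "PP \<rho> n \<le> (\<Prod>k<n. exp (\<rho> / (real k + 1)))"
    unfolding PP_def using \<rho> by (intro prod_mono) (auto simp: exp_ge_add_one_self add_nonneg_nonneg)
  also have "\<dots> = exp (\<rho> * HH n)" by (simp add: HH_def sum_distrib_left exp_sum)
  also have "\<dots> \<le> exp (\<rho> * (1 + ln (real n)))"
    using harmonic_bounds(2)[OF n] \<rho> by (simp add: mult_left_mono)
  also have "\<dots> = exp \<rho> * real n powr \<rho>" using n by (simp add: powr_def distrib_left exp_add mult.commute)
  finally have P: "PP \<rho> n \<le> exp \<rho> * real n powr \<rho>" .
  have P0: "0 \<le> PP \<rho> n" unfolding PP_def using \<rho> by (intro prod_nonneg) auto
  have "real (mm \<rho> C n) \<le> real C * real (hh n) ^ 3 * PP \<rho> n + 1"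
  proof -
    have "0 \<le> real C * real (hh n) ^ 3 * PP \<rho> n" using P0 by simp
    then show ?thesis unfolding mm_def by (subst of_nat_nat) (auto intro: of_int_ceiling_le_add_one)
  qed
  also have "\<dots> \<le> real C * real (hh n) ^ 3 * (exp \<rho> * real n powr \<rho>) + 1" using P by (intro add_right_mono mult_left_mono) auto
  finally show "0 \<le> real (mm \<rho> C n) \<and> real (mm \<rho> C n) \<le> real C * real (hh n) ^ 3 * (exp \<rho> * real n powr \<rho>) + 1" by simp
qed

context
  fixes \<rho> :: real and C c :: nat and dim :: "nat \<Rightarrow> nat"
  assumes \<rho>: "0 \<le> \<rho>" "\<rho> \<le> 1" and dim: "(\<lambda>n. real (dim n)) \<in> O(\<lambda>n. ln (real n))"
begin

lemma soft_dim: "(\<lambda>n. real (dim n)) \<in> soft_powr 0"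
  by (rule soft_powrI[of _ _ 1], rule landau_o.big_trans[OF dim]) real_asymp

lemmas soft_polylog = soft_dim soft_hh soft_KK

lemma soft_coin_count: "(\<lambda>n. real (coin_count \<rho> C c n (dim n))) \<in> soft_powr \<rho>"
  unfolding coin_count_def of_nat_mult
  by (intro soft_powr_multl[of "\<lambda>n. real c * real (hh n)"] soft_powr_multr[of "\<lambda>n. real (mm \<rho> C n)"]
      soft_powr_multl[of "\<lambda>n. real c"] soft_powr_multl[of "\<lambda>n. real (dim n)"] soft_polylog soft_mm \<rho> soft_powr_const order_refl)

lemma soft_mm_n: "(\<lambda>n. real (mm \<rho> C n) * real n) \<in> soft_powr (1 + \<rho>)"
  using soft_powr_mult[OF soft_mm[OF \<rho>(1), of C] soft_powr_id] by (simp add: add.commute)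

lemma soft_powr_n: "(\<lambda>n. real n) \<in> soft_powr (1 + \<rho>)"
  by (rule soft_powr_mono[OF soft_powr_id]) (use \<rho> in simp)

lemma soft_powr_polylog: "f \<in> soft_powr 0 \<Longrightarrow> f \<in> soft_powr (1 + \<rho>)"
  by (erule soft_powr_mono) (use \<rho> in simp)

lemma soft_powr_sub: "f \<in> soft_powr \<rho> \<Longrightarrow> f \<in> soft_powr (1 + \<rho>)"
  by (erule soft_powr_mono) simp

lemma soft_bud: "(\<lambda>n. real (bud \<rho> C n)) \<in> soft_powr (1 + \<rho>)"
proof -
  have "(\<lambda>n. 4 * (real (mm \<rho> C n) * real n) * real (hh n) + real n * (4 * real (hh n) * (real (hh n) + 4)) + 1) \<in> soft_powr (1 + \<rho>)"
    by (intro soft_powr_add soft_powr_multr[of "\<lambda>n. 4 * (real (mm \<rho> C n) * real n)"] soft_powr_multl[of "\<lambda>n. 4"]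
       soft_mm_n soft_powr_multr[of "\<lambda>n. real n"] soft_powr_n soft_polylog soft_powr_multl[of "\<lambda>n. 4 * real (hh n)"]
       soft_powr_const order_refl) (use \<rho> in auto)
  then show ?thesis by (rule back_subst[where P = "\<lambda>f. f \<in> soft_powr (1 + \<rho>)"]) (simp add: fun_eq_iff bud_def algebra_simps)
qed

lemma soft_max_word: "(\<lambda>n. real (max_word \<rho> C c n (dim n))) \<in> soft_powr 2"
proof -
  have up: "f \<in> soft_powr a \<Longrightarrow> a \<le> 2 \<Longrightarrow> f \<in> soft_powr 2" for f a by (rule soft_powr_mono)
  have n2: "(\<lambda>n. real n * real n) \<in> soft_powr 2" using soft_powr_mult[OF soft_powr_id soft_powr_id] by simp
  have "(\<lambda>n. 8 + 3 * real n + 4 * 2 ^ hh n + (real (hh n) + 2) * (real n * real n) + real (hh n) + real (KK n) + real (dim n) +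
      real (dim n) * real (KK n) + real (mm \<rho> C n) + real c * real (hh n) + real (coin_count \<rho> C c n (dim n)) + real (bud \<rho> C n)) \<in> soft_powr 2"
    by (intro soft_powr_add soft_powr_const up[OF soft_coin_count] up[OF soft_bud] up[OF soft_mm[OF \<rho>(1)]]
      up[OF soft_powr_multl[OF soft_powr_const[of 0 3] soft_powr_id]] up[OF soft_powr_multl[OF soft_powr_const[of 0 4] soft_two_pow_hh]]
      soft_powr_multl[OF soft_powr_add[OF soft_hh soft_powr_const[of 0 2]] n2] up[OF soft_hh] up[OF soft_KK] up[OF soft_dim]
      up[OF soft_powr_multl[OF soft_dim soft_KK]] up[OF soft_powr_multl[OF soft_powr_const[of 0 "real c"] soft_hh]])
      (use \<rho> in auto)
  then show ?thesis by (rule back_subst[where P = "\<lambda>f. f \<in> soft_powr 2"]) (simp add: fun_eq_iff max_word_def algebra_simps)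
qed

text \<open>Words are bounded by n^2 up to logarithms, hence eventually by n^3, so they have at most
  three times as many bits as n.\<close>

lemma soft_nat_len: "(\<lambda>n. real (nat_len (max_word \<rho> C c n (dim n)))) \<in> soft_powr 0"
proof -
  obtain k where k: "(\<lambda>n. real (max_word \<rho> C c n (dim n))) \<in> O(\<lambda>n. real n powr 2 * ln (real n) ^ k)"
    using soft_max_word by (rule soft_powrE)
  have "(\<lambda>n. real n powr 2 * ln (real n) ^ k) \<in> o(\<lambda>n. real n ^ 3)" by real_asymp
  with k have "(\<lambda>n. real (max_word \<rho> C c n (dim n))) \<in> o(\<lambda>n. real n ^ 3)" by (rule landau_o.big_small_trans)
  then have "eventually (\<lambda>n. norm (real (max_word \<rho> C c n (dim n))) \<le> 1 * norm (real n ^ 3)) sequentially"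
    by (rule landau_o.smallD) simp
  then have ev: "eventually (\<lambda>n. max_word \<rho> C c n (dim n) \<le> n ^ 3) sequentially"
    by (rule eventually_mono) (simp flip: of_nat_power)
  have "(\<lambda>n. real (nat_len (max_word \<rho> C c n (dim n)))) \<in> O(\<lambda>n. 3 * (real (hh n) + 1))"
  proof (rule bigoI[where c = 1], rule eventually_mono[OF eventually_conj[OF ev eventually_ge_at_top[of 2]]])
    fix n assume n: "max_word \<rho> C c n (dim n) \<le> n ^ 3 \<and> 2 \<le> n"
    have "n < 2 ^ (hh n + 1)" by (rule le_less_trans[OF hh_ge]) simp
    then have l: "nat_len n \<le> hh n + 1" by (simp add: nat_len_def floorlog_leI)
    have "nat_len (max_word \<rho> C c n (dim n)) \<le> 3 * nat_len n" using n by (intro nat_len_pow_le) auto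
    then have "nat_len (max_word \<rho> C c n (dim n)) \<le> 3 * (hh n + 1)" by (rule le_trans[OF _ mult_le_mono2[OF l]])
    then have "real (nat_len (max_word \<rho> C c n (dim n))) \<le> real (3 * (hh n + 1))" by (rule of_nat_mono)
    then show "norm (real (nat_len (max_word \<rho> C c n (dim n)))) \<le> 1 * norm (3 * (real (hh n) + 1))" by simp
  qed
  moreover have "(\<lambda>n. 3 * (real (hh n) + 1)) \<in> soft_powr 0"
    by (intro soft_powr_multl soft_powr_add soft_hh soft_powr_const order_refl)
  ultimately show ?thesis by (elim soft_powrE) (rule soft_powrI, erule (1) landau_o.big_trans)
qed

text \<open>The leading terms are the \<open>mm\<close> projections with nearly linear work each,
  and the budget, of order n powr (1 + \<rho>), times the cost of one distance.\<close>

lemma soft_total_steps: "(\<lambda>n. real (total_steps \<rho> C c n (dim n))) \<in> soft_powr (1 + \<rho>)"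
proof -
  have k0: "(\<lambda>n. x) \<in> soft_powr 0" for x by (rule soft_powr_const) simp
  have k: "(\<lambda>n. x) \<in> soft_powr (1 + \<rho>)" for x by (rule soft_powr_const) (use \<rho> in simp)
  have nf: "(\<lambda>n. real n * f n) \<in> soft_powr 1" if "f \<in> soft_powr 0" for f
    using that by (rule soft_powr_multr[OF soft_powr_id])
  have nf': "(\<lambda>n. real n * f n) \<in> soft_powr (1 + \<rho>)" if "f \<in> soft_powr 0" for f
    using that by (rule soft_powr_multr[OF soft_powr_n])
  have k1: "(\<lambda>n. x) \<in> soft_powr 1" for x by (rule soft_powr_const) simp
  have init: "(\<lambda>n. real (init_steps \<rho> C n (dim n))) \<in> soft_powr (1 + \<rho>)"
  proof -
    have "(\<lambda>n. 3 * real (hh n) + 4 * real n + 2 * real (mm \<rho> C n) + 20 + (2 + real n * (3 * real (dim n) + 10)) + 2 +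
     (3 * real n + 6 + (real (hh n) + 1) * (10 * real n + 6)) + (5 * real n + 30 * real n + 5 * (real n * real (hh n)) + 5)) \<in> soft_powr (1 + \<rho>)"
      by (intro soft_powr_add k soft_powr_multl[OF k0] soft_powr_multl[OF soft_powr_add[OF soft_hh k0]]
        soft_powr_polylog[OF soft_hh] soft_powr_n soft_powr_sub[OF soft_mm[OF \<rho>(1)]] nf' soft_dim soft_hh k0)
    then show ?thesis by (rule back_subst[where P = "\<lambda>f. f \<in> soft_powr (1 + \<rho>)"]) (simp add: fun_eq_iff init_steps_def algebra_simps)
  qed
  define body where "body n = 9 + real n * (3 * (real (dim n) * real (KK n)) + 6) +
       (real (hh n) + 2) * (16 * (real n + real n * real (hh n)) + 20 * real n) + 6 * real n + real n * real (hh n) * (20 + 9 * real (hh n))" for n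
  have body: "body \<in> soft_powr 1"
    unfolding body_def mult.assoc
    by (intro soft_powr_add k1 soft_powr_multl[OF k0] soft_powr_multl[OF soft_powr_add[OF soft_hh k0]]
        soft_powr_id nf soft_powr_multl soft_polylog k0)
  have "(\<lambda>n. 2 + real c * real (hh n) * (5 + real (mm \<rho> C n) * body n + real (bud \<rho> C n) * (3 * real (dim n) + 14)) + (2 + 3 * real n)) \<in> soft_powr (1 + \<rho>)"
  proof -
    have "(\<lambda>n. real (mm \<rho> C n) * body n) \<in> soft_powr (1 + \<rho>)"
      using soft_powr_mult[OF soft_mm[OF \<rho>(1), of C] body] by (simp add: add.commute)
    moreover have "(\<lambda>n. real (bud \<rho> C n) * (3 * real (dim n) + 14)) \<in> soft_powr (1 + \<rho>)"
      by (intro soft_powr_multr soft_bud soft_powr_add soft_powr_multl soft_dim k0)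
    ultimately show ?thesis
      by (intro soft_powr_add k soft_powr_multl[of "\<lambda>n. real c * real (hh n)"] soft_powr_multl[OF k0] soft_hh soft_powr_n)
  qed
  then have main: "(\<lambda>n. real (main_steps \<rho> C c n (dim n))) \<in> soft_powr (1 + \<rho>)"
    by (rule back_subst[where P = "\<lambda>f. f \<in> soft_powr (1 + \<rho>)"]) (simp add: fun_eq_iff main_steps_def body_def algebra_simps)
  have "(\<lambda>n. 3 * real (coin_count \<rho> C c n (dim n)) + 2) \<in> soft_powr (1 + \<rho>)"
    by (intro soft_powr_add soft_powr_multl[OF k0] soft_powr_sub[OF soft_coin_count] k)
  from soft_powr_add[OF soft_powr_add[OF init this] main] show ?thesis
    by (rule back_subst[where P = "\<lambda>f. f \<in> soft_powr (1 + \<rho>)"]) (simp add: fun_eq_iff total_steps_def algebra_simps)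
qed

lemma soft_input_size: "(\<lambda>n. 3 + 2 * real n + real n * real (dim n)) \<in> soft_powr (1 + \<rho>)"
  by (intro soft_powr_add soft_powr_multr[OF soft_powr_n] soft_powr_multl[of "\<lambda>n. 2"] soft_powr_n soft_dim soft_powr_const) (use \<rho> in auto)

end

theorem theorem4:
  fixes \<alpha> :: real
  assumes "\<alpha> > 1"
  shows "\<forall>c::nat. \<exists>P::com. \<forall>dim::nat \<Rightarrow> nat.
    (\<lambda>n. real (dim n)) \<in> O(\<lambda>n. ln (real n)) \<longrightarrow>
    (\<exists>\<tau> \<sigma> :: nat \<Rightarrow> real.
       \<tau> \<in> soft_O (\<lambda>n. real n powr (1 + 1 / \<alpha>\<^sup>2)) \<and>
       \<sigma> \<in> soft_O (\<lambda>n. real n powr (1 + 1 / \<alpha>\<^sup>2)) \<and>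
       (\<forall>n X T pts es.
          X \<subseteq> euclid (dim n) \<and> card X = n \<and> spanning_tree_on X T \<and> presents pts es X T \<longrightarrow>
          (let R = exec P (input_state \<alpha> (dim n) pts es) in
             lossless_spmf R \<and>
             (\<forall>s\<in>set_spmf R. real (run_time s) \<le> \<tau> n \<and> real (peak_space s) \<le> \<sigma> n) \<and>
             measure (measure_spmf R)
               {s. \<exists>ACW. outputs pts es s ACW \<and> approximates_cut_weights \<alpha> T ACW}
               \<ge> 1 - 1 / real n ^ c)))"
proof
  fix c :: nat
  define \<rho> where "\<rho> = 1 / \<alpha>\<^sup>2"
  define C :: nat where "C = 53747712"
  \<comment> \<open>The weight of the program text depends on c only, so the factor Z in the running
    time is a constant.\<close>
  define Z where "Z = cwt (PROG C c)"
  have \<rho>: "0 \<le> \<rho>" "\<rho> \<le> 1" using assms by (auto simp: \<rho>_def)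
  show "\<exists>P::com. \<forall>dim::nat \<Rightarrow> nat.
    (\<lambda>n. real (dim n)) \<in> O(\<lambda>n. ln (real n)) \<longrightarrow>
    (\<exists>\<tau> \<sigma> :: nat \<Rightarrow> real.
       \<tau> \<in> soft_O (\<lambda>n. real n powr (1 + 1 / \<alpha>\<^sup>2)) \<and>
       \<sigma> \<in> soft_O (\<lambda>n. real n powr (1 + 1 / \<alpha>\<^sup>2)) \<and>
       (\<forall>n X T pts es.
          X \<subseteq> euclid (dim n) \<and> card X = n \<and> spanning_tree_on X T \<and> presents pts es X T \<longrightarrow>
          (let R = exec P (input_state \<alpha> (dim n) pts es) in
             lossless_spmf R \<and>
             (\<forall>s\<in>set_spmf R. real (run_time s) \<le> \<tau> n \<and> real (peak_space s) \<le> \<sigma> n) \<and>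
             measure (measure_spmf R)
               {s. \<exists>ACW. outputs pts es s ACW \<and> approximates_cut_weights \<alpha> T ACW}
               \<ge> 1 - 1 / real n ^ c)))"
    unfolding \<rho>_def[symmetric]
  proof (intro exI[of _ "PROG C c"] allI impI)
    fix dim :: "nat \<Rightarrow> nat"
    assume dim: "(\<lambda>n. real (dim n)) \<in> O(\<lambda>n. ln (real n))"
    define M where "M n = max_word \<rho> C c n (dim n)" for n
    define A where "A n = (3 + 2 * n + n * dim n) * (3 * nat_len (M n))" for n
    define B where "B n = Z * nat_len (M n) * total_steps \<rho> C c n (dim n)" for n
    have len: "(\<lambda>n. real (nat_len (M n))) \<in> soft_powr 0" unfolding M_def by (rule soft_nat_len[OF \<rho> dim])
    have k0: "(\<lambda>n. x) \<in> soft_powr 0" for x by (rule soft_powr_const) simp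
    have B: "(\<lambda>n. real (B n)) \<in> soft_powr (1 + \<rho>)"
      unfolding B_def of_nat_mult by (intro soft_powr_multl soft_total_steps[OF \<rho> dim] k0 len)
    have "(\<lambda>n. (3 + 2 * real n + real n * real (dim n)) * (3 * real (nat_len (M n)))) \<in> soft_powr (1 + \<rho>)"
      by (intro soft_powr_multr soft_input_size[OF \<rho> dim] soft_powr_multl k0 len)
    then have A: "(\<lambda>n. real (A n)) \<in> soft_powr (1 + \<rho>)" unfolding A_def by simp
    have run: "lossless_spmf R \<and> (\<forall>s\<in>set_spmf R. real (run_time s) \<le> real (B n) \<and> real (peak_space s) \<le> real (A n) + real (B n)) \<and>
        1 - 1 / real n ^ c \<le> measure (measure_spmf R) {s. \<exists>ACW. outputs pts es s ACW \<and> approximates_cut_weights \<alpha> T ACW}"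
      if inst: "X \<subseteq> euclid (dim n)" "card X = n" "spanning_tree_on X T" "presents pts es X T"
        and R: "R = exec (PROG C c) (input_state \<alpha> (dim n) pts es)" for n X T pts es R
    proof -
      have "2 \<le> M n" by (simp add: M_def max_word_def)
      then interpret ram_tree Z "M n" "dim n" n pts es X T
        using inst by unfold_locales
      have b: "max_word (1 / \<alpha>\<^sup>2) 53747712 c n (dim n) \<le> M n" by (simp add: M_def \<rho>_def C_def)
      have Zc: "cwt (PROG 53747712 c) \<le> Z" by (simp add: Z_def C_def)
      have \<alpha>: "1 \<le> \<alpha>" using assms by simp
      note inp = input_ok[OF word_bounds(6)[OF b] word_bounds(1)[OF b], where ?\<alpha> = \<alpha>]
      note ex = exec_PROG[OF Zc \<alpha> b inp, folded C_def \<rho>_def R]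
      have "real (run_time s) \<le> real (B n) \<and> real (peak_space s) \<le> real (A n) + real (B n)" if s: "s \<in> set_spmf R" for s
        using ex(2)[OF s] unfolding A_def B_def of_nat_add[symmetric] of_nat_le_iff .
      then show ?thesis using ex(1,3) by blast
    qed
    show "\<exists>\<tau> \<sigma> :: nat \<Rightarrow> real. \<tau> \<in> soft_powr (1 + \<rho>) \<and> \<sigma> \<in> soft_powr (1 + \<rho>) \<and>
       (\<forall>n X T pts es.
          X \<subseteq> euclid (dim n) \<and> card X = n \<and> spanning_tree_on X T \<and> presents pts es X T \<longrightarrow>
          (let R = exec (PROG C c) (input_state \<alpha> (dim n) pts es) in
             lossless_spmf R \<and>
             (\<forall>s\<in>set_spmf R. real (run_time s) \<le> \<tau> n \<and> real (peak_space s) \<le> \<sigma> n) \<and>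
             measure (measure_spmf R)
               {s. \<exists>ACW. outputs pts es s ACW \<and> approximates_cut_weights \<alpha> T ACW}
               \<ge> 1 - 1 / real n ^ c))"
    proof (rule exI[of _ "\<lambda>n. real (B n)"], rule exI[of _ "\<lambda>n. real (A n) + real (B n)"], intro conjI allI impI)
      show "(\<lambda>n. real (B n)) \<in> soft_powr (1 + \<rho>)" by (rule B)
      show "(\<lambda>n. real (A n) + real (B n)) \<in> soft_powr (1 + \<rho>)" by (rule soft_powr_add[OF A B])
      show "let R = exec (PROG C c) (input_state \<alpha> (dim n) pts es) in
             lossless_spmf R \<and>
             (\<forall>s\<in>set_spmf R. real (run_time s) \<le> real (B n) \<and> real (peak_space s) \<le> real (A n) + real (B n)) \<and>
             measure (measure_spmf R)
               {s. \<exists>ACW. outputs pts es s ACW \<and> approximates_cut_weights \<alpha> T ACW}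
               \<ge> 1 - 1 / real n ^ c"
        if "X \<subseteq> euclid (dim n) \<and> card X = n \<and> spanning_tree_on X T \<and> presents pts es X T" for n X T pts es
        unfolding Let_def by (rule run[where X = X and T = T and n = n, OF _ _ _ _ refl]) (use that in simp_all)
    qed
  qed
qed

end
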